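(* Let $\{(Y_{ik},X_{ik}): i\ge 1,\ 1\le k\le c_i\}$ be random vectors in $\mathbb{R}\times\mathbb{R}^d$ ($i$ indexes clusters, $k$ indexes observations within cluster $i$). Assume: (1) the clusters $(Y_{ik},X_{ik})_{1\le k\le c_i}$, $i\ge 1$, are independent of one another (dependence within a cluster is arbitrary), and $c_i\le c_{\max}<\infty$ for all $i\ge 1$; (2) $T\subset(0,1)$ is closed, $B\subset\mathbb{R}^d$ is compact and convex, $\beta(\tau)$ lies in the interior of $B$ for every $\tau\in T$, and $Q_{ik}(\tau\mid x)=x^\top\beta(\tau)$ for all $\tau\in T$, all $x$ in the support $\mathcal{X}_{ik}$ of $X_{ik}$, and all $i,k$; (3) (i) for some $q>2$, $\mathrm{E}|X_{ik}|^q<\infty$ uniformly in $i,k$; (ii) $n^{-1}\sum_{i=1}^n\sum_{k=1}^{c_i}\mathrm{E}X_{ik}X_{ik}^\top$ is positive definite uniformly in $n$; (iii) the conditional density $f_{ik}(y\mid X_{ik}=x)$ of $Y_{ik}$ and its derivative in $y$ are bounded in absolute value uniformly in $y$, $x\in\mathcal{X}_{ik}$, $i$ and $k$; (iv) $f_{ik}(x^\top b\mid X_{ik}=x)$ is bounded away from zero uniformly in $b\in B$, $x\in\mathcal{X}_{ik}$, $i$ and $k$; (4) the limits $J(\tau)=\lim_{n\to\infty}J_n(\tau)$ and $\Sigma(\tau,\tau')=\lim_{n\to\infty}\Sigma_n(\tau,\tau')$ exist for all $\tau,\tau'\in T$. Let $W_1,W_2,\dots$ be iid, independent of the data, with $\mathrm{E}W_1=0$,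 $\mathrm{Var}\,W_1=1$ and $\mathrm{E}|W_1|^q<\infty$ (same $q$ as in (3)(i)), and let $\hat\beta_n^*(\tau)$ be the wild gradient bootstrap estimator. Put $V(\tau,\tau')=J^{-1}(\tau)\Sigma(\tau,\tau')J^{-1}(\tau')$ and $\hat V_n^*(\tau,\tau')=\mathrm{E}^*\,n(\hat\beta_n^*(\tau)-\hat\beta_n(\tau))(\hat\beta_n^*(\tau')-\hat\beta_n(\tau'))^\top$. Then, as $n\to\infty$, (i) for all $\tau,\tau'\in T$, $\hat V_n^*(\tau,\tau')\to V(\tau,\tau')$ in probability; and (ii) if $q>4$, then $\sup_{\tau,\tau'\in T}|\hat V_n^*(\tau,\tau')-V(\tau,\tau')|\to0$ in probability.
   Context: $Q_{ik}(\tau\mid x)=\inf\{y:\mathrm{P}(Y_{ik}\le y\mid X_{ik}=x)\ge\tau\}$. $\rho_\tau(z)=(\tau-1\{z<0\})z$ and $\psi_\tau(z)=\tau-1\{z<0\}$. $|\cdot|$ is the Euclidean norm of a vector and the Frobenius norm of a matrix. The quantile regression estimator is $\hat\beta_n(\tau)\in\arg\min_{b\in B}\mathbb{M}_n(b,\tau)$ with $\mathbb{M}_n(b,\tau)=n^{-1}\sum_{i=1}^n\sum_{k=1}^{c_i}\rho_\tau(Y_{ik}-X_{ik}^\top b)$. $$J_n(\tau)=\frac1n\sum_{i=1}^n\sum_{k=1}^{c_i}\mathrm{E}f_{ik}(X_{ik}^\top\beta(\tau)\mid X_{ik})X_{ik}X_{ik}^\top,$$ $$\Sigma_n(\tau,\tau')=\frac1n\sum_{i=1}^n\sum_{k=1}^{c_i}\sum_{l=1}^{c_i}\mathrm{E}\,\psi_\tau(Y_{ik}-X_{ik}^\top\beta(\tau))\psi_{\tau'}(Y_{il}-X_{il}^\top\beta(\tau'))X_{ik}X_{il}^\top.$$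 "Positive definite uniformly in $n$" means the smallest eigenvalue is bounded away from zero uniformly in $n$. Wild gradient bootstrap: $\mathbb{W}_n(b,\tau)=n^{-1/2}\sum_{i=1}^nW_i\sum_{k=1}^{c_i}\psi_\tau(Y_{ik}-X_{ik}^\top b)X_{ik}$, $\mathbb{W}_n(\tau)=\mathbb{W}_n(\hat\beta_n(\tau),\tau)$, and $\hat\beta_n^*(\tau)$ is any minimizer over $b\in B$ of $\mathbb{M}_n^*(b,\tau)=\mathbb{M}_n(b,\tau)+\mathbb{W}_n(\tau)^\top b/\sqrt{n}$. $\mathrm{E}^*(\cdot)=\mathrm{E}(\cdot\mid D_n)$ with $D_n=\{(Y_{ik},X_{ik}):1\le k\le c_i,1\le i\le n\}$. Possibly non-measurable quantities are treated with outer probability/expectation. *)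

theory Defs
  imports "HOL-Probability.Probability"
begin

definition check_loss :: "real \<Rightarrow> real \<Rightarrow> real" where
  "check_loss \<tau> z = (\<tau> - of_bool (z < 0)) * z"

definition check_score :: "real \<Rightarrow> real \<Rightarrow> real" where
  "check_score \<tau> z = \<tau> - of_bool (z < 0)"

text \<open>The norm of \<^typ>\<open>real ^ 'd ^ 'd\<close> is the Frobenius norm.\<close>

definition outer_prod :: "real ^ 'd \<Rightarrow> real ^ 'd \<Rightarrow> real ^ 'd ^ 'd" where
  "outer_prod u v = (\<chi> r s. u $ r * v $ s)"

definition smallest_eigenvalue :: "real ^ 'd ^ 'd \<Rightarrow> real" where
  "smallest_eigenvalue A = Min {l. \<exists>v. v \<noteq> 0 \<and> A *v v = l *\<^sub>R v}"

definition law_support :: "'a measure \<Rightarrow> ('a \<Rightarrow> 'b::topological_space) \<Rightarrow> 'b set" where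
  "law_support M X = {x. \<forall>U. open U \<longrightarrow> x \<in> U \<longrightarrow> measure M (X -` U \<inter> space M) > 0}"

text \<open>
  \<open>f y x\<close> is the conditional density at \<open>y\<close> of \<open>Y\<close> given \<open>X = x\<close>: the joint law of \<open>(X, Y)\<close> has
  density \<open>f\<close> with respect to the product of the law of \<open>X\<close> and Lebesgue measure, and \<open>f\<close> is a
  probability density in \<open>y\<close> for every \<open>x\<close> in the support of \<open>X\<close>.  Fixing \<open>f\<close> fixes the version
  of the conditional law of \<open>Y\<close> given \<open>X = x\<close> used at every such \<open>x\<close>.
\<close>

definition is_cond_density ::
  "'a measure \<Rightarrow> ('a \<Rightarrow> real) \<Rightarrow> ('a \<Rightarrow> real ^ 'd) \<Rightarrow> (real \<Rightarrow> real ^ 'd \<Rightarrow> real) \<Rightarrow> bool" where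
  "is_cond_density M Y X f \<longleftrightarrow>
     (\<lambda>(x, y). f y x) \<in> borel_measurable (borel \<Otimes>\<^sub>M borel) \<and>
     (\<forall>x\<in>law_support M X. (\<forall>y. 0 \<le> f y x) \<and> (\<integral>\<^sup>+y. ennreal (f y x) \<partial>lborel) = 1) \<and>
     distr M (borel \<Otimes>\<^sub>M borel) (\<lambda>\<omega>. (X \<omega>, Y \<omega>)) =
       density (distr M borel X \<Otimes>\<^sub>M lborel) (\<lambda>(x, y). ennreal (f y x))"

definition cond_quantile :: "(real \<Rightarrow> real ^ 'd \<Rightarrow> real) \<Rightarrow> real \<Rightarrow> real ^ 'd \<Rightarrow> real" where
  "cond_quantile f \<tau> x = Inf {y. cdf (density lborel (\<lambda>u. ennreal (f u x))) y \<ge> \<tau>}"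

text \<open>
  Cluster \<open>i \<ge> 1\<close> consists of the observations \<open>(Y i k, X i k)\<close> with \<open>1 \<le> k \<le> c i\<close>; values at
  other indices are irrelevant.
\<close>

definition cluster ::
  "(nat \<Rightarrow> nat) \<Rightarrow> (nat \<Rightarrow> nat \<Rightarrow> 'a \<Rightarrow> real) \<Rightarrow> (nat \<Rightarrow> nat \<Rightarrow> 'a \<Rightarrow> real ^ 'd) \<Rightarrow>
   nat \<Rightarrow> 'a \<Rightarrow> nat \<Rightarrow> real \<times> (real ^ 'd)" where
  "cluster c Y X i \<omega> = (\<lambda>k\<in>{1..c i}. (Y i k \<omega>, X i k \<omega>))"

definition data_on ::
  "(nat \<Rightarrow> nat) \<Rightarrow> (nat \<Rightarrow> nat \<Rightarrow> 'a \<Rightarrow> real) \<Rightarrow> (nat \<Rightarrow> nat \<Rightarrow> 'a \<Rightarrow> real ^ 'd) \<Rightarrow>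
   nat set \<Rightarrow> 'a \<Rightarrow> nat \<times> nat \<Rightarrow> real \<times> (real ^ 'd)" where
  "data_on c Y X I \<omega> = (\<lambda>(i, k)\<in>(SIGMA i:I. {1..c i}). (Y i k \<omega>, X i k \<omega>))"

text \<open>
  The \<open>\<sigma>\<close>-algebra generated by the clusters in \<open>I\<close>: \<open>D\<^sub>n\<close> is the case \<open>I = {1..n}\<close>, all data the
  case \<open>I = {1..}\<close>.
\<close>

definition data_algebra ::
  "'a measure \<Rightarrow> (nat \<Rightarrow> nat) \<Rightarrow> (nat \<Rightarrow> nat \<Rightarrow> 'a \<Rightarrow> real) \<Rightarrow>
   (nat \<Rightarrow> nat \<Rightarrow> 'a \<Rightarrow> real ^ 'd) \<Rightarrow> nat set \<Rightarrow> 'a measure" where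
  "data_algebra M c Y X I =
     vimage_algebra (space M) (data_on c Y X I) (PiM (SIGMA i:I. {1..c i}) (\<lambda>_. borel))"

definition weight_algebra :: "'a measure \<Rightarrow> (nat \<Rightarrow> 'a \<Rightarrow> real) \<Rightarrow> 'a measure" where
  "weight_algebra M W =
     vimage_algebra (space M) (\<lambda>\<omega>. \<lambda>i\<in>{1..}. W i \<omega>) (PiM {1..} (\<lambda>_. borel))"

definition objective ::
  "(nat \<Rightarrow> nat) \<Rightarrow> (nat \<Rightarrow> nat \<Rightarrow> 'a \<Rightarrow> real) \<Rightarrow> (nat \<Rightarrow> nat \<Rightarrow> 'a \<Rightarrow> real ^ 'd) \<Rightarrow>
   nat \<Rightarrow> 'a \<Rightarrow> real ^ 'd \<Rightarrow> real \<Rightarrow> real" where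
  "objective c Y X n \<omega> b \<tau> =
     (1 / real n) * (\<Sum>i=1..n. \<Sum>k=1..c i. check_loss \<tau> (Y i k \<omega> - X i k \<omega> \<bullet> b))"

definition wild_gradient ::
  "(nat \<Rightarrow> nat) \<Rightarrow> (nat \<Rightarrow> nat \<Rightarrow> 'a \<Rightarrow> real) \<Rightarrow> (nat \<Rightarrow> nat \<Rightarrow> 'a \<Rightarrow> real ^ 'd) \<Rightarrow>
   (nat \<Rightarrow> 'a \<Rightarrow> real) \<Rightarrow> nat \<Rightarrow> 'a \<Rightarrow> real ^ 'd \<Rightarrow> real \<Rightarrow> real ^ 'd" where
  "wild_gradient c Y X W n \<omega> b \<tau> =
     (1 / sqrt (real n)) *\<^sub>R
       (\<Sum>i=1..n. W i \<omega> *\<^sub>R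
         (\<Sum>k=1..c i. check_score \<tau> (Y i k \<omega> - X i k \<omega> \<bullet> b) *\<^sub>R X i k \<omega>))"

text \<open>The argument \<open>bh\<close> is the value of the quantile regression estimator at \<open>\<tau>\<close>.\<close>

definition boot_objective ::
  "(nat \<Rightarrow> nat) \<Rightarrow> (nat \<Rightarrow> nat \<Rightarrow> 'a \<Rightarrow> real) \<Rightarrow> (nat \<Rightarrow> nat \<Rightarrow> 'a \<Rightarrow> real ^ 'd) \<Rightarrow>
   (nat \<Rightarrow> 'a \<Rightarrow> real) \<Rightarrow> nat \<Rightarrow> 'a \<Rightarrow> real ^ 'd \<Rightarrow> real ^ 'd \<Rightarrow> real \<Rightarrow> real" where
  "boot_objective c Y X W n \<omega> bh b \<tau> =
     objective c Y X n \<omega> b \<tau> + (wild_gradient c Y X W n \<omega> bh \<tau> \<bullet> b) / sqrt (real n)"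

definition mean_gram ::
  "'a measure \<Rightarrow> (nat \<Rightarrow> nat) \<Rightarrow> (nat \<Rightarrow> nat \<Rightarrow> 'a \<Rightarrow> real ^ 'd) \<Rightarrow> nat \<Rightarrow> real ^ 'd ^ 'd" where
  "mean_gram M c X n =
     (1 / real n) *\<^sub>R (\<Sum>i=1..n. \<Sum>k=1..c i. \<integral>\<omega>. outer_prod (X i k \<omega>) (X i k \<omega>) \<partial>M)"

definition J_mat ::
  "'a measure \<Rightarrow> (nat \<Rightarrow> nat) \<Rightarrow> (nat \<Rightarrow> nat \<Rightarrow> 'a \<Rightarrow> real ^ 'd) \<Rightarrow>
   (nat \<Rightarrow> nat \<Rightarrow> real \<Rightarrow> real ^ 'd \<Rightarrow> real) \<Rightarrow> (real \<Rightarrow> real ^ 'd) \<Rightarrow>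
   nat \<Rightarrow> real \<Rightarrow> real ^ 'd ^ 'd" where
  "J_mat M c X f \<beta> n \<tau> =
     (1 / real n) *\<^sub>R (\<Sum>i=1..n. \<Sum>k=1..c i.
       \<integral>\<omega>. f i k (X i k \<omega> \<bullet> \<beta> \<tau>) (X i k \<omega>) *\<^sub>R outer_prod (X i k \<omega>) (X i k \<omega>) \<partial>M)"

definition Sigma_mat ::
  "'a measure \<Rightarrow> (nat \<Rightarrow> nat) \<Rightarrow> (nat \<Rightarrow> nat \<Rightarrow> 'a \<Rightarrow> real) \<Rightarrow>
   (nat \<Rightarrow> nat \<Rightarrow> 'a \<Rightarrow> real ^ 'd) \<Rightarrow> (real \<Rightarrow> real ^ 'd) \<Rightarrow>
   nat \<Rightarrow> real \<Rightarrow> real \<Rightarrow> real ^ 'd ^ 'd" where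
  "Sigma_mat M c Y X \<beta> n \<tau> \<tau>' =
     (1 / real n) *\<^sub>R (\<Sum>i=1..n. \<Sum>k=1..c i. \<Sum>l=1..c i.
       \<integral>\<omega>. (check_score \<tau> (Y i k \<omega> - X i k \<omega> \<bullet> \<beta> \<tau>) *
            check_score \<tau>' (Y i l \<omega> - X i l \<omega> \<bullet> \<beta> \<tau>')) *\<^sub>R
           outer_prod (X i k \<omega>) (X i l \<omega>) \<partial>M)"

definition outer_prob :: "'a measure \<Rightarrow> 'a set \<Rightarrow> real" where
  "outer_prob M A = (INF E\<in>{E \<in> sets M. A \<subseteq> E}. measure M E)"

definition tends_to_zero_in_prob :: "'a measure \<Rightarrow> (nat \<Rightarrow> 'a \<Rightarrow> ennreal) \<Rightarrow> bool" where
  "tends_to_zero_in_prob M Z \<longleftrightarrow>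
     (\<forall>\<epsilon>::real. \<epsilon> > 0 \<longrightarrow> (\<lambda>n. outer_prob M {\<omega> \<in> space M. Z n \<omega> > ennreal \<epsilon>}) \<longlonglongrightarrow> 0)"

definition outer_expectation :: "'a measure \<Rightarrow> ('a \<Rightarrow> real) \<Rightarrow> real" where
  "outer_expectation M Z =
     Inf {\<integral>\<omega>. U \<omega> \<partial>M | U. integrable M U \<and> (\<forall>\<omega>\<in>space M. Z \<omega> \<le> U \<omega>)}"

text \<open>
  A minimal measurable majorant.  It is unique up to null sets, exists for every bounded \<open>Z\<close>, and
  is almost surely equal to \<open>Z\<close> if \<open>Z\<close> is measurable.
\<close>

definition is_measurable_cover :: "'a measure \<Rightarrow> ('a \<Rightarrow> real) \<Rightarrow> ('a \<Rightarrow> real) \<Rightarrow> bool" where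
  "is_measurable_cover M Z U \<longleftrightarrow>
     U \<in> borel_measurable M \<and> (\<forall>\<omega>\<in>space M. Z \<omega> \<le> U \<omega>) \<and>
     (\<forall>U'\<in>borel_measurable M. (\<forall>\<omega>\<in>space M. Z \<omega> \<le> U' \<omega>) \<longrightarrow> (AE \<omega> in M. U \<omega> \<le> U' \<omega>))"

definition cond_outer_exp :: "'a measure \<Rightarrow> 'a measure \<Rightarrow> ('a \<Rightarrow> real) \<Rightarrow> 'a \<Rightarrow> real" where
  "cond_outer_exp M F Z = real_cond_exp M F (SOME U. is_measurable_cover M Z U)"

text \<open>
  For a fixed \<open>Z\<close>, \<open>cond_outer_exp M F Z\<close> is only determined up to a null set depending on \<open>Z\<close>, so
  a supremum over uncountably many \<open>Z\<close> is meaningless unless the versions are chosen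
  simultaneously.  A regular conditional probability \<open>K\<close> given \<open>F\<close> does this: the conditional
  (outer) expectation of \<open>Z\<close> at \<open>\<omega>\<close> is then the (outer) expectation of \<open>Z\<close> under \<open>K \<omega>\<close>.
\<close>

definition is_regular_cond_prob :: "'a measure \<Rightarrow> 'a measure \<Rightarrow> ('a \<Rightarrow> 'a measure) \<Rightarrow> bool" where
  "is_regular_cond_prob M F K \<longleftrightarrow>
     K \<in> measurable F (prob_algebra M) \<and>
     (\<forall>A\<in>sets M. AE \<omega> in M. measure (K \<omega>) A = real_cond_exp M F (indicator A) \<omega>)"

text \<open>
  The bootstrap covariance estimate, taken entrywise, as a function of the conditional expectation
  operator \<open>Est\<close>; \<open>bh\<close> and \<open>bs\<close> are the quantile regression estimator and its bootstrap version.
\<close>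

definition boot_cov ::
  "(('a \<Rightarrow> real) \<Rightarrow> 'a \<Rightarrow> real) \<Rightarrow> (nat \<Rightarrow> real \<Rightarrow> 'a \<Rightarrow> real ^ 'd) \<Rightarrow>
   (nat \<Rightarrow> real \<Rightarrow> 'a \<Rightarrow> real ^ 'd) \<Rightarrow> nat \<Rightarrow> real \<Rightarrow> real \<Rightarrow> 'a \<Rightarrow> real ^ 'd ^ 'd" where
  "boot_cov Est bh bs n \<tau> \<tau>' \<omega> =
     (\<chi> r s. Est (\<lambda>\<omega>'. (real n *\<^sub>R outer_prod (bs n \<tau> \<omega>' - bh n \<tau> \<omega>')
                                         (bs n \<tau>' \<omega>' - bh n \<tau>' \<omega>')) $ r $ s) \<omega>)"

text \<open>For measurable \<open>Z\<close> all of these are the usual notions.\<close>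

lemma outer_expectation_eq_integral:
  assumes "integrable M Z"
  shows "outer_expectation M Z = (\<integral>\<omega>. Z \<omega> \<partial>M)"
  unfolding outer_expectation_def
proof (rule cInf_eq_minimum)
  show "(\<integral>\<omega>. Z \<omega> \<partial>M) \<in> {\<integral>\<omega>. U \<omega> \<partial>M | U. integrable M U \<and> (\<forall>\<omega>\<in>space M. Z \<omega> \<le> U \<omega>)}"
    using assms by auto
qed (use assms in \<open>auto intro!: integral_mono\<close>)

lemma outer_prob_eq_measure:
  assumes "prob_space M" "A \<in> sets M"
  shows "outer_prob M A = measure M A"
proof -
  interpret prob_space M by fact
  show ?thesis
    unfolding outer_prob_def
  proof (rule cInf_eq_minimum)
    show "measure M A \<in> measure M ` {E \<in> sets M. A \<subseteq> E}" using assms by auto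
  qed (auto intro!: finite_measure_mono)
qed

lemma cond_outer_exp_eq_real_cond_exp:
  assumes "prob_space M" "subalgebra M F" "integrable M Z"
  shows "AE \<omega> in M. cond_outer_exp M F Z \<omega> = real_cond_exp M F Z \<omega>"
proof -
  interpret prob_space M by fact
  interpret finite_measure_subalgebra M F by standard fact
  define U where "U = (SOME U. is_measurable_cover M Z U)"
  have "is_measurable_cover M Z Z"
    using assms(3) by (auto simp: is_measurable_cover_def)
  then have U: "is_measurable_cover M Z U"
    unfolding U_def by (rule someI[where P = "is_measurable_cover M Z"])
  have [measurable]: "Z \<in> borel_measurable M" "U \<in> borel_measurable M"
    using U assms(3) by (auto simp: is_measurable_cover_def)
  have "AE \<omega> in M. U \<omega> \<le> Z \<omega>"
    using U assms(3) by (auto simp: is_measurable_cover_def)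
  moreover have "AE \<omega> in M. Z \<omega> \<le> U \<omega>"
    using U by (auto simp: is_measurable_cover_def)
  ultimately have "AE \<omega> in M. U \<omega> = Z \<omega>" by eventually_elim simp
  then show ?thesis
    unfolding cond_outer_exp_def U_def[symmetric] by (intro real_cond_exp_cong) auto
qed

end

theory Submission
  imports Defs "HOL-Real_Asymp.Real_Asymp"
begin

text \<open>
  The lower bound on the conditional densities over a neighbourhood of \<open>\<beta> \<tau>\<close> forces the supports of the
  regressors to be bounded: \<open>x \<bullet> b\<close> sweeps an interval of length proportional to \<open>norm x\<close> on which
  a probability density is bounded below. Sums of scores are therefore sums of bounded variables, and
  Bernstein's inequality on a net of polynomial cardinality controls them uniformly in \<open>b\<close> and
  \<open>\<tau>\<close> up to super-polynomially small probabilities; the weights are truncated, and their tails are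
  summed in mean square, for which moments of order \<open>q > 2\<close> suffice in both parts.

  Both estimators satisfy Minty variational inequalities for the subgradient of the empirical criterion.
  Strong monotonicity of the mean subgradient turns them into rates and then into the Bahadur
  representation \<open>sqrt n (\<beta>star - \<beta>hat) = - J\<^sub>n\<^sup>-\<^sup>1 W\<^sub>n(\<beta>)\<close> with a remainder that is square integrable,
  tends to \<open>0\<close> in mean square and does not depend on \<open>\<tau>\<close>. The conditional covariance of the
  leading term is explicit, and converges uniformly because its entries are Lipschitz in \<open>\<tau>\<close>. All
  bounds are measurable and independent of the choice of minimizers, so they also bound outer
  expectations.
\<close>

section \<open>Bernstein bounds, independence and nets\<close>

text \<open>Three obstacles shape the argument. The criterion has kinks, so a minimizer need not be
  a zero of the chosen subgradient; a Minty inequality evaluates the subgradient only at other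
  points and holds for every minimizer, also on the boundary of \<open>B\<close>. The minimizers
  need not be measurable, so the Bahadur bound is pointwise, for all of them at once, on an event
  \<open>data_good\<close> that lies in the data algebra and can be pulled out of conditional
  expectations. Bad weights cannot be discarded in this way, because conditional second moments are
  taken over them; they are charged to the remainder \<open>rho\<close>. Off
  \<open>weight_good\<close> only a bound of order \<open>n\<close> is available besides the
  truncation error, so the failure probability must beat \<open>n^2\<close>: hence exponential
  inequalities on nets of polynomial size. The exponents fit as follows: the localization radius
  \<open>n powr (- 1/4)\<close> gives sums of increments a variance of order
  \<open>n powr (3/4)\<close>, and the slack \<open>sx\<close> must be small enough that the squared
  rate \<open>n powr (4 * sx - 1)\<close> still vanishes after multiplication by
  \<open>sqrt n\<close>.\<close>

lemma exp_le_quadratic: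
  fixes x :: real
  assumes "\<bar>x\<bar> \<le> 1"
  shows "exp x \<le> 1 + x + x\<^sup>2"
proof (cases "x \<ge> 0")
  case True
  then show ?thesis using exp_bound[of x] assms by auto
next
  case False
  define y where "y = -x"
  have y: "0 < y" "y \<le> 1" using False assms by (auto simp: y_def)
  \<comment> \<open>For negative arguments the claim is multiplied by \<open>exp y\<close>, and
    \<open>exp y\<close> is replaced by its quadratic Taylor polynomial; the product of the two
    polynomials has no negative coefficient.\<close>
  have "1 \<le> (1 - y + y\<^sup>2) * (1 + y + y\<^sup>2 / 2)"
  proof -
    have "(1 - y + y\<^sup>2) * (1 + y + y\<^sup>2 / 2) = 1 + y\<^sup>2 / 2 + y^3 / 2 + y^4 / 2"
      by (simp add: field_simps power2_eq_square power3_eq_cube power4_eq_xxxx)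
    then show ?thesis using y by simp
  qed
  also have "\<dots> \<le> (1 - y + y\<^sup>2) * exp y"
  proof (rule mult_left_mono)
    show "1 + y + y\<^sup>2 / 2 \<le> exp y" using exp_lower_Taylor_quadratic[of y] y by simp
    show "0 \<le> 1 - y + y\<^sup>2" using y by simp
  qed
  finally have "exp (-y) \<le> 1 - y + y\<^sup>2"
    by (simp add: exp_minus field_simps)
  then show ?thesis by (simp add: y_def)
qed

text \<open>Exponential Markov inequality with \<open>exp x \<le> 1 + x + x\<^sup>2\<close>, which
  is available because \<open>l * c \<le> 1\<close>. The parameter \<open>l\<close> stays free: it
  is chosen differently according to whether the sum of the variances is of order \<open>n\<close>,
  of smaller order, or bounded.\<close>

lemma (in prob_space) bernstein_upper_tail:
  fixes \<xi> :: "'i \<Rightarrow> 'a \<Rightarrow> real"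
  assumes fin: "finite I" and indep: "indep_vars (\<lambda>_. borel) \<xi> I"
    and bound: "\<And>i. i \<in> I \<Longrightarrow> AE x in M. \<bar>\<xi> i x\<bar> \<le> c"
    and mean: "\<And>i. i \<in> I \<Longrightarrow> expectation (\<xi> i) = 0"
    and var: "(\<Sum>i\<in>I. expectation (\<lambda>x. (\<xi> i x)\<^sup>2)) \<le> V"
    and l: "0 \<le> l" "l * c \<le> 1"
  shows "prob {x\<in>space M. t \<le> (\<Sum>i\<in>I. \<xi> i x)} \<le> exp (l\<^sup>2 * V - l * t)"
proof (cases "l = 0")
  case True
  then show ?thesis by simp
next
  case False
  with l have lpos: "l > 0" by simp
  have meas[measurable]: "\<xi> i \<in> borel_measurable M" if "i \<in> I" for i
    using indep that by (auto simp: indep_vars_def)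
  have int: "integrable M (\<xi> i)" if "i \<in> I" for i
    using bound[OF that] meas[OF that] by (intro integrable_const_bound[where B=c]) auto
  have int2: "integrable M (\<lambda>x. (\<xi> i x)\<^sup>2)" if "i \<in> I" for i
  proof (rule integrable_const_bound[where B="c\<^sup>2"])
    show "AE x in M. norm ((\<xi> i x)\<^sup>2) \<le> c\<^sup>2"
      using bound[OF that] by eventually_elim (simp add: power2_le_iff_abs_le abs_le_square_iff[symmetric])
  qed (use meas[OF that] in auto)
  have bnd: "AE x in M. \<bar>l * \<xi> i x\<bar> \<le> 1" if "i \<in> I" for i
    using bound[OF that]
  proof eventually_elim
    case (elim x)
    have "\<bar>l * \<xi> i x\<bar> \<le> l * c" using elim l by (simp add: abs_mult mult_left_mono)
    with l show ?case by simp
  qed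
  have inte: "integrable M (\<lambda>x. exp (l * \<xi> i x))" if "i \<in> I" for i
  proof (rule integrable_const_bound[where B="exp 1"])
    show "AE x in M. norm (exp (l * \<xi> i x)) \<le> exp 1"
      using bnd[OF that] by eventually_elim auto
  qed (use meas[OF that] in auto)
  have ind: "indep_vars (\<lambda>_. borel) (\<lambda>i x. exp (l * \<xi> i x)) I"
    by (rule indep_vars_compose2[OF indep]) auto
  have prodexp: "exp (l * (\<Sum>i\<in>I. \<xi> i x)) = (\<Prod>i\<in>I. exp (l * \<xi> i x))" for x
    by (simp add: sum_distrib_left exp_sum fin)
  have intp: "integrable M (\<lambda>x. exp (l * (\<Sum>i\<in>I. \<xi> i x)))"
    unfolding prodexp by (rule indep_vars_integrable[OF fin ind inte])
  have "expectation (\<lambda>x. exp (l * (\<Sum>i\<in>I. \<xi> i x))) = (\<Prod>i\<in>I. expectation (\<lambda>x. exp (l * \<xi> i x)))"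
    unfolding prodexp by (rule indep_vars_lebesgue_integral[OF fin ind inte])
  also have "\<dots> \<le> (\<Prod>i\<in>I. exp (l\<^sup>2 * expectation (\<lambda>x. (\<xi> i x)\<^sup>2)))"
  proof (rule prod_mono, intro conjI)
    fix i assume i: "i \<in> I"
    show "0 \<le> expectation (\<lambda>x. exp (l * \<xi> i x))" by simp
    have "expectation (\<lambda>x. exp (l * \<xi> i x)) \<le> expectation (\<lambda>x. 1 + l * \<xi> i x + l\<^sup>2 * (\<xi> i x)\<^sup>2)"
    proof (rule integral_mono_AE)
      show "AE x in M. exp (l * \<xi> i x) \<le> 1 + l * \<xi> i x + l\<^sup>2 * (\<xi> i x)\<^sup>2"
        using bnd[OF i] 
        proof eventually_elim
          case (elim x)
          show ?case using exp_le_quadratic[OF elim] by (simp add: power_mult_distrib)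
        qed
    qed (use inte int int2 i in auto)
    also have "\<dots> = 1 + l\<^sup>2 * expectation (\<lambda>x. (\<xi> i x)\<^sup>2)"
      using int[OF i] int2[OF i] mean[OF i] by (simp add: prob_space)
    also have "\<dots> \<le> exp (l\<^sup>2 * expectation (\<lambda>x. (\<xi> i x)\<^sup>2))"
      by (rule exp_ge_add_one_self)
    finally show "expectation (\<lambda>x. exp (l * \<xi> i x)) \<le> exp (l\<^sup>2 * expectation (\<lambda>x. (\<xi> i x)\<^sup>2))" .
  qed
  also have "\<dots> = exp (l\<^sup>2 * (\<Sum>i\<in>I. expectation (\<lambda>x. (\<xi> i x)\<^sup>2)))"
    by (simp add: sum_distrib_left exp_sum fin)
  also have "\<dots> \<le> exp (l\<^sup>2 * V)"
    using var by (simp add: mult_left_mono)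
  finally have E: "expectation (\<lambda>x. exp (l * (\<Sum>i\<in>I. \<xi> i x))) \<le> exp (l\<^sup>2 * V)" .
  have "{x\<in>space M. t \<le> (\<Sum>i\<in>I. \<xi> i x)} = {x\<in>space M. exp (l * t) \<le> exp (l * (\<Sum>i\<in>I. \<xi> i x))}"
    using lpos by auto
  also have "prob \<dots> \<le> expectation (\<lambda>x. exp (l * (\<Sum>i\<in>I. \<xi> i x))) / exp (l * t)"
    by (rule integral_Markov_inequality_measure[OF intp, of "{}"]) auto
  also have "\<dots> \<le> exp (l\<^sup>2 * V) / exp (l * t)"
    using E by (simp add: divide_right_mono)
  finally show ?thesis by (simp add: exp_diff)
qed

text \<open>The price of uniformity is the factor \<open>card J\<close>, which the nets below keep
  polynomial; applying the one-sided bound to \<open>\<xi>\<close> and to its negative accounts for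
  the 2.\<close>

lemma (in prob_space) bernstein_union_bound:
  fixes \<xi> :: "'j \<Rightarrow> 'i \<Rightarrow> 'a \<Rightarrow> real"
  assumes finJ: "finite J" and fin: "finite I"
    and indep: "\<And>j. j \<in> J \<Longrightarrow> indep_vars (\<lambda>_. borel) (\<xi> j) I"
    and bound: "\<And>j i. j \<in> J \<Longrightarrow> i \<in> I \<Longrightarrow> AE x in M. \<bar>\<xi> j i x\<bar> \<le> c"
    and mean: "\<And>j i. j \<in> J \<Longrightarrow> i \<in> I \<Longrightarrow> expectation (\<xi> j i) = 0"
    and var: "\<And>j. j \<in> J \<Longrightarrow> (\<Sum>i\<in>I. expectation (\<lambda>x. (\<xi> j i x)\<^sup>2)) \<le> V"
    and l: "0 \<le> l" "l * c \<le> 1"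
  shows "prob {x\<in>space M. \<exists>j\<in>J. t < \<bar>\<Sum>i\<in>I. \<xi> j i x\<bar>} \<le> 2 * card J * exp (l\<^sup>2 * V - l * t)"
proof -
  have meas[measurable]: "\<xi> j i \<in> borel_measurable M" if "j \<in> J" "i \<in> I" for i j
    using indep that by (auto simp: indep_vars_def)
  define P where "P j = {x\<in>space M. t \<le> (\<Sum>i\<in>I. \<xi> j i x)} \<union> {x\<in>space M. t \<le> (\<Sum>i\<in>I. - \<xi> j i x)}" for j
  have Pm[measurable]: "P j \<in> events" if "j \<in> J" for j
    unfolding P_def using that by measurable
  have "prob {x\<in>space M. \<exists>j\<in>J. t < \<bar>\<Sum>i\<in>I. \<xi> j i x\<bar>} \<le> prob (\<Union>j\<in>J. P j)"
    using finJ by (intro finite_measure_mono) (auto simp: P_def sum_negf)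
  also have "\<dots> \<le> (\<Sum>j\<in>J. prob (P j))"
    using finJ by (intro finite_measure_subadditive_finite) auto
  also have "\<dots> \<le> (\<Sum>j\<in>J. 2 * exp (l\<^sup>2 * V - l * t))"
  proof (rule sum_mono)
    fix j assume j: "j \<in> J"
    have 1: "prob {x\<in>space M. t \<le> (\<Sum>i\<in>I. \<xi> j i x)} \<le> exp (l\<^sup>2 * V - l * t)"
      by (rule bernstein_upper_tail[OF fin indep[OF j] _ _ var[OF j] l]) (use bound mean j in auto)
    have ind': "indep_vars (\<lambda>_. borel) (\<lambda>i x. - \<xi> j i x) I"
      by (rule indep_vars_compose2[OF indep[OF j]]) auto
    have 2: "prob {x\<in>space M. t \<le> (\<Sum>i\<in>I. - \<xi> j i x)} \<le> exp (l\<^sup>2 * V - l * t)"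
      by (rule bernstein_upper_tail[OF fin ind' _ _ _ l]) (use bound mean var j in auto)
    have "prob (P j) \<le> prob {x\<in>space M. t \<le> (\<Sum>i\<in>I. \<xi> j i x)} + prob {x\<in>space M. t \<le> (\<Sum>i\<in>I. - \<xi> j i x)}"
      unfolding P_def using j by (intro measure_Un_le) auto
    with 1 2 show "prob (P j) \<le> 2 * exp (l\<^sup>2 * V - l * t)" by simp
  qed
  finally show ?thesis by simp
qed

text \<open>On rectangles the probability factors first across the two sides and then within each
  family; rectangles are intersection-stable and generate the product algebra. \<open>\<A>\<close>
  and \<open>\<B>\<close> may be any collections that contain the two generated algebras, so the
  data and weight algebras can be inserted.\<close>

lemma (in prob_space) indep_vars_Pair:
  assumes A: "indep_vars N A I" and B: "indep_vars N' B I"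
    and indep: "indep_set \<A> \<B>"
    and sub\<A>: "\<And>S. S \<in> sigma_sets (space M) (\<Union>i\<in>I. {A i -` S \<inter> space M | S. S \<in> sets (N i)}) \<Longrightarrow> S \<in> \<A>"
    and sub\<B>: "\<And>S. S \<in> sigma_sets (space M) (\<Union>i\<in>I. {B i -` S \<inter> space M | S. S \<in> sets (N' i)}) \<Longrightarrow> S \<in> \<B>"
  shows "indep_vars (\<lambda>i. N i \<Otimes>\<^sub>M N' i) (\<lambda>i w. (A i w, B i w)) I"
proof -
  have Am[measurable]: "A i \<in> measurable M (N i)" if "i \<in> I" for i
    using A that by (auto simp: indep_vars_def)
  have Bm[measurable]: "B i \<in> measurable M (N' i)" if "i \<in> I" for i
    using B that by (auto simp: indep_vars_def)
  define G where "G i = {(A i -` S \<inter> space M) \<inter> (B i -` S' \<inter> space M) | S S'. S \<in> sets (N i) \<and> S' \<in> sets (N' i)}" for i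
  have "indep_sets G I"
    unfolding indep_sets_def
  proof (intro conjI ballI allI impI)
    fix i assume "i \<in> I" then show "G i \<subseteq> events" unfolding G_def by auto
  next
    fix K E assume K: "K \<subseteq> I" "K \<noteq> {}" "finite K" and E: "E \<in> Pi K G"
    have "\<forall>i\<in>K. \<exists>S S'. S \<in> sets (N i) \<and> S' \<in> sets (N' i) \<and> E i = (A i -` S \<inter> space M) \<inter> (B i -` S' \<inter> space M)"
    proof
      fix i assume "i \<in> K"
      then have "E i \<in> G i" using E by auto
      then show "\<exists>S S'. S \<in> sets (N i) \<and> S' \<in> sets (N' i) \<and> E i = (A i -` S \<inter> space M) \<inter> (B i -` S' \<inter> space M)"
        unfolding G_def by blast
    qed
    then obtain S S' where S: "\<And>i. i \<in> K \<Longrightarrow> S i \<in> sets (N i)" "\<And>i. i \<in> K \<Longrightarrow> S' i \<in> sets (N' i)"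
      and Ei: "\<And>i. i \<in> K \<Longrightarrow> E i = (A i -` S i \<inter> space M) \<inter> (B i -` S' i \<inter> space M)"
      by metis
    let ?A = "\<lambda>i. A i -` S i \<inter> space M" and ?B = "\<lambda>i. B i -` S' i \<inter> space M"
    have a: "(\<Inter>i\<in>K. ?A i) \<in> \<A>"
    proof (rule sub\<A>)
      interpret sigma_algebra "space M" "sigma_sets (space M) (\<Union>i\<in>I. {A i -` S \<inter> space M | S. S \<in> sets (N i)})"
        by (rule sigma_algebra_sigma_sets) auto
      show "(\<Inter>i\<in>K. ?A i) \<in> sigma_sets (space M) (\<Union>i\<in>I. {A i -` S \<inter> space M | S. S \<in> sets (N i)})"
        using K S by (intro finite_INT) (blast intro: sigma_sets.Basic)+
    qed
    have b: "(\<Inter>i\<in>K. ?B i) \<in> \<B>"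
    proof (rule sub\<B>)
      interpret sigma_algebra "space M" "sigma_sets (space M) (\<Union>i\<in>I. {B i -` S \<inter> space M | S. S \<in> sets (N' i)})"
        by (rule sigma_algebra_sigma_sets) auto
      show "(\<Inter>i\<in>K. ?B i) \<in> sigma_sets (space M) (\<Union>i\<in>I. {B i -` S \<inter> space M | S. S \<in> sets (N' i)})"
        using K S by (intro finite_INT) (blast intro: sigma_sets.Basic)+
    qed
    have pA: "prob (\<Inter>i\<in>L. ?A i) = (\<Prod>i\<in>L. prob (?A i))" if "L \<subseteq> K" "L \<noteq> {}" for L
    proof -
      have "indep_sets (\<lambda>i. {A i -` S \<inter> space M | S. S \<in> sets (N i)}) I"
        using A unfolding indep_vars_def2 by auto
      then show ?thesis
        using that K S finite_subset[OF that(1)] by (intro indep_setsD[where I=I]) blast+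
    qed
    have pB: "prob (\<Inter>i\<in>L. ?B i) = (\<Prod>i\<in>L. prob (?B i))" if "L \<subseteq> K" "L \<noteq> {}" for L
    proof -
      have "indep_sets (\<lambda>i. {B i -` S \<inter> space M | S. S \<in> sets (N' i)}) I"
        using B unfolding indep_vars_def2 by auto
      then show ?thesis
        using that K S finite_subset[OF that(1)] by (intro indep_setsD[where I=I]) blast+
    qed
    have single: "prob (?A i \<inter> ?B i) = prob (?A i) * prob (?B i)" if "i \<in> K" for i
    proof (rule indep_setD[OF indep])
      show "?A i \<in> \<A>" using that K S by (intro sub\<A> sigma_sets.Basic) blast
      show "?B i \<in> \<B>" using that K S by (intro sub\<B> sigma_sets.Basic) blast
    qed
    have "prob (\<Inter>i\<in>K. E i) = prob ((\<Inter>i\<in>K. ?A i) \<inter> (\<Inter>i\<in>K. ?B i))"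
      using K by (intro arg_cong[where f=prob]) (auto simp: Ei)
    also have "\<dots> = prob (\<Inter>i\<in>K. ?A i) * prob (\<Inter>i\<in>K. ?B i)"
      by (rule indep_setD[OF indep a b])
    also have "\<dots> = (\<Prod>i\<in>K. prob (?A i) * prob (?B i))"
      using pA[OF order_refl K(2)] pB[OF order_refl K(2)] by (simp only: prod.distrib)
    also have "\<dots> = (\<Prod>i\<in>K. prob (E i))"
      by (intro prod.cong) (auto simp: Ei single)
    finally show "prob (\<Inter>i\<in>K. E i) = (\<Prod>i\<in>K. prob (E i))" .
  qed
  then have sig: "indep_sets (\<lambda>i. sigma_sets (space M) (G i)) I"
  proof (rule indep_sets_sigma)
    fix i assume "i \<in> I"
    show "Int_stable (G i)"
    proof (rule Int_stableI)
      fix a b assume "a \<in> G i" "b \<in> G i"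
      from \<open>a \<in> G i\<close> obtain S S' where 1: "a = (A i -` S \<inter> space M) \<inter> (B i -` S' \<inter> space M)" "S \<in> sets (N i)" "S' \<in> sets (N' i)"
        unfolding G_def by blast
      from \<open>b \<in> G i\<close> obtain U U' where 2: "b = (A i -` U \<inter> space M) \<inter> (B i -` U' \<inter> space M)" "U \<in> sets (N i)" "U' \<in> sets (N' i)"
        unfolding G_def by blast
      from 1 2 have "a \<inter> b = (A i -` (S \<inter> U) \<inter> space M) \<inter> (B i -` (S' \<inter> U') \<inter> space M)"
        "S \<inter> U \<in> sets (N i)" "S' \<inter> U' \<in> sets (N' i)" by auto
      then show "a \<inter> b \<in> G i" unfolding G_def by blast
    qed
  qed
  show ?thesis
    unfolding indep_vars_def2
  proof (intro conjI ballI)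
    fix i assume "i \<in> I"
    then show "random_variable (N i \<Otimes>\<^sub>M N' i) (\<lambda>w. (A i w, B i w))" by measurable
  next
    show "indep_sets (\<lambda>i. {(\<lambda>w. (A i w, B i w)) -` S \<inter> space M | S. S \<in> sets (N i \<Otimes>\<^sub>M N' i)}) I"
    proof (rule indep_sets_mono_sets[OF sig])
      fix i assume i: "i \<in> I"
      have sp: "(\<lambda>w. (A i w, B i w)) \<in> space M \<rightarrow> space (N i) \<times> space (N' i)"
        using Am[OF i] Bm[OF i] by (auto dest: measurable_space)
      have "{(\<lambda>w. (A i w, B i w)) -` S \<inter> space M | S. S \<in> sets (N i \<Otimes>\<^sub>M N' i)}
          = sigma_sets (space M) {(\<lambda>w. (A i w, B i w)) -` S \<inter> space M | S. S \<in> {a \<times> b | a b. a \<in> sets (N i) \<and> b \<in> sets (N' i)}}"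
        unfolding sets_pair_measure by (rule sigma_sets_vimage_commute[OF sp])
      also have "\<dots> \<subseteq> sigma_sets (space M) (G i)"
        by (intro sigma_sets_mono') (auto simp: G_def vimage_def)
      finally show "{(\<lambda>w. (A i w, B i w)) -` S \<inter> space M | S. S \<in> sets (N i \<Otimes>\<^sub>M N' i)} \<subseteq> sigma_sets (space M) (G i)" .
    qed
  qed
qed

text \<open>By second countability the complement of the support is covered by countably many null
  basic open sets. This is what allows assumptions made for \<open>x\<close> in the support to be
  used almost surely.\<close>

lemma AE_in_law_support:
  fixes X :: "'a \<Rightarrow> 'b::second_countable_topology"
  assumes M: "prob_space M" and [measurable]: "X \<in> borel_measurable M"
  shows "AE w in M. X w \<in> law_support M X"
proof -
  interpret prob_space M by fact
  obtain \<B> :: "'b set set" where cB: "countable \<B>" and basis: "topological_basis \<B>"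
    by (metis ex_countable_basis)
  define \<N> where "\<N> = {U\<in>\<B>. measure M (X -` U \<inter> space M) = 0}"
  have "countable \<N>" using cB by (auto simp: \<N>_def)
  have "AE w in M. \<forall>U\<in>\<N>. X w \<notin> U"
  proof (subst AE_ball_countable[OF \<open>countable \<N>\<close>], intro ballI)
    fix U assume U: "U \<in> \<N>"
    then have [measurable]: "U \<in> sets borel"
      using basis by (auto simp: \<N>_def topological_basis_open intro!: borel_open)
    have "X -` U \<inter> space M \<in> null_sets M"
      using U by (auto simp: \<N>_def null_sets_def emeasure_eq_measure)
    then show "AE w in M. X w \<notin> U"
      by (rule AE_I') auto
  qed
  then show ?thesis
  proof eventually_elim
    case (elim w)
    show ?case unfolding law_support_def
    proof (intro CollectI allI impI)
      fix U assume "open U" "X w \<in> U"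
      then obtain B where B: "B \<in> \<B>" "X w \<in> B" "B \<subseteq> U"
        using basis by (metis topological_basisE)
      then have "B \<notin> \<N>" using elim by auto
      then have "0 < measure M (X -` B \<inter> space M)"
        using B measure_nonneg[of M "X -` B \<inter> space M"] by (auto simp: \<N>_def less_le)
      also have "\<dots> \<le> measure M (X -` U \<inter> space M)"
        using B \<open>open U\<close> by (intro finite_measure_mono) (auto simp: measurable_sets borel_open)
      finally show "0 < measure M (X -` U \<inter> space M)" .
    qed
  qed
qed

text \<open>The net is a lattice of mesh \<open>1 / (n * d)\<close> in a box. Rounding down moves
  each of the \<open>d\<close> coordinates by at most the mesh, so the l1 norm bounds the error by
  \<open>1 / n\<close>. The points of the net need not lie in \<open>S\<close>.\<close>

lemma polynomial_net:
  fixes S :: "(real ^ 'd) set"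
  assumes "bounded S"
  obtains C :: real and p :: nat where "\<And>n::nat. n \<ge> 1 \<Longrightarrow>
    \<exists>G. finite G \<and> real (card G) \<le> C * real n ^ p \<and> (\<forall>b\<in>S. \<exists>g\<in>G. norm (b - g) \<le> 1 / real n)"
proof -
  define d where "d = CARD('d)"
  have dpos: "d > 0" by (simp add: d_def)
  obtain K0 where K0: "\<And>b. b \<in> S \<Longrightarrow> norm b \<le> K0" using assms by (auto simp: bounded_iff)
  define K :: nat where "K = nat \<lceil>K0\<rceil> + 1"
  have K: "norm b \<le> real K" if "b \<in> S" for b
    using K0[OF that] unfolding K_def by linarith
  show thesis
  proof (rule that[of "(real (3 * K * d)) ^ d" d])
    fix n :: nat assume n: "n \<ge> 1"
    define m where "m = n * d"
    have m: "m \<ge> 1" using n dpos by (simp add: m_def)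
    define Z where "Z = {- int (K * m) .. int (K * m)}"
    define G :: "(real ^ 'd) set" where "G = (\<lambda>k. \<chi> i. real_of_int (k i) / real m) ` (PiE UNIV (\<lambda>_. Z))"
    have fin: "finite G" unfolding G_def Z_def by (intro finite_imageI finite_PiE) auto
    have "card G \<le> card (PiE (UNIV::'d set) (\<lambda>_. Z))"
      unfolding G_def by (intro card_image_le finite_PiE) (auto simp: Z_def)
    also have "\<dots> = (2 * K * m + 1) ^ d"
    proof -
      have "card Z = nat (2 * int (K * m) + 1)" by (simp add: Z_def)
      also have "\<dots> = 2 * K * m + 1" by linarith
      finally show ?thesis by (simp add: card_PiE d_def)
    qed
    also have "\<dots> \<le> (3 * K * m) ^ d"
    proof (rule power_mono)
      have "1 \<le> K * m" using m by (simp add: K_def)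
      then show "2 * K * m + 1 \<le> 3 * K * m" by simp
    qed simp
    also have "\<dots> = (3 * K * d) ^ d * n ^ d" by (simp add: m_def power_mult_distrib)
    finally have "real (card G) \<le> real ((3 * K * d) ^ d * n ^ d)" by (simp only: of_nat_le_iff)
    then have card: "real (card G) \<le> (real (3 * K * d)) ^ d * real n ^ d" by simp
    have near: "\<exists>g\<in>G. norm (b - g) \<le> 1 / real n" if b: "b \<in> S" for b
    proof -
      define k where "k i = \<lfloor>real m * b $ i\<rfloor>" for i
      have kZ: "k i \<in> Z" for i
      proof -
        have "\<bar>b $ i\<bar> \<le> real K" using component_le_norm_cart[of b i] K[OF b] by linarith
        then have "\<bar>real m * b $ i\<bar> \<le> real (K * m)" using m by (simp add: abs_mult mult.commute mult_left_mono)
        then show ?thesis unfolding k_def Z_def by (auto simp: le_floor_iff floor_le_iff abs_le_iff)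
      qed
      define g :: "real ^ 'd" where "g = (\<chi> i. real_of_int (k i) / real m)"
      have gG: "g \<in> G" unfolding G_def g_def using kZ by auto
      have "\<bar>(b - g) $ i\<bar> \<le> 1 / real m" for i
      proof -
        have "0 \<le> real m * b $ i - real_of_int (k i)" "real m * b $ i - real_of_int (k i) \<le> 1"
          unfolding k_def by linarith+
        moreover have "(b - g) $ i = (real m * b $ i - real_of_int (k i)) / real m"
          using m by (simp add: g_def field_simps)
        ultimately show ?thesis using m by (simp add: divide_right_mono)
      qed
      then have "norm (b - g) \<le> (\<Sum>i\<in>(UNIV::'d set). 1 / real m)"
        by (intro order_trans[OF norm_le_l1_cart] sum_mono) auto
      also have "\<dots> = 1 / real n" using dpos n by (simp add: m_def d_def)
      finally show ?thesis using gG by auto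
    qed
    show "\<exists>G. finite G \<and> real (card G) \<le> real (3 * K * d) ^ d * real n ^ d \<and> (\<forall>b\<in>S. \<exists>g\<in>G. norm (b - g) \<le> 1 / real n)"
      using fin card near by blast
  qed
qed

section \<open>Measurable covers and regular conditional probabilities\<close>

text \<open>Minimize the expectation over the measurable majorants that are bounded by
  \<open>c\<close>: the pointwise infimum of a minimizing sequence is again one of them and attains
  the minimum.\<close>

lemma (in prob_space) measurable_cover_exists:
  fixes Z :: "'a \<Rightarrow> real"
  assumes Z: "\<And>w. w \<in> space M \<Longrightarrow> \<bar>Z w\<bar> \<le> c"
  shows "\<exists>U. is_measurable_cover M Z U"
proof -
  define \<U> where "\<U> = {U \<in> borel_measurable M. \<forall>w\<in>space M. Z w \<le> U w \<and> \<bar>U w\<bar> \<le> c}"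
  have int: "integrable M U" if "U \<in> \<U>" for U
    using that by (intro integrable_const_bound[where B=c]) (auto simp: \<U>_def)
  have ge: "- c \<le> expectation U" if "U \<in> \<U>" for U
  proof -
    have "expectation (\<lambda>_. - c) \<le> expectation U"
    proof (rule integral_mono)
      show "- c \<le> U w" if "w \<in> space M" for w
      proof -
        have "\<bar>U w\<bar> \<le> c" using \<open>U \<in> \<U>\<close> that by (auto simp: \<U>_def)
        then show ?thesis by linarith
      qed
    qed (use int[OF that] in auto)
    then show ?thesis by (simp add: prob_space)
  qed
  define m where "m = (INF U\<in>\<U>. expectation U)"
  have bdd: "bdd_below (expectation ` \<U>)" using ge by (intro bdd_belowI[of _ "-c"]) auto
  have "c \<ge> 0" using Z not_empty by (metis abs_ge_zero equals0I order_trans)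
  then have "(\<lambda>_. c) \<in> \<U>" using Z by (auto simp: \<U>_def abs_le_iff)
  then have ne: "\<U> \<noteq> {}" by auto
  have "\<exists>U\<in>\<U>. expectation U < m + 1 / real (Suc n)" for n
    using cInf_lessD[of "expectation ` \<U>" "m + 1 / real (Suc n)"] ne by (auto simp: m_def)
  then obtain U where U: "\<And>n. U n \<in> \<U>" and EU: "\<And>n. expectation (U n) < m + 1 / real (Suc n)" by metis
  define S where "S w = (INF n. U n w)" for w
  have Um: "U n \<in> borel_measurable M" for n using U by (auto simp: \<U>_def)
  have Ub: "Z w \<le> U n w" "\<bar>U n w\<bar> \<le> c" if "w \<in> space M" for w n
    using U[of n] that by (auto simp: \<U>_def)
  have bb: "bdd_below (range (\<lambda>n. U n w))" if "w \<in> space M" for w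
    using Ub(1)[OF that] by (intro bdd_belowI[of _ "Z w"]) auto
  have SU: "S w \<le> U n w" if "w \<in> space M" for w n
    unfolding S_def using bb[OF that] by (intro cINF_lower) auto
  have ZS: "Z w \<le> S w" if "w \<in> space M" for w
    unfolding S_def using Ub(1)[OF that] by (intro cINF_greatest) auto
  have Sm: "S \<in> borel_measurable M"
    unfolding S_def[abs_def] using bb Um by (intro borel_measurable_cINF) auto
  have Sc: "\<bar>S w\<bar> \<le> c" if "w \<in> space M" for w
    using SU[OF that, of 0] ZS[OF that] Ub(2)[OF that, of 0] Z[OF that] by (auto simp: abs_le_iff)
  have S\<U>: "S \<in> \<U>" using Sm ZS Sc by (auto simp: \<U>_def)
  have "expectation S \<le> m"
  proof (rule field_le_epsilon)
    fix e :: real assume "e > 0"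
    then obtain n where "1 / real (Suc n) < e" by (metis nat_approx_posE)
    moreover have "expectation S \<le> expectation (U n)"
      using SU int[OF S\<U>] int[OF U] by (intro integral_mono) auto
    ultimately show "expectation S \<le> m + e" using EU[of n] by linarith
  qed
  have "AE w in M. S w \<le> U' w" if [measurable]: "U' \<in> borel_measurable M" and U': "\<forall>w\<in>space M. Z w \<le> U' w" for U'
  proof -
    \<comment> \<open>If \<open>U'\<close> were smaller than \<open>S\<close> on a set of positive
      measure, \<open>V\<close> would be a majorant in the class with expectation below the minimum
      \<open>m\<close>.\<close>
    define V where "V w = min (S w) (U' w)" for w
    have "V \<in> \<U>"
      unfolding \<U>_def V_def[abs_def] using Sm ZS Sc U' Z
      by (auto simp: abs_le_iff min_def) (smt (verit, best))+
    have [measurable]: "S \<in> borel_measurable M" by fact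
    have "m \<le> expectation V" unfolding m_def using \<open>V \<in> \<U>\<close> by (intro cINF_lower bdd)
    then have le: "expectation (\<lambda>w. S w - V w) \<le> 0"
      using \<open>expectation S \<le> m\<close> int[OF S\<U>] int[OF \<open>V \<in> \<U>\<close>] by simp
    have "AE w in M. S w - V w = 0"
    proof (subst integral_nonneg_eq_0_iff_AE[symmetric])
      show "integrable M (\<lambda>w. S w - V w)" using int[OF S\<U>] int[OF \<open>V \<in> \<U>\<close>] by simp
      have nn: "0 \<le> S w - V w" for w by (simp add: V_def)
      then show "AE w in M. 0 \<le> S w - V w" by simp
      have "0 \<le> expectation (\<lambda>w. S w - V w)" using nn by (intro integral_nonneg_AE) auto
      then show "expectation (\<lambda>w. S w - V w) = 0" using le by simp
    qed
    then show ?thesis by eventually_elim (auto simp: V_def)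
  qed
  then have "is_measurable_cover M Z S"
    unfolding is_measurable_cover_def using Sm ZS by blast
  then show ?thesis by blast
qed

text \<open>Tested on a set of \<open>F\<close>, whose indicator is independent of \<open>g\<close>.
  The collection \<open>\<W>\<close> only has to contain the preimages under
  \<open>g\<close>.\<close>

lemma (in prob_space) real_cond_exp_indep:
  fixes g :: "'a \<Rightarrow> real"
  assumes sub: "subalgebra M F" and indep: "indep_set (sets F) \<W>" and g: "integrable M g"
    and pre: "\<And>S. S \<in> sets borel \<Longrightarrow> g -` S \<inter> space M \<in> \<W>"
  shows "AE w in M. real_cond_exp M F g w = expectation g"
proof -
  interpret finite_measure_subalgebra M F by standard fact
  show ?thesis
  proof (rule real_cond_exp_charact[OF _ g])
    fix A assume A: "A \<in> sets F"
    then have [measurable]: "A \<in> events" using sub by (auto simp: subalgebra_def)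
    have pre1: "(indicator A :: 'a \<Rightarrow> real) -` S \<inter> space M \<in> sets F" for S
    proof -
      have "space M \<in> sets F" using sub by (metis sets.top subalgebra_def)
      moreover have "(indicator A :: 'a \<Rightarrow> real) -` S \<inter> space M =
          (if 1 \<in> S then A else {}) \<union> (if 0 \<in> S then space M - A else {})"
        using sets.sets_into_space[OF \<open>A \<in> events\<close>] by (auto simp: indicator_def of_bool_def split: if_splits)
      ultimately show ?thesis using A by auto
    qed
    have "indep_var borel (indicator A :: 'a \<Rightarrow> real) borel g"
      unfolding indep_var_eq
    proof (intro conjI)
      have i0: "indep_set {(indicator A :: 'a \<Rightarrow> real) -` S \<inter> space M | S. S \<in> sets borel} {g -` S \<inter> space M | S. S \<in> sets borel}"
        using pre1 pre g by (intro indep_setI) (auto intro!: indep_setD[OF indep])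
      show "indep_set (sigma_sets (space M) {(indicator A :: 'a \<Rightarrow> real) -` S \<inter> space M | S. S \<in> sets borel}) (sigma_sets (space M) {g -` S \<inter> space M | S. S \<in> sets borel})"
      proof (rule indep_set_sigma_sets[OF i0])
        show "Int_stable {(indicator A :: 'a \<Rightarrow> real) -` S \<inter> space M | S. S \<in> sets borel}"
          unfolding Int_stable_def by (smt (verit, best) Int_assoc Int_left_commute inf.idem mem_Collect_eq sets.Int vimage_Int)
        show "Int_stable {g -` S \<inter> space M | S. S \<in> sets borel}"
          unfolding Int_stable_def by (smt (verit, best) Int_assoc Int_left_commute inf.idem mem_Collect_eq sets.Int vimage_Int)
      qed
    qed (use g in auto)
    then have "expectation (\<lambda>w. indicator A w * g w) = expectation (indicator A) * expectation g"
      using g by (intro indep_var_lebesgue_integral) (auto simp: emeasure_eq_measure)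
    then show "(\<integral>w\<in>A. g w \<partial>M) = (\<integral>w\<in>A. expectation g \<partial>M)"
      by (simp add: set_lebesgue_integral_def)
  qed auto
qed

section \<open>Integration against a regular conditional probability\<close>

lemma (in prob_space) regular_cond_prob_measurable:
  assumes K: "is_regular_cond_prob M F K" and sub: "subalgebra M F"
  shows "K \<in> measurable F (subprob_algebra M)" "K \<in> measurable M (subprob_algebra M)"
    "\<And>w. w \<in> space M \<Longrightarrow> prob_space (K w)" "\<And>w. w \<in> space M \<Longrightarrow> sets (K w) = sets M"
    "\<And>w. w \<in> space M \<Longrightarrow> space (K w) = space M"
proof -
  have KF: "K \<in> measurable F (prob_algebra M)" using K by (simp add: is_regular_cond_prob_def)
  then show *: "K \<in> measurable F (subprob_algebra M)" by (rule measurable_prob_algebraD)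
  show "K \<in> measurable M (subprob_algebra M)" by (rule measurable_from_subalg[OF sub *])
  fix w assume "w \<in> space M"
  then have "K w \<in> space (prob_algebra M)" using KF sub by (auto simp: subalgebra_def dest: measurable_space)
  then show "prob_space (K w)" "sets (K w) = sets M"
    by (auto simp: space_prob_algebra)
  then show "space (K w) = space M" by (auto dest: sets_eq_imp_space_eq)
qed

text \<open>The definition gives the identity only for indicators of fixed events. For
  \<open>A\<close> in \<open>F\<close> it says that mixing the kernel \<open>K\<close> over
  \<open>density M (indicator A)\<close> reproduces this measure, and integrals against such a
  mixture iterate.\<close>

lemma (in prob_space) regular_cond_prob_nn_integral:
  fixes g :: "'a \<Rightarrow> ennreal"
  assumes K: "is_regular_cond_prob M F K" and sub: "subalgebra M F" and g[measurable]: "g \<in> borel_measurable M"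
  shows "AE w in M. (\<integral>\<^sup>+w'. g w' \<partial>K w) = nn_cond_exp M F g w"
proof -
  interpret finite_measure_subalgebra M F by standard fact
  note Km = regular_cond_prob_measurable[OF K sub]
  show ?thesis
  proof (rule nn_cond_exp_charact)
    fix A assume A: "A \<in> sets F"
    then have [measurable]: "A \<in> events" using sub by (auto simp: subalgebra_def)
    define N where "N = density M (indicator A)"
    have setsN[measurable_cong]: "sets N = sets M" and spN: "space N = space M" by (auto simp: N_def)
    have KN[measurable]: "K \<in> measurable N (subprob_algebra M)" using Km(2) by (simp cong: measurable_cong_sets add: setsN)
    have neN: "space N \<noteq> {}" using not_empty by (simp add: spN)
    have "N \<bind> K = N"
    proof (rule measure_eqI)
      show "sets (N \<bind> K) = sets N" using Km(4) neN by (subst sets_bind[of _ _ M]) (auto simp: setsN spN)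
      fix B assume "B \<in> sets (N \<bind> K)"
      then have B[measurable]: "B \<in> events" using Km(4) neN by (subst (asm) sets_bind[of _ _ M]) (auto simp: setsN spN)
      let ?r = "real_cond_exp M F (indicator B)"
      have rB: "integrable M (indicator B :: 'a \<Rightarrow> real)" by (simp add: emeasure_eq_measure)
      have "emeasure (N \<bind> K) B = (\<integral>\<^sup>+w. emeasure (K w) B \<partial>N)"
        by (rule emeasure_bind[OF neN KN B])
      also have "\<dots> = (\<integral>\<^sup>+w. indicator A w * emeasure (K w) B \<partial>M)"
        unfolding N_def using Km(2) by (subst nn_integral_density) auto
      also have "\<dots> = (\<integral>\<^sup>+w. ennreal (indicator A w * ?r w) \<partial>M)"
      proof (rule nn_integral_cong_AE)
        have "AE w in M. measure (K w) B = ?r w" using K B by (simp add: is_regular_cond_prob_def)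
        then show "AE w in M. indicator A w * emeasure (K w) B = ennreal (indicator A w * ?r w)"
        proof (rule AE_mp, intro AE_I2 impI)
          fix w assume w: "w \<in> space M" "measure (K w) B = ?r w"
          interpret Kw: prob_space "K w" by (rule Km(3)[OF w(1)])
          show "indicator A w * emeasure (K w) B = ennreal (indicator A w * ?r w)"
            using w(2) by (auto simp: indicator_def Kw.emeasure_eq_measure)
        qed
      qed
      also have "\<dots> = ennreal (\<integral>w. indicator A w * ?r w \<partial>M)"
      proof (rule nn_integral_eq_integral)
        show "integrable M (\<lambda>w. indicator A w * ?r w)"
          using integrable_mult_indicator[OF _ real_cond_exp_int(1)[OF rB], of A] by simp
        show "AE w in M. 0 \<le> indicator A w * ?r w"
          using real_cond_exp_pos[of "indicator B"] by (auto simp: indicator_def)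
      qed
      also have "(\<integral>w. indicator A w * ?r w \<partial>M) = (\<integral>w. indicator A w * indicator B w \<partial>M)"
        using real_cond_exp_intA[OF rB A] by (simp add: set_lebesgue_integral_def)
      also have "\<dots> = measure M (A \<inter> B)"
        by (simp add: indicator_inter_arith[symmetric])
      also have "ennreal \<dots> = emeasure N B"
        unfolding N_def by (simp add: emeasure_density emeasure_eq_measure flip: indicator_inter_arith)
      finally show "emeasure (N \<bind> K) B = emeasure N B" .
    qed
    then have "(\<integral>\<^sup>+w. g w \<partial>N) = (\<integral>\<^sup>+w. \<integral>\<^sup>+w'. g w' \<partial>K w \<partial>N)"
      using nn_integral_bind[OF g KN] by simp
    moreover have "(\<lambda>w. \<integral>\<^sup>+w'. g w' \<partial>K w) \<in> borel_measurable M"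
      by (rule measurable_compose[OF Km(2) nn_integral_measurable_subprob_algebra[OF g]])
    ultimately show "(\<integral>\<^sup>+w\<in>A. g w \<partial>M) = (\<integral>\<^sup>+w\<in>A. (\<integral>\<^sup>+w'. g w' \<partial>K w) \<partial>M)"
      unfolding N_def by (simp add: nn_integral_density mult.commute)
  next
    show "(\<lambda>w. \<integral>\<^sup>+w'. g w' \<partial>K w) \<in> borel_measurable F"
      by (rule measurable_compose[OF Km(1) nn_integral_measurable_subprob_algebra[OF g]])
  qed auto
qed

text \<open>\<open>real_cond_exp\<close> is by definition the difference of the conditional
  expectations of the positive and the negative part, so the nonnegative case applies to each of
  them; applied to the norm it gives integrability under almost every \<open>K w\<close>.\<close>

lemma (in prob_space) regular_cond_prob_integral:
  fixes g :: "'a \<Rightarrow> real"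
  assumes K: "is_regular_cond_prob M F K" and sub: "subalgebra M F" and g: "integrable M g"
  shows "AE w in M. integrable (K w) g \<and> (\<integral>w'. g w' \<partial>K w) = real_cond_exp M F g w"
proof -
  interpret finite_measure_subalgebra M F by standard fact
  note Km = regular_cond_prob_measurable[OF K sub]
  have gm[measurable]: "g \<in> borel_measurable M" using g by auto
  have fin: "AE w in M. nn_cond_exp M F (\<lambda>x. ennreal (norm (g x))) w < \<infinity>"
  proof -
    have "(\<integral>\<^sup>+ x. nn_cond_exp M F (\<lambda>x. ennreal (norm (g x))) x \<partial>M) = (\<integral>\<^sup>+ x. ennreal (norm (g x)) \<partial>M)"
      using nn_cond_exp_intg[of "\<lambda>_. 1" "\<lambda>x. ennreal (norm (g x))"] by simp
    also have "\<dots> < \<infinity>" using g by (auto simp: integrable_iff_bounded)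
    finally have "AE x in M. nn_cond_exp M F (\<lambda>x. ennreal (norm (g x))) x \<noteq> \<infinity>"
      by (intro nn_integral_PInf_AE) auto
    then show ?thesis by eventually_elim (simp add: less_top)
  qed
  have "AE w in M. (\<integral>\<^sup>+x. ennreal (g x) \<partial>K w) = nn_cond_exp M F (\<lambda>x. ennreal (g x)) w"
    by (rule regular_cond_prob_nn_integral[OF K sub]) auto
  moreover have "AE w in M. (\<integral>\<^sup>+x. ennreal (- g x) \<partial>K w) = nn_cond_exp M F (\<lambda>x. ennreal (- g x)) w"
    by (rule regular_cond_prob_nn_integral[OF K sub]) auto
  moreover have "AE w in M. (\<integral>\<^sup>+x. ennreal (norm (g x)) \<partial>K w) = nn_cond_exp M F (\<lambda>x. ennreal (norm (g x))) w"
    by (rule regular_cond_prob_nn_integral[OF K sub]) auto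
  ultimately show ?thesis using fin AE_space
  proof eventually_elim
    case (elim w)
    have "g \<in> borel_measurable (K w)" using gm Km(4)[OF elim(5)] by (simp cong: measurable_cong_sets)
    then have i: "integrable (K w) g" using elim(3,4) by (auto simp: integrable_iff_bounded)
    show ?case using i elim(1,2) by (simp add: real_lebesgue_integral_def[OF i] real_cond_exp_def)
  qed
qed

text \<open>For \<open>A\<close> in \<open>F\<close> the conditional expectation of its indicator is
  the indicator itself, so \<open>K w\<close> gives \<open>A\<close> mass 0 or 1.\<close>

lemma (in prob_space) regular_cond_prob_AE_iff:
  assumes K: "is_regular_cond_prob M F K" and sub: "subalgebra M F" and A: "A \<in> sets F"
  shows "AE w in M. AE w' in K w. w' \<in> A \<longleftrightarrow> w \<in> A"
proof -
  interpret finite_measure_subalgebra M F by standard fact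
  note Km = regular_cond_prob_measurable[OF K sub]
  have AM[measurable]: "A \<in> events" using A sub by (auto simp: subalgebra_def)
  have "AE w in M. measure (K w) A = real_cond_exp M F (indicator A) w"
    using K AM by (simp add: is_regular_cond_prob_def)
  moreover have "AE w in M. real_cond_exp M F (indicator A) w = indicator A w"
    using A by (intro real_cond_exp_F_meas) (auto simp: emeasure_eq_measure)
  ultimately show ?thesis using AE_space
  proof eventually_elim
    case (elim w)
    interpret Kw: prob_space "K w" by (rule Km(3)[OF elim(3)])
    have [measurable]: "A \<in> Kw.events" using AM Km(4)[OF elim(3)] by simp
    show ?case
    proof (cases "w \<in> A")
      case True
      then have "Kw.prob A = 1" using elim by simp
      then have "AE w' in K w. w' \<in> A" by (simp add: Kw.prob_eq_1)
      then show ?thesis using True by simp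
    next
      case False
      then have "Kw.prob A = 0" using elim by simp
      then have "AE w' in K w. w' \<notin> A" by (simp add: Kw.prob_eq_0)
      then show ?thesis using False by simp
    qed
  qed
qed

text \<open>The rational level sets determine the value of \<open>Z\<close>, so countably many null
  sets suffice. The consequence needed later is that under \<open>K w\<close> the data are frozen at
  their values at \<open>w\<close>.\<close>

lemma (in prob_space) regular_cond_prob_const:
  fixes Z :: "'a \<Rightarrow> real"
  assumes K: "is_regular_cond_prob M F K" and sub: "subalgebra M F" and Z[measurable]: "Z \<in> borel_measurable F"
  shows "AE w in M. AE w' in K w. Z w' = Z w"
proof -
  have spF: "space F = space M" using sub by (simp add: subalgebra_def)
  have "AE w in M. \<forall>r::rat. AE w' in K w. w' \<in> {x\<in>space F. Z x \<le> of_rat r} \<longleftrightarrow> w \<in> {x\<in>space F. Z x \<le> of_rat r}"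
    unfolding AE_all_countable
    by (intro allI regular_cond_prob_AE_iff[OF K sub]) measurable
  then show ?thesis using AE_space
  proof eventually_elim
    case (elim w)
    from elim(1) have "AE w' in K w. \<forall>r::rat. w' \<in> {x\<in>space F. Z x \<le> of_rat r} \<longleftrightarrow> w \<in> {x\<in>space F. Z x \<le> of_rat r}"
      by (subst AE_all_countable)
    then show ?case using AE_space
    proof eventually_elim
      case (elim w')
      have sp: "w' \<in> space M" "w \<in> space M"
        using elim(2) regular_cond_prob_measurable(5)[OF K sub] \<open>w \<in> space M\<close> by auto
      have iff: "Z w' \<le> of_rat r \<longleftrightarrow> Z w \<le> of_rat r" for r
        using elim(1) sp by (auto simp: spF)
      show "Z w' = Z w"
      proof (rule ccontr)
        assume "Z w' \<noteq> Z w"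
        then consider "Z w' < Z w" | "Z w < Z w'" by linarith
        then show False
        proof cases
          case 1
          then obtain r where "Z w' < of_rat r" "of_rat r < Z w" using of_rat_dense by blast
          then show False using iff[of r] by linarith
        next
          case 2
          then obtain r where "Z w < of_rat r" "of_rat r < Z w'" using of_rat_dense by blast
          then show False using iff[of r] by linarith
        qed
      qed
    qed
  qed
qed

section \<open>Conditional densities and quantiles\<close>

locale differentiable_density =
  fixes h :: "real \<Rightarrow> real"
  assumes h_nonneg: "0 \<le> h y" and h_total: "(\<integral>\<^sup>+y. ennreal (h y) \<partial>lborel) = 1"
    and h_diff: "h differentiable (at y)"
begin

abbreviation law :: "real measure" where "law \<equiv> density lborel (\<lambda>u. ennreal (h u))"

lemma isCont_h: "isCont h y"
  using h_diff differentiable_imp_continuous_within by blast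

lemma measurable_h[measurable]: "h \<in> borel_measurable borel"
  using isCont_h by (intro borel_measurable_continuous_onI) (auto intro: continuous_at_imp_continuous_on)

lemma real_distribution_law: "real_distribution law"
proof -
  have "prob_space law"
    by (rule prob_spaceI) (simp add: emeasure_density h_total)
  then show ?thesis by (simp add: real_distribution_def real_distribution_axioms_def)
qed

sublocale real_distribution law by (rule real_distribution_law)

lemma measure_singleton: "measure law {y} = 0"
proof -
  have "emeasure law {y} = 0"
    by (subst emeasure_density) (auto simp: nn_integral_0_iff_AE intro!: AE_mp[OF AE_lborel_singleton[of y]])
  then show ?thesis by (simp add: measure_def)
qed

lemma isCont_cdf_law: "isCont (cdf law) y"
  by (simp add: isCont_cdf measure_singleton)

lemma measure_lessThan: "measure law {..<y} = cdf law y"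
proof -
  have "measure law {..y} = measure law {..<y} + measure law {y}"
    by (subst finite_measure_Union[symmetric]) (auto intro!: arg_cong[where f="measure law"])
  then show ?thesis by (simp add: measure_singleton cdf_def)
qed

text \<open>The closed segment leaves the order of \<open>a\<close> and \<open>b\<close> open; they
  will be values \<open>x \<bullet> b'\<close> and \<open>x \<bullet> b\<close>, whose order is
  unknown.\<close>

lemma cdf_mean_value:
  "\<exists>\<xi>\<in>closed_segment a b. cdf law b - cdf law a = h \<xi> * (b - a)"
proof -
  have *: "\<exists>\<xi>\<in>{a..b}. cdf law b - cdf law a = h \<xi> * (b - a)" if ab: "a < b" for a b
  proof -
    \<comment> \<open>The antiderivative is built on a larger interval so that its derivative is
      two-sided at \<open>a\<close> and \<open>b\<close> as well.\<close>
    have c: "continuous_on {a - 1..b + 1} h"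
      using isCont_h by (intro continuous_at_imp_continuous_on) auto
    obtain g where g: "\<And>x. x \<in> {a-1..b+1} \<Longrightarrow> (g has_vector_derivative h x) (at x within {a-1..b+1})"
      using antiderivative_continuous[OF c] by blast
    have d: "(g has_real_derivative h x) (at x)" if "x \<in> {a..b}" for x
    proof -
      have "x \<in> interior {a-1..b+1}" using that by auto
      then have "at x within {a-1..b+1} = at x" by (rule at_within_interior)
      then show ?thesis using g[of x] that by (simp add: has_real_derivative_iff_has_vector_derivative)
    qed
    have "cdf law b - cdf law a = measure law {a<..b}"
      using that by (intro cdf_diff_eq)
    also have "\<dots> = enn2real (\<integral>\<^sup>+x. ennreal (h x) * indicator {a<..b} x \<partial>lborel)"
      by (simp add: measure_def emeasure_density)
    also have "(\<integral>\<^sup>+x. ennreal (h x) * indicator {a<..b} x \<partial>lborel) = (\<integral>\<^sup>+x. ennreal (h x) * indicator {a..b} x \<partial>lborel)"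
      by (rule nn_integral_cong_AE, rule AE_mp[OF AE_lborel_singleton[of a]]) (auto simp: indicator_def)
    also have "\<dots> = g b - g a"
      by (rule nn_integral_FTC_Icc) (use that d h_nonneg in auto)
    finally have "cdf law b - cdf law a = g b - g a"
      using that d h_nonneg DERIV_nonneg_imp_nondecreasing[of a b g]
      by (metis atLeastAtMost_iff diff_ge_0_iff_ge enn2real_ennreal less_imp_le)
    moreover obtain z where "a < z" "z < b" "g b - g a = (b - a) * h z"
      using MVT2[OF ab, of g h] d by auto
    ultimately show ?thesis by (intro bexI[of _ z]) (auto simp: mult.commute)
  qed
  consider "a < b" | "a = b" | "b < a" by linarith
  then show ?thesis
  proof cases
    case 1 then show ?thesis using *[of a b] by (auto simp: closed_segment_eq_real_ivl)
  next
    case 2 then show ?thesis by auto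
  next
    case 3
    then obtain \<xi> where "\<xi> \<in> {b..a}" "cdf law a - cdf law b = h \<xi> * (a - b)" using *[of b a] by auto
    then show ?thesis using 3 by (intro bexI[of _ \<xi>]) (auto simp: closed_segment_eq_real_ivl algebra_simps)
  qed
qed

text \<open>Continuity of the distribution function is used twice: the set of the infimum is closed,
  so the value at the infimum is at least \<open>t\<close>, and a point where the value is exactly
  \<open>t\<close> shows that it is at most \<open>t\<close>.\<close>

lemma cdf_at_quantile:
  assumes "0 < t" "t < 1"
  shows "cdf law (Inf {y. cdf law y \<ge> t}) = t"
proof -
  let ?S = "{y. cdf law y \<ge> t}"
  have "\<forall>\<^sub>F y in at_top. cdf law y > t"
    using cdf_lim_at_top_prob assms(2) by (rule order_tendstoD(1))
  then obtain y1 where y1: "cdf law y1 > t" by (metis eventually_at_top_linorder order_refl)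
  have "\<forall>\<^sub>F y in at_bot. cdf law y < t"
    using cdf_lim_at_bot assms(1) by (rule order_tendstoD(2))
  then obtain y0 where y0: "cdf law y0 < t" by (metis eventually_at_bot_linorder order_refl)
  have lb: "y0 < y" if "y \<in> ?S" for y
    using that y0 cdf_nondecreasing[of y y0] by (force simp: not_less)
  have bdd: "bdd_below ?S" using lb by (intro bdd_belowI[of _ y0]) (auto simp: less_imp_le)
  have ne: "?S \<noteq> {}" using y1 by (auto intro: less_imp_le)
  have "closed ?S"
    using isCont_cdf_law by (intro closed_Collect_le continuous_intros continuous_at_imp_continuous_on) auto
  then have 1: "Inf ?S \<in> ?S" using ne bdd by (intro closed_contains_Inf)
  have "y0 \<le> y1" using y0 y1 cdf_nondecreasing[of y1 y0] by (force simp: not_le)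
  then obtain z where z: "cdf law z = t"
    using IVT[of "cdf law" y0 t y1] y0 y1 isCont_cdf_law by auto
  then have "Inf ?S \<le> z" by (intro cInf_lower bdd) auto
  then have "cdf law (Inf ?S) \<le> t" using cdf_nondecreasing z by force
  with 1 show ?thesis by auto
qed

end

section \<open>One observation: increments of its conditional distribution function\<close>

locale density_observation = prob_space M
  for M :: "'a measure" +
  fixes X :: "'a \<Rightarrow> real ^ 'd" and Y :: "'a \<Rightarrow> real" and f :: "real \<Rightarrow> real ^ 'd \<Rightarrow> real"
    and B :: "(real ^ 'd) set" and Cf Cd \<epsilon> :: real
  assumes X_meas[measurable]: "X \<in> borel_measurable M" and Y_meas[measurable]: "Y \<in> borel_measurable M"
    and dens: "is_cond_density M Y X f"
    and f_le: "\<And>x y. x \<in> law_support M X \<Longrightarrow> \<bar>f y x\<bar> \<le> Cf"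
    and f_der: "\<And>x y. x \<in> law_support M X \<Longrightarrow> (\<lambda>u. f u x) differentiable (at y) \<and> \<bar>deriv (\<lambda>u. f u x) y\<bar> \<le> Cd"
    and f_ge: "\<And>x b. x \<in> law_support M X \<Longrightarrow> b \<in> B \<Longrightarrow> \<epsilon> \<le> f (x \<bullet> b) x"
    and B_convex: "convex B" and eps: "\<epsilon> > 0"
begin

abbreviation supp :: "(real ^ 'd) set" where "supp \<equiv> law_support M X"

abbreviation F :: "real ^ 'd \<Rightarrow> real \<Rightarrow> real" where "F x \<equiv> cdf (density lborel (\<lambda>u. ennreal (f u x)))"

lemma AE_supp: "AE w in M. X w \<in> supp"
  by (rule AE_in_law_support[OF prob_space_axioms X_meas])

lemma supp_density: "x \<in> supp \<Longrightarrow> differentiable_density (\<lambda>u. f u x)"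
  using dens f_der unfolding is_cond_density_def differentiable_density_def by auto

lemma f_measurable[measurable]: "(\<lambda>(x, y). f y x) \<in> borel_measurable (borel \<Otimes>\<^sub>M borel)"
  using dens by (auto simp: is_cond_density_def)

text \<open>As \<open>x \<bullet> b\<close> is linear in \<open>b\<close>, the intermediate point of
  the mean value theorem is again of the form \<open>x \<bullet> b''\<close> with \<open>b''\<close>
  between \<open>b'\<close> and \<open>b\<close>. For \<open>b\<close> and \<open>b'\<close> in the
  convex set \<open>B\<close> the lower bound on the density then applies at this point.\<close>

lemma F_segment:
  assumes "x \<in> supp"
  shows "\<exists>t\<in>{0..1}. F x (x \<bullet> b) - F x (x \<bullet> b') = f (x \<bullet> ((1 - t) *\<^sub>R b' + t *\<^sub>R b)) x * (x \<bullet> (b - b'))"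
proof -
  interpret D: differentiable_density "\<lambda>u. f u x" by (rule supp_density[OF assms])
  obtain \<xi> where "\<xi> \<in> closed_segment (x \<bullet> b') (x \<bullet> b)" "F x (x \<bullet> b) - F x (x \<bullet> b') = f \<xi> x * (x \<bullet> b - x \<bullet> b')"
    using D.cdf_mean_value by blast
  then show ?thesis
    by (auto simp: closed_segment_def inner_diff_right inner_add_right)
qed

lemma F_increment_ge:
  assumes "x \<in> supp" "b \<in> B" "b' \<in> B"
  shows "\<epsilon> * (x \<bullet> (b - b'))\<^sup>2 \<le> (F x (x \<bullet> b) - F x (x \<bullet> b')) * (x \<bullet> (b - b'))"
proof -
  obtain t where t: "t \<in> {0..1}" "F x (x \<bullet> b) - F x (x \<bullet> b') = f (x \<bullet> ((1 - t) *\<^sub>R b' + t *\<^sub>R b)) x * (x \<bullet> (b - b'))"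
    using F_segment[OF assms(1)] by blast
  have "(1 - t) *\<^sub>R b' + t *\<^sub>R b \<in> B"
    using B_convex assms t by (intro convexD) auto
  from f_ge[OF assms(1) this]
  have "\<epsilon> * (x \<bullet> (b - b'))\<^sup>2 \<le> f (x \<bullet> ((1 - t) *\<^sub>R b' + t *\<^sub>R b)) x * (x \<bullet> (b - b'))\<^sup>2"
    by (rule mult_right_mono) simp
  then show ?thesis unfolding t(2) power2_eq_square by (simp only: mult.assoc)
qed

lemma F_increment_le:
  assumes "x \<in> supp"
  shows "\<bar>F x (x \<bullet> b) - F x (x \<bullet> b')\<bar> \<le> Cf * \<bar>x \<bullet> (b - b')\<bar>"
proof -
  obtain t where t: "F x (x \<bullet> b) - F x (x \<bullet> b') = f (x \<bullet> ((1 - t) *\<^sub>R b' + t *\<^sub>R b)) x * (x \<bullet> (b - b'))"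
    using F_segment[OF assms(1)] by blast
  show ?thesis unfolding t using f_le[OF assms] by (simp add: abs_mult mult_right_mono)
qed

lemma f_lipschitz:
  assumes "x \<in> supp"
  shows "\<bar>f u x - f v x\<bar> \<le> Cd * \<bar>u - v\<bar>"
proof -
  have "norm (f u x - f v x) \<le> Cd * norm (u - v)"
  proof (rule field_differentiable_bound[of UNIV])
    show "((\<lambda>u. f u x) has_field_derivative deriv (\<lambda>u. f u x) z) (at z within UNIV)" for z
      using f_der[OF assms, of z] by (simp add: DERIV_deriv_iff_real_differentiable)
    show "norm (deriv (\<lambda>u. f u x) z) \<le> Cd" for z using f_der[OF assms, of z] by simp
  qed auto
  then show ?thesis by simp
qed

lemma Cf_nonneg: "0 \<le> Cf" and Cd_nonneg: "0 \<le> Cd"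
proof -
  obtain x where "x \<in> supp"
  proof (rule ccontr)
    assume no: "\<not> thesis"
    have "AE w in M. False" using AE_supp
    proof eventually_elim
      case (elim w)
      with no that show False by blast
    qed
    then show False by simp
  qed
  then show "0 \<le> Cf" "0 \<le> Cd"
    using f_le[of x 0] f_der[of x 0] by linarith+
qed

text \<open>Three points occur because the derivative will be taken at the true parameter
  \<open>b0\<close>, while the increment runs between the estimator and its bootstrap version. The
  error is a product of distances.\<close>

lemma F_linearization:
  assumes "x \<in> supp"
  shows "\<bar>F x (x \<bullet> b) - F x (x \<bullet> b') - f (x \<bullet> b0) x * (x \<bullet> (b - b'))\<bar>
    \<le> Cd * (\<bar>x \<bullet> (b - b0)\<bar> + \<bar>x \<bullet> (b' - b0)\<bar>) * \<bar>x \<bullet> (b - b')\<bar>"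
proof -
  obtain t where t: "t \<in> {0..1}" "F x (x \<bullet> b) - F x (x \<bullet> b') = f (x \<bullet> ((1 - t) *\<^sub>R b' + t *\<^sub>R b)) x * (x \<bullet> (b - b'))"
    using F_segment[OF assms(1)] by blast
  let ?z = "x \<bullet> ((1 - t) *\<^sub>R b' + t *\<^sub>R b)"
  have "?z - x \<bullet> b0 = (1 - t) * (x \<bullet> (b' - b0)) + t * (x \<bullet> (b - b0))"
    by (simp add: inner_add_right inner_diff_right algebra_simps)
  also have "\<bar>\<dots>\<bar> \<le> \<bar>(1 - t) * (x \<bullet> (b' - b0))\<bar> + \<bar>t * (x \<bullet> (b - b0))\<bar>" by (rule abs_triangle_ineq)
  also have "\<dots> \<le> 1 * \<bar>x \<bullet> (b' - b0)\<bar> + 1 * \<bar>x \<bullet> (b - b0)\<bar>"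
    using t(1) unfolding abs_mult by (intro add_mono mult_right_mono) auto
  finally have z: "\<bar>?z - x \<bullet> b0\<bar> \<le> \<bar>x \<bullet> (b - b0)\<bar> + \<bar>x \<bullet> (b' - b0)\<bar>" by simp
  have "\<bar>f ?z x - f (x \<bullet> b0) x\<bar> \<le> Cd * (\<bar>x \<bullet> (b - b0)\<bar> + \<bar>x \<bullet> (b' - b0)\<bar>)"
    using f_lipschitz[OF assms, of ?z "x \<bullet> b0"] mult_left_mono[OF z Cd_nonneg] by linarith
  then show ?thesis
    unfolding t(2) by (simp add: left_diff_distrib[symmetric] abs_mult mult_right_mono)
qed

lemma norm_supp_le:
  assumes "x \<in> supp" "r > 0" "ball b0 r \<subseteq> B"
  shows "norm x \<le> 1 / (\<epsilon> * r)"
proof (cases "x = 0")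
  case True then show ?thesis using assms eps by simp
next
  case False
  interpret D: differentiable_density "\<lambda>u. f u x" by (rule supp_density[OF assms(1)])
  \<comment> \<open>A segment in the direction of \<open>x\<close>, of half-length
    \<open>r / 2\<close> so that its ends stay in the open ball. Between \<open>s = -1\<close> and
    \<open>s = 1\<close> the value \<open>x \<bullet> b s\<close> increases by
    \<open>r * norm x\<close>.\<close>
  define b where "b s = b0 + (s * (r/2) / norm x) *\<^sub>R x" for s :: real
  have bB: "b s \<in> B" if "\<bar>s\<bar> \<le> 1" for s
  proof -
    have "norm ((s * (r/2) / norm x) *\<^sub>R x) = \<bar>s\<bar> * (r/2)" using assms False by (simp add: abs_mult)
    also have "\<dots> < r" using that assms(2) mult_right_mono[OF that, of "r/2"] by simp
    finally show ?thesis using assms(3) by (auto simp: b_def dist_norm subset_iff)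
  qed
  have d: "x \<bullet> (b 1 - b (-1)) = r * norm x"
  proof -
    have "b 1 - b (-1) = (1 * (r/2) / norm x - (-1) * (r/2) / norm x) *\<^sub>R x"
      unfolding b_def scaleR_diff_left by simp
    also have "1 * (r/2) / norm x - (-1) * (r/2) / norm x = r / norm x" by (simp add: field_simps)
    finally show ?thesis using False by (simp add: dot_square_norm power2_eq_square)
  qed
  have "\<epsilon> * (r * norm x)\<^sup>2 \<le> (F x (x \<bullet> b 1) - F x (x \<bullet> b (-1))) * (r * norm x)"
    using F_increment_ge[OF assms(1) bB[of 1] bB[of "-1"]] d by simp
  also have "\<dots> \<le> 1 * (r * norm x)"
    using D.cdf_bounded_prob[of "x \<bullet> b 1"] D.cdf_nonneg[of "x \<bullet> b (-1)"] assms(2)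
    by (intro mult_right_mono) auto
  finally have "\<epsilon> * (r * norm x) \<le> 1"
    using False assms(2) by (simp add: power2_eq_square)
  then show ?thesis using assms eps by (simp add: field_simps)
qed

lemma cdf_quantile:
  assumes "x \<in> supp" "0 < t" "t < 1" "cond_quantile f t x = z"
  shows "F x z = t"
proof -
  interpret D: differentiable_density "\<lambda>u. f u x" by (rule supp_density[OF assms(1)])
  show ?thesis using D.cdf_at_quantile[OF assms(2,3)] assms(4) by (simp add: cond_quantile_def)
qed

section \<open>Integrating out the response given the regressor\<close>

lemma nn_integral_pair:
  assumes G[measurable]: "G \<in> borel_measurable (borel \<Otimes>\<^sub>M borel)"
  shows "(\<integral>\<^sup>+w. G (X w, Y w) \<partial>M) = (\<integral>\<^sup>+w. (\<integral>\<^sup>+u. ennreal (f u (X w)) * G (X w, u) \<partial>lborel) \<partial>M)"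
proof -
  interpret P: sigma_finite_measure "distr M borel X"
    using prob_space_distr[OF X_meas] prob_space_imp_sigma_finite by blast
  have dd: "distr M (borel \<Otimes>\<^sub>M borel) (\<lambda>w. (X w, Y w)) =
       density (distr M borel X \<Otimes>\<^sub>M lborel) (\<lambda>(x, y). ennreal (f y x))"
    using dens by (simp add: is_cond_density_def)
  have "(\<integral>\<^sup>+w. G (X w, Y w) \<partial>M) = (\<integral>\<^sup>+p. G p \<partial>distr M (borel \<Otimes>\<^sub>M borel) (\<lambda>w. (X w, Y w)))"
    by (subst nn_integral_distr) auto
  also have "\<dots> = (\<integral>\<^sup>+p. (\<lambda>(x, y). ennreal (f y x)) p * G p \<partial>(distr M borel X \<Otimes>\<^sub>M lborel))"
    unfolding dd by (rule nn_integral_density) measurable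
  also have "\<dots> = (\<integral>\<^sup>+x. \<integral>\<^sup>+u. (\<lambda>(x, y). ennreal (f y x)) (x, u) * G (x, u) \<partial>lborel \<partial>distr M borel X)"
    by (rule lborel.nn_integral_fst[symmetric]) measurable
  also have "\<dots> = (\<integral>\<^sup>+w. (\<integral>\<^sup>+u. ennreal (f u (X w)) * G (X w, u) \<partial>lborel) \<partial>M)"
    by (subst nn_integral_distr) auto
  finally show ?thesis .
qed

lemma prob_band_le:
  assumes "0 \<le> \<eta>"
  shows "prob {w\<in>space M. \<bar>Y w - X w \<bullet> g\<bar> \<le> \<eta>} \<le> 2 * \<eta> * Cf"
proof -
  define G :: "(real ^ 'd) \<times> real \<Rightarrow> ennreal" where "G = (\<lambda>(x, y). indicator {z. \<bar>z\<bar> \<le> \<eta>} (y - x \<bullet> g))"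
  have [measurable]: "G \<in> borel_measurable (borel \<Otimes>\<^sub>M borel)" unfolding G_def by measurable
  have "emeasure M {w\<in>space M. \<bar>Y w - X w \<bullet> g\<bar> \<le> \<eta>} = (\<integral>\<^sup>+w. G (X w, Y w) \<partial>M)"
  proof -
    have "(\<integral>\<^sup>+w. G (X w, Y w) \<partial>M) = (\<integral>\<^sup>+w. indicator {w\<in>space M. \<bar>Y w - X w \<bullet> g\<bar> \<le> \<eta>} w \<partial>M)"
      by (intro nn_integral_cong) (auto simp: G_def indicator_def)
    then show ?thesis by (subst (asm) nn_integral_indicator) auto
  qed
  also have "\<dots> = (\<integral>\<^sup>+w. (\<integral>\<^sup>+u. ennreal (f u (X w)) * G (X w, u) \<partial>lborel) \<partial>M)"
    by (rule nn_integral_pair) measurable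
  also have "\<dots> \<le> (\<integral>\<^sup>+w. ennreal (2 * \<eta> * Cf) \<partial>M)"
  proof (rule nn_integral_mono_AE, use AE_supp in eventually_elim)
    fix w assume s: "X w \<in> supp"
    have "(\<integral>\<^sup>+u. ennreal (f u (X w)) * G (X w, u) \<partial>lborel) \<le> (\<integral>\<^sup>+u. ennreal Cf * indicator {X w \<bullet> g - \<eta> .. X w \<bullet> g + \<eta>} u \<partial>lborel)"
    proof (rule nn_integral_mono)
      fix u
      have "f u (X w) \<le> Cf" using f_le[OF s, of u] by simp
      then show "ennreal (f u (X w)) * G (X w, u) \<le> ennreal Cf * indicator {X w \<bullet> g - \<eta> .. X w \<bullet> g + \<eta>} u"
        unfolding G_def by (auto simp: indicator_def intro!: ennreal_leI)
    qed
    also have "\<dots> = ennreal Cf * ennreal (2 * \<eta>)"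
      using assms by (simp add: nn_integral_cmult)
    finally show "(\<integral>\<^sup>+u. ennreal (f u (X w)) * G (X w, u) \<partial>lborel) \<le> ennreal (2 * \<eta> * Cf)"
      using assms Cf_nonneg by (simp add: ennreal_mult[symmetric] mult.commute)
  qed
  also have "\<dots> = ennreal (2 * \<eta> * Cf)" by (simp add: emeasure_space_1)
  finally show ?thesis using assms Cf_nonneg by (simp add: emeasure_eq_measure)
qed

lemma F_measurable[measurable]: "(\<lambda>w. F (X w) (X w \<bullet> b)) \<in> borel_measurable M"
proof -
  \<comment> \<open>With the half-line written through \<open>z - u\<close>, the integrand is
    jointly measurable in \<open>x\<close>, \<open>z\<close> and \<open>u\<close>, so integrating
    out \<open>u\<close> leaves a measurable function.\<close>
  have "F x z = enn2real (\<integral>\<^sup>+u. ennreal (f u x) * indicator {0..} (z - u) \<partial>lborel)" for x z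
  proof -
    have fx[measurable]: "(\<lambda>u. f u x) \<in> borel_measurable borel"
      using measurable_compose[OF measurable_Pair1'[of x borel borel] f_measurable] by simp
    have "(\<integral>\<^sup>+u. ennreal (f u x) * indicator {..z} u \<partial>lborel) = (\<integral>\<^sup>+u. ennreal (f u x) * indicator {0..} (z - u) \<partial>lborel)"
      by (rule nn_integral_cong) (auto simp: indicator_def)
    then show ?thesis by (simp add: cdf_def measure_def emeasure_density)
  qed
  then show ?thesis by simp
qed

text \<open>Conditioning on \<open>X\<close> turns the jump at \<open>Y < X \<bullet> b\<close> into
  the differentiable function \<open>F\<close>. The strict inequality makes no difference because
  the conditional law has no atoms.\<close>

lemma expectation_F_nonneg:
  assumes h[measurable]: "h \<in> borel_measurable borel" and nn: "\<And>x. 0 \<le> h x"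
  shows "expectation (\<lambda>w. of_bool (Y w < X w \<bullet> b) * h (X w)) = expectation (\<lambda>w. F (X w) (X w \<bullet> b) * h (X w))"
proof -
  define G :: "(real ^ 'd) \<times> real \<Rightarrow> ennreal" where "G = (\<lambda>(x, y). indicator {0<..} (x \<bullet> b - y) * ennreal (h x))"
  have [measurable]: "G \<in> borel_measurable (borel \<Otimes>\<^sub>M borel)" unfolding G_def by measurable
  have "(\<integral>\<^sup>+w. ennreal (of_bool (Y w < X w \<bullet> b) * h (X w)) \<partial>M) = (\<integral>\<^sup>+w. G (X w, Y w) \<partial>M)"
    by (intro nn_integral_cong) (auto simp: G_def)
  also have "\<dots> = (\<integral>\<^sup>+w. (\<integral>\<^sup>+u. ennreal (f u (X w)) * G (X w, u) \<partial>lborel) \<partial>M)"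
    by (rule nn_integral_pair) measurable
  also have "\<dots> = (\<integral>\<^sup>+w. ennreal (F (X w) (X w \<bullet> b) * h (X w)) \<partial>M)"
  proof (rule nn_integral_cong_AE, use AE_supp in eventually_elim)
    fix w assume s: "X w \<in> supp"
    interpret D: differentiable_density "\<lambda>u. f u (X w)" by (rule supp_density[OF s])
    have "(\<integral>\<^sup>+u. ennreal (f u (X w)) * G (X w, u) \<partial>lborel)
        = (\<integral>\<^sup>+u. ennreal (h (X w)) * (ennreal (f u (X w)) * indicator {..<X w \<bullet> b} u) \<partial>lborel)"
      by (intro nn_integral_cong) (auto simp: G_def indicator_def mult.commute)
    also have "\<dots> = ennreal (h (X w)) * emeasure D.law {..<X w \<bullet> b}"
      by (subst nn_integral_cmult) (auto simp: emeasure_density)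
    also have "emeasure D.law {..<X w \<bullet> b} = ennreal (F (X w) (X w \<bullet> b))"
      by (simp add: D.emeasure_eq_measure D.measure_lessThan)
    finally show "(\<integral>\<^sup>+u. ennreal (f u (X w)) * G (X w, u) \<partial>lborel) = ennreal (F (X w) (X w \<bullet> b) * h (X w))"
      by (simp add: ennreal_mult[symmetric] nn D.cdf_nonneg mult.commute)
  qed
  finally have *: "(\<integral>\<^sup>+w. ennreal (of_bool (Y w < X w \<bullet> b) * h (X w)) \<partial>M)
      = (\<integral>\<^sup>+w. ennreal (F (X w) (X w \<bullet> b) * h (X w)) \<partial>M)" .
  have "expectation (\<lambda>w. of_bool (Y w < X w \<bullet> b) * h (X w)) = enn2real (\<integral>\<^sup>+w. ennreal (of_bool (Y w < X w \<bullet> b) * h (X w)) \<partial>M)"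
    using nn by (intro integral_eq_nn_integral) auto
  moreover have "expectation (\<lambda>w. F (X w) (X w \<bullet> b) * h (X w)) = enn2real (\<integral>\<^sup>+w. ennreal (F (X w) (X w \<bullet> b) * h (X w)) \<partial>M)"
  proof (rule integral_eq_nn_integral)
    show "AE w in M. 0 \<le> F (X w) (X w \<bullet> b) * h (X w)"
      using nn by (auto simp: cdf_def)
  qed measurable
  ultimately show ?thesis using * by simp
qed

lemma F_bounds: "X w \<in> supp \<Longrightarrow> 0 \<le> F (X w) z \<and> F (X w) z \<le> 1"
proof -
  assume s: "X w \<in> supp"
  interpret D: differentiable_density "\<lambda>u. f u (X w)" by (rule supp_density[OF s])
  show ?thesis using D.cdf_bounded_prob D.cdf_nonneg by simp
qed

lemma integrable_bounded_supp:
  fixes g :: "'a \<Rightarrow> real"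
  assumes "g \<in> borel_measurable M" "\<And>w. X w \<in> supp \<Longrightarrow> \<bar>g w\<bar> \<le> c"
  shows "integrable M g"
  using assms AE_supp by (intro integrable_const_bound[where B=c]) auto

lemma expectation_F:
  assumes h[measurable]: "h \<in> borel_measurable borel" and bd: "\<And>x. x \<in> supp \<Longrightarrow> \<bar>h x\<bar> \<le> c"
  shows "expectation (\<lambda>w. of_bool (Y w < X w \<bullet> b) * h (X w)) = expectation (\<lambda>w. F (X w) (X w \<bullet> b) * h (X w))"
proof -
  define p where "p x = max 0 (h x)" for x
  define m where "m x = max 0 (- h x)" for x
  have h_eq: "h x = p x - m x" for x by (auto simp: p_def m_def)
  have [measurable]: "p \<in> borel_measurable borel" "m \<in> borel_measurable borel"
    unfolding p_def[abs_def] m_def[abs_def] by measurable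
  have pm: "0 \<le> p x" "0 \<le> m x" for x by (auto simp: p_def m_def)
  have pb: "p x \<le> c" "m x \<le> c" if "x \<in> supp" for x using bd[OF that] by (auto simp: p_def m_def)
  have i1: "integrable M (\<lambda>w. of_bool (Y w < X w \<bullet> b) * p (X w))" "integrable M (\<lambda>w. of_bool (Y w < X w \<bullet> b) * m (X w))"
    using pm pb abs_of_nonneg[OF pm(1)] abs_of_nonneg[OF pm(2)] order_trans[OF pm(1) pb(1)]
    by (intro integrable_bounded_supp[where c=c]; simp)+
  have *: "\<bar>F (X w) z * y\<bar> \<le> c" if "X w \<in> supp" "0 \<le> y" "y \<le> c" for w z y
  proof -
    have "\<bar>F (X w) z * y\<bar> = F (X w) z * y" using F_bounds[OF that(1), of z] that by simp
    also have "\<dots> \<le> 1 * c" using F_bounds[OF that(1), of z] that by (intro mult_mono) auto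
    finally show ?thesis by simp
  qed
  have i2: "integrable M (\<lambda>w. F (X w) (X w \<bullet> b) * p (X w))" "integrable M (\<lambda>w. F (X w) (X w \<bullet> b) * m (X w))"
    using pm pb * by (intro integrable_bounded_supp[where c=c]; simp)+
  show ?thesis
    unfolding h_eq right_diff_distrib
    using i1 i2 expectation_F_nonneg[of p b] expectation_F_nonneg[of m b] pm by simp
qed

end

section \<open>The quantile regression model\<close>

lemma continuous_on_outer_prod: "continuous_on UNIV (\<lambda>(u :: real ^ 'd, v). outer_prod u v)"
  unfolding outer_prod_def case_prod_beta
  by (intro continuous_on_vec_lambda continuous_intros)

lemma measurable_outer_prod[measurable]:
  fixes g h :: "'a \<Rightarrow> real ^ 'd"
  assumes "g \<in> borel_measurable M" "h \<in> borel_measurable M"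
  shows "(\<lambda>x. outer_prod (g x) (h x)) \<in> borel_measurable M"
  using borel_measurable_continuous_Pair[OF assms continuous_on_outer_prod[unfolded case_prod_beta]] by simp

lemma norm_outer_prod: "norm (outer_prod u v) = norm u * norm (v :: real ^ 'd)"
proof -
  have "outer_prod u v \<bullet> outer_prod u v = (u \<bullet> u) * (v \<bullet> v)"
    by (simp add: inner_vec_def outer_prod_def sum_product algebra_simps)
  then show ?thesis by (simp add: norm_eq_sqrt_inner real_sqrt_mult)
qed

lemma outer_prod_mult_vec: "outer_prod u v *v w = (v \<bullet> w) *\<^sub>R u"
  by (simp add: vec_eq_iff matrix_vector_mult_def outer_prod_def inner_vec_def sum_distrib_left mult_ac)

lemma outer_prod_inner: "(outer_prod u v *v w) \<bullet> z = (v \<bullet> w) * (u \<bullet> z)"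
  by (simp add: outer_prod_mult_vec)

lemma outer_prod_diff_left: "outer_prod (u - u') v = outer_prod u v - outer_prod u' v"
  and outer_prod_diff_right: "outer_prod u (v - v') = outer_prod u v - outer_prod u v'"
  by (simp_all add: outer_prod_def vec_eq_iff algebra_simps)

text \<open>Integrals, sums and limits of matrices are handled by testing them with pairs of
  vectors.\<close>

lemma bounded_linear_quadratic_form:
  "bounded_linear (\<lambda>A :: real ^ 'd ^ 'd. (A *v w) \<bullet> z)"
  unfolding linear_conv_bounded_linear[symmetric]
  by (rule linearI)
     (simp_all add: matrix_vector_mult_add_rdistrib inner_add_left scaleR_matrix_vector_assoc[symmetric])

lemma norm_matrix_vector_mult_le: "norm (A *v x) \<le> norm A * norm (x :: real ^ 'd)" for A :: "real ^ 'd ^ 'd"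
proof -
  have "norm (A *v x) = L2_set (\<lambda>i. A $ i \<bullet> x) UNIV"
    by (simp add: norm_vec_def matrix_vector_mult_def inner_vec_def L2_set_def)
  also have "\<dots> \<le> L2_set (\<lambda>i. norm (A $ i) * norm x) UNIV"
  proof -
    have "L2_set (\<lambda>i. \<bar>A $ i \<bullet> x\<bar>) UNIV \<le> L2_set (\<lambda>i. norm (A $ i) * norm x) UNIV"
      by (intro L2_set_mono Cauchy_Schwarz_ineq2) auto
    then show ?thesis by (simp add: L2_set_def)
  qed
  also have "\<dots> = norm A * norm x"
    unfolding norm_vec_def[of A] by (rule L2_set_left_distrib[symmetric]) simp
  finally show ?thesis .
qed

text \<open>\<open>smallest_eigenvalue\<close> is the \<open>Min\<close> of the set of eigenvalues,
  so this set has to be shown finite, and the minimum of the Rayleigh quotient has to be recognized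
  as a member of it. Symmetry serves both purposes: it makes eigenvectors orthogonal, and it turns
  the first-order condition into the eigenvalue equation.\<close>

lemma smallest_eigenvalue_le_quadratic_form:
  fixes A :: "real ^ 'd ^ 'd"
  assumes sym: "\<And>u v. (A *v u) \<bullet> v = (A *v v) \<bullet> u"
  shows "smallest_eigenvalue A * (norm v)\<^sup>2 \<le> (A *v v) \<bullet> v"
proof -
  let ?E = "{l. \<exists>v. v \<noteq> 0 \<and> A *v v = l *\<^sub>R v}"
  \<comment> \<open>One eigenvector is chosen for each eigenvalue; these vectors are nonzero and
    pairwise orthogonal, hence independent, hence finite in number.\<close>
  have finite: "finite ?E"
  proof -
    have "\<forall>l\<in>?E. \<exists>v. v \<noteq> 0 \<and> A *v v = l *\<^sub>R v" by blast
    from bchoice[OF this] obtain w where w: "\<And>l. l \<in> ?E \<Longrightarrow> w l \<noteq> 0 \<and> A *v w l = l *\<^sub>R w l" by auto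
    have orth: "w l \<bullet> w l' = 0" if "l \<in> ?E" "l' \<in> ?E" "l \<noteq> l'" for l l'
    proof -
      have "l * (w l \<bullet> w l') = l' * (w l \<bullet> w l')"
        using sym[of "w l" "w l'"] w that by (simp add: inner_commute)
      then show ?thesis using that by simp
    qed
    have inj: "inj_on w ?E"
    proof (rule inj_onI)
      fix l l' assume *: "l \<in> ?E" "l' \<in> ?E" "w l = w l'"
      then show "l = l'" using orth[OF *(1,2)] w[OF *(1)] by (cases "l = l'") auto
    qed
    have "independent (w ` ?E)"
    proof (rule pairwise_orthogonal_independent)
      show "pairwise orthogonal (w ` ?E)"
        unfolding pairwise_image using orth by (simp only: pairwise_def orthogonal_def) blast
      show "0 \<notin> w ` ?E" using w by (metis (no_types, lifting) imageE)
    qed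
    then have "finite (w ` ?E)" by (rule independent_imp_finite)
    then show ?thesis using inj finite_imageD by blast
  qed
  let ?q = "\<lambda>v. (A *v v) \<bullet> v"
  have sph: "compact (sphere (0 :: real ^ 'd) 1)" "sphere (0 :: real ^ 'd) 1 \<noteq> {}" by auto
  have "continuous_on (sphere 0 1) ?q"
    by (intro continuous_intros linear_continuous_on) auto
  from continuous_attains_inf[OF sph this]
  obtain u where u: "u \<in> sphere 0 1" "\<And>y. y \<in> sphere 0 1 \<Longrightarrow> ?q u \<le> ?q y" by blast
  define l where "l = ?q u"
  have min: "l * (norm y)\<^sup>2 \<le> ?q y" for y
  proof (cases "y = 0")
    case False
    have "l \<le> ?q (y /\<^sub>R norm y)" unfolding l_def by (rule u(2)) (use False in auto)
    also have "\<dots> = ?q y / (norm y)\<^sup>2" by (simp add: matrix_vector_mult_scaleR power2_eq_square field_simps)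
    finally show ?thesis using False by (simp add: field_simps)
  qed simp
  \<comment> \<open>The first-order condition for the minimizer \<open>u\<close>, tested in the
    direction of the residual \<open>z\<close>.\<close>
  have "A *v u = l *\<^sub>R u"
  proof (rule ccontr)
    assume ne: "A *v u \<noteq> l *\<^sub>R u"
    define z where "z = A *v u - l *\<^sub>R u"
    have zz: "z \<bullet> z > 0" using ne by (simp add: z_def)
    have uu: "u \<bullet> u = 1" using u(1) by (simp add: dot_square_norm)
    have ineq: "0 \<le> 2 * s * (z \<bullet> z) + s\<^sup>2 * (?q z - l * (z \<bullet> z))" for s
    proof -
      have "l * ((u + s *\<^sub>R z) \<bullet> (u + s *\<^sub>R z)) \<le> ?q (u + s *\<^sub>R z)" using min[of "u + s *\<^sub>R z"] by (simp add: dot_square_norm)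
      also have "?q (u + s *\<^sub>R z) = l + 2 * s * ((A *v u) \<bullet> z) + s\<^sup>2 * ?q z"
        using sym[of z u] by (simp add: matrix_vector_right_distrib matrix_vector_mult_scaleR inner_add_left inner_add_right l_def power2_eq_square algebra_simps)
      also have "l * ((u + s *\<^sub>R z) \<bullet> (u + s *\<^sub>R z)) = l + 2 * s * (l * (u \<bullet> z)) + s\<^sup>2 * l * (z \<bullet> z)"
        using uu by (simp add: inner_add_left inner_add_right power2_eq_square algebra_simps inner_commute)
      finally have "0 \<le> 2 * s * ((A *v u) \<bullet> z - l * (u \<bullet> z)) + s\<^sup>2 * (?q z - l * (z \<bullet> z))"
        by (simp add: algebra_simps)
      also have "(A *v u) \<bullet> z - l * (u \<bullet> z) = z \<bullet> z" by (simp add: z_def inner_diff_left)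
      finally show ?thesis .
    qed
    define a where "a = z \<bullet> z"
    define b where "b = \<bar>?q z - l * (z \<bullet> z)\<bar> + a"
    have ab: "a > 0" "b > 0" using zz abs_ge_zero[of "?q z - l * (z \<bullet> z)"] unfolding a_def b_def by linarith+
    \<comment> \<open>At \<open>s = - (a / b)\<close> the linear term is
      \<open>- 2 * a\<^sup>2 / b\<close>, while the quadratic one is at most
      \<open>a\<^sup>2 / b\<close> because \<open>b\<close> dominates its coefficient; the summand
      \<open>a\<close> in \<open>b\<close> makes \<open>b\<close> positive.\<close>
    have "0 \<le> 2 * (- (a / b)) * a + (- (a / b))\<^sup>2 * b"
    proof -
      have "(- (a / b))\<^sup>2 * (?q z - l * (z \<bullet> z)) \<le> (- (a / b))\<^sup>2 * b"
        using ab by (intro mult_left_mono) (auto simp: b_def)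
      then show ?thesis using ineq[of "- (a / b)"] unfolding a_def by linarith
    qed
    also have "\<dots> = - (a\<^sup>2 / b)" using ab by (simp add: power2_eq_square field_simps)
    finally show False using ab by (simp add: divide_le_0_iff zero_le_divide_iff)
  qed
  moreover have "u \<noteq> 0" using u(1) by auto
  ultimately have "l \<in> ?E" by blast
  then have "smallest_eigenvalue A \<le> l"
    unfolding smallest_eigenvalue_def by (rule Min_le[OF finite])
  then show ?thesis using min[of v] by (meson mult_right_mono order_trans zero_le_power2)
qed

lemma (in prob_space) norm_expectation_le:
  fixes g :: "'a \<Rightarrow> 'b::{banach, second_countable_topology}"
  assumes "AE w in M. norm (g w) \<le> C" "0 \<le> C"
  shows "norm (expectation g) \<le> C"
proof (cases "integrable M g")
  case True
  have "norm (expectation g) \<le> expectation (\<lambda>w. norm (g w))" by (rule integral_norm_bound)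
  also have "\<dots> \<le> expectation (\<lambda>_. C)"
    using assms True by (intro integral_mono_AE) auto
  finally show ?thesis by (simp add: prob_space)
\<comment> \<open>A nonintegrable function has integral 0, which settles the remaining case.\<close>
qed (simp add: not_integrable_integral_eq assms)

lemma (in prob_space) abs_expectation_le:
  fixes g :: "'a \<Rightarrow> real"
  assumes "AE w in M. \<bar>g w\<bar> \<le> C" "0 \<le> C"
  shows "\<bar>expectation g\<bar> \<le> C"
  using norm_expectation_le[of g C] assms by simp

lemma norm_le_if_inner_le:
  fixes u :: "'b::real_inner"
  assumes "\<And>v. \<bar>u \<bullet> v\<bar> \<le> C * norm v" "0 \<le> C"
  shows "norm u \<le> C"
proof (cases "u = 0")
  case False
  then show ?thesis using assms(1)[of u] by (simp add: dot_square_norm power2_eq_square)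
qed (simp add: assms)

text \<open>The quantitative form of the model. Every uniform bound is an explicit constant, the
  Gram condition is a lower bound \<open>lam\<close> on quadratic forms, and the regressors are
  bounded by \<open>R\<close> on their supports, which the lower bound on the densities implies.
  \<open>R \<ge> 1\<close> and \<open>c_max \<ge> 1\<close> are normalizations.\<close>

locale qr_model = prob_space M
  for M :: "'a measure" +
  fixes c :: "nat \<Rightarrow> nat" and c_max :: nat
    and Y :: "nat \<Rightarrow> nat \<Rightarrow> 'a \<Rightarrow> real"
    and X :: "nat \<Rightarrow> nat \<Rightarrow> 'a \<Rightarrow> real ^ 'd"
    and f :: "nat \<Rightarrow> nat \<Rightarrow> real \<Rightarrow> real ^ 'd \<Rightarrow> real"
    and T :: "real set" and B :: "(real ^ 'd) set"
    and \<beta> :: "real \<Rightarrow> real ^ 'd"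
    and R Cf Cd \<epsilon> lam :: real
  assumes Y_rv: "\<And>i k. i \<ge> 1 \<Longrightarrow> k \<in> {1..c i} \<Longrightarrow> Y i k \<in> borel_measurable M"
    and X_rv: "\<And>i k. i \<ge> 1 \<Longrightarrow> k \<in> {1..c i} \<Longrightarrow> X i k \<in> borel_measurable M"
    and clusters_indep: "indep_vars (\<lambda>i. PiM {1..c i} (\<lambda>_. borel)) (cluster c Y X) {1..}"
    and clusters_bounded: "\<And>i. i \<ge> 1 \<Longrightarrow> c i \<le> c_max"
    and T_unit: "T \<subseteq> {0<..<1}"
    and B_compact: "compact B" and B_convex: "convex B"
    and \<beta>_in_B: "\<And>\<tau>. \<tau> \<in> T \<Longrightarrow> \<beta> \<tau> \<in> B"
    and f_density: "\<And>i k. i \<ge> 1 \<Longrightarrow> k \<in> {1..c i} \<Longrightarrow> is_cond_density M (Y i k) (X i k) (f i k)"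
    and quantile_linear:
      "\<And>i k \<tau> x. i \<ge> 1 \<Longrightarrow> k \<in> {1..c i} \<Longrightarrow> \<tau> \<in> T \<Longrightarrow> x \<in> law_support M (X i k) \<Longrightarrow>
         cond_quantile (f i k) \<tau> x = x \<bullet> \<beta> \<tau>"
    and f_le: "\<And>i k x y. i \<ge> 1 \<Longrightarrow> k \<in> {1..c i} \<Longrightarrow> x \<in> law_support M (X i k) \<Longrightarrow> \<bar>f i k y x\<bar> \<le> Cf"
    and f_der: "\<And>i k x y. i \<ge> 1 \<Longrightarrow> k \<in> {1..c i} \<Longrightarrow> x \<in> law_support M (X i k) \<Longrightarrow>
         (\<lambda>u. f i k u x) differentiable (at y) \<and> \<bar>deriv (\<lambda>u. f i k u x) y\<bar> \<le> Cd"
    and f_ge: "\<And>i k x b. i \<ge> 1 \<Longrightarrow> k \<in> {1..c i} \<Longrightarrow> x \<in> law_support M (X i k) \<Longrightarrow> b \<in> B \<Longrightarrow> \<epsilon> \<le> f i k (x \<bullet> b) x"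
    and eps_pos: "\<epsilon> > 0" and R_pos: "R \<ge> 1" and c_max_pos: "c_max \<ge> 1"
    and Cf_nonneg: "Cf \<ge> 0" and Cd_nonneg: "Cd \<ge> 0"
    and supp_bounded: "\<And>i k x. i \<ge> 1 \<Longrightarrow> k \<in> {1..c i} \<Longrightarrow> x \<in> law_support M (X i k) \<Longrightarrow> norm x \<le> R"
    and lam_pos: "lam > 0"
    and gram: "\<And>n v. n \<ge> 1 \<Longrightarrow>
       lam * (norm v)\<^sup>2 \<le> (1 / real n) * (\<Sum>i=1..n. \<Sum>k=1..c i. expectation (\<lambda>w. (X i k w \<bullet> v)\<^sup>2))"
begin

lemma observation:
  assumes "i \<ge> 1" "k \<in> {1..c i}"
  shows "density_observation M (X i k) (Y i k) (f i k) B Cf Cd \<epsilon>"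
  using assms X_rv Y_rv f_density f_le f_der f_ge B_convex eps_pos
  by (intro density_observation.intro density_observation_axioms.intro prob_space_axioms) auto

lemma AE_supp:
  assumes "i \<ge> 1" "k \<in> {1..c i}"
  shows "AE w in M. X i k w \<in> law_support M (X i k)"
  by (rule AE_in_law_support[OF prob_space_axioms X_rv[OF assms]])

lemma AE_norm_X_le:
  assumes "i \<ge> 1" "k \<in> {1..c i}"
  shows "AE w in M. norm (X i k w) \<le> R"
  using AE_supp[OF assms] by eventually_elim (rule supp_bounded[OF assms])

lemma mean_norm_le:
  fixes a :: "nat \<Rightarrow> nat \<Rightarrow> 'b::real_normed_vector"
  assumes "n \<ge> 1" "\<And>i k. i \<in> {1..n} \<Longrightarrow> k \<in> {1..c i} \<Longrightarrow> norm (a i k) \<le> C" "0 \<le> C"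
  shows "norm ((1 / real n) *\<^sub>R (\<Sum>i=1..n. \<Sum>k=1..c i. a i k)) \<le> real c_max * C"
proof -
  have "norm (\<Sum>i=1..n. \<Sum>k=1..c i. a i k) \<le> (\<Sum>i=1..n. \<Sum>k=1..c i. norm (a i k))"
    by (intro order_trans[OF norm_sum] sum_mono norm_sum)
  also have "\<dots> \<le> (\<Sum>i=1..n. real c_max * C)"
  proof (rule sum_mono)
    fix i assume i: "i \<in> {1..n}"
    have "(\<Sum>k=1..c i. norm (a i k)) \<le> (\<Sum>k=1..c i. C)" using assms(2) i by (intro sum_mono) auto
    also have "\<dots> \<le> real c_max * C" using clusters_bounded[of i] i assms(3) by (simp add: mult_right_mono)
    finally show "(\<Sum>k=1..c i. norm (a i k)) \<le> real c_max * C" .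
  qed
  finally have "norm (\<Sum>i=1..n. \<Sum>k=1..c i. a i k) \<le> real n * (real c_max * C)" by simp
  then show ?thesis using assms(1) by (simp add: field_simps)
qed

lemma mean_abs_le:
  fixes a :: "nat \<Rightarrow> nat \<Rightarrow> real"
  assumes "n \<ge> 1" "\<And>i k. i \<in> {1..n} \<Longrightarrow> k \<in> {1..c i} \<Longrightarrow> \<bar>a i k\<bar> \<le> C" "0 \<le> C"
  shows "\<bar>(1 / real n) * (\<Sum>i=1..n. \<Sum>k=1..c i. a i k)\<bar> \<le> real c_max * C"
  using mean_norm_le[of n a C] assms by simp

definition score :: "nat \<Rightarrow> nat \<Rightarrow> real ^ 'd \<Rightarrow> real \<Rightarrow> 'a \<Rightarrow> real ^ 'd" where
  "score i k b t w = check_score t (Y i k w - X i k w \<bullet> b) *\<^sub>R X i k w"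

definition cscore :: "nat \<Rightarrow> real ^ 'd \<Rightarrow> real \<Rightarrow> 'a \<Rightarrow> real ^ 'd" where
  "cscore i b t w = (\<Sum>k=1..c i. score i k b t w)"

text \<open>One selection from the subdifferential of the convex criterion; at a vanishing residual
  it follows the convention of \<open>check_score\<close>. As a function of \<open>b\<close> it is
  piecewise constant and jumps.\<close>

definition grad :: "nat \<Rightarrow> real ^ 'd \<Rightarrow> real \<Rightarrow> 'a \<Rightarrow> real ^ 'd" where
  "grad n b t w = - (1 / real n) *\<^sub>R (\<Sum>i=1..n. cscore i b t w)"

definition mean_grad :: "nat \<Rightarrow> real ^ 'd \<Rightarrow> real \<Rightarrow> real ^ 'd" where
  "mean_grad n b t = - (1 / real n) *\<^sub>R (\<Sum>i=1..n. expectation (cscore i b t))"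

lemma score_measurable[measurable]:
  assumes "i \<ge> 1" "k \<in> {1..c i}"
  shows "score i k b t \<in> borel_measurable M"
proof -
  have [measurable]: "X i k \<in> borel_measurable M" "Y i k \<in> borel_measurable M" using X_rv Y_rv assms by auto
  show ?thesis unfolding score_def[abs_def] check_score_def by measurable
qed

lemma cscore_measurable[measurable]:
  assumes "i \<ge> 1"
  shows "cscore i b t \<in> borel_measurable M"
  unfolding cscore_def[abs_def] using assms by (intro borel_measurable_sum score_measurable) auto

lemma norm_score_le: "norm (X i k w) \<le> R \<Longrightarrow> t \<in> {0..1} \<Longrightarrow> norm (score i k b t w) \<le> R"
proof -
  assume *: "norm (X i k w) \<le> R" "t \<in> {0..1}"
  have "norm (score i k b t w) \<le> 1 * norm (X i k w)"
    unfolding score_def norm_scaleR using * by (intro mult_right_mono) (auto simp: check_score_def)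
  with * show ?thesis by simp
qed

lemma score_integrable:
  assumes "i \<ge> 1" "k \<in> {1..c i}" "t \<in> {0..1}"
  shows "integrable M (score i k b t)"
  using AE_norm_X_le[OF assms(1,2)] norm_score_le[OF _ assms(3)] score_measurable[OF assms(1,2)]
  by (intro integrable_const_bound[where B=R]) auto

text \<open>The jumps of the scores are integrated out: in the mean only the conditional
  distribution functions remain, and these can be differentiated in \<open>b\<close>.\<close>

lemma mean_grad_inner:
  assumes "t \<in> {0..1}"
  shows "mean_grad n b t \<bullet> v = (1 / real n) * (\<Sum>i=1..n. \<Sum>k=1..c i.
     expectation (\<lambda>w. (cdf (density lborel (\<lambda>u. ennreal (f i k u (X i k w)))) (X i k w \<bullet> b) - t) * (X i k w \<bullet> v)))"
proof -
  have E1: "expectation (score i k b t) \<bullet> v =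
     - expectation (\<lambda>w. (cdf (density lborel (\<lambda>u. ennreal (f i k u (X i k w)))) (X i k w \<bullet> b) - t) * (X i k w \<bullet> v))"
    if ik: "i \<ge> 1" "k \<in> {1..c i}" for i k
  proof -
    interpret O: density_observation M "X i k" "Y i k" "f i k" B Cf Cd \<epsilon> by (rule observation[OF ik])
    have bd: "\<bar>x \<bullet> v\<bar> \<le> R * norm v" if "x \<in> O.supp" for x
      using Cauchy_Schwarz_ineq2[of x v] supp_bounded[OF ik that] by (meson mult_right_mono norm_ge_zero order_trans)
    have i1: "integrable M (\<lambda>w. X i k w \<bullet> v)"
      by (rule O.integrable_bounded_supp) (use bd in auto)
    have i2: "integrable M (\<lambda>w. O.F (X i k w) (X i k w \<bullet> b) * (X i k w \<bullet> v))"
    proof (rule O.integrable_bounded_supp)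
      fix w assume s: "X i k w \<in> O.supp"
      have "\<bar>O.F (X i k w) (X i k w \<bullet> b) * (X i k w \<bullet> v)\<bar> \<le> 1 * \<bar>X i k w \<bullet> v\<bar>"
        unfolding abs_mult using O.F_bounds[OF s, of "X i k w \<bullet> b"] by (intro mult_right_mono) auto
      then show "\<bar>O.F (X i k w) (X i k w \<bullet> b) * (X i k w \<bullet> v)\<bar> \<le> R * norm v" using bd[OF s] by simp
    qed measurable
    have i3: "integrable M (\<lambda>w. of_bool (Y i k w < X i k w \<bullet> b) * (X i k w \<bullet> v))"
      by (rule O.integrable_bounded_supp[where c="R * norm v"]) (use bd R_pos in auto)
    have "expectation (score i k b t) \<bullet> v = expectation (\<lambda>w. score i k b t w \<bullet> v)"
      using score_integrable[OF ik assms] by simp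
    also have "\<dots> = expectation (\<lambda>w. t * (X i k w \<bullet> v) - of_bool (Y i k w < X i k w \<bullet> b) * (X i k w \<bullet> v))"
      by (intro Bochner_Integration.integral_cong) (auto simp: score_def check_score_def left_diff_distrib)
    also have "\<dots> = t * expectation (\<lambda>w. X i k w \<bullet> v) - expectation (\<lambda>w. of_bool (Y i k w < X i k w \<bullet> b) * (X i k w \<bullet> v))"
      using i1 i3 by simp
    also have "expectation (\<lambda>w. of_bool (Y i k w < X i k w \<bullet> b) * (X i k w \<bullet> v))
        = expectation (\<lambda>w. O.F (X i k w) (X i k w \<bullet> b) * (X i k w \<bullet> v))"
      by (rule O.expectation_F[where h="\<lambda>x. x \<bullet> v"]) (use bd in auto)
    finally show ?thesis using i1 i2 by (simp add: left_diff_distrib)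
  qed
  have E2: "expectation (cscore i b t) = (\<Sum>k=1..c i. expectation (score i k b t))" if "i \<ge> 1" for i
    unfolding cscore_def[abs_def] using that assms by (intro Bochner_Integration.integral_sum score_integrable) auto
  have "mean_grad n b t \<bullet> v = - (1 / real n) * (\<Sum>i=1..n. expectation (cscore i b t) \<bullet> v)"
    by (simp add: mean_grad_def inner_sum_left)
  also have "(\<Sum>i=1..n. expectation (cscore i b t) \<bullet> v) = (\<Sum>i=1..n. \<Sum>k=1..c i. expectation (score i k b t) \<bullet> v)"
    by (intro sum.cong) (auto simp: E2 inner_sum_left)
  also have "\<dots> = (\<Sum>i=1..n. \<Sum>k=1..c i. - expectation (\<lambda>w. (cdf (density lborel (\<lambda>u. ennreal (f i k u (X i k w)))) (X i k w \<bullet> b) - t) * (X i k w \<bullet> v)))"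
    by (intro sum.cong refl) (simp only: E1 atLeastAtMost_iff)
  finally show ?thesis by (simp add: sum_negf)
qed

end

section \<open>Mean subgradient: monotonicity, Lipschitz bounds and linearization\<close>

context qr_model
begin

abbreviation condF :: "nat \<Rightarrow> nat \<Rightarrow> 'a \<Rightarrow> real \<Rightarrow> real" where
  "condF i k w \<equiv> cdf (density lborel (\<lambda>u. ennreal (f i k u (X i k w))))"

abbreviation \<kappa> :: real where "\<kappa> \<equiv> \<epsilon> * lam"

lemma kappa_pos: "\<kappa> > 0" using eps_pos lam_pos by simp

lemma inner_X_le: "norm (x :: real ^ 'd) \<le> R \<Longrightarrow> \<bar>x \<bullet> v\<bar> \<le> R * norm v"
  using Cauchy_Schwarz_ineq2[of x v] by (meson mult_right_mono norm_ge_zero order_trans)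

lemma condF_inner_integrable:
  assumes ik: "i \<ge> 1" "k \<in> {1..c i}"
  shows "integrable M (\<lambda>w. condF i k w (X i k w \<bullet> b) * (X i k w \<bullet> v))"
proof -
  interpret O: density_observation M "X i k" "Y i k" "f i k" B Cf Cd \<epsilon> by (rule observation[OF ik])
  show ?thesis
  proof (rule O.integrable_bounded_supp)
    fix w assume s: "X i k w \<in> O.supp"
    have "\<bar>O.F (X i k w) (X i k w \<bullet> b) * (X i k w \<bullet> v)\<bar> \<le> 1 * \<bar>X i k w \<bullet> v\<bar>"
      unfolding abs_mult using O.F_bounds[OF s, of "X i k w \<bullet> b"] by (intro mult_right_mono) auto
    then show "\<bar>O.F (X i k w) (X i k w \<bullet> b) * (X i k w \<bullet> v)\<bar> \<le> R * norm v"
      using inner_X_le[OF supp_bounded[OF ik s], of v] by simp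
  qed measurable
qed

lemma X_inner_integrable:
  assumes ik: "i \<ge> 1" "k \<in> {1..c i}"
  shows "integrable M (\<lambda>w. X i k w \<bullet> v)" "integrable M (\<lambda>w. (X i k w \<bullet> v)\<^sup>2)"
proof -
  have [measurable]: "X i k \<in> borel_measurable M" by (rule X_rv[OF ik])
  have *: "AE w in M. \<bar>X i k w \<bullet> v\<bar> \<le> R * norm v"
    using AE_norm_X_le[OF ik] by eventually_elim (rule inner_X_le)
  then show "integrable M (\<lambda>w. X i k w \<bullet> v)"
    by (intro integrable_const_bound[where B="R * norm v"]) auto
  have "AE w in M. \<bar>(X i k w \<bullet> v)\<^sup>2\<bar> \<le> (R * norm v)\<^sup>2"
    using *
  proof eventually_elim
    case (elim w)
    then show ?case using power_mono[OF elim abs_ge_zero, of 2] by simp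
  qed
  then show "integrable M (\<lambda>w. (X i k w \<bullet> v)\<^sup>2)"
    by (intro integrable_const_bound[where B="(R * norm v)\<^sup>2"]) auto
qed

lemma mean_grad_diff_inner:
  assumes "t \<in> {0..1}" "t' \<in> {0..1}"
  shows "(mean_grad n b t - mean_grad n b' t') \<bullet> v = (1 / real n) * (\<Sum>i=1..n. \<Sum>k=1..c i.
     expectation (\<lambda>w. (condF i k w (X i k w \<bullet> b) - condF i k w (X i k w \<bullet> b') - (t - t')) * (X i k w \<bullet> v)))"
proof -
  have *: "expectation (\<lambda>w. (condF i k w (X i k w \<bullet> b) - t) * (X i k w \<bullet> v)) - expectation (\<lambda>w. (condF i k w (X i k w \<bullet> b') - t') * (X i k w \<bullet> v))
    = expectation (\<lambda>w. (condF i k w (X i k w \<bullet> b) - condF i k w (X i k w \<bullet> b') - (t - t')) * (X i k w \<bullet> v))"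
    if ik: "i \<ge> 1" "k \<in> {1..c i}" for i k
  proof -
    have "integrable M (\<lambda>w. (condF i k w (X i k w \<bullet> b) - t) * (X i k w \<bullet> v))" for b t
      unfolding left_diff_distrib using condF_inner_integrable[OF ik] X_inner_integrable(1)[OF ik]
      by (intro Bochner_Integration.integrable_diff integrable_mult_right)
    from Bochner_Integration.integral_diff[OF this this, of b t b' t', symmetric]
    show ?thesis by (simp only: left_diff_distrib[symmetric]) (simp add: algebra_simps)
  qed
  show ?thesis
    unfolding inner_diff_left mean_grad_inner[OF assms(1)] mean_grad_inner[OF assms(2)]
      right_diff_distrib[symmetric] sum_subtractf[symmetric]
    by (intro arg_cong2[where f="(*)"] refl sum.cong) (simp only: * atLeastAtMost_iff)
qed

text \<open>The constant is the lower density bound times the Gram bound: on the support the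
  increment of the distribution function times \<open>x \<bullet> (b - b')\<close> is at least
  \<open>\<epsilon>\<close> times the square of the latter, and averaging these squares produces
  \<open>lam\<close>.\<close>

lemma mean_grad_strongly_monotone:
  assumes "n \<ge> 1" "b \<in> B" "b' \<in> B" "t \<in> {0..1}"
  shows "\<kappa> * (norm (b - b'))\<^sup>2 \<le> (mean_grad n b t - mean_grad n b' t) \<bullet> (b - b')"
proof -
  let ?v = "b - b'"
  have "\<epsilon> * (lam * (norm ?v)\<^sup>2) \<le> \<epsilon> * ((1 / real n) * (\<Sum>i=1..n. \<Sum>k=1..c i. expectation (\<lambda>w. (X i k w \<bullet> ?v)\<^sup>2)))"
    using gram[OF assms(1)] eps_pos by (intro mult_left_mono) auto
  also have "\<dots> = (1 / real n) * (\<Sum>i=1..n. \<Sum>k=1..c i. \<epsilon> * expectation (\<lambda>w. (X i k w \<bullet> ?v)\<^sup>2))"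
    by (simp add: sum_distrib_left algebra_simps)
  also have "\<dots> \<le> (1 / real n) * (\<Sum>i=1..n. \<Sum>k=1..c i.
     expectation (\<lambda>w. (condF i k w (X i k w \<bullet> b) - condF i k w (X i k w \<bullet> b')) * (X i k w \<bullet> ?v)))"
  proof (intro mult_left_mono sum_mono)
    fix i k assume "i \<in> {1..n}" "k \<in> {1..c i}"
    then have ik: "i \<ge> 1" "k \<in> {1..c i}" by auto
    interpret O: density_observation M "X i k" "Y i k" "f i k" B Cf Cd \<epsilon> by (rule observation[OF ik])
    have "\<epsilon> * expectation (\<lambda>w. (X i k w \<bullet> ?v)\<^sup>2) = expectation (\<lambda>w. \<epsilon> * (X i k w \<bullet> ?v)\<^sup>2)" by simp
    also have "\<dots> \<le> expectation (\<lambda>w. (condF i k w (X i k w \<bullet> b) - condF i k w (X i k w \<bullet> b')) * (X i k w \<bullet> ?v))"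
    proof (rule integral_mono_AE)
      show "AE w in M. \<epsilon> * (X i k w \<bullet> ?v)\<^sup>2 \<le> (condF i k w (X i k w \<bullet> b) - condF i k w (X i k w \<bullet> b')) * (X i k w \<bullet> ?v)"
        using O.AE_supp by eventually_elim (rule O.F_increment_ge[OF _ assms(2,3)])
      show "integrable M (\<lambda>w. \<epsilon> * (X i k w \<bullet> ?v)\<^sup>2)" using X_inner_integrable(2)[OF ik] by simp
      show "integrable M (\<lambda>w. (condF i k w (X i k w \<bullet> b) - condF i k w (X i k w \<bullet> b')) * (X i k w \<bullet> ?v))"
        unfolding left_diff_distrib using condF_inner_integrable[OF ik] by simp
    qed
    finally show "\<epsilon> * expectation (\<lambda>w. (X i k w \<bullet> ?v)\<^sup>2) \<le>
       expectation (\<lambda>w. (condF i k w (X i k w \<bullet> b) - condF i k w (X i k w \<bullet> b')) * (X i k w \<bullet> ?v))" .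
  qed auto
  also have "\<dots> = (mean_grad n b t - mean_grad n b' t) \<bullet> ?v"
    using mean_grad_diff_inner[OF assms(4,4), of n b b' ?v] by simp
  finally show ?thesis by (simp add: mult.assoc)
qed

lemma mean_grad_lipschitz:
  assumes "n \<ge> 1" "t \<in> {0..1}"
  shows "norm (mean_grad n b t - mean_grad n b' t) \<le> real c_max * (Cf * R\<^sup>2) * norm (b - b')"
proof (rule norm_le_if_inner_le)
  fix v :: "real ^ 'd"
  have "\<bar>(mean_grad n b t - mean_grad n b' t) \<bullet> v\<bar> \<le> real c_max * (Cf * (R * norm (b - b')) * (R * norm v))"
    unfolding mean_grad_diff_inner[OF assms(2,2)]
  proof (rule mean_abs_le[OF assms(1)])
    show "0 \<le> Cf * (R * norm (b - b')) * (R * norm v)" using Cf_nonneg R_pos by simp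
    fix i k assume "i \<in> {1..n}" "k \<in> {1..c i}"
    then have ik: "i \<ge> 1" "k \<in> {1..c i}" by auto
    interpret O: density_observation M "X i k" "Y i k" "f i k" B Cf Cd \<epsilon> by (rule observation[OF ik])
    show "\<bar>expectation (\<lambda>w. (condF i k w (X i k w \<bullet> b) - condF i k w (X i k w \<bullet> b') - (t - t)) * (X i k w \<bullet> v))\<bar>
        \<le> Cf * (R * norm (b - b')) * (R * norm v)"
    proof (rule abs_expectation_le)
      show "AE w in M. \<bar>(condF i k w (X i k w \<bullet> b) - condF i k w (X i k w \<bullet> b') - (t - t)) * (X i k w \<bullet> v)\<bar> \<le> Cf * (R * norm (b - b')) * (R * norm v)"
        using O.AE_supp
      proof eventually_elim
        case (elim w)
        have 1: "\<bar>condF i k w (X i k w \<bullet> b) - condF i k w (X i k w \<bullet> b')\<bar> \<le> Cf * (R * norm (b - b'))"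
          using O.F_increment_le[OF elim, of b b'] mult_left_mono[OF inner_X_le[OF supp_bounded[OF ik elim], of "b - b'"] Cf_nonneg]
          by linarith
        show ?case
          using mult_mono[OF 1 inner_X_le[OF supp_bounded[OF ik elim], of v]] Cf_nonneg R_pos by (simp add: abs_mult)
      qed
    qed (use Cf_nonneg R_pos in simp)
  qed
  then show "\<bar>(mean_grad n b t - mean_grad n b' t) \<bullet> v\<bar> \<le> real c_max * (Cf * R\<^sup>2) * norm (b - b') * norm v"
    by (simp add: power2_eq_square mult_ac)
qed (use Cf_nonneg in simp)

lemma condF_quantile:
  assumes "i \<ge> 1" "k \<in> {1..c i}" "X i k w \<in> law_support M (X i k)" "\<tau> \<in> T"
  shows "condF i k w (X i k w \<bullet> \<beta> \<tau>) = \<tau>"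
proof -
  interpret O: density_observation M "X i k" "Y i k" "f i k" B Cf Cd \<epsilon> by (rule observation[OF assms(1,2)])
  show ?thesis
    by (rule O.cdf_quantile[OF assms(3) _ _ quantile_linear[OF assms(1,2,4,3)]]) (use T_unit assms(4) in auto)
qed

lemma T_in_unit: "\<tau> \<in> T \<Longrightarrow> \<tau> \<in> {0..1}" using T_unit by force

lemma mean_grad_at_beta:
  assumes "n \<ge> 1" "\<tau> \<in> T"
  shows "mean_grad n (\<beta> \<tau>) \<tau> = 0"
proof -
  have "norm (mean_grad n (\<beta> \<tau>) \<tau>) \<le> 0"
  proof (rule norm_le_if_inner_le)
    fix v
    have "\<bar>mean_grad n (\<beta> \<tau>) \<tau> \<bullet> v\<bar> \<le> real c_max * 0"
      unfolding mean_grad_inner[OF T_in_unit[OF assms(2)]]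
    proof (rule mean_abs_le[OF assms(1)])
      fix i k assume "i \<in> {1..n}" "k \<in> {1..c i}"
      then have ik: "i \<ge> 1" "k \<in> {1..c i}" by auto
      show "\<bar>expectation (\<lambda>w. (condF i k w (X i k w \<bullet> \<beta> \<tau>) - \<tau>) * (X i k w \<bullet> v))\<bar> \<le> 0"
        by (rule abs_expectation_le, use AE_supp[OF ik] in eventually_elim)
           (use condF_quantile[OF ik _ assms(2)] in auto)
    qed simp
    then show "\<bar>mean_grad n (\<beta> \<tau>) \<tau> \<bullet> v\<bar> \<le> 0 * norm v" by simp
  qed simp
  then show ?thesis by simp
qed

text \<open>Strong monotonicity inverts the quantile relation: on the support the distribution
  functions at the two parameters have the known values \<open>\<tau>\<close> and
  \<open>\<tau>'\<close>, so their difference is exact. The first cluster alone, that is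
  \<open>n = 1\<close>, already yields the constant.\<close>

lemma beta_lipschitz:
  assumes "\<tau> \<in> T" "\<tau>' \<in> T"
  shows "norm (\<beta> \<tau> - \<beta> \<tau>') \<le> real c_max * R / \<kappa> * \<bar>\<tau> - \<tau>'\<bar>"
proof (cases "\<beta> \<tau> = \<beta> \<tau>'")
  case False
  let ?v = "\<beta> \<tau> - \<beta> \<tau>'"
  have "\<kappa> * (norm ?v)\<^sup>2 \<le> (mean_grad 1 (\<beta> \<tau>) \<tau> - mean_grad 1 (\<beta> \<tau>') \<tau>) \<bullet> ?v"
    by (rule mean_grad_strongly_monotone) (use assms \<beta>_in_B T_in_unit in auto)
  also have "\<dots> \<le> \<bar>(mean_grad 1 (\<beta> \<tau>) \<tau> - mean_grad 1 (\<beta> \<tau>') \<tau>) \<bullet> ?v\<bar>" by simp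
  also have "\<dots> \<le> real c_max * (\<bar>\<tau> - \<tau>'\<bar> * (R * norm ?v))"
    unfolding mean_grad_diff_inner[OF T_in_unit[OF assms(1)] T_in_unit[OF assms(1)]]
  proof (rule mean_abs_le)
    fix i k assume "i \<in> {1..1::nat}" "k \<in> {1..c i}"
    then have ik: "i \<ge> 1" "k \<in> {1..c i}" by auto
    show "\<bar>expectation (\<lambda>w. (condF i k w (X i k w \<bullet> \<beta> \<tau>) - condF i k w (X i k w \<bullet> \<beta> \<tau>') - (\<tau> - \<tau>)) * (X i k w \<bullet> ?v))\<bar>
      \<le> \<bar>\<tau> - \<tau>'\<bar> * (R * norm ?v)"
    proof (rule abs_expectation_le, use AE_supp[OF ik] in eventually_elim)
      fix w assume s: "X i k w \<in> law_support M (X i k)"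
      show "\<bar>(condF i k w (X i k w \<bullet> \<beta> \<tau>) - condF i k w (X i k w \<bullet> \<beta> \<tau>') - (\<tau> - \<tau>)) * (X i k w \<bullet> ?v)\<bar> \<le> \<bar>\<tau> - \<tau>'\<bar> * (R * norm ?v)"
        using inner_X_le[OF supp_bounded[OF ik s], of ?v] condF_quantile[OF ik s] assms
        by (simp add: abs_mult mult_left_mono)
    qed (use R_pos in simp)
  qed (use R_pos in auto)
  finally have "\<kappa> * norm ?v * norm ?v \<le> real c_max * R * \<bar>\<tau> - \<tau>'\<bar> * norm ?v"
    by (simp add: power2_eq_square mult_ac)
  then have "\<kappa> * norm ?v \<le> real c_max * R * \<bar>\<tau> - \<tau>'\<bar>"
    using False by (simp only: mult_le_cancel_right) (auto simp: not_less)
  then show ?thesis using kappa_pos by (simp add: field_simps)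
next
  case True
  then show ?thesis using kappa_pos R_pos by simp
qed

lemma f_at_beta_measurable:
  assumes ik: "i \<ge> 1" "k \<in> {1..c i}"
  shows "(\<lambda>w. f i k (X i k w \<bullet> b) (X i k w)) \<in> borel_measurable M"
proof -
  interpret O: density_observation M "X i k" "Y i k" "f i k" B Cf Cd \<epsilon> by (rule observation[OF ik])
  have "(\<lambda>w. (X i k w, X i k w \<bullet> b)) \<in> M \<rightarrow>\<^sub>M borel \<Otimes>\<^sub>M borel" by measurable
  from measurable_compose[OF this O.f_measurable] show ?thesis by simp
qed

lemma J_integrand_integrable:
  assumes ik: "i \<ge> 1" "k \<in> {1..c i}"
  shows "integrable M (\<lambda>w. f i k (X i k w \<bullet> b) (X i k w) *\<^sub>R outer_prod (X i k w) (X i k w))"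
proof (rule integrable_const_bound[where B="Cf * (R * R)"])
  have [measurable]: "X i k \<in> borel_measurable M" by (rule X_rv[OF ik])
  note [measurable] = f_at_beta_measurable[OF ik]
  show "(\<lambda>w. f i k (X i k w \<bullet> b) (X i k w) *\<^sub>R outer_prod (X i k w) (X i k w)) \<in> borel_measurable M"
    by measurable
  show "AE w in M. norm (f i k (X i k w \<bullet> b) (X i k w) *\<^sub>R outer_prod (X i k w) (X i k w)) \<le> Cf * (R * R)"
    using AE_supp[OF ik]
  proof eventually_elim
    case (elim w)
    show ?case
      unfolding norm_scaleR norm_outer_prod
      using f_le[OF ik elim] supp_bounded[OF ik elim] R_pos Cf_nonneg by (intro mult_mono) auto
  qed
qed

abbreviation Jn :: "nat \<Rightarrow> real \<Rightarrow> real ^ 'd ^ 'd" where "Jn \<equiv> J_mat M c X f \<beta>"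

lemma Jn_inner:
  "(Jn n \<tau> *v u) \<bullet> v = (1 / real n) * (\<Sum>i=1..n. \<Sum>k=1..c i.
     expectation (\<lambda>w. f i k (X i k w \<bullet> \<beta> \<tau>) (X i k w) * (X i k w \<bullet> u) * (X i k w \<bullet> v)))"
proof -
  let ?L = "\<lambda>A :: real ^ 'd ^ 'd. (A *v u) \<bullet> v"
  interpret L: bounded_linear ?L by (rule bounded_linear_quadratic_form)
  have "?L (Jn n \<tau>) = (1 / real n) * (\<Sum>i=1..n. \<Sum>k=1..c i. ?L (expectation (\<lambda>w. f i k (X i k w \<bullet> \<beta> \<tau>) (X i k w) *\<^sub>R outer_prod (X i k w) (X i k w))))"
    unfolding J_mat_def L.scaleR L.sum by simp
  also have "\<dots> = (1 / real n) * (\<Sum>i=1..n. \<Sum>k=1..c i.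
     expectation (\<lambda>w. f i k (X i k w \<bullet> \<beta> \<tau>) (X i k w) * (X i k w \<bullet> u) * (X i k w \<bullet> v)))"
  proof (intro arg_cong2[where f="(*)"] refl sum.cong)
    fix i k assume "i \<in> {1..n}" "k \<in> {1..c i}"
    then have ik: "i \<ge> 1" "k \<in> {1..c i}" by auto
    show "?L (expectation (\<lambda>w. f i k (X i k w \<bullet> \<beta> \<tau>) (X i k w) *\<^sub>R outer_prod (X i k w) (X i k w)))
      = expectation (\<lambda>w. f i k (X i k w \<bullet> \<beta> \<tau>) (X i k w) * (X i k w \<bullet> u) * (X i k w \<bullet> v))"
      by (subst integral_bounded_linear[OF L.bounded_linear_axioms J_integrand_integrable[OF ik], symmetric])
         (simp add: L.scaleR outer_prod_inner mult.assoc)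
  qed
  finally show ?thesis .
qed

lemma J_scalar_integrable:
  assumes ik: "i \<ge> 1" "k \<in> {1..c i}"
  shows "integrable M (\<lambda>w. f i k (X i k w \<bullet> b) (X i k w) * (X i k w \<bullet> u) * (X i k w \<bullet> v))"
  using integrable_bounded_linear[OF bounded_linear_quadratic_form[of u v] J_integrand_integrable[OF ik, of b]]
  by (simp add: scaleR_matrix_vector_assoc[symmetric] outer_prod_inner mult.assoc)

text \<open>The same constant as for the mean subgradient, and for the same reason; it makes the
  matrices \<open>Jn\<close> invertible with inverses bounded uniformly in \<open>n\<close> and
  \<open>\<tau>\<close>.\<close>

lemma Jn_ge:
  assumes "n \<ge> 1" "\<tau> \<in> T"
  shows "\<kappa> * (norm v)\<^sup>2 \<le> (Jn n \<tau> *v v) \<bullet> v"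
proof -
  have "\<epsilon> * (lam * (norm v)\<^sup>2) \<le> \<epsilon> * ((1 / real n) * (\<Sum>i=1..n. \<Sum>k=1..c i. expectation (\<lambda>w. (X i k w \<bullet> v)\<^sup>2)))"
    using gram[OF assms(1)] eps_pos by (intro mult_left_mono) auto
  also have "\<dots> = (1 / real n) * (\<Sum>i=1..n. \<Sum>k=1..c i. \<epsilon> * expectation (\<lambda>w. (X i k w \<bullet> v)\<^sup>2))"
    by (simp add: sum_distrib_left algebra_simps)
  also have "\<dots> \<le> (Jn n \<tau> *v v) \<bullet> v"
    unfolding Jn_inner
  proof (intro mult_left_mono sum_mono)
    fix i k assume "i \<in> {1..n}" "k \<in> {1..c i}"
    then have ik: "i \<ge> 1" "k \<in> {1..c i}" by auto
    have "\<epsilon> * expectation (\<lambda>w. (X i k w \<bullet> v)\<^sup>2) = expectation (\<lambda>w. \<epsilon> * (X i k w \<bullet> v)\<^sup>2)" by simp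
    also have "\<dots> \<le> expectation (\<lambda>w. f i k (X i k w \<bullet> \<beta> \<tau>) (X i k w) * (X i k w \<bullet> v) * (X i k w \<bullet> v))"
    proof (rule integral_mono_AE)
      show "AE w in M. \<epsilon> * (X i k w \<bullet> v)\<^sup>2 \<le> f i k (X i k w \<bullet> \<beta> \<tau>) (X i k w) * (X i k w \<bullet> v) * (X i k w \<bullet> v)"
        using AE_supp[OF ik]
      proof eventually_elim
        case (elim w)
        have "\<epsilon> * (X i k w \<bullet> v)\<^sup>2 \<le> f i k (X i k w \<bullet> \<beta> \<tau>) (X i k w) * (X i k w \<bullet> v)\<^sup>2"
          using f_ge[OF ik elim \<beta>_in_B[OF assms(2)]] by (rule mult_right_mono) simp
        then show ?case by (simp add: power2_eq_square mult.assoc)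
      qed
      show "integrable M (\<lambda>w. \<epsilon> * (X i k w \<bullet> v)\<^sup>2)" using X_inner_integrable(2)[OF ik] by simp
    qed (rule J_scalar_integrable[OF ik])
    finally show "\<epsilon> * expectation (\<lambda>w. (X i k w \<bullet> v)\<^sup>2)
      \<le> expectation (\<lambda>w. f i k (X i k w \<bullet> \<beta> \<tau>) (X i k w) * (X i k w \<bullet> v) * (X i k w \<bullet> v))" .
  qed auto
  finally show ?thesis by (simp add: mult.assoc)
qed

text \<open>\<open>Jn n \<tau>\<close> is the derivative of the mean subgradient at
  \<open>\<beta> \<tau>\<close>. The error is a product of distances, so in the Bahadur
  representation it is quadratic in the rates.\<close>

lemma mean_grad_linearization:
  assumes "n \<ge> 1" "\<tau> \<in> T"
  shows "norm (mean_grad n b \<tau> - mean_grad n b' \<tau> - Jn n \<tau> *v (b - b'))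
    \<le> real c_max * (Cd * R^3) * (norm (b - \<beta> \<tau>) + norm (b' - \<beta> \<tau>)) * norm (b - b')"
proof (rule norm_le_if_inner_le)
  fix v :: "real ^ 'd"
  let ?C = "Cd * (R * norm (b - \<beta> \<tau>) + R * norm (b' - \<beta> \<tau>)) * (R * norm (b - b')) * (R * norm v)"
  let ?A = "\<lambda>i k w. (condF i k w (X i k w \<bullet> b) - condF i k w (X i k w \<bullet> b') - (\<tau> - \<tau>)) * (X i k w \<bullet> v)"
  let ?D = "\<lambda>i k w. f i k (X i k w \<bullet> \<beta> \<tau>) (X i k w) * (X i k w \<bullet> (b - b')) * (X i k w \<bullet> v)"
  have "(mean_grad n b \<tau> - mean_grad n b' \<tau> - Jn n \<tau> *v (b - b')) \<bullet> v
    = (1 / real n) * (\<Sum>i=1..n. \<Sum>k=1..c i. expectation (?A i k) - expectation (?D i k))"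
    unfolding inner_diff_left[of _ "Jn n \<tau> *v (b - b')"] mean_grad_diff_inner[OF T_in_unit T_in_unit, OF assms(2,2)] Jn_inner
    by (simp only: right_diff_distrib[symmetric] sum_subtractf[symmetric])
  also have "\<bar>\<dots>\<bar> \<le> real c_max * ?C"
  proof (rule mean_abs_le[OF assms(1)])
    show "0 \<le> ?C" using Cd_nonneg R_pos by simp
    fix i k assume "i \<in> {1..n}" "k \<in> {1..c i}"
    then have ik: "i \<ge> 1" "k \<in> {1..c i}" by auto
    interpret O: density_observation M "X i k" "Y i k" "f i k" B Cf Cd \<epsilon> by (rule observation[OF ik])
    have "integrable M (?A i k)"
      using condF_inner_integrable[OF ik] by (simp add: left_diff_distrib)
    then have "expectation (?A i k) - expectation (?D i k) = expectation (\<lambda>w. ?A i k w - ?D i k w)"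
      using J_scalar_integrable[OF ik] by (intro Bochner_Integration.integral_diff[symmetric])
    also have "\<bar>\<dots>\<bar> \<le> ?C"
    proof (rule abs_expectation_le)
      show "0 \<le> ?C" using Cd_nonneg R_pos by simp
      show "AE w in M. \<bar>?A i k w - ?D i k w\<bar> \<le> ?C"
        using O.AE_supp
      proof eventually_elim
        case (elim w)
        note XR = inner_X_le[OF supp_bounded[OF ik elim]]
        have "\<bar>condF i k w (X i k w \<bullet> b) - condF i k w (X i k w \<bullet> b') - f i k (X i k w \<bullet> \<beta> \<tau>) (X i k w) * (X i k w \<bullet> (b - b'))\<bar>
          \<le> Cd * (\<bar>X i k w \<bullet> (b - \<beta> \<tau>)\<bar> + \<bar>X i k w \<bullet> (b' - \<beta> \<tau>)\<bar>) * \<bar>X i k w \<bullet> (b - b')\<bar>"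
          by (rule O.F_linearization[OF elim])
        also have "\<dots> \<le> Cd * (R * norm (b - \<beta> \<tau>) + R * norm (b' - \<beta> \<tau>)) * (R * norm (b - b'))"
          using Cd_nonneg R_pos by (intro mult_mono add_mono XR order_refl) auto
        finally have "\<bar>condF i k w (X i k w \<bullet> b) - condF i k w (X i k w \<bullet> b') - f i k (X i k w \<bullet> \<beta> \<tau>) (X i k w) * (X i k w \<bullet> (b - b'))\<bar> * \<bar>X i k w \<bullet> v\<bar> \<le> ?C"
          using Cd_nonneg R_pos by (intro mult_mono XR) auto
        then show ?case by (simp only: abs_mult[symmetric] left_diff_distrib diff_self diff_zero)
      qed
    qed
    finally show "\<bar>expectation (?A i k) - expectation (?D i k)\<bar> \<le> ?C" .
  qed
  finally show "\<bar>(mean_grad n b \<tau> - mean_grad n b' \<tau> - Jn n \<tau> *v (b - b')) \<bullet> v\<bar>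
    \<le> real c_max * (Cd * R^3) * (norm (b - \<beta> \<tau>) + norm (b' - \<beta> \<tau>)) * norm (b - b') * norm v"
    by (simp add: power3_eq_cube algebra_simps)
qed (use Cd_nonneg R_pos in simp)

text \<open>Combined with the Lipschitz bound for \<open>\<beta>\<close>, this makes the functions
  \<open>Jn n\<close> equi-Lipschitz in the level.\<close>

lemma Jn_lipschitz:
  assumes "n \<ge> 1"
  shows "norm (Jn n \<tau> - Jn n \<tau>') \<le> real c_max * (Cd * R^3) * norm (\<beta> \<tau> - \<beta> \<tau>')"
proof -
  let ?H = "\<lambda>\<tau> i k w. f i k (X i k w \<bullet> \<beta> \<tau>) (X i k w) *\<^sub>R outer_prod (X i k w) (X i k w)"
  let ?C = "Cd * (R * norm (\<beta> \<tau> - \<beta> \<tau>')) * (R * R)"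
  have "Jn n \<tau> - Jn n \<tau>' = (1 / real n) *\<^sub>R (\<Sum>i=1..n. \<Sum>k=1..c i. expectation (?H \<tau> i k) - expectation (?H \<tau>' i k))"
    unfolding J_mat_def by (simp only: scaleR_diff_right sum_subtractf)
  also have "norm \<dots> \<le> real c_max * ?C"
  proof (rule mean_norm_le[OF assms])
    show "0 \<le> ?C" using Cd_nonneg R_pos by simp
    fix i k assume "i \<in> {1..n}" "k \<in> {1..c i}"
    then have ik: "i \<ge> 1" "k \<in> {1..c i}" by auto
    interpret O: density_observation M "X i k" "Y i k" "f i k" B Cf Cd \<epsilon> by (rule observation[OF ik])
    have "expectation (?H \<tau> i k) - expectation (?H \<tau>' i k) = expectation (\<lambda>w. ?H \<tau> i k w - ?H \<tau>' i k w)"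
      using J_integrand_integrable[OF ik] by (intro Bochner_Integration.integral_diff[symmetric])
    also have "norm \<dots> \<le> ?C"
    proof (rule norm_expectation_le)
      show "0 \<le> ?C" using Cd_nonneg R_pos by simp
      show "AE w in M. norm (?H \<tau> i k w - ?H \<tau>' i k w) \<le> ?C"
        using O.AE_supp
      proof eventually_elim
        case (elim w)
        have "\<bar>f i k (X i k w \<bullet> \<beta> \<tau>) (X i k w) - f i k (X i k w \<bullet> \<beta> \<tau>') (X i k w)\<bar> \<le> Cd * \<bar>X i k w \<bullet> (\<beta> \<tau> - \<beta> \<tau>')\<bar>"
          using O.f_lipschitz[OF elim] by (simp add: inner_diff_right)
        also have "\<dots> \<le> Cd * (R * norm (\<beta> \<tau> - \<beta> \<tau>'))"
          using Cd_nonneg inner_X_le[OF supp_bounded[OF ik elim]] by (intro mult_left_mono)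
        finally show ?case
          unfolding scaleR_left_diff_distrib[symmetric] norm_scaleR norm_outer_prod
          using supp_bounded[OF ik elim] Cd_nonneg R_pos by (intro mult_mono) auto
      qed
    qed
    finally show "norm (expectation (?H \<tau> i k) - expectation (?H \<tau>' i k)) \<le> ?C" .
  qed
  finally show ?thesis by (simp add: power3_eq_cube mult_ac)
qed

end

section \<open>Minty variational inequalities\<close>

lemma check_loss_subgradient:
  assumes "t \<in> {0..1}"
  shows "check_loss t u + check_score t u * (u' - u) \<le> check_loss t u'"
  using assms unfolding check_loss_def check_score_def
  by (cases "u < 0"; cases "u' < 0") (auto simp: algebra_simps mult_le_0_iff mult_nonneg_nonpos2 intro: mult_nonneg_nonpos mult_left_le_one_le)

lemma coercive_norm_le:
  fixes A :: "real ^ 'd ^ 'd"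
  assumes "\<And>v. \<kappa> * (norm v)\<^sup>2 \<le> (A *v v) \<bullet> v" "\<kappa> > 0"
  shows "\<kappa> * norm v \<le> norm (A *v v)"
proof (cases "v = 0")
  case False
  have "\<kappa> * norm v * norm v \<le> norm (A *v v) * norm v"
    using assms(1)[of v] norm_cauchy_schwarz[of "A *v v" v] by (simp add: power2_eq_square)
  then show ?thesis using False by (simp only: mult_le_cancel_right) (auto simp: not_less)
qed simp

lemma coercive_invertible:
  fixes A :: "real ^ 'd ^ 'd"
  assumes "\<And>v. \<kappa> * (norm v)\<^sup>2 \<le> (A *v v) \<bullet> v" "\<kappa> > 0"
  shows "invertible A"
proof -
  have "v = 0" if "A *v v = 0" for v
    using coercive_norm_le[of \<kappa> A v] assms that by (simp add: mult_le_0_iff)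
  then show ?thesis
    unfolding invertible_left_inverse matrix_left_invertible_ker by blast
qed

text \<open>\<open>matrix_inv\<close> is a choice that is meaningful only for invertible matrices.
  Coercivity excludes a kernel and at the same time bounds the inverse.\<close>

lemma coercive_inverse:
  fixes A :: "real ^ 'd ^ 'd"
  assumes "\<And>v. \<kappa> * (norm v)\<^sup>2 \<le> (A *v v) \<bullet> v" "\<kappa> > 0"
  shows "A *v (matrix_inv A *v y) = y" "matrix_inv A *v (A *v y) = y" "norm (matrix_inv A *v y) \<le> norm y / \<kappa>"
proof -
  have i: "A ** matrix_inv A = mat 1 \<and> matrix_inv A ** A = mat 1"
    using coercive_invertible[OF assms] unfolding invertible_def matrix_inv_def by (rule someI_ex)
  then show 1: "A *v (matrix_inv A *v y) = y" "matrix_inv A *v (A *v y) = y"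
    by (simp_all add: matrix_vector_mul_assoc)
  have "\<kappa> * norm (matrix_inv A *v y) \<le> norm y"
    using coercive_norm_le[OF assms, of "matrix_inv A *v y"] 1 by simp
  then show "norm (matrix_inv A *v y) \<le> norm y / \<kappa>" using assms(2) by (simp add: field_simps)
qed

text \<open>At \<open>a\<close> itself the inequality is void. A step from \<open>a\<close> against
  the direction of \<open>G a\<close> leads to a point \<open>b\<close> at which the inequality
  forces \<open>G b\<close> to be nonpositive in this direction; as \<open>G b\<close> differs from
  \<open>G a\<close> by at most \<open>e\<close>, the vector \<open>G a\<close> cannot be longer
  than \<open>e\<close>.\<close>

lemma variational_interior_small:
  fixes G :: "'e::real_inner \<Rightarrow> 'e"
  assumes "\<And>b. b \<in> B \<Longrightarrow> 0 \<le> G b \<bullet> (b - a)" "cball a s \<subseteq> B" "s > 0"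
    and "\<And>b. norm (b - a) \<le> s \<Longrightarrow> norm (G a - G b) \<le> e" "0 \<le> e"
  shows "norm (G a) \<le> e"
proof (cases "G a = 0")
  case False
  define u where "u = G a /\<^sub>R norm (G a)"
  have u: "norm u = 1" "G a \<bullet> u = norm (G a)" using False by (auto simp: u_def dot_square_norm power2_eq_square)
  define b where "b = a - s *\<^sub>R u"
  have nb: "norm (b - a) = s" using u assms(3) by (simp add: b_def)
  have "b \<in> B" using assms(2) nb by (auto simp: dist_norm norm_minus_commute subset_iff)
  then have "0 \<le> G b \<bullet> (b - a)" by (rule assms(1))
  then have "G b \<bullet> u \<le> 0" using assms(3) by (simp add: b_def mult_le_0_iff)
  have "norm (G a) = (G a - G b) \<bullet> u + G b \<bullet> u" by (simp add: u inner_diff_left)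
  also have "\<dots> \<le> norm (G a - G b) * norm u" using \<open>G b \<bullet> u \<le> 0\<close> norm_cauchy_schwarz[of "G a - G b" u] by linarith
  also have "\<dots> \<le> e" using u assms(4)[of b] nb by simp
  finally show ?thesis .
qed (use assms in simp)

text \<open>
  \<open>G\<close> is the subgradient of the empirical criterion, \<open>Gb\<close> its mean, \<open>ah\<close> the estimator and \<open>as\<close>
  the bootstrap estimator, both characterised by their Minty variational inequalities; testing
  these at midpoints gives a priori bounds without assuming that \<open>ah\<close> or \<open>as\<close> is interior.
\<close>

locale minty_pair =
  fixes G Gb :: "real ^ 'd \<Rightarrow> real ^ 'd" and B :: "(real ^ 'd) set"
    and b0 ah as w :: "real ^ 'd" and A :: "real ^ 'd ^ 'd"
    and \<kappa> L L3 e1 e2 \<delta> s r :: real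
  assumes conv: "convex B" and inB: "b0 \<in> B" "ah \<in> B" "as \<in> B"
    and pos: "\<kappa> > 0" "s > 0" "s \<le> \<delta>" "0 \<le> e1" "0 \<le> e2" "0 \<le> L" "0 \<le> L3"
    and mono: "\<And>b b'. b \<in> B \<Longrightarrow> b' \<in> B \<Longrightarrow> \<kappa> * (norm (b - b'))\<^sup>2 \<le> (Gb b - Gb b') \<bullet> (b - b')"
    and lip: "\<And>b b'. norm (Gb b - Gb b') \<le> L * norm (b - b')"
    and lin: "\<And>b b'. norm (Gb b - Gb b' - A *v (b - b')) \<le> L3 * (norm (b - b0) + norm (b' - b0)) * norm (b - b')"
    and zero: "Gb b0 = 0"
    and ball: "cball b0 r \<subseteq> B"
    and E1: "\<And>b. b \<in> B \<Longrightarrow> norm (G b - Gb b) \<le> e1"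
    and E2: "\<And>b b'. b \<in> B \<Longrightarrow> b' \<in> B \<Longrightarrow> norm (b - b') \<le> \<delta> \<Longrightarrow> norm ((G b - Gb b) - (G b' - Gb b')) \<le> e2"
    and opt_h: "\<And>b. b \<in> B \<Longrightarrow> 0 \<le> G b \<bullet> (b - ah)"
    and opt_s: "\<And>b. b \<in> B \<Longrightarrow> 0 \<le> (G b + w) \<bullet> (b - as)"
begin

lemma midpoint_in: "x \<in> B \<Longrightarrow> y \<in> B \<Longrightarrow> (1/2) *\<^sub>R (x + y) \<in> B"
  using convexD[OF conv, of x y "1/2" "1/2"] by (simp add: scaleR_add_right)

lemma estimator_close: "norm (ah - b0) \<le> 2 * e1 / \<kappa>"
proof -
  \<comment> \<open>Neither endpoint is informative: at \<open>b0\<close> the monotonicity of the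
    mean against \<open>b0\<close> is void, and at \<open>ah\<close> the optimality inequality is
    void. At the midpoint the two oppose each other.\<close>
  define m where "m = (1/2) *\<^sub>R (ah + b0)"
  define d where "d = ah - b0"
  have mB: "m \<in> B" unfolding m_def using inB by (intro midpoint_in)
  have m1: "m - ah = - (1/2) *\<^sub>R d" "m - b0 = (1/2) *\<^sub>R d"
    by (simp_all add: m_def d_def vec_eq_iff field_simps)
  have "0 \<le> G m \<bullet> (m - ah)" by (rule opt_h[OF mB])
  then have g: "G m \<bullet> d \<le> 0" by (simp add: m1)
  have "\<kappa> * (norm (m - b0))\<^sup>2 \<le> (Gb m - Gb b0) \<bullet> (m - b0)" by (rule mono[OF mB inB(1)])
  then have "\<kappa> / 2 * (norm d)\<^sup>2 \<le> Gb m \<bullet> d" by (simp add: m1 zero power2_eq_square)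
  also have "Gb m \<bullet> d = G m \<bullet> d - (G m - Gb m) \<bullet> d" by (simp add: inner_diff_left)
  also have "\<dots> \<le> e1 * norm d"
    using g Cauchy_Schwarz_ineq2[of "G m - Gb m" d] mult_right_mono[OF E1[OF mB] norm_ge_zero[of d]] by linarith
  finally have "\<kappa> / 2 * norm d * norm d \<le> e1 * norm d" by (simp add: power2_eq_square)
  then have "\<kappa> / 2 * norm d \<le> e1"
    using pos by (cases "d = 0") (simp_all only: mult_le_cancel_right, auto simp: not_less)
  then show ?thesis using pos by (simp add: d_def field_simps)
qed

lemma cball_in_B: "norm (a - b0) + s \<le> r \<Longrightarrow> cball a s \<subseteq> B"
  using ball by (auto intro!: subsetD[OF ball] simp: subset_iff) (smt (verit) dist_commute dist_norm dist_triangle)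

lemma G_increment:
  assumes "norm (a - b0) + s \<le> r" "norm (b - a) \<le> s"
  shows "norm (G a - G b) \<le> e2 + L * s"
proof -
  have B: "a \<in> B" "b \<in> B" using cball_in_B[OF assms(1)] pos assms(2) by (auto simp: subset_iff dist_norm norm_minus_commute)
  have "G a - G b = ((G a - Gb a) - (G b - Gb b)) + (Gb a - Gb b)" by simp
  also have "norm \<dots> \<le> e2 + L * norm (a - b)"
    using E2[OF B] lip[of a b] assms(2) pos by (intro order_trans[OF norm_triangle_ineq] add_mono) (auto simp: norm_minus_commute)
  also have "\<dots> \<le> e2 + L * s" using assms(2) pos by (auto simp: norm_minus_commute intro: mult_left_mono)
  finally show ?thesis .
qed

lemma grad_at_estimator:
  assumes "norm (ah - b0) + s \<le> r"
  shows "norm (G ah) \<le> e2 + L * s"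
  by (rule variational_interior_small[OF opt_h cball_in_B[OF assms] pos(2)])
     (use G_increment[OF assms] pos in auto)

lemma grad_at_boot_estimator:
  assumes "norm (as - b0) + s \<le> r"
  shows "norm (G as + w) \<le> e2 + L * s"
  by (rule variational_interior_small[of B "\<lambda>b. G b + w", OF opt_s cball_in_B[OF assms] pos(2)])
     (use G_increment[OF assms] pos in auto)

lemma boot_crude:
  assumes "norm (ah - b0) + s \<le> r"
  shows "norm (as - ah) \<le> 2 / \<kappa> * (norm w + (e2 + L * s) + 2 * e1)"
proof -
  \<comment> \<open>Monotonicity is now taken against \<open>ah\<close> instead of
    \<open>b0\<close>. The price is the value \<open>G ah\<close>, which
    \<open>grad_at_estimator\<close> bounds.\<close>
  define m where "m = (1/2) *\<^sub>R (ah + as)"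
  define d where "d = as - ah"
  have mB: "m \<in> B" unfolding m_def using inB by (intro midpoint_in)
  have m1: "m - as = - (1/2) *\<^sub>R d" "m - ah = (1/2) *\<^sub>R d"
    by (simp_all add: m_def d_def vec_eq_iff field_simps)
  have "0 \<le> (G m + w) \<bullet> (m - as)" by (rule opt_s[OF mB])
  then have g: "(G m + w) \<bullet> d \<le> 0" by (simp add: m1)
  have "\<kappa> * (norm (m - ah))\<^sup>2 \<le> (Gb m - Gb ah) \<bullet> (m - ah)" by (rule mono[OF mB inB(2)])
  then have "\<kappa> / 2 * (norm d)\<^sup>2 \<le> (Gb m - Gb ah) \<bullet> d" by (simp add: m1 power2_eq_square)
  also have "\<dots> = (G m + w) \<bullet> d - w \<bullet> d - G ah \<bullet> d - (G m - Gb m) \<bullet> d + (G ah - Gb ah) \<bullet> d"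
    by (simp add: inner_diff_left inner_add_left)
  also have "\<dots> \<le> norm w * norm d + (e2 + L * s) * norm d + e1 * norm d + e1 * norm d"
  proof -
    have "- (w \<bullet> d) \<le> norm w * norm d" using Cauchy_Schwarz_ineq2[of w d] by linarith
    moreover have "- (G ah \<bullet> d) \<le> (e2 + L * s) * norm d"
      using Cauchy_Schwarz_ineq2[of "G ah" d] mult_right_mono[OF grad_at_estimator[OF assms] norm_ge_zero[of d]] by linarith
    moreover have "- ((G m - Gb m) \<bullet> d) \<le> e1 * norm d"
      using Cauchy_Schwarz_ineq2[of "G m - Gb m" d] mult_right_mono[OF E1[OF mB] norm_ge_zero[of d]] by linarith
    moreover have "(G ah - Gb ah) \<bullet> d \<le> e1 * norm d"
      using Cauchy_Schwarz_ineq2[of "G ah - Gb ah" d] mult_right_mono[OF E1[OF inB(2)] norm_ge_zero[of d]] by linarith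
    ultimately show ?thesis using g by linarith
  qed
  finally have "(\<kappa> / 2 * norm d) * norm d \<le> (norm w + (e2 + L * s) + 2 * e1) * norm d"
    by (simp add: power2_eq_square algebra_simps)
  moreover have "0 \<le> norm w + (e2 + L * s) + 2 * e1" using pos by simp
  ultimately have "\<kappa> / 2 * norm d \<le> norm w + (e2 + L * s) + 2 * e1"
    by (cases "d = 0") (simp_all only: mult_le_cancel_right, auto simp: not_less)
  then show ?thesis using pos by (simp add: d_def field_simps)
qed

text \<open>The nearly vanishing vectors \<open>G as + w\<close> and \<open>G ah\<close> are
  subtracted; the centred empirical part then changes by at most \<open>e2\<close>, and the mean
  part is linearized. The larger error \<open>e1\<close> enters only through the distances, which is
  what makes the remainder smaller than the estimation error.\<close>

lemma boot_linearization:
  assumes "norm (ah - b0) + s \<le> r" "norm (as - b0) + s \<le> r" "norm (as - ah) \<le> \<delta>"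
  shows "norm (A *v (as - ah) + w) \<le> 3 * e2 + 2 * L * s + L3 * (norm (as - b0) + norm (ah - b0)) * norm (as - ah)"
proof -
  have "A *v (as - ah) + w = (G as + w) - G ah - ((G as - Gb as) - (G ah - Gb ah)) - (Gb as - Gb ah - A *v (as - ah))"
    by simp
  also have "norm \<dots> \<le> norm (G as + w) + norm (G ah) + norm ((G as - Gb as) - (G ah - Gb ah)) + norm (Gb as - Gb ah - A *v (as - ah))"
    by (meson add_mono norm_triangle_ineq4 order_refl order_trans)
  also have "\<dots> \<le> (e2 + L * s) + (e2 + L * s) + e2 + L3 * (norm (as - b0) + norm (ah - b0)) * norm (as - ah)"
    by (intro add_mono grad_at_boot_estimator grad_at_estimator E2 lin assms inB)
  finally show ?thesis by simp
qed

end

section \<open>Cluster scores, their increments and the subgradient inequality\<close>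

context qr_model
begin

text \<open>The bound by \<open>R\<close> holds only almost surely; stated cluster by cluster it can
  be made part of an event in the data algebra.\<close>

definition okX :: "nat \<Rightarrow> 'a \<Rightarrow> bool" where
  "okX i w \<longleftrightarrow> (\<forall>k\<in>{1..c i}. norm (X i k w) \<le> R)"

text \<open>Counts the observations at which the score can change when \<open>b\<close> moves from \<open>g\<close> by at most \<open>\<eta> / R\<close>.\<close>

definition band :: "nat \<Rightarrow> real ^ 'd \<Rightarrow> real \<Rightarrow> 'a \<Rightarrow> real" where
  "band i g \<eta> w = (\<Sum>k=1..c i. of_bool (\<bar>Y i k w - X i k w \<bullet> g\<bar> \<le> \<eta>))"

abbreviation SB :: real where "SB \<equiv> real c_max * R"

lemma SB_ge: "1 \<le> SB" using c_max_pos R_pos mult_mono[of 1 "real c_max" 1 R] by simp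

lemma AE_okX: "i \<ge> 1 \<Longrightarrow> AE w in M. okX i w"
  unfolding okX_def by (intro AE_finite_allI AE_norm_X_le) auto

lemma norm_cscore_le:
  assumes "i \<ge> 1" "okX i w" "t \<in> {0..1}"
  shows "norm (cscore i b t w) \<le> SB"
proof -
  have "norm (cscore i b t w) \<le> (\<Sum>k=1..c i. R)"
    unfolding cscore_def using assms by (intro order_trans[OF norm_sum] sum_mono norm_score_le) (auto simp: okX_def)
  also have "\<dots> \<le> SB" using clusters_bounded[OF assms(1)] R_pos by (simp add: mult_right_mono)
  finally show ?thesis .
qed

text \<open>An indicator can change between \<open>b'\<close> and \<open>b\<close> only if the
  residual at \<open>b'\<close> is at most the change of the fitted value. The band is centred at
  \<open>b'\<close> alone, so one band covers all \<open>b\<close> close to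
  \<open>b'\<close>.\<close>

lemma cscore_increment:
  assumes "i \<ge> 1" "okX i w" "R * norm (b - b') \<le> \<eta>"
  shows "norm (cscore i b t w - cscore i b' t' w) \<le> R * (real c_max * \<bar>t - t'\<bar> + band i b' \<eta> w)"
proof -
  have "norm (cscore i b t w - cscore i b' t' w) \<le> (\<Sum>k=1..c i. norm (score i k b t w - score i k b' t' w))"
    unfolding cscore_def sum_subtractf[symmetric] by (rule norm_sum)
  also have "\<dots> \<le> (\<Sum>k=1..c i. R * (\<bar>t - t'\<bar> + of_bool (\<bar>Y i k w - X i k w \<bullet> b'\<bar> \<le> \<eta>)))"
  proof (rule sum_mono)
    fix k assume k: "k \<in> {1..c i}"
    then have X: "norm (X i k w) \<le> R" using assms by (auto simp: okX_def)
    have "\<bar>X i k w \<bullet> b - X i k w \<bullet> b'\<bar> \<le> \<eta>"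
      using inner_X_le[OF X, of "b - b'"] assms(3) by (simp add: inner_diff_right)
    then have "\<bar>check_score t (Y i k w - X i k w \<bullet> b) - check_score t' (Y i k w - X i k w \<bullet> b')\<bar>
        \<le> \<bar>t - t'\<bar> + of_bool (\<bar>Y i k w - X i k w \<bullet> b'\<bar> \<le> \<eta>)"
      by (auto simp: check_score_def of_bool_def)
    then show "norm (score i k b t w - score i k b' t' w) \<le> R * (\<bar>t - t'\<bar> + of_bool (\<bar>Y i k w - X i k w \<bullet> b'\<bar> \<le> \<eta>))"
      unfolding score_def scaleR_left_diff_distrib[symmetric] norm_scaleR mult.commute[of R] using X
      by (intro mult_mono) auto
  qed
  also have "\<dots> = R * (real (c i) * \<bar>t - t'\<bar> + band i b' \<eta> w)"
    by (simp add: band_def sum_distrib_left[symmetric] sum.distrib)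
  also have "\<dots> \<le> R * (real c_max * \<bar>t - t'\<bar> + band i b' \<eta> w)"
    using clusters_bounded[OF assms(1)] R_pos by (intro mult_left_mono add_mono mult_right_mono) auto
  finally show ?thesis .
qed

lemma band_measurable[measurable]: "i \<ge> 1 \<Longrightarrow> band i g \<eta> \<in> borel_measurable M"
proof -
  assume i: "i \<ge> 1"
  have "(\<lambda>w. of_bool (\<bar>Y i k w - X i k w \<bullet> g\<bar> \<le> \<eta>) :: real) \<in> borel_measurable M" if "k \<in> {1..c i}" for k
  proof -
    have [measurable]: "X i k \<in> borel_measurable M" "Y i k \<in> borel_measurable M" using X_rv Y_rv i that by auto
    show ?thesis by measurable
  qed
  then show ?thesis unfolding band_def[abs_def] by (intro borel_measurable_sum)
qed

lemma band_bounds: "i \<ge> 1 \<Longrightarrow> 0 \<le> band i g \<eta> w" "i \<ge> 1 \<Longrightarrow> band i g \<eta> w \<le> real c_max"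
proof -
  assume i: "i \<ge> 1"
  show "0 \<le> band i g \<eta> w" unfolding band_def by (intro sum_nonneg) auto
  have "band i g \<eta> w \<le> (\<Sum>k=1..c i. 1)" unfolding band_def by (intro sum_mono) auto
  then show "band i g \<eta> w \<le> real c_max" using clusters_bounded[OF i] by simp
qed

lemma band_integrable: "i \<ge> 1 \<Longrightarrow> integrable M (band i g \<eta>)"
  using band_bounds by (intro integrable_const_bound[where B="real c_max"]) (auto simp: abs_of_nonneg)

lemma expectation_band_le:
  assumes "i \<ge> 1" "0 \<le> \<eta>"
  shows "expectation (band i g \<eta>) \<le> real c_max * (2 * \<eta> * Cf)"
proof -
  have *: "integrable M (\<lambda>w. of_bool (\<bar>Y i k w - X i k w \<bullet> g\<bar> \<le> \<eta>) :: real)"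
    "expectation (\<lambda>w. of_bool (\<bar>Y i k w - X i k w \<bullet> g\<bar> \<le> \<eta>)) \<le> 2 * \<eta> * Cf" if "k \<in> {1..c i}" for k
  proof -
    interpret O: density_observation M "X i k" "Y i k" "f i k" B Cf Cd \<epsilon> by (rule observation[OF assms(1) that])
    show "integrable M (\<lambda>w. of_bool (\<bar>Y i k w - X i k w \<bullet> g\<bar> \<le> \<eta>) :: real)"
      by (intro integrable_const_bound[where B=1]) auto
    have "expectation (\<lambda>w. of_bool (\<bar>Y i k w - X i k w \<bullet> g\<bar> \<le> \<eta>)) = expectation (indicator {w\<in>space M. \<bar>Y i k w - X i k w \<bullet> g\<bar> \<le> \<eta>})"
      by (intro Bochner_Integration.integral_cong) (auto simp: indicator_def)
    also have "\<dots> \<le> 2 * \<eta> * Cf" using O.prob_band_le[OF assms(2), of g] by simp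
    finally show "expectation (\<lambda>w. of_bool (\<bar>Y i k w - X i k w \<bullet> g\<bar> \<le> \<eta>)) \<le> 2 * \<eta> * Cf" .
  qed
  have "expectation (band i g \<eta>) = (\<Sum>k=1..c i. expectation (\<lambda>w. of_bool (\<bar>Y i k w - X i k w \<bullet> g\<bar> \<le> \<eta>)))"
    unfolding band_def[abs_def] using * by (intro Bochner_Integration.integral_sum)
  also have "\<dots> \<le> (\<Sum>k=1..c i. 2 * \<eta> * Cf)" using * by (intro sum_mono)
  also have "\<dots> \<le> real c_max * (2 * \<eta> * Cf)"
    using clusters_bounded[OF assms(1)] assms(2) Cf_nonneg by (simp add: mult_right_mono)
  finally show ?thesis .
qed

lemma cscore_integrable: "i \<ge> 1 \<Longrightarrow> t \<in> {0..1} \<Longrightarrow> integrable M (cscore i b t)"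
proof -
  assume a: "i \<ge> 1" "t \<in> {0..1}"
  have "AE w in M. norm (cscore i b t w) \<le> SB"
    using AE_okX[OF a(1)] by eventually_elim (rule norm_cscore_le[OF a(1) _ a(2)])
  then show ?thesis using cscore_measurable[OF a(1)] by (intro integrable_const_bound) auto
qed

text \<open>The expected number of residuals in a band is proportional to its width, so the jumps
  become a Lipschitz bound in the mean.\<close>

lemma cscore_increment_expectation:
  assumes "i \<ge> 1" "t \<in> {0..1}" "t' \<in> {0..1}"
  shows "expectation (\<lambda>w. norm (cscore i b t w - cscore i b' t' w)) \<le> SB * (\<bar>t - t'\<bar> + 2 * R * Cf * norm (b - b'))"
proof -
  have "expectation (\<lambda>w. norm (cscore i b t w - cscore i b' t' w)) \<le> expectation (\<lambda>w. R * (real c_max * \<bar>t - t'\<bar> + band i b' (R * norm (b - b')) w))"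
  proof (rule integral_mono_AE)
    show "AE w in M. norm (cscore i b t w - cscore i b' t' w) \<le> R * (real c_max * \<bar>t - t'\<bar> + band i b' (R * norm (b - b')) w)"
      using AE_okX[OF assms(1)] by eventually_elim (rule cscore_increment[OF assms(1) _ order_refl])
  qed (use assms cscore_integrable band_integrable in auto)
  also have "\<dots> = R * (real c_max * \<bar>t - t'\<bar> + expectation (band i b' (R * norm (b - b'))))"
    using band_integrable[OF assms(1)] by (simp add: prob_space)
  also have "\<dots> \<le> R * (real c_max * \<bar>t - t'\<bar> + real c_max * (2 * (R * norm (b - b')) * Cf))"
    using R_pos assms by (intro mult_left_mono add_mono expectation_band_le) auto
  finally show ?thesis by (simp add: algebra_simps)
qed

abbreviation Sn :: "nat \<Rightarrow> real \<Rightarrow> real \<Rightarrow> real ^ 'd ^ 'd" where "Sn \<equiv> Sigma_mat M c Y X \<beta>"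

lemma outer_prod_sum: "outer_prod (\<Sum>k\<in>K. u k) (\<Sum>l\<in>L. v l) = (\<Sum>k\<in>K. \<Sum>l\<in>L. outer_prod (u k) (v l :: real ^ 'd))"
  by (simp add: outer_prod_def vec_eq_iff sum_product)

lemma outer_cscore_integrable:
  assumes "i \<ge> 1" "t \<in> {0..1}" "t' \<in> {0..1}"
  shows "integrable M (\<lambda>w. outer_prod (cscore i b t w) (cscore i b' t' w))"
proof (rule integrable_const_bound[where B="SB * SB"])
  show "AE w in M. norm (outer_prod (cscore i b t w) (cscore i b' t' w)) \<le> SB * SB"
    using AE_okX[OF assms(1)]
    by eventually_elim (use norm_cscore_le[OF assms(1)] assms SB_ge in \<open>auto simp: norm_outer_prod intro!: mult_mono\<close>)
qed (use assms cscore_measurable in auto)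

text \<open>The double sum over the observations of a cluster is the outer product of two cluster
  scores, so arbitrary dependence within a cluster needs no separate treatment.\<close>

lemma Sn_eq:
  assumes "\<tau> \<in> T" "\<tau>' \<in> T"
  shows "Sn n \<tau> \<tau>' = (1 / real n) *\<^sub>R (\<Sum>i=1..n. expectation (\<lambda>w. outer_prod (cscore i (\<beta> \<tau>) \<tau> w) (cscore i (\<beta> \<tau>') \<tau>' w)))"
  unfolding Sigma_mat_def
proof (intro arg_cong2[where f=scaleR] refl sum.cong)
  fix i assume "i \<in> {1..n}" then have i: "i \<ge> 1" by simp
  have int: "integrable M (\<lambda>w. outer_prod (score i k (\<beta> \<tau>) \<tau> w) (score i l (\<beta> \<tau>') \<tau>' w))"
    if kl: "k \<in> {1..c i}" "l \<in> {1..c i}" for k l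
  proof (rule integrable_const_bound[where B="R * R"])
    show "AE w in M. norm (outer_prod (score i k (\<beta> \<tau>) \<tau> w) (score i l (\<beta> \<tau>') \<tau>' w)) \<le> R * R"
      using AE_okX[OF i]
      by eventually_elim (use norm_score_le T_in_unit assms R_pos kl in \<open>auto simp: norm_outer_prod okX_def intro!: mult_mono\<close>)
  qed (use kl i score_measurable in auto)
  have e: "outer_prod (score i k (\<beta> \<tau>) \<tau> w) (score i l (\<beta> \<tau>') \<tau>' w) =
     (check_score \<tau> (Y i k w - X i k w \<bullet> \<beta> \<tau>) * check_score \<tau>' (Y i l w - X i l w \<bullet> \<beta> \<tau>')) *\<^sub>R outer_prod (X i k w) (X i l w)" for k l w
    by (simp add: score_def outer_prod_def vec_eq_iff)
  show "(\<Sum>k=1..c i. \<Sum>l=1..c i. expectation (\<lambda>w. (check_score \<tau> (Y i k w - X i k w \<bullet> \<beta> \<tau>) *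
            check_score \<tau>' (Y i l w - X i l w \<bullet> \<beta> \<tau>')) *\<^sub>R outer_prod (X i k w) (X i l w)))
    = expectation (\<lambda>w. outer_prod (cscore i (\<beta> \<tau>) \<tau> w) (cscore i (\<beta> \<tau>') \<tau>' w))"
    unfolding cscore_def outer_prod_sum e[symmetric]
    by (subst Bochner_Integration.integral_sum, intro Bochner_Integration.integrable_sum int, assumption+)
       (intro sum.cong refl Bochner_Integration.integral_sum[symmetric] int, assumption+)
qed

text \<open>By bilinearity one factor of the outer product is exchanged at a time, the other one
  being bounded by \<open>SB\<close>. With the Lipschitz bound for \<open>\<beta>\<close> this makes
  \<open>Sn n\<close> equi-Lipschitz in the pair of levels.\<close>

lemma Sn_increment:
  assumes n: "n \<ge> 1" and T: "\<tau> \<in> T" "\<tau>' \<in> T" "\<sigma> \<in> T" "\<sigma>' \<in> T"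
  shows "norm (Sn n \<tau> \<tau>' - Sn n \<sigma> \<sigma>') \<le> SB\<^sup>2 * (\<bar>\<tau> - \<sigma>\<bar> + 2 * R * Cf * norm (\<beta> \<tau> - \<beta> \<sigma>)) + SB\<^sup>2 * (\<bar>\<tau>' - \<sigma>'\<bar> + 2 * R * Cf * norm (\<beta> \<tau>' - \<beta> \<sigma>'))"
    (is "_ \<le> ?C")
proof -
  let ?o = "\<lambda>i t t' w. outer_prod (cscore i (\<beta> t) t w) (cscore i (\<beta> t') t' w)"
  have eq: "Sn n \<tau> \<tau>' - Sn n \<sigma> \<sigma>' = (1 / real n) *\<^sub>R (\<Sum>i=1..n. expectation (?o i \<tau> \<tau>') - expectation (?o i \<sigma> \<sigma>'))"
    unfolding Sn_eq[OF T(1,2)] Sn_eq[OF T(3,4)] by (simp only: scaleR_diff_right sum_subtractf)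
  have "norm ((1 / real n) *\<^sub>R (\<Sum>i=1..n. expectation (?o i \<tau> \<tau>') - expectation (?o i \<sigma> \<sigma>'))) \<le> (1 / real n) * (\<Sum>i=1..n. ?C)"
    unfolding norm_scaleR
  proof (intro mult_mono order_trans[OF norm_sum] sum_mono)
    fix i assume "i \<in> {1..n}" then have i: "i \<ge> 1" by simp
    note oi = outer_cscore_integrable[OF i T_in_unit T_in_unit]
    note ci = cscore_integrable[OF i T_in_unit]
    have s1: "norm (expectation (?o i \<tau> \<tau>') - expectation (?o i \<sigma> \<sigma>')) = norm (expectation (\<lambda>w. ?o i \<tau> \<tau>' w - ?o i \<sigma> \<sigma>' w))"
      using oi T by simp
    have s2: "norm (expectation (\<lambda>w. ?o i \<tau> \<tau>' w - ?o i \<sigma> \<sigma>' w)) \<le> expectation (\<lambda>w. norm (?o i \<tau> \<tau>' w - ?o i \<sigma> \<sigma>' w))" by (rule integral_norm_bound)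
    have s3: "expectation (\<lambda>w. norm (?o i \<tau> \<tau>' w - ?o i \<sigma> \<sigma>' w)) \<le> expectation (\<lambda>w. SB * norm (cscore i (\<beta> \<tau>) \<tau> w - cscore i (\<beta> \<sigma>) \<sigma> w) + SB * norm (cscore i (\<beta> \<tau>') \<tau>' w - cscore i (\<beta> \<sigma>') \<sigma>' w))"
    proof (rule integral_mono_AE)
      show "AE w in M. norm (?o i \<tau> \<tau>' w - ?o i \<sigma> \<sigma>' w)
        \<le> SB * norm (cscore i (\<beta> \<tau>) \<tau> w - cscore i (\<beta> \<sigma>) \<sigma> w) + SB * norm (cscore i (\<beta> \<tau>') \<tau>' w - cscore i (\<beta> \<sigma>') \<sigma>' w)"
        using AE_okX[OF i]
      proof eventually_elim
        case (elim w)
        have eq: "?o i \<tau> \<tau>' w - ?o i \<sigma> \<sigma>' w = outer_prod (cscore i (\<beta> \<tau>) \<tau> w - cscore i (\<beta> \<sigma>) \<sigma> w) (cscore i (\<beta> \<tau>') \<tau>' w)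
          + outer_prod (cscore i (\<beta> \<sigma>) \<sigma> w) (cscore i (\<beta> \<tau>') \<tau>' w - cscore i (\<beta> \<sigma>') \<sigma>' w)"
          by (simp add: outer_prod_diff_left outer_prod_diff_right)
        have "norm (outer_prod (cscore i (\<beta> \<tau>) \<tau> w - cscore i (\<beta> \<sigma>) \<sigma> w) (cscore i (\<beta> \<tau>') \<tau>' w)
          + outer_prod (cscore i (\<beta> \<sigma>) \<sigma> w) (cscore i (\<beta> \<tau>') \<tau>' w - cscore i (\<beta> \<sigma>') \<sigma>' w)) \<le> norm (cscore i (\<beta> \<tau>) \<tau> w - cscore i (\<beta> \<sigma>) \<sigma> w) * SB + SB * norm (cscore i (\<beta> \<tau>') \<tau>' w - cscore i (\<beta> \<sigma>') \<sigma>' w)"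
          using norm_cscore_le[OF i elim] T T_in_unit SB_ge
          by (intro order_trans[OF norm_triangle_ineq] add_mono) (auto simp: norm_outer_prod intro!: mult_mono)
        then show ?case unfolding eq by (simp only: mult.commute)
      qed
    qed (use oi ci T in auto)
    have s4: "expectation (\<lambda>w. SB * norm (cscore i (\<beta> \<tau>) \<tau> w - cscore i (\<beta> \<sigma>) \<sigma> w) + SB * norm (cscore i (\<beta> \<tau>') \<tau>' w - cscore i (\<beta> \<sigma>') \<sigma>' w))
      \<le> SB * (SB * (\<bar>\<tau> - \<sigma>\<bar> + 2 * R * Cf * norm (\<beta> \<tau> - \<beta> \<sigma>))) + SB * (SB * (\<bar>\<tau>' - \<sigma>'\<bar> + 2 * R * Cf * norm (\<beta> \<tau>' - \<beta> \<sigma>')))"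
      using ci T SB_ge cscore_increment_expectation[OF i] T_in_unit
      by (simp add: add_mono mult_left_mono)
    show "norm (expectation (?o i \<tau> \<tau>') - expectation (?o i \<sigma> \<sigma>')) \<le> ?C"
    proof -
      have e: "SB * (SB * x) + SB * (SB * y) = SB\<^sup>2 * x + SB\<^sup>2 * y" for x y by (simp add: power2_eq_square)
      show ?thesis unfolding s1 by (rule order_trans[OF s2 order_trans[OF s3 s4[unfolded e]]])
    qed
  qed (use n in \<open>auto intro!: sum_nonneg\<close>)
  moreover have "(1 / real n) * (\<Sum>i=1..n. ?C) = ?C" using n by simp
  ultimately show ?thesis unfolding eq by (simp only:)
qed

lemma grad_subgradient:
  assumes "t \<in> {0..1}"
  shows "objective c Y X n w b t + grad n b t w \<bullet> (b' - b) \<le> objective c Y X n w b' t"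
proof -
  have "grad n b t w \<bullet> (b' - b) = (1 / real n) * (\<Sum>i=1..n. \<Sum>k=1..c i. - (score i k b t w \<bullet> (b' - b)))"
    by (simp add: grad_def cscore_def inner_sum_left sum_negf)
  also have "(\<Sum>i=1..n. \<Sum>k=1..c i. - (score i k b t w \<bullet> (b' - b)))
    = (\<Sum>i=1..n. \<Sum>k=1..c i. check_score t (Y i k w - X i k w \<bullet> b) * ((Y i k w - X i k w \<bullet> b') - (Y i k w - X i k w \<bullet> b)))"
    by (intro sum.cong refl) (simp add: score_def inner_diff_right algebra_simps)
  finally have "grad n b t w \<bullet> (b' - b) = (1 / real n) * (\<Sum>i=1..n. \<Sum>k=1..c i. check_score t (Y i k w - X i k w \<bullet> b) * ((Y i k w - X i k w \<bullet> b') - (Y i k w - X i k w \<bullet> b)))" .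
  then have "objective c Y X n w b t + grad n b t w \<bullet> (b' - b) = (1 / real n) * (\<Sum>i=1..n. \<Sum>k=1..c i. check_loss t (Y i k w - X i k w \<bullet> b) + check_score t (Y i k w - X i k w \<bullet> b) * ((Y i k w - X i k w \<bullet> b') - (Y i k w - X i k w \<bullet> b)))"
    by (simp only: objective_def sum.distrib distrib_left)
  also have "\<dots> \<le> objective c Y X n w b' t"
    unfolding objective_def by (intro mult_left_mono sum_mono check_loss_subgradient[OF assms]) auto
  finally show ?thesis .
qed

text \<open>Optimality of \<open>a\<close> is combined with the subgradient at \<open>b\<close>, so
  the subgradient is never evaluated at \<open>a\<close>. The linear term \<open>g\<close> is 0 for
  the estimator and the scaled wild gradient for the bootstrap estimator.\<close>

lemma minty_inequality:
  assumes "t \<in> {0..1}" "is_arg_min (\<lambda>b. objective c Y X n w b t + g \<bullet> b) (\<lambda>b. b \<in> B) a" "b \<in> B"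
  shows "0 \<le> (grad n b t w + g) \<bullet> (b - a)"
proof -
  have "objective c Y X n w a t + g \<bullet> a \<le> objective c Y X n w b t + g \<bullet> b"
    using assms(2,3) by (auto simp: is_arg_min_def not_less)
  moreover have "objective c Y X n w b t + grad n b t w \<bullet> (a - b) \<le> objective c Y X n w a t"
    by (rule grad_subgradient[OF assms(1)])
  ultimately show ?thesis by (simp add: inner_add_left inner_diff_right)
qed

end

section \<open>Bootstrap weights\<close>

lemma measurable_data_algebra:
  fixes Y :: "nat \<Rightarrow> nat \<Rightarrow> 'a \<Rightarrow> real" and X :: "nat \<Rightarrow> nat \<Rightarrow> 'a \<Rightarrow> real ^ 'd"
  assumes "i \<in> I" "k \<in> {1..c i}"
  shows "Y i k \<in> borel_measurable (data_algebra M c Y X I)" "X i k \<in> borel_measurable (data_algebra M c Y X I)"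
proof -
  let ?S = "SIGMA i:I. {1..c i}"
  have d: "data_on c Y X I \<in> data_algebra M c Y X I \<rightarrow>\<^sub>M PiM ?S (\<lambda>_. borel)"
    unfolding data_algebra_def
    by (intro measurable_vimage_algebra1) (auto simp: data_on_def space_PiM)
  have "(i, k) \<in> ?S" using assms by auto
  from measurable_compose[OF d measurable_component_singleton[OF this]]
  have p: "(\<lambda>w. (Y i k w, X i k w)) \<in> borel_measurable (data_algebra M c Y X I)"
    using assms by (simp add: data_on_def)
  show "Y i k \<in> borel_measurable (data_algebra M c Y X I)" "X i k \<in> borel_measurable (data_algebra M c Y X I)"
    using measurable_compose[OF p borel_measurable_continuous_onI[OF continuous_on_fst[OF continuous_on_id]]]
      measurable_compose[OF p borel_measurable_continuous_onI[OF continuous_on_snd[OF continuous_on_id]]]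
    by simp_all
qed

lemma space_data_algebra[simp]: "space (data_algebra M c Y X I) = space M"
  by (simp add: data_algebra_def)

lemma space_weight_algebra[simp]: "space (weight_algebra M W) = space M"
  by (simp add: weight_algebra_def)

lemma measurable_cluster_data_algebra:
  fixes Y :: "nat \<Rightarrow> nat \<Rightarrow> 'a \<Rightarrow> real" and X :: "nat \<Rightarrow> nat \<Rightarrow> 'a \<Rightarrow> real ^ 'd"
  assumes "i \<in> I"
  shows "cluster c Y X i \<in> data_algebra M c Y X I \<rightarrow>\<^sub>M PiM {1..c i} (\<lambda>_. borel)"
  unfolding cluster_def[abs_def]
  using measurable_data_algebra[OF assms, where c=c and Y=Y and M=M and X=X]
  by (intro measurable_restrict) (auto simp: borel_prod[symmetric])

lemma measurable_weight_algebra: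
  assumes "i \<ge> 1"
  shows "W i \<in> borel_measurable (weight_algebra M W)"
proof -
  have d: "(\<lambda>w. \<lambda>i\<in>{1..}. W i w) \<in> weight_algebra M W \<rightarrow>\<^sub>M PiM {1..} (\<lambda>_. borel)"
    unfolding weight_algebra_def by (intro measurable_vimage_algebra1) (auto simp: space_PiM)
  have "i \<in> {1..}" using assms by auto
  from measurable_compose[OF d measurable_component_singleton[OF this]]
  show ?thesis using assms by simp
qed

lemma subalgebra_vimage_algebra:
  assumes "f \<in> M \<rightarrow>\<^sub>M N"
  shows "subalgebra M (vimage_algebra (space M) f N)"
proof -
  have "sets (vimage_algebra (space M) f N) = {f -` A \<inter> space M | A. A \<in> sets N}"
    using measurable_space[OF assms] by (intro sets_vimage_algebra2) auto
  then show ?thesis unfolding subalgebra_def using measurable_sets[OF assms] by auto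
qed

context qr_model
begin

lemma subalgebra_data_algebra:
  assumes "I \<subseteq> {1..}"
  shows "subalgebra M (data_algebra M c Y X I)"
  unfolding data_algebra_def
proof (rule subalgebra_vimage_algebra)
  have "(\<lambda>w. (Y i k w, X i k w)) \<in> borel_measurable M" if "i \<in> I" "k \<in> {1..c i}" for i k
    using X_rv[of i k] Y_rv[of i k] that assms by (auto simp: borel_prod[symmetric])
  then show "data_on c Y X I \<in> M \<rightarrow>\<^sub>M PiM (SIGMA i:I. {1..c i}) (\<lambda>_. borel)"
    unfolding data_on_def[abs_def] by (intro measurable_restrict) auto
qed

text \<open>Each coordinate of the data indexed by \<open>I\<close> is measurable with respect to
  the algebra for \<open>J\<close>, hence so is everything that these coordinates generate.\<close>

lemma data_algebra_mono:
  assumes "I \<subseteq> J" "J \<subseteq> {1..}"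
  shows "sets (data_algebra M c Y X I) \<subseteq> sets (data_algebra M c Y X J)"
proof -
  have "(\<lambda>w. (Y i k w, X i k w)) \<in> borel_measurable (data_algebra M c Y X J)" if "i \<in> I" "k \<in> {1..c i}" for i k
    using measurable_data_algebra[of i J k, where c=c and Y=Y and M=M and X=X] that assms by (auto simp: borel_prod[symmetric])
  then have d: "data_on c Y X I \<in> data_algebra M c Y X J \<rightarrow>\<^sub>M PiM (SIGMA i:I. {1..c i}) (\<lambda>_. borel)"
    unfolding data_on_def[abs_def] by (intro measurable_restrict) auto
  have "subalgebra (data_algebra M c Y X J) (data_algebra M c Y X I)"
    using subalgebra_vimage_algebra[OF d] unfolding data_algebra_def[of M c Y X I] by simp
  then show ?thesis by (simp add: subalgebra_def)
qed

text \<open>\<open>cscore\<close> as a function of the cluster alone, the form in which independence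
  and measurability of the clusters pass to the scores.\<close>

definition zscore :: "nat \<Rightarrow> real ^ 'd \<Rightarrow> real \<Rightarrow> (nat \<Rightarrow> real \<times> (real ^ 'd)) \<Rightarrow> real ^ 'd" where
  "zscore i b t z = (\<Sum>k=1..c i. check_score t (fst (z k) - snd (z k) \<bullet> b) *\<^sub>R snd (z k))"

definition zband :: "nat \<Rightarrow> real ^ 'd \<Rightarrow> real \<Rightarrow> (nat \<Rightarrow> real \<times> (real ^ 'd)) \<Rightarrow> real" where
  "zband i g \<eta> z = (\<Sum>k=1..c i. of_bool (\<bar>fst (z k) - snd (z k) \<bullet> g\<bar> \<le> \<eta>))"

lemma measurable_coordinates:
  assumes "k \<in> {1..c i}"
  shows "(\<lambda>z. fst (z k)) \<in> borel_measurable (PiM {1..c i} (\<lambda>_. borel :: (real \<times> (real ^ 'd)) measure))"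
    "(\<lambda>z. snd (z k)) \<in> borel_measurable (PiM {1..c i} (\<lambda>_. borel :: (real \<times> (real ^ 'd)) measure))"
  using measurable_compose[OF measurable_component_singleton[OF assms] borel_measurable_continuous_onI[OF continuous_on_fst[OF continuous_on_id]]]
    measurable_compose[OF measurable_component_singleton[OF assms] borel_measurable_continuous_onI[OF continuous_on_snd[OF continuous_on_id]]]
  by simp_all

lemma zscore_measurable[measurable]: "zscore i b t \<in> borel_measurable (PiM {1..c i} (\<lambda>_. borel))"
  unfolding zscore_def[abs_def]
proof (rule borel_measurable_sum)
  fix k assume "k \<in> {1..c i}"
  note [measurable] = measurable_coordinates[OF this]
  show "(\<lambda>z. check_score t (fst (z k) - snd (z k) \<bullet> b) *\<^sub>R snd (z k)) \<in> borel_measurable (PiM {1..c i} (\<lambda>_. borel))"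
    unfolding check_score_def by measurable
qed

lemma zband_measurable[measurable]: "zband i b \<eta> \<in> borel_measurable (PiM {1..c i} (\<lambda>_. borel))"
  unfolding zband_def[abs_def]
proof (rule borel_measurable_sum)
  fix k assume "k \<in> {1..c i}"
  note [measurable] = measurable_coordinates[OF this]
  show "(\<lambda>z. of_bool (\<bar>fst (z k) - snd (z k) \<bullet> b\<bar> \<le> \<eta>) :: real) \<in> borel_measurable (PiM {1..c i} (\<lambda>_. borel))"
    by measurable
qed

lemma cscore_cluster: "cscore i b t w = zscore i b t (cluster c Y X i w)"
  and band_cluster: "band i g \<eta> w = zband i g \<eta> (cluster c Y X i w)"
  by (auto simp: cscore_def score_def zscore_def band_def zband_def cluster_def intro!: sum.cong)

lemma cscore_data_measurable: "i \<in> I \<Longrightarrow> cscore i b t \<in> borel_measurable (data_algebra M c Y X I)"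
  and band_data_measurable: "i \<in> I \<Longrightarrow> band i g \<eta> \<in> borel_measurable (data_algebra M c Y X I)"
proof -
  assume i: "i \<in> I"
  note cl = measurable_cluster_data_algebra[OF i, where c=c and Y=Y and M=M and X=X]
  show "cscore i b t \<in> borel_measurable (data_algebra M c Y X I)" "band i g \<eta> \<in> borel_measurable (data_algebra M c Y X I)"
    unfolding cscore_cluster[abs_def] band_cluster[abs_def]
    by (rule measurable_compose[OF cl zscore_measurable] measurable_compose[OF cl zband_measurable])+
qed

end

locale wild_model = qr_model M c c_max Y X f T B \<beta> R Cf Cd \<epsilon> lam
  for M :: "'a measure"
    and c :: "nat \<Rightarrow> nat" and c_max :: nat
    and Y :: "nat \<Rightarrow> nat \<Rightarrow> 'a \<Rightarrow> real"
    and X :: "nat \<Rightarrow> nat \<Rightarrow> 'a \<Rightarrow> real ^ 'd"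
    and f :: "nat \<Rightarrow> nat \<Rightarrow> real \<Rightarrow> real ^ 'd \<Rightarrow> real"
    and T :: "real set" and B :: "(real ^ 'd) set"
    and \<beta> :: "real \<Rightarrow> real ^ 'd"
    and R Cf Cd \<epsilon> lam :: real +
  fixes W :: "nat \<Rightarrow> 'a \<Rightarrow> real" and q r :: real
  assumes q: "q > 2"
    and W_indep: "indep_vars (\<lambda>_. borel) W {1..}"
    and W_ident: "\<And>i. i \<ge> 1 \<Longrightarrow> distr M borel (W i) = distr M borel (W 1)"
    and W_indep_data: "indep_set (sets (data_algebra M c Y X {1..})) (sets (weight_algebra M W))"
    and W_mean: "expectation (W 1) = 0"
    and W_var: "expectation (\<lambda>w. (W 1 w)\<^sup>2) = 1"
    and W_moment: "integrable M (\<lambda>w. \<bar>W 1 w\<bar> powr q)"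
    and r_pos: "r > 0" and beta_ball: "\<And>\<tau>. \<tau> \<in> T \<Longrightarrow> cball (\<beta> \<tau>) r \<subseteq> B"
begin

lemma W_measurable[measurable]: "i \<ge> 1 \<Longrightarrow> W i \<in> borel_measurable M"
  using W_indep by (auto simp: indep_vars_def)

lemma W_transfer:
  fixes g :: "real \<Rightarrow> real"
  assumes "i \<ge> 1" "g \<in> borel_measurable borel"
  shows "expectation (\<lambda>w. g (W i w)) = expectation (\<lambda>w. g (W 1 w))"
    "integrable M (\<lambda>w. g (W i w)) \<longleftrightarrow> integrable M (\<lambda>w. g (W 1 w))"
  using integral_distr[OF W_measurable[OF assms(1)] assms(2)] integral_distr[OF W_measurable[of 1] assms(2)]
    integrable_distr_eq[OF W_measurable[OF assms(1)] assms(2)] integrable_distr_eq[OF W_measurable[of 1] assms(2)] W_ident[OF assms(1)]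
  by simp_all

lemma cluster_weight_indep:
  "indep_vars (\<lambda>i. PiM {1..c i} (\<lambda>_. borel) \<Otimes>\<^sub>M borel) (\<lambda>i w. (cluster c Y X i w, W i w)) {1..}"
proof (rule indep_vars_Pair[OF clusters_indep W_indep W_indep_data])
  fix S assume S: "S \<in> sigma_sets (space M) (\<Union>i\<in>{1..}. {cluster c Y X i -` S \<inter> space M | S. S \<in> sets (PiM {1..c i} (\<lambda>_. borel))})"
  have "(\<Union>i\<in>{1..}. {cluster c Y X i -` S \<inter> space M | S. S \<in> sets (PiM {1..c i} (\<lambda>_. borel))}) \<subseteq> sets (data_algebra M c Y X {1..})"
    using measurable_sets[OF measurable_cluster_data_algebra[of _ "{1..}", where c=c and Y=Y and M=M and X=X]] by auto
  from sets.sigma_sets_subset[OF this] S show "S \<in> sets (data_algebra M c Y X {1..})" by auto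
next
  fix S assume S: "S \<in> sigma_sets (space M) (\<Union>i\<in>{1..}. {W i -` S \<inter> space M | S. S \<in> sets borel})"
  have "(\<Union>i\<in>{1..}. {W i -` S \<inter> space M | S. S \<in> sets borel}) \<subseteq> sets (weight_algebra M W)"
    using measurable_sets[OF measurable_weight_algebra[of _ W M]] by auto
  from sets.sigma_sets_subset[OF this] S show "S \<in> sets (weight_algebra M W)" by auto
qed

lemma expectation_weight_data:
  fixes u v :: "'a \<Rightarrow> real"
  assumes u: "u \<in> borel_measurable (weight_algebra M W)" "integrable M u"
    and v: "v \<in> borel_measurable (data_algebra M c Y X {1..})" "integrable M v"
  shows "expectation (\<lambda>w. u w * v w) = expectation u * expectation v" "integrable M (\<lambda>w. u w * v w)"
proof -
  have uM: "u \<in> borel_measurable M" and vM: "v \<in> borel_measurable M" using u v by auto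
  have pu: "u -` S \<inter> space M \<in> sets (weight_algebra M W)" if "S \<in> sets borel" for S
    using measurable_sets[OF u(1) that] by simp
  have pv: "v -` S \<inter> space M \<in> sets (data_algebra M c Y X {1..})" if "S \<in> sets borel" for S
    using measurable_sets[OF v(1) that] by simp
  have "indep_set {v -` S \<inter> space M | S. S \<in> sets borel} {u -` S \<inter> space M | S. S \<in> sets borel}"
    using pu pv uM vM by (intro indep_setI) (auto intro!: indep_setD[OF W_indep_data])
  then have "indep_set (sigma_sets (space M) {v -` S \<inter> space M | S. S \<in> sets borel}) (sigma_sets (space M) {u -` S \<inter> space M | S. S \<in> sets borel})"
  proof (rule indep_set_sigma_sets)
    show "Int_stable {v -` S \<inter> space M | S. S \<in> sets borel}"
      unfolding Int_stable_def by (smt (verit, best) Int_assoc Int_left_commute inf.idem mem_Collect_eq sets.Int vimage_Int)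
    show "Int_stable {u -` S \<inter> space M | S. S \<in> sets borel}"
      unfolding Int_stable_def by (smt (verit, best) Int_assoc Int_left_commute inf.idem mem_Collect_eq sets.Int vimage_Int)
  qed
  then have i: "indep_var borel v borel u" unfolding indep_var_eq using uM vM by auto
  show "expectation (\<lambda>w. u w * v w) = expectation u * expectation v"
    using indep_var_lebesgue_integral[OF i v(2) u(2)] by (simp add: mult.commute)
  show "integrable M (\<lambda>w. u w * v w)"
    using indep_var_integrable[OF i v(2) u(2)] by (simp add: mult.commute)
qed

lemma W_integrable: "i \<ge> 1 \<Longrightarrow> integrable M (W i)" "i \<ge> 1 \<Longrightarrow> integrable M (\<lambda>w. (W i w)\<^sup>2)"
proof -
  \<comment> \<open>If the square were not integrable, its integral would be 0 and not 1.\<close>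
  have "integrable M (\<lambda>w. (W 1 w)\<^sup>2)"
    using W_var not_integrable_integral_eq by fastforce
  then show *: "i \<ge> 1 \<Longrightarrow> integrable M (\<lambda>w. (W i w)\<^sup>2)"
    using W_transfer(2)[of i "\<lambda>x. x\<^sup>2"] by simp
  assume i: "i \<ge> 1"
  show "integrable M (W i)"
  proof (rule Bochner_Integration.integrable_bound)
    show "integrable M (\<lambda>w. 1 + (W i w)\<^sup>2)" using *[OF i] by simp
    have "\<bar>x\<bar> \<le> \<bar>1 + x\<^sup>2\<bar>" for x :: real
      using zero_le_power2[of "\<bar>x\<bar> - 1"] by (simp add: power2_eq_square algebra_simps)
    then show "AE w in M. norm (W i w) \<le> norm (1 + (W i w)\<^sup>2)" by simp
  qed (use i in simp)
qed

section \<open>Truncated and recentred weights\<close>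

definition tmean :: "real \<Rightarrow> real" where
  "tmean m = expectation (\<lambda>w. if \<bar>W 1 w\<bar> \<le> m then W 1 w else 0)"

text \<open>Recentring restores mean 0 after truncation, so that sums weighted with independent data
  stay centred. It at most doubles the bound \<open>m\<close>.\<close>

definition trunc :: "real \<Rightarrow> real \<Rightarrow> real" where
  "trunc m x = (if \<bar>x\<bar> \<le> m then x else 0) - tmean m"

lemma trunc_measurable[measurable]: "trunc m \<in> borel_measurable borel"
  unfolding trunc_def[abs_def] by measurable

lemma trunc_bound: "0 \<le> m \<Longrightarrow> \<bar>trunc m x\<bar> \<le> 2 * m"
proof -
  assume m: "0 \<le> m"
  have "\<bar>tmean m\<bar> \<le> m" unfolding tmean_def by (rule abs_expectation_le) (use m in auto)
  then show ?thesis using m by (auto simp: trunc_def)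
qed

lemma trunc_integrable: "i \<ge> 1 \<Longrightarrow> 0 \<le> m \<Longrightarrow> integrable M (\<lambda>w. trunc m (W i w))"
    "i \<ge> 1 \<Longrightarrow> 0 \<le> m \<Longrightarrow> integrable M (\<lambda>w. (trunc m (W i w))\<^sup>2)"
proof -
  assume i: "i \<ge> 1" and m: "0 \<le> m"
  have [measurable]: "W i \<in> borel_measurable M" using i by simp
  show "integrable M (\<lambda>w. trunc m (W i w))"
    using trunc_bound[OF m] by (intro integrable_const_bound[where B="2 * m"]) auto
  show "integrable M (\<lambda>w. (trunc m (W i w))\<^sup>2)"
  proof (intro integrable_const_bound[where B="(2 * m)\<^sup>2"] AE_I2)
    show "norm ((trunc m (W i w))\<^sup>2) \<le> (2 * m)\<^sup>2" for w
      using power_mono[OF trunc_bound[OF m] abs_ge_zero, of "W i w" 2] by simp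
  qed auto
qed

lemma trunc_mean: "i \<ge> 1 \<Longrightarrow> 0 \<le> m \<Longrightarrow> expectation (\<lambda>w. trunc m (W i w)) = 0"
proof -
  assume i: "i \<ge> 1" and m: "0 \<le> m"
  have [measurable]: "W 1 \<in> borel_measurable M" by simp
  have "integrable M (\<lambda>w. if \<bar>W 1 w\<bar> \<le> m then W 1 w else 0)"
    by (intro integrable_const_bound[where B=m]) (use m in auto)
  then show ?thesis
    using W_transfer(1)[OF i trunc_measurable] by (simp add: trunc_def tmean_def prob_space del: One_nat_def)
qed

text \<open>Recentring at the mean only lowers a second moment, and so does truncation, which leaves
  the variance 1 of the weights as a bound for every \<open>m\<close>.\<close>

lemma trunc_second_moment: "i \<ge> 1 \<Longrightarrow> 0 \<le> m \<Longrightarrow> expectation (\<lambda>w. (trunc m (W i w))\<^sup>2) \<le> 1"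
proof -
  assume i: "i \<ge> 1" and m: "0 \<le> m"
  have [measurable]: "W 1 \<in> borel_measurable M" by simp
  let ?U = "\<lambda>w. if \<bar>W 1 w\<bar> \<le> m then W 1 w else 0"
  have i1: "integrable M ?U" by (intro integrable_const_bound[where B=m]) (use m in auto)
  have i2: "integrable M (\<lambda>w. (?U w)\<^sup>2)"
    by (rule Bochner_Integration.integrable_bound[OF W_integrable(2)[of 1]]) auto
  have "expectation (\<lambda>w. (trunc m (W i w))\<^sup>2) = expectation (\<lambda>w. (trunc m (W 1 w))\<^sup>2)"
    by (rule W_transfer(1)[OF i]) measurable
  also have "\<dots> = expectation (\<lambda>w. (?U w)\<^sup>2 - 2 * tmean m * ?U w + (tmean m)\<^sup>2)"
    by (intro Bochner_Integration.integral_cong refl) (simp add: trunc_def power2_eq_square algebra_simps)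
  also have "\<dots> = expectation (\<lambda>w. (?U w)\<^sup>2) - (tmean m)\<^sup>2"
    using i1 i2 by (simp add: prob_space tmean_def power2_eq_square)
  also have "\<dots> \<le> expectation (\<lambda>w. (?U w)\<^sup>2)" by simp
  also have "\<dots> \<le> expectation (\<lambda>w. (W 1 w)\<^sup>2)"
    by (intro integral_mono i2 W_integrable(2)) auto
  finally show ?thesis by (simp only: W_var)
qed

text \<open>The summands are functions \<open>h j i\<close> of a cluster together with its weight,
  so that one inequality serves sums with and without weights. Centring doubles the sup bound to
  \<open>2 * C\<close> and does not increase second moments.\<close>

lemma deviation_bound:
  fixes h :: "'j \<Rightarrow> nat \<Rightarrow> (nat \<Rightarrow> real \<times> (real ^ 'd)) \<times> real \<Rightarrow> real"
  defines "\<zeta> \<equiv> \<lambda>j i w. h j i (cluster c Y X i w, W i w)"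
  assumes J: "finite J"
    and meas: "\<And>j i. j \<in> J \<Longrightarrow> i \<in> {1..n} \<Longrightarrow> h j i \<in> borel_measurable (PiM {1..c i} (\<lambda>_. borel) \<Otimes>\<^sub>M borel)"
    and bound: "\<And>j i. j \<in> J \<Longrightarrow> i \<in> {1..n} \<Longrightarrow> AE w in M. \<bar>\<zeta> j i w\<bar> \<le> C" "0 \<le> C"
    and var: "\<And>j. j \<in> J \<Longrightarrow> (\<Sum>i=1..n. expectation (\<lambda>w. (\<zeta> j i w)\<^sup>2)) \<le> V"
    and l: "0 \<le> l" "l * (2 * C) \<le> 1"
  shows "prob {w\<in>space M. \<exists>j\<in>J. t < \<bar>\<Sum>i=1..n. \<zeta> j i w - expectation (\<zeta> j i)\<bar>} \<le> 2 * card J * exp (l\<^sup>2 * V - l * t)"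
proof (rule bernstein_union_bound[OF J])
  have zm[measurable]: "\<zeta> j i \<in> borel_measurable M" if "j \<in> J" "i \<in> {1..n}" for j i
  proof -
    have "(\<lambda>w. (cluster c Y X i w, W i w)) \<in> M \<rightarrow>\<^sub>M PiM {1..c i} (\<lambda>_. borel) \<Otimes>\<^sub>M borel"
      using cluster_weight_indep that unfolding indep_vars_def by auto
    from measurable_compose[OF this meas[OF that]] show ?thesis by (simp add: \<zeta>_def)
  qed
  have int: "integrable M (\<zeta> j i)" if "j \<in> J" "i \<in> {1..n}" for j i
    using bound(1)[OF that] zm[OF that] by (intro integrable_const_bound[where B=C]) auto
  have int2: "integrable M (\<lambda>w. (\<zeta> j i w)\<^sup>2)" if "j \<in> J" "i \<in> {1..n}" for j i
  proof (rule integrable_const_bound[where B="C\<^sup>2"])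
    show "AE w in M. norm ((\<zeta> j i w)\<^sup>2) \<le> C\<^sup>2"
      using bound(1)[OF that]
    proof eventually_elim
      case (elim w)
      then show ?case using power_mono[OF elim abs_ge_zero, of 2] by simp
    qed
  qed (use zm[OF that] in auto)
  fix j assume j: "j \<in> J"
  have "indep_vars (\<lambda>i. PiM {1..c i} (\<lambda>_. borel) \<Otimes>\<^sub>M borel) (\<lambda>i w. (cluster c Y X i w, W i w)) {1..n}"
    by (rule indep_vars_subset[OF cluster_weight_indep]) auto
  from indep_vars_compose2[OF this, where N="\<lambda>_. borel" and Y="\<lambda>i z. h j i z - expectation (\<zeta> j i)"]
  show "indep_vars (\<lambda>_. borel) (\<lambda>i w. \<zeta> j i w - expectation (\<zeta> j i)) {1..n}"
    using meas[OF j] by (simp add: \<zeta>_def)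
  show "(\<Sum>i=1..n. expectation (\<lambda>w. (\<zeta> j i w - expectation (\<zeta> j i))\<^sup>2)) \<le> V"
  proof (rule order_trans[OF sum_mono var[OF j]])
    fix i assume i: "i \<in> {1..n}"
    have "expectation (\<lambda>w. (\<zeta> j i w - expectation (\<zeta> j i))\<^sup>2) = expectation (\<lambda>w. (\<zeta> j i w)\<^sup>2) - (expectation (\<zeta> j i))\<^sup>2"
      using variance_eq[OF int[OF j i] int2[OF j i]] .
    then show "expectation (\<lambda>w. (\<zeta> j i w - expectation (\<zeta> j i))\<^sup>2) \<le> expectation (\<lambda>w. (\<zeta> j i w)\<^sup>2)" by simp
  qed
  fix i assume i: "i \<in> {1..n}"
  have "\<bar>expectation (\<zeta> j i)\<bar> \<le> C" by (rule abs_expectation_le[OF bound(1)[OF j i] bound(2)])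
  then show "AE w in M. \<bar>\<zeta> j i w - expectation (\<zeta> j i)\<bar> \<le> 2 * C"
    using bound(1)[OF j i] by (auto elim!: eventually_mono)
  show "expectation (\<lambda>w. \<zeta> j i w - expectation (\<zeta> j i)) = 0"
    using int[OF j i] by (simp add: prob_space)
qed (use l in auto)

end

section \<open>Uniform deviation bounds\<close>

locale wild_grid = wild_model M c c_max Y X f T B \<beta> R Cf Cd \<epsilon> lam W q r
  for M :: "'a measure"
    and c :: "nat \<Rightarrow> nat" and c_max :: nat
    and Y :: "nat \<Rightarrow> nat \<Rightarrow> 'a \<Rightarrow> real"
    and X :: "nat \<Rightarrow> nat \<Rightarrow> 'a \<Rightarrow> real ^ 'd"
    and f :: "nat \<Rightarrow> nat \<Rightarrow> real \<Rightarrow> real ^ 'd \<Rightarrow> real"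
    and T :: "real set" and B :: "(real ^ 'd) set"
    and \<beta> :: "real \<Rightarrow> real ^ 'd"
    and R Cf Cd \<epsilon> lam :: real
    and W :: "nat \<Rightarrow> 'a \<Rightarrow> real" and q r :: real +
  fixes G :: "nat \<Rightarrow> (real ^ 'd) set" and Cg :: real and pg :: nat
  assumes G_finite: "\<And>n. n \<ge> 1 \<Longrightarrow> finite (G n)"
    and G_card: "\<And>n. n \<ge> 1 \<Longrightarrow> real (card (G n)) \<le> Cg * real n ^ pg"
    and G_net: "\<And>n b. n \<ge> 1 \<Longrightarrow> b \<in> B \<Longrightarrow> \<exists>g\<in>G n. norm (b - g) \<le> 1 / real n"
begin

text \<open>
  The weights are truncated at \<open>n powr gam\<close>: \<open>gam > 1 / (2 * q - 2)\<close> makes the discarded tails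
  negligible, \<open>gam < 1 / 2\<close> keeps Bernstein's inequality effective; \<open>sx\<close> is the resulting slack.
\<close>

definition gam :: real where "gam = (1 / (2 * q - 2) + 1 / 2) / 2"

definition sx :: real where "sx = min (1 / 16) ((1 / 2 - gam) / 4)"

lemma gam_bounds: "1 / (2 * q - 2) < gam" "gam < 1 / 2" "0 < gam"
proof -
  define x where "x = 1 / (2 * q - 2)"
  have "0 < x" "x < 1 / 2" using q by (auto simp: x_def field_simps)
  then show "1 / (2 * q - 2) < gam" "gam < 1 / 2" "0 < gam" unfolding gam_def x_def[symmetric] by simp_all
qed

lemma sx_bounds: "0 < sx" "sx \<le> 1 / 16" "gam - 1 / 2 + 4 * sx \<le> 0"
proof -
  show "0 < sx" "sx \<le> 1 / 16" using gam_bounds by (auto simp: sx_def)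
  have "sx \<le> (1 / 2 - gam) / 4" unfolding sx_def by (rule min.cobounded2)
  then have "4 * sx \<le> 4 * ((1 / 2 - gam) / 4)" by (rule mult_left_mono) simp
  then show "gam - 1 / 2 + 4 * sx \<le> 0" by simp
qed

text \<open>A grid of the whole interval [0, 1], independent of the shape of \<open>T\<close>; the
  scores are bounded by \<open>SB\<close> at all these levels.\<close>

definition TG :: "nat \<Rightarrow> real set" where "TG n = (\<lambda>j. real j / real n) ` {0..n}"

lemma TG_finite: "finite (TG n)" by (simp add: TG_def)

lemma TG_card: "n \<ge> 1 \<Longrightarrow> real (card (TG n)) \<le> 2 * real n"
proof -
  assume "n \<ge> 1"
  have "card (TG n) \<le> card {0..n}" unfolding TG_def by (rule card_image_le) simp
  then have "card (TG n) \<le> n + 1" by simp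
  with \<open>n \<ge> 1\<close> show ?thesis by simp
qed

lemma TG_unit: "n \<ge> 1 \<Longrightarrow> u \<in> TG n \<Longrightarrow> u \<in> {0..1}"
  by (auto simp: TG_def field_simps)

lemma TG_net: "n \<ge> 1 \<Longrightarrow> t \<in> {0..1} \<Longrightarrow> \<exists>u\<in>TG n. \<bar>t - u\<bar> \<le> 1 / real n"
proof -
  assume n: "n \<ge> 1" and t: "t \<in> {0..1}"
  define j where "j = nat \<lfloor>t * real n\<rfloor>"
  have tn: "0 \<le> t * real n" "t * real n \<le> real n" using t n by (auto simp: mult_left_le_one_le)
  then have "real j = of_int \<lfloor>t * real n\<rfloor>" unfolding j_def by simp
  then have j: "real j \<le> t * real n" "t * real n < real j + 1" by linarith+
  then have "real j \<le> real n" using tn by linarith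
  then have "j \<le> n" by simp
  moreover have "\<bar>t - real j / real n\<bar> \<le> 1 / real n"
  proof -
    have "t - real j / real n = (t * real n - real j) / real n" using n by (simp add: field_simps)
    then show ?thesis using j n by (simp add: divide_right_mono)
  qed
  ultimately show ?thesis by (auto simp: TG_def)
qed

text \<open>Decay faster than every power of \<open>n\<close>, in a form closed under sums: the same
  \<open>K\<close> serves as a factor and in the exponent, so two bounds merge by adding their
  constants and powers.\<close>

definition superpoly :: "(nat \<Rightarrow> real) \<Rightarrow> bool" where
  "superpoly a \<longleftrightarrow> (\<exists>K p. K \<ge> 0 \<and> (\<forall>\<^sub>F n in sequentially. a n \<le> K * real n ^ p * exp (K - real n powr sx)))"

lemma superpoly_add:
  assumes "superpoly a" "superpoly b"
  shows "superpoly (\<lambda>n. a n + b n)"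
proof -
  obtain K p where K: "K \<ge> 0" "\<forall>\<^sub>F n in sequentially. a n \<le> K * real n ^ p * exp (K - real n powr sx)"
    using assms(1) by (auto simp: superpoly_def)
  obtain L o' where L: "L \<ge> 0" "\<forall>\<^sub>F n in sequentially. b n \<le> L * real n ^ o' * exp (L - real n powr sx)"
    using assms(2) by (auto simp: superpoly_def)
  have "\<forall>\<^sub>F n in sequentially. a n + b n \<le> (K + L) * real n ^ (p + o') * exp (K + L - real n powr sx)"
    using K(2) L(2) eventually_ge_at_top[of 1]
  proof eventually_elim
    case (elim n)
    have p: "real n ^ p \<le> real n ^ (p + o')" "real n ^ o' \<le> real n ^ (p + o')"
      using elim(3) by (auto intro!: power_increasing)
    have "a n + b n \<le> K * real n ^ p * exp (K - real n powr sx) + L * real n ^ o' * exp (L - real n powr sx)"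
      using elim by simp
    also have "\<dots> \<le> K * real n ^ (p + o') * exp (K + L - real n powr sx) + L * real n ^ (p + o') * exp (K + L - real n powr sx)"
      using K L p by (intro add_mono mult_mono) auto
    finally show ?case by (simp add: algebra_simps)
  qed
  then show ?thesis unfolding superpoly_def using K L by (intro exI[of _ "K + L"] exI[of _ "p + o'"]) auto
qed

lemma superpoly_mono: "superpoly b \<Longrightarrow> (\<forall>\<^sub>F n in sequentially. a n \<le> b n) \<Longrightarrow> superpoly a"
proof -
  assume "superpoly b" and ab: "\<forall>\<^sub>F n in sequentially. a n \<le> b n"
  then obtain K p where K: "K \<ge> 0" "\<forall>\<^sub>F n in sequentially. b n \<le> K * real n ^ p * exp (K - real n powr sx)"
    by (auto simp: superpoly_def)
  from ab K(2) have "\<forall>\<^sub>F n in sequentially. a n \<le> K * real n ^ p * exp (K - real n powr sx)"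
    by eventually_elim linarith
  then show "superpoly a" unfolding superpoly_def using K(1) by blast
qed

text \<open>The factor \<open>n\<^sup>2\<close> is the cost of the crude bound of order
  \<open>n\<close> off \<open>weight_good\<close> once the remainder is squared.\<close>

lemma superpoly_limit:
  assumes "superpoly a" "\<And>n. 0 \<le> a n"
  shows "(\<lambda>n. (real n)\<^sup>2 * a n) \<longlonglongrightarrow> 0" "a \<longlonglongrightarrow> 0"
proof -
  obtain K p where K: "K \<ge> 0" "\<forall>\<^sub>F n in sequentially. a n \<le> K * real n ^ p * exp (K - real n powr sx)"
    using assms(1) by (auto simp: superpoly_def)
  have s: "sx > 0" by (rule sx_bounds)
  have lim: "(\<lambda>n. (real n)\<^sup>2 * (K * real n ^ p * exp (K - real n powr sx))) \<longlonglongrightarrow> 0"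
    using s by real_asymp
  show 1: "(\<lambda>n. (real n)\<^sup>2 * a n) \<longlonglongrightarrow> 0"
  proof (rule tendsto_sandwich[OF _ _ tendsto_const lim])
    show "\<forall>\<^sub>F n in sequentially. 0 \<le> (real n)\<^sup>2 * a n" using assms(2) by simp
    show "\<forall>\<^sub>F n in sequentially. (real n)\<^sup>2 * a n \<le> (real n)\<^sup>2 * (K * real n ^ p * exp (K - real n powr sx))"
      using K(2) by eventually_elim (auto intro: mult_left_mono)
  qed
  show "a \<longlonglongrightarrow> 0"
  proof (rule tendsto_sandwich[OF _ _ tendsto_const 1])
    show "\<forall>\<^sub>F n in sequentially. 0 \<le> a n" using assms(2) by simp
    show "\<forall>\<^sub>F n in sequentially. a n \<le> (real n)\<^sup>2 * a n"
      using eventually_ge_at_top[of 1]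
    proof eventually_elim
      case (elim n)
      then have "1 * a n \<le> (real n)\<^sup>2 * a n" using assms(2) by (intro mult_right_mono) (auto simp: power2_eq_square mult_ge1_I)
      then show ?case by simp
    qed
  qed
qed

text \<open>Bernstein's inequality over index sets of polynomial cardinality. The eventual
  conditions on \<open>l\<close> are, in this order: validity of the quadratic bound on the
  exponential, boundedness of the variance term, and an exponent of at least
  \<open>n powr sx\<close>.\<close>

lemma superpoly_deviation:
  fixes h :: "nat \<Rightarrow> 'j \<Rightarrow> nat \<Rightarrow> (nat \<Rightarrow> real \<times> (real ^ 'd)) \<times> real \<Rightarrow> real"
  defines "\<zeta> \<equiv> \<lambda>n j i w. h n j i (cluster c Y X i w, W i w)"
  assumes J: "\<And>n. n \<ge> 1 \<Longrightarrow> finite (J n)" "\<And>n. n \<ge> 1 \<Longrightarrow> real (card (J n)) \<le> A * real n ^ a" "A \<ge> 0"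
    and meas: "\<And>n j i. n \<ge> 1 \<Longrightarrow> j \<in> J n \<Longrightarrow> i \<in> {1..n} \<Longrightarrow> h n j i \<in> borel_measurable (PiM {1..c i} (\<lambda>_. borel) \<Otimes>\<^sub>M borel)"
    and bound: "\<And>n j i. n \<ge> 1 \<Longrightarrow> j \<in> J n \<Longrightarrow> i \<in> {1..n} \<Longrightarrow> AE w in M. \<bar>\<zeta> n j i w\<bar> \<le> C n" "\<And>n. 0 \<le> C n"
    and var: "\<And>n j i. n \<ge> 1 \<Longrightarrow> j \<in> J n \<Longrightarrow> i \<in> {1..n} \<Longrightarrow> expectation (\<lambda>w. (\<zeta> n j i w)\<^sup>2) \<le> V n"
    and l: "\<And>n. 0 \<le> l n" "\<forall>\<^sub>F n in sequentially. l n * (2 * C n) \<le> 1"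
      "\<forall>\<^sub>F n in sequentially. (l n)\<^sup>2 * (real n * V n) \<le> K" "\<forall>\<^sub>F n in sequentially. real n powr sx \<le> l n * t n"
  shows "superpoly (\<lambda>n. prob {w\<in>space M. \<exists>j\<in>J n. t n < \<bar>\<Sum>i=1..n. \<zeta> n j i w - expectation (\<zeta> n j i)\<bar>})"
proof -
  define L where "L = max K (2 * A)"
  have "\<forall>\<^sub>F n in sequentially. prob {w\<in>space M. \<exists>j\<in>J n. t n < \<bar>\<Sum>i=1..n. \<zeta> n j i w - expectation (\<zeta> n j i)\<bar>}
      \<le> L * real n ^ a * exp (L - real n powr sx)"
    using l(2,3,4) eventually_ge_at_top[of 1]
  proof eventually_elim
    case (elim n)
    have v: "(\<Sum>i=1..n. expectation (\<lambda>w. (\<zeta> n j i w)\<^sup>2)) \<le> real n * V n" if "j \<in> J n" for j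
    proof -
      have "(\<Sum>i=1..n. expectation (\<lambda>w. (\<zeta> n j i w)\<^sup>2)) \<le> (\<Sum>i=1..n. V n)"
        by (intro sum_mono var elim(4) that)
      then show ?thesis by simp
    qed
    have "prob {w\<in>space M. \<exists>j\<in>J n. t n < \<bar>\<Sum>i=1..n. \<zeta> n j i w - expectation (\<zeta> n j i)\<bar>}
       \<le> 2 * card (J n) * exp ((l n)\<^sup>2 * (real n * V n) - l n * t n)"
      unfolding \<zeta>_def
      by (rule deviation_bound[OF J(1)[OF elim(4)] meas[OF elim(4)] bound(1)[OF elim(4), unfolded \<zeta>_def] bound(2) v[unfolded \<zeta>_def] l(1) elim(1)])
    also have "\<dots> \<le> (2 * (A * real n ^ a)) * exp (K - real n powr sx)"
      using J(2)[OF elim(4)] J(3) elim by (intro mult_mono) auto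
    also have "\<dots> \<le> (L * real n ^ a) * exp (L - real n powr sx)"
    proof -
      have "2 * (A * real n ^ a) = (2 * A) * real n ^ a" by simp
      also have "\<dots> \<le> L * real n ^ a" by (intro mult_right_mono) (auto simp: L_def)
      finally show ?thesis
        by (rule mult_mono) (use J(3) in \<open>auto simp: L_def\<close>)
    qed
    finally show ?case .
  qed
  then show ?thesis unfolding superpoly_def using J(3) by (intro exI[of _ L] exI[of _ a]) (auto simp: L_def)
qed

abbreviation Theta :: "nat \<Rightarrow> ((real ^ 'd) \<times> real) set" where "Theta n \<equiv> G n \<times> TG n"

text \<open>The radius has to exceed the estimation rates, which are of order at most
  \<open>n powr (2 * sx - 1/2)\<close>, and still reduce the variance of the increments. The factor
  3 leaves room for moving both members of a pair at distance \<open>n powr (- 1/4)\<close> to the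
  net.\<close>

definition Near :: "nat \<Rightarrow> ((real ^ 'd) \<times> (real ^ 'd) \<times> real) set" where
  "Near n = {(g, g', t). g \<in> G n \<and> g' \<in> G n \<and> t \<in> TG n \<and> norm (g - g') \<le> 3 * real n powr (- 1/4)}"

lemma Theta_card: "n \<ge> 1 \<Longrightarrow> finite (Theta n)" "n \<ge> 1 \<Longrightarrow> real (card (Theta n)) \<le> 2 * Cg * real n ^ (pg + 1)"
proof -
  assume n: "n \<ge> 1"
  show "finite (Theta n)" using G_finite[OF n] TG_finite by simp
  have "real (card (Theta n)) = real (card (G n)) * real (card (TG n))"
    using G_finite[OF n] TG_finite by (simp add: card_cartesian_product)
  also have "\<dots> \<le> (Cg * real n ^ pg) * (2 * real n)"
    using G_card[OF n] TG_card[OF n] by (intro mult_mono) (auto intro: order_trans[OF of_nat_0_le_iff])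
  finally show "real (card (Theta n)) \<le> 2 * Cg * real n ^ (pg + 1)" by (simp add: mult_ac)
qed

lemma Cg_nonneg: "0 \<le> Cg" using G_card[of 1] by (simp add: order_trans[OF of_nat_0_le_iff])

lemma Near_card: "n \<ge> 1 \<Longrightarrow> finite (Near n)" "n \<ge> 1 \<Longrightarrow> real (card (Near n)) \<le> 2 * Cg * Cg * real n ^ (pg + (pg + 1))"
proof -
  assume n: "n \<ge> 1"
  have sub: "Near n \<subseteq> G n \<times> Theta n" by (auto simp: Near_def)
  have fin: "finite (G n \<times> Theta n)" using G_finite[OF n] TG_finite by simp
  show "finite (Near n)" using finite_subset[OF sub fin] .
  have "real (card (Near n)) \<le> real (card (G n \<times> Theta n))" using card_mono[OF fin sub] by simp
  also have "\<dots> = real (card (G n)) * real (card (Theta n))" by (simp add: card_cartesian_product)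
  also have "\<dots> \<le> (Cg * real n ^ pg) * (2 * Cg * real n ^ (pg + 1))"
    using G_card[OF n] Theta_card[OF n] Cg_nonneg by (intro mult_mono) auto
  finally show "real (card (Near n)) \<le> 2 * Cg * Cg * real n ^ (pg + (pg + 1))" by (simp add: power_add mult_ac)
qed

definition Kinc :: real where "Kinc = 2 * SB * (SB * (2 * R * Cf * 3))"

lemma Kinc_nonneg: "0 \<le> Kinc" using SB_ge R_pos Cf_nonneg by (simp add: Kinc_def)

lemma square_le: "\<bar>x\<bar> \<le> y \<Longrightarrow> x\<^sup>2 \<le> y\<^sup>2" for x y :: real
  using power_mono[of "\<bar>x\<bar>" y 2] by simp

lemma component_bound:
  assumes "i \<ge> 1" "t \<in> {0..1}"
  shows "AE w in M. \<bar>cscore i b t w $ k\<bar> \<le> SB" "expectation (\<lambda>w. (cscore i b t w $ k)\<^sup>2) \<le> SB\<^sup>2"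
    "(\<lambda>w. cscore i b t w $ k) \<in> borel_measurable M"
    "integrable M (\<lambda>w. (cscore i b t w $ k)\<^sup>2)"
proof -
  show 1: "AE w in M. \<bar>cscore i b t w $ k\<bar> \<le> SB"
    using AE_okX[OF assms(1)] by eventually_elim (rule order_trans[OF component_le_norm_cart norm_cscore_le[OF assms(1) _ assms(2)]])
  show m: "(\<lambda>w. cscore i b t w $ k) \<in> borel_measurable M"
    by (rule measurable_compose[OF cscore_measurable[OF assms(1)]]) (auto intro!: borel_measurable_continuous_onI continuous_intros)
  have 2: "AE w in M. \<bar>(cscore i b t w $ k)\<^sup>2\<bar> \<le> SB\<^sup>2"
    using 1 by eventually_elim (simp only: abs_power2 square_le)
  show "expectation (\<lambda>w. (cscore i b t w $ k)\<^sup>2) \<le> SB\<^sup>2"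
    using abs_expectation_le[OF 2] by simp
  show "integrable M (\<lambda>w. (cscore i b t w $ k)\<^sup>2)"
    by (rule integrable_const_bound[where B="SB\<^sup>2"]) (use 2 m in auto)
qed

text \<open>The square of a bounded increment is at most its bound times its absolute value, and the
  expected absolute value is proportional to the distance. Because of the jumps the variance is thus
  controlled only linearly, not quadratically, in the distance.\<close>

lemma increment_bound:
  assumes "n \<ge> 1" "i \<ge> 1" "(g, g', t) \<in> Near n"
  shows "AE w in M. \<bar>cscore i g t w $ k - cscore i g' t w $ k\<bar> \<le> 2 * SB"
    "expectation (\<lambda>w. (cscore i g t w $ k - cscore i g' t w $ k)\<^sup>2) \<le> Kinc * real n powr (- 1/4)"
    "integrable M (\<lambda>w. (cscore i g t w $ k - cscore i g' t w $ k)\<^sup>2)"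
proof -
  have t: "t \<in> {0..1}" using assms TG_unit by (auto simp: Near_def)
  note m[measurable] = component_bound(3)[OF assms(2) t]
  show 1: "AE w in M. \<bar>cscore i g t w $ k - cscore i g' t w $ k\<bar> \<le> 2 * SB"
    using component_bound(1)[OF assms(2) t, of g k] component_bound(1)[OF assms(2) t, of g' k] by eventually_elim linarith
  have 2: "AE w in M. \<bar>(cscore i g t w $ k - cscore i g' t w $ k)\<^sup>2\<bar> \<le> (2 * SB)\<^sup>2"
    using 1 by eventually_elim (simp only: abs_power2 square_le)
  show 3: "integrable M (\<lambda>w. (cscore i g t w $ k - cscore i g' t w $ k)\<^sup>2)"
    by (rule integrable_const_bound[where B="(2 * SB)\<^sup>2"]) (use 2 in auto)
  have "expectation (\<lambda>w. (cscore i g t w $ k - cscore i g' t w $ k)\<^sup>2) \<le> expectation (\<lambda>w. 2 * SB * norm (cscore i g t w - cscore i g' t w))"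
  proof (rule integral_mono_AE)
    show "AE w in M. (cscore i g t w $ k - cscore i g' t w $ k)\<^sup>2 \<le> 2 * SB * norm (cscore i g t w - cscore i g' t w)"
      using 1
    proof eventually_elim
      case (elim w)
      have "\<bar>cscore i g t w $ k - cscore i g' t w $ k\<bar> \<le> norm (cscore i g t w - cscore i g' t w)"
        using component_le_norm_cart[of "cscore i g t w - cscore i g' t w" k] by simp
      from mult_mono[OF elim this] SB_ge show ?case by (simp add: power2_eq_square)
    qed
    show "integrable M (\<lambda>w. 2 * SB * norm (cscore i g t w - cscore i g' t w))"
      using cscore_integrable[OF assms(2) t] by simp
  qed (rule 3)
  also have "\<dots> = 2 * SB * expectation (\<lambda>w. norm (cscore i g t w - cscore i g' t w))" by simp
  also have "\<dots> \<le> 2 * SB * (SB * (\<bar>t - t\<bar> + 2 * R * Cf * norm (g - g')))"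
    using SB_ge by (intro mult_left_mono cscore_increment_expectation assms(2) t) auto
  also have "\<dots> \<le> 2 * SB * (SB * (2 * R * Cf * (3 * real n powr (- 1/4))))"
  proof -
    have "norm (g - g') \<le> 3 * real n powr (- 1/4)" using assms(3) by (auto simp: Near_def)
    moreover have "0 \<le> 2 * R * Cf" "0 \<le> SB" "0 \<le> 2 * SB" using SB_ge R_pos Cf_nonneg by auto
    ultimately show ?thesis by (simp only: diff_self abs_zero add_0_left) (intro mult_left_mono, assumption+)
  qed
  also have "\<dots> = Kinc * real n powr (- 1/4)" by (simp add: Kinc_def)
  finally show "expectation (\<lambda>w. (cscore i g t w $ k - cscore i g' t w $ k)\<^sup>2) \<le> Kinc * real n powr (- 1/4)" .
qed

text \<open>Bands of width of order \<open>1 / n\<close> contain a bounded expected number of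
  residuals in total, so the variance of the whole sum is bounded and a constant \<open>l\<close>
  suffices.\<close>

lemma superpoly_band:
  "superpoly (\<lambda>n. prob {w\<in>space M. \<exists>g\<in>G n. 2 * real c_max * real n powr sx < \<bar>\<Sum>i=1..n. band i g (R / real n) w - expectation (band i g (R / real n))\<bar>})"
  unfolding band_cluster[abs_def]
proof (rule superpoly_deviation[where h="\<lambda>n g i p. zband i g (R / real n) (fst p)" and A=Cg and a=pg and C="\<lambda>_. real c_max"
    and V="\<lambda>n. real c_max * (real c_max * (2 * (R / real n) * Cf))" and l="\<lambda>_. 1 / (2 * real c_max)" and K="Cf * R * real c_max" , unfolded fst_conv])
  have cm: "real c_max \<ge> 1" using c_max_pos by simp
  fix n g i assume "n \<ge> (1::nat)" "g \<in> G n" "i \<in> {1..n}"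
  then have i: "i \<ge> 1" and n: "n \<ge> 1" by auto
  show "AE w in M. \<bar>zband i g (R / real n) (cluster c Y X i w)\<bar> \<le> real c_max"
    unfolding band_cluster[symmetric] using band_bounds[OF i] by (simp add: abs_of_nonneg)
  have "expectation (\<lambda>w. (band i g (R / real n) w)\<^sup>2) \<le> expectation (\<lambda>w. real c_max * band i g (R / real n) w)"
  proof (rule integral_mono)
    have "(band i g (R / real n) w)\<^sup>2 \<le> real c_max * band i g (R / real n) w" for w
      unfolding power2_eq_square using band_bounds[OF i] by (intro mult_right_mono)
    then show "(band i g (R / real n) w)\<^sup>2 \<le> real c_max * band i g (R / real n) w" for w .
    show "integrable M (\<lambda>w. real c_max * band i g (R / real n) w)" using band_integrable[OF i] by simp
    show "integrable M (\<lambda>w. (band i g (R / real n) w)\<^sup>2)"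
    proof (rule integrable_const_bound[where B="(real c_max)\<^sup>2"])
      show "AE w in M. norm ((band i g (R / real n) w)\<^sup>2) \<le> (real c_max)\<^sup>2"
        using band_bounds[OF i, of g "R / real n"] by (intro AE_I2) (simp add: abs_of_nonneg power_mono)
    qed (use i in measurable)
  qed
  also have "\<dots> \<le> real c_max * (real c_max * (2 * (R / real n) * Cf))"
    using R_pos i by (simp only: Bochner_Integration.integral_mult_right_zero) (intro mult_left_mono expectation_band_le, auto)
  finally show "expectation (\<lambda>w. (zband i g (R / real n) (cluster c Y X i w))\<^sup>2) \<le> real c_max * (real c_max * (2 * (R / real n) * Cf))"
    unfolding band_cluster .
next
  have cm: "real c_max \<ge> 1" using c_max_pos by simp
  show "\<forall>\<^sub>F n in sequentially. (1 / (2 * real c_max))\<^sup>2 * (real n * (real c_max * (real c_max * (2 * (R / real n) * Cf)))) \<le> Cf * R * real c_max"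
    using eventually_ge_at_top[of 1]
  proof eventually_elim
    case (elim n)
    have "(1 / (2 * real c_max))\<^sup>2 * (real n * (real c_max * (real c_max * (2 * (R / real n) * Cf)))) = (R * Cf / 2)"
      using elim cm by (simp add: field_simps power2_eq_square)
    also have "\<dots> \<le> Cf * R * 1" using R_pos Cf_nonneg by simp
    also have "\<dots> \<le> Cf * R * real c_max" using R_pos Cf_nonneg cm by (intro mult_left_mono) auto
    finally show ?case .
  qed
  show "\<forall>\<^sub>F n in sequentially. real n powr sx \<le> 1 / (2 * real c_max) * (2 * real c_max * real n powr sx)"
    using cm by simp
  show "\<forall>\<^sub>F n in sequentially. 1 / (2 * real c_max) * (2 * real c_max) \<le> 1"
    using cm by simp
qed (use G_finite G_card Cg_nonneg in \<open>auto intro: measurable_compose[OF measurable_fst zband_measurable[simplified]]\<close>)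

text \<open>
  Two regimes of Bernstein's inequality: deviations \<open>n powr (1/2 + sx)\<close> of sums with variance of
  order \<open>n\<close>, and deviations \<open>n powr (1/2 - sx)\<close> of sums with variance of order \<open>n powr (3/4)\<close>.
\<close>

lemma regime_large:
  assumes "0 \<le> C"
  shows "\<forall>\<^sub>F n in sequentially. real n powr (- 1/2) * (2 * (C * real n powr gam)) \<le> 1"
    "\<forall>\<^sub>F n in sequentially. (real n powr (- 1/2))\<^sup>2 * (real n * V) \<le> V"
    "\<forall>\<^sub>F n in sequentially. real n powr sx \<le> real n powr (- 1/2) * real n powr (1/2 + sx)"
proof -
  have g: "gam - 1/2 < 0" using gam_bounds by simp
  have "(\<lambda>n. real n powr (- 1/2) * (2 * (C * real n powr gam))) \<longlonglongrightarrow> 0" using g by real_asymp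
  then have "\<forall>\<^sub>F n in sequentially. real n powr (- 1/2) * (2 * (C * real n powr gam)) < 1" by (rule order_tendstoD) simp
  then show "\<forall>\<^sub>F n in sequentially. real n powr (- 1/2) * (2 * (C * real n powr gam)) \<le> 1"
    by (rule eventually_mono) simp
  show "\<forall>\<^sub>F n in sequentially. (real n powr (- 1/2))\<^sup>2 * (real n * V) \<le> V"
    using eventually_ge_at_top[of 1]
  proof eventually_elim
    case (elim n)
    have "(real n powr (- 1/2))\<^sup>2 * real n = 1"
      using elim by (simp add: power2_eq_square powr_add[symmetric] powr_minus field_simps)
    then show ?case by (simp add: mult.assoc[symmetric])
  qed
  show "\<forall>\<^sub>F n in sequentially. real n powr sx \<le> real n powr (- 1/2) * real n powr (1/2 + sx)"
    by (simp add: powr_add[symmetric])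
qed

lemma regime_small:
  assumes "0 \<le> C" "0 \<le> V"
  shows "\<forall>\<^sub>F n in sequentially. real n powr (2 * sx - 1/2) * (2 * (C * real n powr gam)) \<le> 1"
    "\<forall>\<^sub>F n in sequentially. (real n powr (2 * sx - 1/2))\<^sup>2 * (real n * (V * real n powr (- 1/4))) \<le> V"
    "\<forall>\<^sub>F n in sequentially. real n powr sx \<le> real n powr (2 * sx - 1/2) * real n powr (1/2 - sx)"
proof -
  have g: "2 * sx - 1/2 + gam < 0" using sx_bounds by linarith
  have "(\<lambda>n. real n powr (2 * sx - 1/2) * (2 * (C * real n powr gam))) \<longlonglongrightarrow> 0" using g by real_asymp
  then have "\<forall>\<^sub>F n in sequentially. real n powr (2 * sx - 1/2) * (2 * (C * real n powr gam)) < 1" by (rule order_tendstoD) simp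
  then show "\<forall>\<^sub>F n in sequentially. real n powr (2 * sx - 1/2) * (2 * (C * real n powr gam)) \<le> 1"
    by (rule eventually_mono) simp
  show "\<forall>\<^sub>F n in sequentially. (real n powr (2 * sx - 1/2))\<^sup>2 * (real n * (V * real n powr (- 1/4))) \<le> V"
    using eventually_ge_at_top[of 1]
  proof eventually_elim
    case (elim n)
    have "(real n powr (2 * sx - 1/2))\<^sup>2 * (real n * (V * real n powr (- 1/4))) = V * ((real n powr (2 * sx - 1/2))\<^sup>2 * real n powr 1 * real n powr (- 1/4))"
      using elim by simp
    also have "\<dots> = V * real n powr (4 * sx - 1/4)"
      unfolding power2_eq_square powr_add[symmetric] by simp
    \<comment> \<open>Here the bound \<open>sx \<le> 1 / 16\<close> enters: the exponent
      \<open>4 * sx - 1/4\<close> must not be positive.\<close>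
    also have "\<dots> \<le> V * 1"
    proof (rule mult_left_mono)
      have "real n powr (4 * sx - 1/4) \<le> real n powr 0" using elim sx_bounds by (intro powr_mono) auto
      then show "real n powr (4 * sx - 1/4) \<le> 1" using elim by simp
    qed (use assms in simp)
    finally show ?case by simp
  qed
  show "\<forall>\<^sub>F n in sequentially. real n powr sx \<le> real n powr (2 * sx - 1/2) * real n powr (1/2 - sx)"
    by (simp add: powr_add[symmetric])
qed

end

section \<open>Exponential bounds at the points of the nets\<close>

context wild_grid
begin

text \<open>Bounded variables are also placed under a bound \<open>C * n powr gam\<close>, so that
  weighted and unweighted sums can share the choice of \<open>l\<close>.\<close>

lemma powr_gam_ge: "n \<ge> 1 \<Longrightarrow> 0 \<le> C \<Longrightarrow> C \<le> C * real n powr gam"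
  using ge_one_powr_ge_zero[of "real n" gam] gam_bounds by (simp add: mult_le_cancel_left1)

lemma measurable_zscore_component:
  "(\<lambda>p. zscore i b t (fst p) $ k) \<in> borel_measurable (PiM {1..c i} (\<lambda>_. borel) \<Otimes>\<^sub>M (borel :: real measure))"
proof -
  have "(\<lambda>p. zscore i b t (fst p)) \<in> borel_measurable (PiM {1..c i} (\<lambda>_. borel) \<Otimes>\<^sub>M (borel :: real measure))"
    by (rule measurable_compose[OF measurable_fst zscore_measurable])
  moreover have "(\<lambda>v :: real ^ 'd. v $ k) \<in> borel_measurable borel"
    by (intro borel_measurable_continuous_onI continuous_intros)
  ultimately show ?thesis by (rule measurable_compose)
qed

lemma measurable_trunc_snd:
  "(\<lambda>p. trunc m (snd p)) \<in> borel_measurable (PiM {1..c i} (\<lambda>_. borel :: (real \<times> (real ^ 'd)) measure) \<Otimes>\<^sub>M borel)"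
  by (rule measurable_compose[OF measurable_snd trunc_measurable])

text \<open>Independence splits the second moment, and the truncated weight contributes at most 1.
  So weighting leaves the order of the variance unchanged although the sup bound grows like
  \<open>n powr gam\<close>.\<close>

lemma weighted_second_moment:
  assumes "i \<ge> 1" "0 \<le> m" "v \<in> borel_measurable (data_algebra M c Y X {1..})"
    "integrable M (\<lambda>w. (v w)\<^sup>2)" "expectation (\<lambda>w. (v w)\<^sup>2) \<le> V"
  shows "expectation (\<lambda>w. (trunc m (W i w) * v w)\<^sup>2) \<le> V"
proof -
  have "(\<lambda>w. (trunc m (W i w))\<^sup>2) \<in> borel_measurable (weight_algebra M W)"
    using measurable_compose[OF measurable_weight_algebra[OF assms(1), of W M] trunc_measurable] by measurable
  then have "expectation (\<lambda>w. (trunc m (W i w))\<^sup>2 * (v w)\<^sup>2) = expectation (\<lambda>w. (trunc m (W i w))\<^sup>2) * expectation (\<lambda>w. (v w)\<^sup>2)"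
    using trunc_integrable[OF assms(1,2)] assms(3,4) by (intro expectation_weight_data) auto
  also have "\<dots> \<le> 1 * expectation (\<lambda>w. (v w)\<^sup>2)"
    by (intro mult_right_mono trunc_second_moment assms) simp
  finally show ?thesis using assms(5) by (simp add: power_mult_distrib)
qed

lemma weighted_mean:
  assumes "i \<ge> 1" "0 \<le> m" "v \<in> borel_measurable (data_algebra M c Y X {1..})" "integrable M v"
  shows "expectation (\<lambda>w. trunc m (W i w) * v w) = 0"
proof -
  have "(\<lambda>w. trunc m (W i w)) \<in> borel_measurable (weight_algebra M W)"
    by (rule measurable_compose[OF measurable_weight_algebra[OF assms(1), of W M] trunc_measurable])
  then show ?thesis
    using expectation_weight_data(1)[of "\<lambda>w. trunc m (W i w)" v] trunc_integrable(1)[OF assms(1,2)] assms trunc_mean by simp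
qed

lemma component_data_measurable:
  "i \<in> I \<Longrightarrow> (\<lambda>w. cscore i b t w $ k) \<in> borel_measurable (data_algebra M c Y X I)"
  by (rule measurable_compose[OF cscore_data_measurable]) (auto intro!: borel_measurable_continuous_onI continuous_intros)

lemma component_integrable: "i \<ge> 1 \<Longrightarrow> t \<in> {0..1} \<Longrightarrow> integrable M (\<lambda>w. cscore i b t w $ k)"
  using component_bound(1,3)[of i t b k] by (intro integrable_const_bound[where B=SB]) auto

abbreviation S_at :: "((real ^ 'd) \<times> real) \<times> 'd \<Rightarrow> nat \<Rightarrow> 'a \<Rightarrow> real" where
  "S_at j i w \<equiv> cscore i (fst (fst j)) (snd (fst j)) w $ snd j"

abbreviation D_at :: "((real ^ 'd) \<times> (real ^ 'd) \<times> real) \<times> 'd \<Rightarrow> nat \<Rightarrow> 'a \<Rightarrow> real" where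
  "D_at j i w \<equiv> cscore i (fst (fst j)) (snd (snd (fst j))) w $ snd j - cscore i (fst (snd (fst j))) (snd (snd (fst j))) w $ snd j"

lemma card_times_UNIV:
  assumes "real (card (A :: 'b set)) \<le> C"
  shows "real (card (A \<times> (UNIV :: 'd set))) \<le> C * real CARD('d)"
  using assms by (simp add: card_cartesian_product mult_right_mono)

lemma superpoly_score:
  "superpoly (\<lambda>n. prob {w\<in>space M. \<exists>j\<in>Theta n \<times> (UNIV :: 'd set). real n powr (1/2 + sx) <
     \<bar>\<Sum>i=1..n. S_at j i w - expectation (S_at j i)\<bar>})"
proof (rule superpoly_deviation[where h="\<lambda>n j i p. zscore i (fst (fst j)) (snd (fst j)) (fst p) $ snd j"
      and C="\<lambda>n. SB * real n powr gam" and V="\<lambda>_. SB\<^sup>2" and l="\<lambda>n. real n powr (- 1/2)" and K="SB\<^sup>2"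
      and A="2 * Cg * real CARD('d)" and a="pg + 1", unfolded fst_conv, folded cscore_cluster])
  fix n :: nat and j :: "((real ^ 'd) \<times> real) \<times> 'd" and i assume n: "n \<ge> 1" and j: "j \<in> Theta n \<times> UNIV" and "i \<in> {1..n}"
  then have i: "i \<ge> 1" and t: "snd (fst j) \<in> {0..1}" using TG_unit[OF n] by auto
  show "AE w in M. \<bar>S_at j i w\<bar> \<le> SB * real n powr gam"
    using component_bound(1)[OF i t, of "fst (fst j)" "snd j"]
    by eventually_elim (rule order_trans[OF _ powr_gam_ge[OF n]], assumption, use SB_ge in linarith)
  show "expectation (\<lambda>w. (S_at j i w)\<^sup>2) \<le> SB\<^sup>2" by (rule component_bound(2)[OF i t])
next
  fix n :: nat assume n: "n \<ge> 1"
  show "real (card (Theta n \<times> (UNIV :: 'd set))) \<le> 2 * Cg * real CARD('d) * real n ^ (pg + 1)"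
    using card_times_UNIV[OF Theta_card(2)[OF n]] by (simp add: mult_ac)
qed (use Theta_card(1) Cg_nonneg SB_ge measurable_zscore_component regime_large[of SB] in auto)

text \<open>Stochastic equicontinuity on the net: close pairs have small variance, which brings the
  deviations below \<open>sqrt n\<close> by a factor \<open>n powr (- sx)\<close>.\<close>

lemma superpoly_increment:
  "superpoly (\<lambda>n. prob {w\<in>space M. \<exists>j\<in>Near n \<times> (UNIV :: 'd set). real n powr (1/2 - sx) <
     \<bar>\<Sum>i=1..n. D_at j i w - expectation (D_at j i)\<bar>})"
proof (rule superpoly_deviation[where h="\<lambda>n j i p. zscore i (fst (fst j)) (snd (snd (fst j))) (fst p) $ snd j - zscore i (fst (snd (fst j))) (snd (snd (fst j))) (fst p) $ snd j"
      and C="\<lambda>n. (2 * SB) * real n powr gam" and V="\<lambda>n. Kinc * real n powr (- 1/4)" and l="\<lambda>n. real n powr (2 * sx - 1/2)" and K="Kinc"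
      and A="2 * Cg * Cg * real CARD('d)" and a="pg + (pg + 1)", unfolded fst_conv, folded cscore_cluster])
  fix n :: nat and j :: "((real ^ 'd) \<times> (real ^ 'd) \<times> real) \<times> 'd" and i
  assume n: "n \<ge> 1" and j: "j \<in> Near n \<times> UNIV" and "i \<in> {1..n}"
  then have i: "i \<ge> 1" and N: "(fst (fst j), fst (snd (fst j)), snd (snd (fst j))) \<in> Near n" by auto
  show "AE w in M. \<bar>D_at j i w\<bar> \<le> (2 * SB) * real n powr gam"
    using increment_bound(1)[OF n i N, of "snd j"]
    by eventually_elim (rule order_trans[OF _ powr_gam_ge[OF n]], assumption, use SB_ge in linarith)
  show "expectation (\<lambda>w. (D_at j i w)\<^sup>2) \<le> Kinc * real n powr (- 1/4)" by (rule increment_bound(2)[OF n i N])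
next
  fix n :: nat assume n: "n \<ge> 1"
  show "real (card (Near n \<times> (UNIV :: 'd set))) \<le> 2 * Cg * Cg * real CARD('d) * real n ^ (pg + (pg + 1))"
    using card_times_UNIV[OF Near_card(2)[OF n]] by (simp add: mult_ac)
qed (use Near_card(1) Cg_nonneg SB_ge measurable_zscore_component regime_small[of "2 * SB" Kinc] Kinc_nonneg in auto)

text \<open>Controls the entries of the sample version of \<open>Sigma_mat\<close> simultaneously
  for all pairs of net points and levels.\<close>

lemma superpoly_product:
  "superpoly (\<lambda>n. prob {w\<in>space M. \<exists>j\<in>(Theta n \<times> (UNIV :: 'd set)) \<times> (Theta n \<times> (UNIV :: 'd set)). real n powr (1/2 + sx) <
     \<bar>\<Sum>i=1..n. S_at (fst j) i w * S_at (snd j) i w - expectation (\<lambda>w. S_at (fst j) i w * S_at (snd j) i w)\<bar>})"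
proof (rule superpoly_deviation[where h="\<lambda>n j i p. zscore i (fst (fst (fst j))) (snd (fst (fst j))) (fst p) $ snd (fst j) * zscore i (fst (fst (snd j))) (snd (fst (snd j))) (fst p) $ snd (snd j)"
      and C="\<lambda>n. SB\<^sup>2 * real n powr gam" and V="\<lambda>_. (SB\<^sup>2)\<^sup>2" and l="\<lambda>n. real n powr (- 1/2)" and K="(SB\<^sup>2)\<^sup>2"
      and A="(2 * Cg * real CARD('d)) * (2 * Cg * real CARD('d))" and a="(pg + 1) + (pg + 1)", unfolded fst_conv, folded cscore_cluster])
  fix n :: nat and j :: "(((real ^ 'd) \<times> real) \<times> 'd) \<times> (((real ^ 'd) \<times> real) \<times> 'd)" and i
  assume n: "n \<ge> 1" and j: "j \<in> (Theta n \<times> UNIV) \<times> (Theta n \<times> UNIV)" and "i \<in> {1..n}"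
  then have i: "i \<ge> 1" and t: "snd (fst (fst j)) \<in> {0..1}" "snd (fst (snd j)) \<in> {0..1}" using TG_unit[OF n] by auto
  have b: "AE w in M. \<bar>S_at (fst j) i w * S_at (snd j) i w\<bar> \<le> SB\<^sup>2"
    using component_bound(1)[OF i t(1), of "fst (fst (fst j))" "snd (fst j)"] component_bound(1)[OF i t(2), of "fst (fst (snd j))" "snd (snd j)"]
  proof eventually_elim
    case (elim w)
    show ?case unfolding abs_mult power2_eq_square using elim SB_ge by (intro mult_mono) auto
  qed
  then show "AE w in M. \<bar>S_at (fst j) i w * S_at (snd j) i w\<bar> \<le> SB\<^sup>2 * real n powr gam"
    by eventually_elim (rule order_trans[OF _ powr_gam_ge[OF n]], assumption, simp)
  have "AE w in M. \<bar>(S_at (fst j) i w * S_at (snd j) i w)\<^sup>2\<bar> \<le> (SB\<^sup>2)\<^sup>2"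
    using b by eventually_elim (simp only: abs_power2 square_le)
  from abs_expectation_le[OF this]
  show "expectation (\<lambda>w. (S_at (fst j) i w * S_at (snd j) i w)\<^sup>2) \<le> (SB\<^sup>2)\<^sup>2" by simp
next
  fix n :: nat assume n: "n \<ge> 1"
  have "real (card (Theta n \<times> (UNIV :: 'd set))) \<le> 2 * Cg * real CARD('d) * real n ^ (pg + 1)"
    using card_times_UNIV[OF Theta_card(2)[OF n]] by (simp add: mult_ac)
  from mult_mono[OF this this]
  show "real (card ((Theta n \<times> (UNIV :: 'd set)) \<times> (Theta n \<times> (UNIV :: 'd set)))) \<le> (2 * Cg * real CARD('d)) * (2 * Cg * real CARD('d)) * real n ^ ((pg + 1) + (pg + 1))"
    using Cg_nonneg by (simp only: card_cartesian_product[of "Theta n \<times> UNIV"] of_nat_mult power_add mult_ac) simp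
qed (use Theta_card(1) Cg_nonneg SB_ge measurable_zscore_component regime_large[of "SB\<^sup>2"] in \<open>auto intro!: borel_measurable_times\<close>)

lemma superpoly_weighted_score:
  "superpoly (\<lambda>n. prob {w\<in>space M. \<exists>j\<in>Theta n \<times> (UNIV :: 'd set). real n powr (1/2 + sx) <
     \<bar>\<Sum>i=1..n. trunc (real n powr gam) (W i w) * S_at j i w - expectation (\<lambda>w. trunc (real n powr gam) (W i w) * S_at j i w)\<bar>})"
proof (rule superpoly_deviation[where h="\<lambda>n j i p. trunc (real n powr gam) (snd p) * zscore i (fst (fst j)) (snd (fst j)) (fst p) $ snd j"
      and C="\<lambda>n. (2 * SB) * real n powr gam" and V="\<lambda>_. SB\<^sup>2" and l="\<lambda>n. real n powr (- 1/2)" and K="SB\<^sup>2"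
      and A="2 * Cg * real CARD('d)" and a="pg + 1", unfolded fst_conv snd_conv, folded cscore_cluster])
  fix n :: nat and j :: "((real ^ 'd) \<times> real) \<times> 'd" and i assume n: "n \<ge> 1" and j: "j \<in> Theta n \<times> UNIV" and "i \<in> {1..n}"
  then have i: "i \<ge> 1" and t: "snd (fst j) \<in> {0..1}" using TG_unit[OF n] by auto
  show "AE w in M. \<bar>trunc (real n powr gam) (W i w) * S_at j i w\<bar> \<le> (2 * SB) * real n powr gam"
    using component_bound(1)[OF i t, of "fst (fst j)" "snd j"]
  proof eventually_elim
    case (elim w)
    have "\<bar>trunc (real n powr gam) (W i w)\<bar> * \<bar>S_at j i w\<bar> \<le> (2 * real n powr gam) * SB"
      using elim trunc_bound[of "real n powr gam"] by (intro mult_mono) auto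
    then show ?case by (simp add: abs_mult mult_ac)
  qed
  show "expectation (\<lambda>w. (trunc (real n powr gam) (W i w) * S_at j i w)\<^sup>2) \<le> SB\<^sup>2"
    using i by (intro weighted_second_moment component_data_measurable component_bound t) auto
next
  fix n :: nat assume n: "n \<ge> 1"
  show "real (card (Theta n \<times> (UNIV :: 'd set))) \<le> 2 * Cg * real CARD('d) * real n ^ (pg + 1)"
    using card_times_UNIV[OF Theta_card(2)[OF n]] by (simp add: mult_ac)
qed (use Theta_card(1) Cg_nonneg SB_ge measurable_zscore_component measurable_trunc_snd regime_large[of "2 * SB"] in \<open>auto intro!: borel_measurable_times\<close>)

text \<open>Equicontinuity of the wild gradient with truncated weights; it permits replacing the
  estimator inside the wild gradient by the true parameter.\<close>

lemma superpoly_weighted_increment: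
  "superpoly (\<lambda>n. prob {w\<in>space M. \<exists>j\<in>Near n \<times> (UNIV :: 'd set). real n powr (1/2 - sx) <
     \<bar>\<Sum>i=1..n. trunc (real n powr gam) (W i w) * D_at j i w - expectation (\<lambda>w. trunc (real n powr gam) (W i w) * D_at j i w)\<bar>})"
proof (rule superpoly_deviation[where h="\<lambda>n j i p. trunc (real n powr gam) (snd p) * (zscore i (fst (fst j)) (snd (snd (fst j))) (fst p) $ snd j - zscore i (fst (snd (fst j))) (snd (snd (fst j))) (fst p) $ snd j)"
      and C="\<lambda>n. (4 * SB) * real n powr gam" and V="\<lambda>n. Kinc * real n powr (- 1/4)" and l="\<lambda>n. real n powr (2 * sx - 1/2)" and K="Kinc"
      and A="2 * Cg * Cg * real CARD('d)" and a="pg + (pg + 1)", unfolded fst_conv snd_conv, folded cscore_cluster])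
  fix n :: nat and j :: "((real ^ 'd) \<times> (real ^ 'd) \<times> real) \<times> 'd" and i
  assume n: "n \<ge> 1" and j: "j \<in> Near n \<times> UNIV" and "i \<in> {1..n}"
  then have i: "i \<ge> 1" and N: "(fst (fst j), fst (snd (fst j)), snd (snd (fst j))) \<in> Near n" by auto
  show "AE w in M. \<bar>trunc (real n powr gam) (W i w) * D_at j i w\<bar> \<le> (4 * SB) * real n powr gam"
    using increment_bound(1)[OF n i N, of "snd j"]
  proof eventually_elim
    case (elim w)
    have "\<bar>trunc (real n powr gam) (W i w)\<bar> * \<bar>D_at j i w\<bar> \<le> (2 * real n powr gam) * (2 * SB)"
      using elim trunc_bound[of "real n powr gam"] by (intro mult_mono) auto
    then show ?case by (simp add: abs_mult mult_ac)
  qed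
  show "expectation (\<lambda>w. (trunc (real n powr gam) (W i w) * D_at j i w)\<^sup>2) \<le> Kinc * real n powr (- 1/4)"
    using i by (intro weighted_second_moment borel_measurable_diff component_data_measurable increment_bound[OF n i N]) auto
next
  fix n :: nat assume n: "n \<ge> 1"
  show "real (card (Near n \<times> (UNIV :: 'd set))) \<le> 2 * Cg * Cg * real CARD('d) * real n ^ (pg + (pg + 1))"
    using card_times_UNIV[OF Near_card(2)[OF n]] by (simp add: mult_ac)
qed (use Near_card(1) Cg_nonneg SB_ge measurable_zscore_component measurable_trunc_snd regime_small[of "4 * SB" Kinc] Kinc_nonneg in \<open>auto intro!: borel_measurable_times borel_measurable_diff\<close>)

end

section \<open>The good events\<close>

context wild_grid
begin

text \<open>Finitely many conditions at net points, all in terms of the first \<open>n\<close>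
  clusters: the event belongs to their algebra, and conditional expectations given the data may be
  restricted to it.\<close>

definition data_good :: "nat \<Rightarrow> 'a set" where
  "data_good n = {w\<in>space M. (\<forall>i\<in>{1..n}. okX i w)
     \<and> (\<forall>g\<in>G n. \<bar>\<Sum>i=1..n. band i g (R / real n) w - expectation (band i g (R / real n))\<bar> \<le> 2 * real c_max * real n powr sx)
     \<and> (\<forall>j\<in>Theta n \<times> UNIV. \<bar>\<Sum>i=1..n. S_at j i w - expectation (S_at j i)\<bar> \<le> real n powr (1/2 + sx))
     \<and> (\<forall>j\<in>Near n \<times> UNIV. \<bar>\<Sum>i=1..n. D_at j i w - expectation (D_at j i)\<bar> \<le> real n powr (1/2 - sx))
     \<and> (\<forall>j\<in>(Theta n \<times> UNIV) \<times> (Theta n \<times> UNIV).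
          \<bar>\<Sum>i=1..n. S_at (fst j) i w * S_at (snd j) i w - expectation (\<lambda>w. S_at (fst j) i w * S_at (snd j) i w)\<bar> \<le> real n powr (1/2 + sx))}"

abbreviation tw :: "nat \<Rightarrow> nat \<Rightarrow> 'a \<Rightarrow> real" where
  "tw n i w \<equiv> trunc (real n powr gam) (W i w)"

text \<open>No centring occurs because the truncated weights have mean 0 and are independent of the
  scores.\<close>

definition weight_good :: "nat \<Rightarrow> 'a set" where
  "weight_good n = {w\<in>space M. (\<forall>j\<in>Theta n \<times> UNIV. \<bar>\<Sum>i=1..n. tw n i w * S_at j i w\<bar> \<le> real n powr (1/2 + sx))
     \<and> (\<forall>j\<in>Near n \<times> UNIV. \<bar>\<Sum>i=1..n. tw n i w * D_at j i w\<bar> \<le> real n powr (1/2 - sx))}"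

lemma okX_data_measurable:
  assumes "i \<in> I"
  shows "{w\<in>space M. okX i w} \<in> sets (data_algebra M c Y X I)"
proof -
  have "{w\<in>space (data_algebra M c Y X I). norm (X i k w) \<le> R} \<in> sets (data_algebra M c Y X I)" if "k \<in> {1..c i}" for k
    using measurable_data_algebra(2)[where c=c and i=i and k=k and Y=Y and M=M and X=X, OF assms that] by measurable
  then have "{w\<in>space (data_algebra M c Y X I). \<forall>k\<in>{1..c i}. norm (X i k w) \<le> R} \<in> sets (data_algebra M c Y X I)"
    by (intro sets.sets_Collect_finite_All) auto
  then show ?thesis by (simp add: okX_def)
qed

lemma data_good_measurable:
  assumes n: "n \<ge> 1"
  shows "data_good n \<in> sets (data_algebra M c Y X {1..n})"
proof -
  let ?F = "data_algebra M c Y X {1..n}"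
  have ball: "{w\<in>space M. \<forall>j\<in>J. \<bar>\<Sum>i=1..n. z j i w - e j i\<bar> \<le> (t :: real)} \<in> sets ?F"
    if J: "finite J" and z: "\<And>j i. i \<in> {1..n} \<Longrightarrow> z j i \<in> borel_measurable ?F" for J :: "'j set" and z e t
  proof -
    have "(\<lambda>w. \<bar>\<Sum>i=1..n. z j i w - e j i\<bar>) \<in> borel_measurable ?F" for j
      using z by (intro borel_measurable_abs borel_measurable_sum borel_measurable_diff) auto
    then have "{w\<in>space ?F. \<bar>\<Sum>i=1..n. z j i w - e j i\<bar> \<le> t} \<in> sets ?F" for j
      by (rule borel_measurable_le) simp
    then have "{w\<in>space ?F. \<forall>j\<in>J. \<bar>\<Sum>i=1..n. z j i w - e j i\<bar> \<le> t} \<in> sets ?F"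
      using J by (intro sets.sets_Collect_finite_All) auto
    then show ?thesis by simp
  qed
  have ok: "{w\<in>space M. \<forall>i\<in>{1..n}. okX i w} \<in> sets ?F"
  proof -
    have "{w\<in>space ?F. okX i w} \<in> sets ?F" if "i \<in> {1..n}" for i
      using okX_data_measurable[OF that] by simp
    then have "{w\<in>space ?F. \<forall>i\<in>{1..n}. okX i w} \<in> sets ?F"
      by (intro sets.sets_Collect_finite_All) auto
    then show ?thesis by simp
  qed
  have eq: "data_good n = {w\<in>space M. \<forall>i\<in>{1..n}. okX i w}
     \<inter> {w\<in>space M. \<forall>g\<in>G n. \<bar>\<Sum>i=1..n. band i g (R / real n) w - expectation (band i g (R / real n))\<bar> \<le> 2 * real c_max * real n powr sx}
     \<inter> {w\<in>space M. \<forall>j\<in>Theta n \<times> (UNIV :: 'd set). \<bar>\<Sum>i=1..n. S_at j i w - expectation (S_at j i)\<bar> \<le> real n powr (1/2 + sx)}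
     \<inter> {w\<in>space M. \<forall>j\<in>Near n \<times> (UNIV :: 'd set). \<bar>\<Sum>i=1..n. D_at j i w - expectation (D_at j i)\<bar> \<le> real n powr (1/2 - sx)}
     \<inter> {w\<in>space M. \<forall>j\<in>(Theta n \<times> (UNIV :: 'd set)) \<times> (Theta n \<times> (UNIV :: 'd set)).
          \<bar>\<Sum>i=1..n. S_at (fst j) i w * S_at (snd j) i w - expectation (\<lambda>w. S_at (fst j) i w * S_at (snd j) i w)\<bar> \<le> real n powr (1/2 + sx)}"
    unfolding data_good_def by blast
  show ?thesis
    unfolding eq
    by (intro sets.Int ok ball borel_measurable_diff borel_measurable_times band_data_measurable component_data_measurable)
       (use G_finite[OF n] Theta_card(1)[OF n] Near_card(1)[OF n] in auto)
qed

lemma sets_data_algebra_M: "sets (data_algebra M c Y X {1..n}) \<subseteq> sets M"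
  using subalgebra_data_algebra[of "{1..n}"] by (auto simp: subalgebra_def)

lemma prob_data_good: "superpoly (\<lambda>n. prob (space M - data_good n))"
proof -
  let ?E2 = "\<lambda>n. {w\<in>space M. \<exists>g\<in>G n. 2 * real c_max * real n powr sx < \<bar>\<Sum>i=1..n. band i g (R / real n) w - expectation (band i g (R / real n))\<bar>}"
  let ?E3 = "\<lambda>n. {w\<in>space M. \<exists>j\<in>Theta n \<times> (UNIV :: 'd set). real n powr (1/2 + sx) < \<bar>\<Sum>i=1..n. S_at j i w - expectation (S_at j i)\<bar>}"
  let ?E4 = "\<lambda>n. {w\<in>space M. \<exists>j\<in>Near n \<times> (UNIV :: 'd set). real n powr (1/2 - sx) < \<bar>\<Sum>i=1..n. D_at j i w - expectation (D_at j i)\<bar>}"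
  let ?E5 = "\<lambda>n. {w\<in>space M. \<exists>j\<in>(Theta n \<times> (UNIV :: 'd set)) \<times> (Theta n \<times> (UNIV :: 'd set)). real n powr (1/2 + sx) <
     \<bar>\<Sum>i=1..n. S_at (fst j) i w * S_at (snd j) i w - expectation (\<lambda>w. S_at (fst j) i w * S_at (snd j) i w)\<bar>}"
  have "prob (space M - data_good n) \<le> prob (?E2 n) + (prob (?E3 n) + (prob (?E4 n) + prob (?E5 n)))" if n: "n \<ge> 1" for n
  proof -
    have bex: "{w\<in>space M. \<exists>j\<in>J. t < \<bar>\<Sum>i=1..n. z j i w - e j i\<bar>} \<in> events"
      if J: "finite J" and z: "\<And>j i. j \<in> J \<Longrightarrow> i \<in> {1..n} \<Longrightarrow> z j i \<in> borel_measurable M" for J :: "'j set" and z e and t :: real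
    proof (intro sets.sets_Collect_finite_Ex J)
      fix j assume "j \<in> J"
      then have "(\<lambda>w. \<bar>\<Sum>i=1..n. z j i w - e j i\<bar>) \<in> borel_measurable M"
        using z by (intro borel_measurable_abs borel_measurable_sum borel_measurable_diff) auto
      then show "{w\<in>space M. t < \<bar>\<Sum>i=1..n. z j i w - e j i\<bar>} \<in> events" by measurable
    qed
    have tj: "snd (fst j) \<in> {0..1}" if "j \<in> Theta n \<times> (UNIV :: 'd set)" for j
      using that TG_unit[OF n] by auto
    have tj': "snd (snd (fst j)) \<in> {0..1}" if "j \<in> Near n \<times> (UNIV :: 'd set)" for j
      using that TG_unit[OF n] by (auto simp: Near_def)
    have m2: "?E2 n \<in> events" by (rule bex) (use G_finite[OF n] in auto)
    have m3: "?E3 n \<in> events" by (rule bex) (use Theta_card(1)[OF n] component_bound(3) tj in auto)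
    have m4: "?E4 n \<in> events"
      by (rule bex) (use Near_card(1)[OF n] component_bound(3) tj' in \<open>auto intro!: borel_measurable_diff\<close>)
    have m5: "?E5 n \<in> events"
      by (rule bex) (use Theta_card(1)[OF n] component_bound(3) tj in \<open>auto intro!: borel_measurable_times\<close>)
    \<comment> \<open>The condition \<open>okX\<close> fails only on a null set, which is why the
      events are compared almost surely instead of pointwise.\<close>
    have e1: "AE w in M. \<forall>i\<in>{1..n}. okX i w"
      by (intro AE_finite_allI AE_okX) auto
    have "prob (space M - data_good n) \<le> prob (?E2 n \<union> (?E3 n \<union> (?E4 n \<union> ?E5 n)))"
    proof (rule finite_measure_mono_AE)
      show "AE w in M. w \<in> space M - data_good n \<longrightarrow> w \<in> ?E2 n \<union> (?E3 n \<union> (?E4 n \<union> ?E5 n))"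
        using e1 by eventually_elim (unfold data_good_def mem_Collect_eq Un_iff Diff_iff, meson not_le)
    qed (use m2 m3 m4 m5 in auto)
    also have "\<dots> \<le> prob (?E2 n) + prob (?E3 n \<union> (?E4 n \<union> ?E5 n))"
      by (intro measure_Un_le m2 sets.Un m3 m4 m5)
    also have "prob (?E3 n \<union> (?E4 n \<union> ?E5 n)) \<le> prob (?E3 n) + prob (?E4 n \<union> ?E5 n)"
      by (intro measure_Un_le sets.Un m3 m4 m5)
    also have "prob (?E4 n \<union> ?E5 n) \<le> prob (?E4 n) + prob (?E5 n)"
      by (intro measure_Un_le m4 m5)
    finally show ?thesis by simp
  qed
  then show ?thesis
    by (intro superpoly_mono[OF superpoly_add[OF superpoly_band superpoly_add[OF superpoly_score superpoly_add[OF superpoly_increment superpoly_product]]]])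
       (auto simp: eventually_sequentially)
qed

lemma weighted_means:
  assumes "n \<ge> 1" "i \<in> {1..n}"
  shows "j \<in> Theta n \<times> UNIV \<Longrightarrow> expectation (\<lambda>w. tw n i w * S_at j i w) = 0"
    "j' \<in> Near n \<times> UNIV \<Longrightarrow> expectation (\<lambda>w. tw n i w * D_at j' i w) = 0"
proof -
  have i: "i \<ge> 1" using assms by simp
  show "j \<in> Theta n \<times> UNIV \<Longrightarrow> expectation (\<lambda>w. tw n i w * S_at j i w) = 0"
    using i TG_unit[OF assms(1)] by (intro weighted_mean component_data_measurable component_integrable) auto
  show "j' \<in> Near n \<times> UNIV \<Longrightarrow> expectation (\<lambda>w. tw n i w * D_at j' i w) = 0"
    using i TG_unit[OF assms(1)]
    by (intro weighted_mean borel_measurable_diff Bochner_Integration.integrable_diff component_data_measurable component_integrable)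
       (auto simp: Near_def)
qed

lemma tw_measurable: "i \<ge> 1 \<Longrightarrow> tw n i \<in> borel_measurable M"
  by (rule measurable_compose[OF W_measurable trunc_measurable])

lemma weight_good_measurable:
  assumes n: "n \<ge> 1"
  shows "weight_good n \<in> events"
proof -
  have ball: "{w\<in>space M. \<forall>j\<in>J. \<bar>\<Sum>i=1..n. z j i w\<bar> \<le> (t :: real)} \<in> events"
    if J: "finite J" and z: "\<And>j i. j \<in> J \<Longrightarrow> i \<in> {1..n} \<Longrightarrow> z j i \<in> borel_measurable M" for J :: "'j set" and z t
  proof (intro sets.sets_Collect_finite_All J)
    fix j assume "j \<in> J"
    then have "(\<lambda>w. \<bar>\<Sum>i=1..n. z j i w\<bar>) \<in> borel_measurable M"
      using z by (intro borel_measurable_abs borel_measurable_sum) auto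
    then show "{w\<in>space M. \<bar>\<Sum>i=1..n. z j i w\<bar> \<le> t} \<in> events" by (rule borel_measurable_le) simp
  qed
  have eq: "weight_good n = {w\<in>space M. \<forall>j\<in>Theta n \<times> (UNIV :: 'd set). \<bar>\<Sum>i=1..n. tw n i w * S_at j i w\<bar> \<le> real n powr (1/2 + sx)}
     \<inter> {w\<in>space M. \<forall>j\<in>Near n \<times> (UNIV :: 'd set). \<bar>\<Sum>i=1..n. tw n i w * D_at j i w\<bar> \<le> real n powr (1/2 - sx)}"
    unfolding weight_good_def by blast
  have tj: "snd (fst j) \<in> {0..1}" if "j \<in> Theta n \<times> (UNIV :: 'd set)" for j
    using that TG_unit[OF n] by auto
  have tj': "snd (snd (fst j)) \<in> {0..1}" if "j \<in> Near n \<times> (UNIV :: 'd set)" for j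
    using that TG_unit[OF n] by (auto simp: Near_def)
  show ?thesis
    unfolding eq
    by (intro sets.Int ball borel_measurable_times borel_measurable_diff tw_measurable component_bound(3))
       (use Theta_card(1)[OF n] Near_card(1)[OF n] tj tj' in auto)
qed

lemma prob_weight_good: "superpoly (\<lambda>n. prob (space M - weight_good n))"
proof -
  let ?E1 = "\<lambda>n. {w\<in>space M. \<exists>j\<in>Theta n \<times> (UNIV :: 'd set). real n powr (1/2 + sx) <
     \<bar>\<Sum>i=1..n. tw n i w * S_at j i w - expectation (\<lambda>w. tw n i w * S_at j i w)\<bar>}"
  let ?E2 = "\<lambda>n. {w\<in>space M. \<exists>j\<in>Near n \<times> (UNIV :: 'd set). real n powr (1/2 - sx) <
     \<bar>\<Sum>i=1..n. tw n i w * D_at j i w - expectation (\<lambda>w. tw n i w * D_at j i w)\<bar>}"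
  have "prob (space M - weight_good n) \<le> prob (?E1 n) + prob (?E2 n)" if n: "n \<ge> 1" for n
  proof -
    have e1: "?E1 n = {w\<in>space M. \<exists>j\<in>Theta n \<times> (UNIV :: 'd set). real n powr (1/2 + sx) < \<bar>\<Sum>i=1..n. tw n i w * S_at j i w\<bar>}"
      by (intro Collect_cong conj_cong refl bex_cong arg_cong2[where f="(<)"] arg_cong[where f=abs] sum.cong) (simp add: weighted_means[OF n])
    have e2: "?E2 n = {w\<in>space M. \<exists>j\<in>Near n \<times> (UNIV :: 'd set). real n powr (1/2 - sx) < \<bar>\<Sum>i=1..n. tw n i w * D_at j i w\<bar>}"
      by (intro Collect_cong conj_cong refl bex_cong arg_cong2[where f="(<)"] arg_cong[where f=abs] sum.cong) (simp add: weighted_means[OF n])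
    have bex: "{w\<in>space M. \<exists>j\<in>J. t < \<bar>\<Sum>i=1..n. z j i w\<bar>} \<in> events"
      if J: "finite J" and z: "\<And>j i. j \<in> J \<Longrightarrow> i \<in> {1..n} \<Longrightarrow> z j i \<in> borel_measurable M" for J :: "'j set" and z and t :: real
    proof (intro sets.sets_Collect_finite_Ex J)
      fix j assume "j \<in> J"
      then have "(\<lambda>w. \<bar>\<Sum>i=1..n. z j i w\<bar>) \<in> borel_measurable M"
        using z by (intro borel_measurable_abs borel_measurable_sum) auto
      then show "{w\<in>space M. t < \<bar>\<Sum>i=1..n. z j i w\<bar>} \<in> events" by measurable
    qed
    have tj: "snd (fst j) \<in> {0..1}" if "j \<in> Theta n \<times> (UNIV :: 'd set)" for j
      using that TG_unit[OF n] by auto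
    have tj': "snd (snd (fst j)) \<in> {0..1}" if "j \<in> Near n \<times> (UNIV :: 'd set)" for j
      using that TG_unit[OF n] by (auto simp: Near_def)
    have m1: "?E1 n \<in> events" unfolding e1
      by (intro bex borel_measurable_times tw_measurable component_bound(3)) (use Theta_card(1)[OF n] tj in auto)
    have m2: "?E2 n \<in> events" unfolding e2
      by (intro bex borel_measurable_times borel_measurable_diff tw_measurable component_bound(3)) (use Near_card(1)[OF n] tj' in auto)
    have "prob (space M - weight_good n) \<le> prob (?E1 n \<union> ?E2 n)"
    proof (rule finite_measure_mono)
      show "space M - weight_good n \<subseteq> ?E1 n \<union> ?E2 n"
        unfolding e1 e2 weight_good_def by (rule subsetI) (unfold mem_Collect_eq Un_iff Diff_iff, meson not_le)
    qed (use m1 m2 in auto)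
    also have "\<dots> \<le> prob (?E1 n) + prob (?E2 n)"
      by (intro measure_Un_le m1 m2)
    finally show ?thesis .
  qed
  then show ?thesis
    by (intro superpoly_mono[OF superpoly_add[OF superpoly_weighted_score superpoly_weighted_increment]])
       (auto simp: eventually_sequentially)
qed

end

section \<open>From the nets to all parameters and levels\<close>

lemma norm_le_card_times:
  fixes x :: "real ^ 'd"
  assumes "\<And>k. \<bar>x $ k\<bar> \<le> t"
  shows "norm x \<le> real CARD('d) * t"
proof -
  have "norm x \<le> (\<Sum>k\<in>UNIV. \<bar>x $ k\<bar>)" by (rule norm_le_l1_cart)
  also have "\<dots> \<le> (\<Sum>k\<in>(UNIV :: 'd set). t)" by (intro sum_mono assms)
  finally show ?thesis by simp
qed

lemma expectation_component:
  fixes g :: "'a \<Rightarrow> real ^ 'd"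
  assumes "integrable M g"
  shows "(\<integral>w. g w \<partial>M) $ k = (\<integral>w. g w $ k \<partial>M)"
  using integral_bounded_linear[OF bounded_linear_vec_nth assms, of k] by simp

context wild_grid
begin

text \<open>In units of \<open>n powr sx\<close>, \<open>Kb\<close> bounds the number of residuals
  in a band of half-width \<open>R / n\<close> and \<open>Kd\<close> the resulting discretization
  error of a sum of scores; \<open>Ke\<close> bounds the expected error. \<open>K1\<close>,
  \<open>K3\<close> and \<open>K5\<close> are the resulting constants for scores and their
  increments, for products, and for weighted sums.\<close>

definition Kb :: real where "Kb = 2 * real c_max + 2 * real c_max * R * Cf"
definition Kd :: real where "Kd = R * (real c_max + Kb)"
definition Ke :: real where "Ke = SB * (1 + 2 * R * Cf)"
definition K1 :: real where "K1 = real CARD('d) + 2 * Kd + 2 * Ke"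
definition K3 :: real where "K3 = 1 + 2 * SB * Kd + 2 * SB * Ke"
definition K5 :: real where "K5 = real CARD('d) + 4 * Kd"

lemma K_nonneg: "0 \<le> Kb" "0 \<le> Kd" "0 \<le> Ke" "0 \<le> K1" "0 \<le> K3" "0 \<le> K5"
proof -
  show b: "0 \<le> Kb" using R_pos Cf_nonneg by (simp add: Kb_def)
  then show d: "0 \<le> Kd" using R_pos by (simp add: Kd_def)
  show e: "0 \<le> Ke" using R_pos Cf_nonneg by (simp add: Ke_def)
  show "0 \<le> K1" "0 \<le> K3" "0 \<le> K5" using d e SB_ge by (simp_all add: K1_def K3_def K5_def)
qed

lemma powr_ge_1: "n \<ge> 1 \<Longrightarrow> 0 \<le> a \<Longrightarrow> 1 \<le> real n powr a"
  by (simp add: ge_one_powr_ge_zero)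

lemma powr_le: "n \<ge> 1 \<Longrightarrow> a \<le> b \<Longrightarrow> real n powr a \<le> real n powr b"
  by (simp add: powr_mono)

context
  fixes n :: nat and w :: 'a
  assumes n: "n \<ge> 1" and good: "w \<in> data_good n"
begin

lemma good_ok: "i \<in> {1..n} \<Longrightarrow> okX i w"
  using good by (auto simp: data_good_def)

lemma band_sum_le:
  assumes "g \<in> G n"
  shows "(\<Sum>i=1..n. band i g (R / real n) w) \<le> Kb * real n powr sx"
proof -
  have "(\<Sum>i=1..n. band i g (R / real n) w) = (\<Sum>i=1..n. band i g (R / real n) w - expectation (band i g (R / real n))) + (\<Sum>i=1..n. expectation (band i g (R / real n)))"
    by (simp add: sum_subtractf)
  also have "\<dots> \<le> 2 * real c_max * real n powr sx + (\<Sum>i=1..n. real c_max * (2 * (R / real n) * Cf))"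
  proof (rule add_mono)
    have "\<bar>\<Sum>i=1..n. band i g (R / real n) w - expectation (band i g (R / real n))\<bar> \<le> 2 * real c_max * real n powr sx"
      using good assms by (auto simp: data_good_def)
    then show "(\<Sum>i=1..n. band i g (R / real n) w - expectation (band i g (R / real n))) \<le> 2 * real c_max * real n powr sx" by linarith
    show "(\<Sum>i=1..n. expectation (band i g (R / real n))) \<le> (\<Sum>i=1..n. real c_max * (2 * (R / real n) * Cf))"
      using R_pos by (intro sum_mono expectation_band_le) auto
  qed
  also have "(\<Sum>i=1..n. real c_max * (2 * (R / real n) * Cf)) = 2 * real c_max * R * Cf * 1"
    using n by simp
  also have "2 * real c_max * R * Cf * 1 \<le> 2 * real c_max * R * Cf * real n powr sx"
    using R_pos Cf_nonneg powr_ge_1[OF n, of sx] sx_bounds by (intro mult_left_mono) auto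
  finally show ?thesis by (simp add: Kb_def algebra_simps)
qed

text \<open>Apart from the change of the level, moving \<open>b\<close> to a net point at distance
  \<open>1 / n\<close> affects only scores whose residual lies in the band, and on
  \<open>data_good\<close> there are at most of order \<open>n powr sx\<close> of these. The net
  error is therefore far below the fluctuations of order \<open>sqrt n\<close>.\<close>

lemma disc_sum_le:
  assumes "g \<in> G n" "norm (b - g) \<le> 1 / real n" "\<bar>t - u\<bar> \<le> 1 / real n"
  shows "(\<Sum>i=1..n. norm (cscore i b t w - cscore i g u w)) \<le> Kd * real n powr sx"
proof -
  have "(\<Sum>i=1..n. norm (cscore i b t w - cscore i g u w)) \<le> (\<Sum>i=1..n. R * (real c_max * (1 / real n) + band i g (R / real n) w))"
  proof (rule sum_mono)
    fix i assume i: "i \<in> {1..n}"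
    have "R * norm (b - g) \<le> R / real n" using assms(2) R_pos mult_left_mono[OF assms(2), of R] by simp
    then have "norm (cscore i b t w - cscore i g u w) \<le> R * (real c_max * \<bar>t - u\<bar> + band i g (R / real n) w)"
      using i good_ok by (intro cscore_increment) auto
    also have "\<dots> \<le> R * (real c_max * (1 / real n) + band i g (R / real n) w)"
      using assms(3) R_pos by (intro mult_left_mono add_mono) auto
    finally show "norm (cscore i b t w - cscore i g u w) \<le> R * (real c_max * (1 / real n) + band i g (R / real n) w)" .
  qed
  also have "\<dots> = R * (real c_max * 1 + (\<Sum>i=1..n. band i g (R / real n) w))"
    using n by (simp add: sum_distrib_left[symmetric] sum.distrib)
  also have "\<dots> \<le> R * (real c_max * real n powr sx + Kb * real n powr sx)"
    using R_pos powr_ge_1[OF n, of sx] sx_bounds by (intro mult_left_mono add_mono band_sum_le assms(1)) auto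
  finally show ?thesis by (simp add: Kd_def algebra_simps)
qed

lemma disc_expectation_le:
  assumes "norm (b - g) \<le> 1 / real n" "\<bar>t - u\<bar> \<le> 1 / real n" "t \<in> {0..1}" "u \<in> {0..1}"
  shows "(\<Sum>i=1..n. expectation (\<lambda>w. norm (cscore i b t w - cscore i g u w))) \<le> Ke"
proof -
  have "(\<Sum>i=1..n. expectation (\<lambda>w. norm (cscore i b t w - cscore i g u w))) \<le> (\<Sum>i=1..n. SB * (1 / real n + 2 * R * Cf * (1 / real n)))"
  proof (rule sum_mono)
    fix i assume "i \<in> {1..n}"
    then have "expectation (\<lambda>w. norm (cscore i b t w - cscore i g u w)) \<le> SB * (\<bar>t - u\<bar> + 2 * R * Cf * norm (b - g))"
      using assms by (intro cscore_increment_expectation) auto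
    also have "\<dots> \<le> SB * (1 / real n + 2 * R * Cf * (1 / real n))"
      using assms SB_ge R_pos Cf_nonneg by (intro mult_left_mono[of _ _ SB] add_mono mult_left_mono[of "norm (b - g)"]) auto
    finally show "expectation (\<lambda>w. norm (cscore i b t w - cscore i g u w)) \<le> SB * (1 / real n + 2 * R * Cf * (1 / real n))" .
  qed
  also have "\<dots> = Ke" using n by (simp add: Ke_def field_simps)
  finally show ?thesis .
qed

lemma disc_mean_le:
  assumes "norm (b - g) \<le> 1 / real n" "\<bar>t - u\<bar> \<le> 1 / real n" "t \<in> {0..1}" "u \<in> {0..1}"
  shows "(\<Sum>i=1..n. norm (expectation (cscore i b t) - expectation (cscore i g u))) \<le> Ke"
proof (rule order_trans[OF sum_mono disc_expectation_le[OF assms]])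
  fix i assume "i \<in> {1..n}"
  then have "expectation (cscore i b t) - expectation (cscore i g u) = expectation (\<lambda>w. cscore i b t w - cscore i g u w)"
    using assms cscore_integrable by (intro Bochner_Integration.integral_diff[symmetric]) auto
  then show "norm (expectation (cscore i b t) - expectation (cscore i g u)) \<le> expectation (\<lambda>w. norm (cscore i b t w - cscore i g u w))"
    using integral_norm_bound[of M "\<lambda>w. cscore i b t w - cscore i g u w"] by (simp only:)
qed

lemma grid_point:
  assumes "b \<in> B" "t \<in> {0..1}"
  obtains g u where "g \<in> G n" "u \<in> TG n" "norm (b - g) \<le> 1 / real n" "\<bar>t - u\<bar> \<le> 1 / real n" "u \<in> {0..1}"
  using G_net[OF n assms(1)] TG_net[OF n assms(2)] TG_unit[OF n] by blast

lemma norm_sum_disc: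
  fixes a a' :: "nat \<Rightarrow> real ^ 'd"
  assumes "(\<Sum>i=1..n. norm (a i - a' i)) \<le> D"
  shows "norm (\<Sum>i=1..n. a i) \<le> norm (\<Sum>i=1..n. a' i) + D"
proof -
  have "(\<Sum>i=1..n. a i) = (\<Sum>i=1..n. a' i) + (\<Sum>i=1..n. a i - a' i)" by (simp add: sum_subtractf)
  also have "norm \<dots> \<le> norm (\<Sum>i=1..n. a' i) + norm (\<Sum>i=1..n. a i - a' i)" by (rule norm_triangle_ineq)
  also have "norm (\<Sum>i=1..n. a i - a' i) \<le> (\<Sum>i=1..n. norm (a i - a' i))" by (rule norm_sum)
  finally show ?thesis using assms by simp
qed

lemma score_deviation:
  assumes "b \<in> B" "t \<in> {0..1}"
  shows "norm (\<Sum>i=1..n. cscore i b t w - expectation (cscore i b t)) \<le> K1 * real n powr (1/2 + sx)"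
proof -
  obtain g u where g: "g \<in> G n" "u \<in> TG n" "norm (b - g) \<le> 1 / real n" "\<bar>t - u\<bar> \<le> 1 / real n" "u \<in> {0..1}"
    by (rule grid_point[OF assms])
  have "norm (\<Sum>i=1..n. cscore i g u w - expectation (cscore i g u)) \<le> real CARD('d) * real n powr (1/2 + sx)"
  proof (rule norm_le_card_times)
    fix k :: 'd
    have "((g, u), k) \<in> Theta n \<times> UNIV" using g by auto
    then have "\<bar>\<Sum>i=1..n. S_at ((g, u), k) i w - expectation (S_at ((g, u), k) i)\<bar> \<le> real n powr (1/2 + sx)"
      using good unfolding data_good_def by blast
    moreover have "(\<Sum>i=1..n. cscore i g u w - expectation (cscore i g u)) $ k = (\<Sum>i=1..n. S_at ((g, u), k) i w - expectation (S_at ((g, u), k) i))"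
      using cscore_integrable g by (simp add: expectation_component)
    ultimately show "\<bar>(\<Sum>i=1..n. cscore i g u w - expectation (cscore i g u)) $ k\<bar> \<le> real n powr (1/2 + sx)" by simp
  qed
  moreover have "norm (\<Sum>i=1..n. cscore i b t w - expectation (cscore i b t)) \<le> norm (\<Sum>i=1..n. cscore i g u w - expectation (cscore i g u)) + (Kd * real n powr sx + Ke)"
  proof (rule norm_sum_disc)
    have "(\<Sum>i=1..n. norm ((cscore i b t w - expectation (cscore i b t)) - (cscore i g u w - expectation (cscore i g u))))
      \<le> (\<Sum>i=1..n. norm (cscore i b t w - cscore i g u w) + norm (expectation (cscore i b t) - expectation (cscore i g u)))"
    proof (rule sum_mono)
      fix i
      have "(cscore i b t w - expectation (cscore i b t)) - (cscore i g u w - expectation (cscore i g u)) = (cscore i b t w - cscore i g u w) - (expectation (cscore i b t) - expectation (cscore i g u))" by simp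
      then show "norm ((cscore i b t w - expectation (cscore i b t)) - (cscore i g u w - expectation (cscore i g u))) \<le> norm (cscore i b t w - cscore i g u w) + norm (expectation (cscore i b t) - expectation (cscore i g u))"
        by (simp only: norm_triangle_ineq4)
    qed
    also have "\<dots> \<le> Kd * real n powr sx + Ke"
      unfolding sum.distrib using g assms by (intro add_mono disc_sum_le disc_mean_le) auto
    finally show "(\<Sum>i=1..n. norm ((cscore i b t w - expectation (cscore i b t)) - (cscore i g u w - expectation (cscore i g u)))) \<le> Kd * real n powr sx + Ke" .
  qed
  moreover have "Kd * real n powr sx + Ke * 1 \<le> Kd * real n powr (1/2 + sx) + Ke * real n powr (1/2 + sx)"
    using K_nonneg powr_le[OF n, of sx "1/2 + sx"] powr_ge_1[OF n, of "1/2 + sx"] sx_bounds by (intro add_mono mult_left_mono) auto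
  moreover have "0 \<le> (Kd + Ke) * real n powr (1/2 + sx)" using K_nonneg by simp
  ultimately have "norm (\<Sum>i=1..n. cscore i b t w - expectation (cscore i b t)) \<le> (real CARD('d) + Kd + Ke) * real n powr (1/2 + sx) + (Kd + Ke) * real n powr (1/2 + sx)"
    by (simp add: algebra_simps)
  then show ?thesis by (simp add: K1_def algebra_simps)
qed

lemma near_grid:
  assumes "norm (b - b') \<le> real n powr (- 1/4)" "norm (b - g) \<le> 1 / real n" "norm (b' - g') \<le> 1 / real n"
    "g \<in> G n" "g' \<in> G n" "u \<in> TG n"
  shows "(g, g', u) \<in> Near n"
proof -
  have "g - g' = (b - b') - (b - g) + (b' - g')" by simp
  also have "norm \<dots> \<le> norm (b - b') + norm (b - g) + norm (b' - g')"
    by (intro order_trans[OF norm_triangle_ineq] add_mono norm_triangle_ineq4 order_refl)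
  also have "\<dots> \<le> real n powr (- 1/4) + 1 / real n + 1 / real n" using assms by simp
  also have "1 / real n = real n powr (- 1)" using n by (simp add: powr_minus divide_inverse)
  also have "real n powr (- 1) \<le> real n powr (- 1/4)" by (rule powr_le[OF n]) simp
  finally show ?thesis using assms by (simp add: Near_def)
qed

lemma increment_deviation:
  assumes "b \<in> B" "b' \<in> B" "norm (b - b') \<le> real n powr (- 1/4)" "t \<in> {0..1}"
  shows "norm (\<Sum>i=1..n. (cscore i b t w - cscore i b' t w) - (expectation (cscore i b t) - expectation (cscore i b' t))) \<le> K1 * real n powr (1/2 - sx)"
proof -
  obtain g u where g: "g \<in> G n" "u \<in> TG n" "norm (b - g) \<le> 1 / real n" "\<bar>t - u\<bar> \<le> 1 / real n" "u \<in> {0..1}"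
    by (rule grid_point[OF assms(1,4)])
  obtain g' where g': "g' \<in> G n" "norm (b' - g') \<le> 1 / real n" using G_net[OF n assms(2)] by blast
  have N: "(g, g', u) \<in> Near n" by (rule near_grid) (use assms g g' in auto)
  let ?D = "\<lambda>b b' t i. (cscore i b t w - cscore i b' t w) - (expectation (cscore i b t) - expectation (cscore i b' t))"
  have "norm (\<Sum>i=1..n. ?D g g' u i) \<le> real CARD('d) * real n powr (1/2 - sx)"
  proof (rule norm_le_card_times)
    fix k :: 'd
    have "((g, g', u), k) \<in> Near n \<times> UNIV" using N by auto
    then have "\<bar>\<Sum>i=1..n. D_at ((g, g', u), k) i w - expectation (D_at ((g, g', u), k) i)\<bar> \<le> real n powr (1/2 - sx)"
      using good unfolding data_good_def by blast
    moreover have "(\<Sum>i=1..n. ?D g g' u i) $ k = (\<Sum>i=1..n. D_at ((g, g', u), k) i w - expectation (D_at ((g, g', u), k) i))"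
      using cscore_integrable component_integrable g by (simp add: expectation_component)
    ultimately show "\<bar>(\<Sum>i=1..n. ?D g g' u i) $ k\<bar> \<le> real n powr (1/2 - sx)" by simp
  qed
  moreover have "norm (\<Sum>i=1..n. ?D b b' t i) \<le> norm (\<Sum>i=1..n. ?D g g' u i) + ((Kd * real n powr sx + Kd * real n powr sx) + (Ke + Ke))"
  proof (rule norm_sum_disc)
    have "(\<Sum>i=1..n. norm (?D b b' t i - ?D g g' u i))
      \<le> (\<Sum>i=1..n. (norm (cscore i b t w - cscore i g u w) + norm (cscore i b' t w - cscore i g' u w))
          + (norm (expectation (cscore i b t) - expectation (cscore i g u)) + norm (expectation (cscore i b' t) - expectation (cscore i g' u))))"
    proof (rule sum_mono)
      fix i
      have "?D b b' t i - ?D g g' u i = ((cscore i b t w - cscore i g u w) - (cscore i b' t w - cscore i g' u w))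
          - ((expectation (cscore i b t) - expectation (cscore i g u)) - (expectation (cscore i b' t) - expectation (cscore i g' u)))" by simp
      then show "norm (?D b b' t i - ?D g g' u i) \<le> (norm (cscore i b t w - cscore i g u w) + norm (cscore i b' t w - cscore i g' u w))
          + (norm (expectation (cscore i b t) - expectation (cscore i g u)) + norm (expectation (cscore i b' t) - expectation (cscore i g' u)))"
        by (simp only:) (intro order_trans[OF norm_triangle_ineq4] add_mono norm_triangle_ineq4)
    qed
    also have "\<dots> \<le> (Kd * real n powr sx + Kd * real n powr sx) + (Ke + Ke)"
      unfolding sum.distrib using g g' assms by (intro add_mono disc_sum_le disc_mean_le) auto
    finally show "(\<Sum>i=1..n. norm (?D b b' t i - ?D g g' u i)) \<le> (Kd * real n powr sx + Kd * real n powr sx) + (Ke + Ke)" .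
  qed
  \<comment> \<open>The discretization error stays within the target because
    \<open>sx \<le> 1/2 - sx\<close>.\<close>
  moreover have "2 * Kd * real n powr sx + 2 * Ke * 1 \<le> 2 * Kd * real n powr (1/2 - sx) + 2 * Ke * real n powr (1/2 - sx)"
    using K_nonneg powr_le[OF n, of sx "1/2 - sx"] powr_ge_1[OF n, of "1/2 - sx"] sx_bounds by (intro add_mono mult_left_mono) auto
  ultimately show ?thesis by (simp add: K1_def algebra_simps)
qed

lemma product_deviation:
  assumes "b \<in> B" "b' \<in> B" "t \<in> {0..1}" "t' \<in> {0..1}"
  shows "\<bar>\<Sum>i=1..n. cscore i b t w $ k * cscore i b' t' w $ l - expectation (\<lambda>w. cscore i b t w $ k * cscore i b' t' w $ l)\<bar> \<le> K3 * real n powr (1/2 + sx)"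
proof -
  obtain g u where g: "g \<in> G n" "u \<in> TG n" "norm (b - g) \<le> 1 / real n" "\<bar>t - u\<bar> \<le> 1 / real n" "u \<in> {0..1}"
    by (rule grid_point[OF assms(1,3)])
  obtain g' u' where g': "g' \<in> G n" "u' \<in> TG n" "norm (b' - g') \<le> 1 / real n" "\<bar>t' - u'\<bar> \<le> 1 / real n" "u' \<in> {0..1}"
    by (rule grid_point[OF assms(2,4)])
  let ?P = "\<lambda>b t b' t' i w. cscore i b t w $ k * cscore i b' t' w $ l"
  have prod_diff: "\<bar>?P b t b' t' i w - ?P g u g' u' i w\<bar> \<le> SB * norm (cscore i b t w - cscore i g u w) + SB * norm (cscore i b' t' w - cscore i g' u' w)"
    if i: "i \<ge> 1" and ok: "okX i w" for i w
  proof -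
    have c1: "\<bar>cscore i b' t' w $ l\<bar> \<le> SB" "\<bar>cscore i g u w $ k\<bar> \<le> SB"
      using norm_cscore_le[OF i ok] assms g by (auto intro: order_trans[OF component_le_norm_cart])
    have c2: "\<bar>cscore i b t w $ k - cscore i g u w $ k\<bar> \<le> norm (cscore i b t w - cscore i g u w)"
      "\<bar>cscore i b' t' w $ l - cscore i g' u' w $ l\<bar> \<le> norm (cscore i b' t' w - cscore i g' u' w)"
      using component_le_norm_cart[of "cscore i b t w - cscore i g u w" k] component_le_norm_cart[of "cscore i b' t' w - cscore i g' u' w" l] by auto
    define x y x' y' where xy: "x = cscore i b t w $ k" "y = cscore i b' t' w $ l" "x' = cscore i g u w $ k" "y' = cscore i g' u' w $ l"
    have "x * y - x' * y' = (x - x') * y + x' * (y - y')" by (simp add: algebra_simps)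
    then have "\<bar>x * y - x' * y'\<bar> \<le> \<bar>x - x'\<bar> * \<bar>y\<bar> + \<bar>x'\<bar> * \<bar>y - y'\<bar>"
      using abs_triangle_ineq[of "(x - x') * y" "x' * (y - y')"] by (simp add: abs_mult)
    also have "\<dots> \<le> norm (cscore i b t w - cscore i g u w) * SB + SB * norm (cscore i b' t' w - cscore i g' u' w)"
      unfolding xy using c1 c2 SB_ge by (intro add_mono mult_mono) auto
    finally show ?thesis unfolding xy by (simp add: mult.commute)
  qed
  have Pint: "integrable M (?P b t b' t' i)" if "i \<ge> 1" "t \<in> {0..1}" "t' \<in> {0..1}" for i b t b' t'
  proof (rule integrable_const_bound[where B="SB * SB"])
    show "AE w in M. norm (?P b t b' t' i w) \<le> SB * SB"
      using component_bound(1)[OF that(1,2), of b k] component_bound(1)[OF that(1,3), of b' l]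
    proof eventually_elim
      case (elim w)
      then show ?case unfolding real_norm_def abs_mult using SB_ge by (intro mult_mono) auto
    qed
  qed (use that component_bound(3) in \<open>auto intro!: borel_measurable_times\<close>)
  define a where "a i = ?P b t b' t' i w - expectation (?P b t b' t' i)" for i
  define a' where "a' i = ?P g u g' u' i w - expectation (?P g u g' u' i)" for i
  have "(((g, u), k), ((g', u'), l)) \<in> (Theta n \<times> UNIV) \<times> (Theta n \<times> UNIV)" using g g' by auto
  then have "\<bar>\<Sum>i=1..n. S_at (fst (((g, u), k), ((g', u'), l))) i w * S_at (snd (((g, u), k), ((g', u'), l))) i w - expectation (\<lambda>w. S_at (fst (((g, u), k), ((g', u'), l))) i w * S_at (snd (((g, u), k), ((g', u'), l))) i w)\<bar> \<le> real n powr (1/2 + sx)"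
    using good unfolding data_good_def by blast
  then have a': "\<bar>\<Sum>i=1..n. a' i\<bar> \<le> real n powr (1/2 + sx)" by (simp add: a'_def)
  have "(\<Sum>i=1..n. \<bar>a i - a' i\<bar>) \<le> (\<Sum>i=1..n. (SB * norm (cscore i b t w - cscore i g u w) + SB * norm (cscore i b' t' w - cscore i g' u' w))
     + (SB * expectation (\<lambda>w. norm (cscore i b t w - cscore i g u w)) + SB * expectation (\<lambda>w. norm (cscore i b' t' w - cscore i g' u' w))))"
  proof (rule sum_mono)
    fix i assume i: "i \<in> {1..n}"
    then have i1: "i \<ge> 1" by simp
    have "\<bar>expectation (?P b t b' t' i) - expectation (?P g u g' u' i)\<bar> = \<bar>expectation (\<lambda>w. ?P b t b' t' i w - ?P g u g' u' i w)\<bar>"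
      using Pint[OF i1] assms g g' by simp
    also have "\<dots> \<le> expectation (\<lambda>w. \<bar>?P b t b' t' i w - ?P g u g' u' i w\<bar>)" by (rule integral_abs_bound)
    also have "\<dots> \<le> expectation (\<lambda>w. SB * norm (cscore i b t w - cscore i g u w) + SB * norm (cscore i b' t' w - cscore i g' u' w))"
    proof (rule integral_mono_AE)
      show "AE w in M. \<bar>?P b t b' t' i w - ?P g u g' u' i w\<bar> \<le> SB * norm (cscore i b t w - cscore i g u w) + SB * norm (cscore i b' t' w - cscore i g' u' w)"
        using AE_okX[OF i1] by eventually_elim (rule prod_diff[OF i1])
    qed (use Pint[OF i1] cscore_integrable[OF i1] assms g g' in auto)
    also have "\<dots> = SB * expectation (\<lambda>w. norm (cscore i b t w - cscore i g u w)) + SB * expectation (\<lambda>w. norm (cscore i b' t' w - cscore i g' u' w))"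
      using cscore_integrable[OF i1] assms g g' by simp
    finally have e: "\<bar>expectation (?P b t b' t' i) - expectation (?P g u g' u' i)\<bar> \<le> SB * expectation (\<lambda>w. norm (cscore i b t w - cscore i g u w)) + SB * expectation (\<lambda>w. norm (cscore i b' t' w - cscore i g' u' w))" .
    have "\<bar>a i - a' i\<bar> \<le> \<bar>?P b t b' t' i w - ?P g u g' u' i w\<bar> + \<bar>expectation (?P b t b' t' i) - expectation (?P g u g' u' i)\<bar>"
      unfolding a_def a'_def by linarith
    with e prod_diff[OF i1 good_ok[OF i]]
    show "\<bar>a i - a' i\<bar> \<le> (SB * norm (cscore i b t w - cscore i g u w) + SB * norm (cscore i b' t' w - cscore i g' u' w))
     + (SB * expectation (\<lambda>w. norm (cscore i b t w - cscore i g u w)) + SB * expectation (\<lambda>w. norm (cscore i b' t' w - cscore i g' u' w)))" by linarith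
  qed
  also have "\<dots> \<le> (SB * (Kd * real n powr sx) + SB * (Kd * real n powr sx)) + (SB * Ke + SB * Ke)"
    unfolding sum.distrib sum_distrib_left[symmetric] using g g' assms SB_ge
    by (intro add_mono mult_left_mono disc_sum_le disc_expectation_le) auto
  finally have d: "(\<Sum>i=1..n. \<bar>a i - a' i\<bar>) \<le> 2 * SB * Kd * real n powr sx + 2 * SB * Ke * 1" by (simp add: algebra_simps)
  also have "\<dots> \<le> 2 * SB * Kd * real n powr (1/2 + sx) + 2 * SB * Ke * real n powr (1/2 + sx)"
    using K_nonneg SB_ge powr_le[OF n, of sx "1/2 + sx"] powr_ge_1[OF n, of "1/2 + sx"] sx_bounds by (intro add_mono mult_left_mono) auto
  finally have d: "(\<Sum>i=1..n. \<bar>a i - a' i\<bar>) \<le> 2 * SB * Kd * real n powr (1/2 + sx) + 2 * SB * Ke * real n powr (1/2 + sx)" .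
  have "(\<Sum>i=1..n. a i) = (\<Sum>i=1..n. a' i) + (\<Sum>i=1..n. a i - a' i)" by (simp add: sum_subtractf)
  then have "\<bar>\<Sum>i=1..n. a i\<bar> \<le> \<bar>\<Sum>i=1..n. a' i\<bar> + (\<Sum>i=1..n. \<bar>a i - a' i\<bar>)"
    using sum_abs[of "\<lambda>i. a i - a' i" "{1..n}"] by linarith
  with a' d show ?thesis by (simp add: a_def K3_def algebra_simps)
qed

lemma tw_bound: "\<bar>tw n i w'\<bar> \<le> 2 * real n powr gam"
  by (rule trunc_bound) simp

lemma weighted_disc:
  fixes a :: "nat \<Rightarrow> real ^ 'd"
  shows "(\<Sum>i=1..n. norm (tw n i w *\<^sub>R a i)) \<le> 2 * real n powr gam * (\<Sum>i=1..n. norm (a i))"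
  unfolding sum_distrib_left norm_scaleR by (intro sum_mono mult_right_mono tw_bound) simp

lemma weighted_score_bound:
  assumes wg: "w \<in> weight_good n" and "b \<in> B" "t \<in> {0..1}"
  shows "norm (\<Sum>i=1..n. tw n i w *\<^sub>R cscore i b t w) \<le> K5 * real n powr (1/2 + sx)"
proof -
  obtain g u where g: "g \<in> G n" "u \<in> TG n" "norm (b - g) \<le> 1 / real n" "\<bar>t - u\<bar> \<le> 1 / real n" "u \<in> {0..1}"
    by (rule grid_point[OF assms(2,3)])
  have "norm (\<Sum>i=1..n. tw n i w *\<^sub>R cscore i g u w) \<le> real CARD('d) * real n powr (1/2 + sx)"
  proof (rule norm_le_card_times)
    fix k :: 'd
    have "((g, u), k) \<in> Theta n \<times> UNIV" using g by auto
    then have "\<bar>\<Sum>i=1..n. tw n i w * S_at ((g, u), k) i w\<bar> \<le> real n powr (1/2 + sx)"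
      using wg unfolding weight_good_def by blast
    then show "\<bar>(\<Sum>i=1..n. tw n i w *\<^sub>R cscore i g u w) $ k\<bar> \<le> real n powr (1/2 + sx)" by simp
  qed
  moreover have "norm (\<Sum>i=1..n. tw n i w *\<^sub>R cscore i b t w) \<le> norm (\<Sum>i=1..n. tw n i w *\<^sub>R cscore i g u w) + 2 * real n powr gam * (Kd * real n powr sx)"
  proof (rule norm_sum_disc)
    have "(\<Sum>i=1..n. norm (tw n i w *\<^sub>R cscore i b t w - tw n i w *\<^sub>R cscore i g u w)) \<le> 2 * real n powr gam * (\<Sum>i=1..n. norm (cscore i b t w - cscore i g u w))"
      unfolding scaleR_diff_right[symmetric] by (rule weighted_disc)
    also have "\<dots> \<le> 2 * real n powr gam * (Kd * real n powr sx)"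
      by (intro mult_left_mono disc_sum_le g) simp
    finally show "(\<Sum>i=1..n. norm (tw n i w *\<^sub>R cscore i b t w - tw n i w *\<^sub>R cscore i g u w)) \<le> 2 * real n powr gam * (Kd * real n powr sx)" .
  qed
  moreover have "2 * real n powr gam * (Kd * real n powr sx) \<le> 4 * Kd * real n powr (1/2 + sx)"
  proof -
    have "2 * real n powr gam * (Kd * real n powr sx) = 2 * Kd * real n powr (gam + sx)" by (simp add: powr_add)
    also have "\<dots> \<le> 4 * Kd * real n powr (1/2 + sx)"
      using K_nonneg gam_bounds by (intro mult_mono powr_le n) auto
    finally show ?thesis .
  qed
  ultimately show ?thesis by (simp add: K5_def algebra_simps)
qed

lemma weighted_increment_bound:
  assumes wg: "w \<in> weight_good n" and "b \<in> B" "b' \<in> B" "norm (b - b') \<le> real n powr (- 1/4)" "t \<in> {0..1}"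
  shows "norm (\<Sum>i=1..n. tw n i w *\<^sub>R (cscore i b t w - cscore i b' t w)) \<le> K5 * real n powr (1/2 - sx)"
proof -
  obtain g u where g: "g \<in> G n" "u \<in> TG n" "norm (b - g) \<le> 1 / real n" "\<bar>t - u\<bar> \<le> 1 / real n" "u \<in> {0..1}"
    by (rule grid_point[OF assms(2,5)])
  obtain g' where g': "g' \<in> G n" "norm (b' - g') \<le> 1 / real n" using G_net[OF n assms(3)] by blast
  have N: "(g, g', u) \<in> Near n" by (rule near_grid) (use assms g g' in auto)
  have "norm (\<Sum>i=1..n. tw n i w *\<^sub>R (cscore i g u w - cscore i g' u w)) \<le> real CARD('d) * real n powr (1/2 - sx)"
  proof (rule norm_le_card_times)
    fix k :: 'd
    have "((g, g', u), k) \<in> Near n \<times> UNIV" using N by auto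
    then have "\<bar>\<Sum>i=1..n. tw n i w * D_at ((g, g', u), k) i w\<bar> \<le> real n powr (1/2 - sx)"
      using wg unfolding weight_good_def by blast
    then show "\<bar>(\<Sum>i=1..n. tw n i w *\<^sub>R (cscore i g u w - cscore i g' u w)) $ k\<bar> \<le> real n powr (1/2 - sx)" by simp
  qed
  moreover have "norm (\<Sum>i=1..n. tw n i w *\<^sub>R (cscore i b t w - cscore i b' t w)) \<le> norm (\<Sum>i=1..n. tw n i w *\<^sub>R (cscore i g u w - cscore i g' u w)) + 2 * real n powr gam * (Kd * real n powr sx + Kd * real n powr sx)"
  proof (rule norm_sum_disc)
    have "(\<Sum>i=1..n. norm (tw n i w *\<^sub>R (cscore i b t w - cscore i b' t w) - tw n i w *\<^sub>R (cscore i g u w - cscore i g' u w)))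
      \<le> 2 * real n powr gam * (\<Sum>i=1..n. norm ((cscore i b t w - cscore i b' t w) - (cscore i g u w - cscore i g' u w)))"
      unfolding scaleR_diff_right[symmetric] by (rule weighted_disc)
    also have "\<dots> \<le> 2 * real n powr gam * (\<Sum>i=1..n. norm (cscore i b t w - cscore i g u w) + norm (cscore i b' t w - cscore i g' u w))"
    proof (intro mult_left_mono sum_mono)
      fix i
      have "(cscore i b t w - cscore i b' t w) - (cscore i g u w - cscore i g' u w) = (cscore i b t w - cscore i g u w) - (cscore i b' t w - cscore i g' u w)" by simp
      then show "norm ((cscore i b t w - cscore i b' t w) - (cscore i g u w - cscore i g' u w)) \<le> norm (cscore i b t w - cscore i g u w) + norm (cscore i b' t w - cscore i g' u w)"
        by (simp only: norm_triangle_ineq4)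
    qed simp
    also have "\<dots> \<le> 2 * real n powr gam * (Kd * real n powr sx + Kd * real n powr sx)"
      unfolding sum.distrib using g g' by (intro mult_left_mono add_mono disc_sum_le) auto
    finally show "(\<Sum>i=1..n. norm (tw n i w *\<^sub>R (cscore i b t w - cscore i b' t w) - tw n i w *\<^sub>R (cscore i g u w - cscore i g' u w)))
      \<le> 2 * real n powr gam * (Kd * real n powr sx + Kd * real n powr sx)" .
  qed
  \<comment> \<open>The weights multiply the discretization error by \<open>n powr gam\<close>. The
    slack \<open>sx\<close> was chosen small enough relative to \<open>1/2 - gam\<close> for
    \<open>gam + sx\<close> to stay below \<open>1/2 - sx\<close>.\<close>
  moreover have "2 * real n powr gam * (Kd * real n powr sx + Kd * real n powr sx) \<le> 4 * Kd * real n powr (1/2 - sx)"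
  proof -
    have "2 * real n powr gam * (Kd * real n powr sx + Kd * real n powr sx) = 4 * Kd * real n powr (gam + sx)" by (simp add: powr_add algebra_simps)
    also have "\<dots> \<le> 4 * Kd * real n powr (1/2 - sx)"
      using K_nonneg sx_bounds by (intro mult_left_mono powr_le n) auto
    finally show ?thesis .
  qed
  ultimately show ?thesis by (simp add: K5_def algebra_simps)
qed

end

end

section \<open>Bahadur representation\<close>

context wild_grid
begin

abbreviation Wn :: "nat \<Rightarrow> 'a \<Rightarrow> real ^ 'd \<Rightarrow> real \<Rightarrow> real ^ 'd" where
  "Wn n w b t \<equiv> wild_gradient c Y X W n w b t"

lemma Wn_eq: "Wn n w b t = (1 / sqrt (real n)) *\<^sub>R (\<Sum>i=1..n. W i w *\<^sub>R cscore i b t w)"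
  by (simp add: wild_gradient_def cscore_def score_def)

text \<open>The contribution of the truncation to the wild gradient.\<close>

definition Qn :: "nat \<Rightarrow> 'a \<Rightarrow> real" where
  "Qn n w = (1 / sqrt (real n)) * (\<Sum>i=1..n. \<bar>W i w - tw n i w\<bar>)"

lemma Qn_nonneg: "0 \<le> Qn n w" by (auto simp: Qn_def intro!: mult_nonneg_nonneg sum_nonneg)

context
  fixes n :: nat and w :: 'a
  assumes n: "n \<ge> 1" and good: "w \<in> data_good n"
begin

text \<open>The discarded part of the weights is estimated in absolute value, so its contribution
  depends on the parameter and the level only through the bound \<open>A\<close>.\<close>

lemma truncation_error:
  assumes "\<And>i. i \<in> {1..n} \<Longrightarrow> norm (a i) \<le> A"
  shows "norm ((1 / sqrt (real n)) *\<^sub>R (\<Sum>i=1..n. W i w *\<^sub>R a i)) \<le> (1 / sqrt (real n)) * norm (\<Sum>i=1..n. tw n i w *\<^sub>R (a i :: real ^ 'd)) + A * Qn n w"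
proof -
  have "(\<Sum>i=1..n. W i w *\<^sub>R a i) = (\<Sum>i=1..n. tw n i w *\<^sub>R a i) + (\<Sum>i=1..n. (W i w - tw n i w) *\<^sub>R a i)"
    by (simp add: scaleR_left_diff_distrib sum_subtractf)
  then have "norm (\<Sum>i=1..n. W i w *\<^sub>R a i) \<le> norm (\<Sum>i=1..n. tw n i w *\<^sub>R a i) + norm (\<Sum>i=1..n. (W i w - tw n i w) *\<^sub>R a i)"
    by (simp only: norm_triangle_ineq)
  also have "norm (\<Sum>i=1..n. (W i w - tw n i w) *\<^sub>R a i) \<le> (\<Sum>i=1..n. \<bar>W i w - tw n i w\<bar> * A)"
    using assms by (intro order_trans[OF norm_sum] sum_mono) (auto intro!: mult_left_mono)
  also have "\<dots> = A * (\<Sum>i=1..n. \<bar>W i w - tw n i w\<bar>)" by (simp add: sum_distrib_left mult.commute)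
  finally have "(1 / sqrt (real n)) * norm (\<Sum>i=1..n. W i w *\<^sub>R a i) \<le> (1 / sqrt (real n)) * (norm (\<Sum>i=1..n. tw n i w *\<^sub>R a i) + A * (\<Sum>i=1..n. \<bar>W i w - tw n i w\<bar>))"
    by (intro mult_left_mono) auto
  then show ?thesis by (simp add: Qn_def algebra_simps)
qed

lemma sqrt_powr: "sqrt (real n) = real n powr (1/2)"
  by (simp add: powr_half_sqrt)

lemma inv_sqrt_powr: "1 / sqrt (real n) * real n powr (1/2 + a) = real n powr a"
  using n by (simp add: sqrt_powr powr_add)

lemma good_cscore_le: "t \<in> {0..1} \<Longrightarrow> i \<in> {1..n} \<Longrightarrow> norm (cscore i b t w) \<le> SB"
  using good_ok[OF n good] by (intro norm_cscore_le) auto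

lemma Wn_bound:
  assumes "w \<in> weight_good n" "b \<in> B" "t \<in> {0..1}"
  shows "norm (Wn n w b t) \<le> K5 * real n powr sx + SB * Qn n w"
proof -
  have "norm (Wn n w b t) \<le> (1 / sqrt (real n)) * norm (\<Sum>i=1..n. tw n i w *\<^sub>R cscore i b t w) + SB * Qn n w"
    unfolding Wn_eq by (rule truncation_error) (use good_cscore_le assms in auto)
  also have "\<dots> \<le> (1 / sqrt (real n)) * (K5 * real n powr (1/2 + sx)) + SB * Qn n w"
    by (intro add_mono mult_left_mono weighted_score_bound[OF n good assms]) (use SB_ge in auto)
  also have "(1 / sqrt (real n)) * (K5 * real n powr (1/2 + sx)) = K5 * real n powr sx"
    by (metis inv_sqrt_powr mult.left_commute)
  finally show ?thesis .
qed

text \<open>Fluctuations of order \<open>n powr (1/2 - sx)\<close> divided by \<open>sqrt n\<close>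
  leave a vanishing bound, up to the truncation error.\<close>

lemma Wn_increment:
  assumes "w \<in> weight_good n" "b \<in> B" "b' \<in> B" "norm (b - b') \<le> real n powr (- 1/4)" "t \<in> {0..1}"
  shows "norm (Wn n w b t - Wn n w b' t) \<le> K5 * real n powr (- sx) + 2 * SB * Qn n w"
proof -
  have e: "Wn n w b t - Wn n w b' t = (1 / sqrt (real n)) *\<^sub>R (\<Sum>i=1..n. W i w *\<^sub>R (cscore i b t w - cscore i b' t w))"
    by (simp add: Wn_eq scaleR_diff_right sum_subtractf)
  have "norm (Wn n w b t - Wn n w b' t) \<le> (1 / sqrt (real n)) * norm (\<Sum>i=1..n. tw n i w *\<^sub>R (cscore i b t w - cscore i b' t w)) + (2 * SB) * Qn n w"
    unfolding e
  proof (rule truncation_error)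
    fix i assume i: "i \<in> {1..n}"
    show "norm (cscore i b t w - cscore i b' t w) \<le> 2 * SB"
      using norm_triangle_ineq4[of "cscore i b t w" "cscore i b' t w"] good_cscore_le[OF assms(5) i, of b] good_cscore_le[OF assms(5) i, of b'] by linarith
  qed
  also have "\<dots> \<le> (1 / sqrt (real n)) * (K5 * real n powr (1/2 - sx)) + (2 * SB) * Qn n w"
    by (intro add_mono mult_left_mono weighted_increment_bound[OF n good assms]) (use SB_ge in auto)
  also have "(1 / sqrt (real n)) * (K5 * real n powr (1/2 - sx)) = K5 * real n powr (- sx)"
    unfolding diff_conv_add_uminus by (metis inv_sqrt_powr mult.left_commute)
  finally show ?thesis .
qed

text \<open>Off \<open>weight_good\<close> no cancellation is available. Truncated weights are at
  most \<open>2 * n powr gam\<close> in absolute value, and \<open>1/2 + gam < 1\<close> yields the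
  order \<open>n\<close>.\<close>

lemma Wn_crude:
  assumes "t \<in> {0..1}"
  shows "norm (Wn n w b t) \<le> 2 * SB * real n + SB * Qn n w"
proof -
  have "norm (Wn n w b t) \<le> (1 / sqrt (real n)) * norm (\<Sum>i=1..n. tw n i w *\<^sub>R cscore i b t w) + SB * Qn n w"
    unfolding Wn_eq by (rule truncation_error) (use good_cscore_le assms in auto)
  also have "\<dots> \<le> 2 * SB * real n + SB * Qn n w"
  proof (rule add_right_mono)
    have "norm (\<Sum>i=1..n. tw n i w *\<^sub>R cscore i b t w) \<le> (\<Sum>i=1..n. (2 * real n powr gam) * SB)"
    proof (intro order_trans[OF norm_sum] sum_mono)
      fix i assume "i \<in> {1..n}"
      then show "norm (tw n i w *\<^sub>R cscore i b t w) \<le> (2 * real n powr gam) * SB"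
        unfolding norm_scaleR by (intro mult_mono tw_bound[OF n good] good_cscore_le assms) auto
    qed
    then have "(1 / sqrt (real n)) * norm (\<Sum>i=1..n. tw n i w *\<^sub>R cscore i b t w) \<le> (1 / sqrt (real n)) * (\<Sum>i=1..n. (2 * real n powr gam) * SB)"
      by (rule mult_left_mono) simp
    also have "\<dots> = 2 * SB * (1 / sqrt (real n) * real n * real n powr gam)" by simp
    also have "1 / sqrt (real n) * real n = sqrt (real n)" using n by (simp add: real_div_sqrt)
    also have "sqrt (real n) * real n powr gam = real n powr (1/2 + gam)" by (simp add: sqrt_powr powr_add)
    also have "2 * SB * real n powr (1/2 + gam) \<le> 2 * SB * real n powr 1"
      using gam_bounds SB_ge by (intro mult_left_mono powr_le n) auto
    finally show "(1 / sqrt (real n)) * norm (\<Sum>i=1..n. tw n i w *\<^sub>R cscore i b t w) \<le> 2 * SB * real n" using n by simp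
  qed
  finally show ?thesis .
qed

lemma grad_deviation:
  assumes "b \<in> B" "t \<in> {0..1}"
  shows "norm (grad n b t w - mean_grad n b t) \<le> K1 * real n powr (sx - 1/2)"
proof -
  have "grad n b t w - mean_grad n b t = - (1 / real n) *\<^sub>R (\<Sum>i=1..n. cscore i b t w - expectation (cscore i b t))"
    by (simp add: grad_def mean_grad_def sum_subtractf scaleR_diff_right)
  then have "norm (grad n b t w - mean_grad n b t) = (1 / real n) * norm (\<Sum>i=1..n. cscore i b t w - expectation (cscore i b t))"
    by simp
  also have "\<dots> \<le> (1 / real n) * (K1 * real n powr (1/2 + sx))"
    by (intro mult_left_mono score_deviation[OF n good assms]) simp
  also have "1 / real n = real n powr (-1)" using n by (simp add: powr_minus divide_inverse)
  also have "real n powr (-1) * (K1 * real n powr (1/2 + sx)) = K1 * (real n powr (-1) * real n powr (1/2 + sx))" by (rule mult.left_commute)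
  also have "\<dots> = K1 * real n powr (sx - 1/2)" unfolding powr_add[symmetric] by simp
  finally show ?thesis .
qed

text \<open>Local fluctuations are below \<open>n powr (- 1/2)\<close> by the factor
  \<open>n powr (- sx)\<close>; this is the error \<open>e2\<close> of the variational argument,
  while \<open>grad_deviation\<close> supplies \<open>e1\<close>.\<close>

lemma grad_increment_deviation:
  assumes "b \<in> B" "b' \<in> B" "norm (b - b') \<le> real n powr (- 1/4)" "t \<in> {0..1}"
  shows "norm ((grad n b t w - mean_grad n b t) - (grad n b' t w - mean_grad n b' t)) \<le> K1 * real n powr (- 1/2 - sx)"
proof -
  have "(grad n b t w - mean_grad n b t) - (grad n b' t w - mean_grad n b' t)
    = - (1 / real n) *\<^sub>R (\<Sum>i=1..n. (cscore i b t w - cscore i b' t w) - (expectation (cscore i b t) - expectation (cscore i b' t)))"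
    by (simp add: grad_def mean_grad_def sum_subtractf scaleR_diff_right)
  then have "norm ((grad n b t w - mean_grad n b t) - (grad n b' t w - mean_grad n b' t))
    = (1 / real n) * norm (\<Sum>i=1..n. (cscore i b t w - cscore i b' t w) - (expectation (cscore i b t) - expectation (cscore i b' t)))"
    by simp
  also have "\<dots> \<le> (1 / real n) * (K1 * real n powr (1/2 - sx))"
    by (intro mult_left_mono increment_deviation[OF n good assms]) simp
  also have "1 / real n = real n powr (-1)" using n by (simp add: powr_minus divide_inverse)
  also have "real n powr (-1) * (K1 * real n powr (1/2 - sx)) = K1 * (real n powr (-1) * real n powr (1/2 - sx))" by (rule mult.left_commute)
  also have "\<dots> = K1 * real n powr (- 1/2 - sx)" unfolding powr_add[symmetric] by simp
  finally show ?thesis .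
qed

end

abbreviation "L1 \<equiv> real c_max * (Cf * R\<^sup>2)"
abbreviation "L3 \<equiv> real c_max * (Cd * R^3)"

text \<open>
  \<open>rad\<close> and \<open>kap\<close> bound the distance of the estimators and the Bahadur remainder while the wild gradient
  is at most \<open>n powr (2 * sx)\<close>. A larger gradient forces \<open>Qn\<close> to be large on \<open>weight_good\<close>, so the
  other two terms of \<open>rho\<close> then absorb a crude bound.
\<close>

definition rad :: "nat \<Rightarrow> real" where
  "rad n = 2 / \<kappa> * (real n powr (2 * sx - 1/2) + ((K1 * real n powr (- 1/2 - sx)) + L1 * (1 / real n)) + 2 * (K1 * real n powr (sx - 1/2)))"

definition kap :: "nat \<Rightarrow> real" where
  "kap n = sqrt (real n) / \<kappa> * (3 * (K1 * real n powr (- 1/2 - sx)) + 2 * L1 * (1 / real n) + L3 * (rad n + 4 * (K1 * real n powr (sx - 1/2)) / \<kappa>) * rad n) + K5 * real n powr (- sx) / \<kappa>"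

definition rho :: "nat \<Rightarrow> 'a \<Rightarrow> real" where
  "rho n w = kap n + 14 * SB / \<kappa> * Qn n w + 14 * SB / \<kappa> * real n * indicator (space M - weight_good n) w"

lemma kap_tendsto: "kap \<longlonglongrightarrow> 0"
proof -
  have s: "sx > 0" "4 * sx - 1/2 < 0" "sx - 1/2 < 0" "3 * sx - 1/2 < 0" "2 * sx - 1/2 < 0" using sx_bounds by linarith+
  have k: "\<kappa> \<noteq> 0" by (rule less_imp_neq[OF kappa_pos, symmetric])
  have r: "rad = (\<lambda>n. 2 / \<kappa> * (real n powr (2 * sx - 1/2) + ((K1 * real n powr (- 1/2 - sx)) + L1 * (1 / real n)) + 2 * (K1 * real n powr (sx - 1/2))))"
    by (rule ext) (simp add: rad_def)
  have a1: "(\<lambda>n. sqrt (real n) * (3 * (k1 * real n powr (- 1/2 - sx)))) \<longlonglongrightarrow> 0" for k1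
    using s by real_asymp
  have a2: "(\<lambda>n. sqrt (real n) * (2 * l * (1 / real n))) \<longlonglongrightarrow> 0" for l
    by real_asymp
  have a3: "(\<lambda>n. sqrt (real n) * (real n powr (2 * sx - 1/2))\<^sup>2) \<longlonglongrightarrow> 0"
    using s by real_asymp
  have a4: "(\<lambda>n. k5 * real n powr (- sx)) \<longlonglongrightarrow> 0" for k5 using s by real_asymp
  have b1: "(\<lambda>n. k1 * real n powr (sx - 1/2) / real n powr (2 * sx - 1/2)) \<longlonglongrightarrow> 0" for k1
    using s by real_asymp
  have b2: "(\<lambda>n. k1 * real n powr (- 1/2 - sx) / real n powr (2 * sx - 1/2)) \<longlonglongrightarrow> 0" for k1
    using s by real_asymp
  have b3: "(\<lambda>n. l * (1 / real n) / real n powr (2 * sx - 1/2)) \<longlonglongrightarrow> 0" for l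
    using s by real_asymp
  \<comment> \<open>Everything is measured in units of \<open>p n\<close>, the order of
    \<open>rad\<close>. The critical term of \<open>kap\<close> is the quadratic one, which is of
    order \<open>sqrt n * (p n)\<^sup>2 = n powr (4 * sx - 1/2)\<close>.\<close>
  define p where "p n = real n powr (2 * sx - 1/2)" for n :: nat
  have b0: "(\<lambda>n. p n / p n) \<longlonglongrightarrow> 1"
    by (rule tendsto_eventually) (use eventually_ge_at_top[of 1] in \<open>auto elim!: eventually_mono simp: p_def\<close>)
  have rp: "(\<lambda>n. rad n / p n) \<longlonglongrightarrow> 2 / \<kappa>"
  proof -
    have "(\<lambda>n. 2 / \<kappa> * (p n / p n + ((K1 * real n powr (- 1/2 - sx)) / p n + L1 * (1 / real n) / p n) + 2 * ((K1 * real n powr (sx - 1/2)) / p n))) \<longlonglongrightarrow> 2 / \<kappa> * (1 + (0 + 0) + 2 * 0)"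
      using b0 b1[of K1] b2[of K1] b3[of L1] unfolding p_def by (intro tendsto_intros)
    moreover have "rad n / p n = 2 / \<kappa> * (p n / p n + ((K1 * real n powr (- 1/2 - sx)) / p n + L1 * (1 / real n) / p n) + 2 * ((K1 * real n powr (sx - 1/2)) / p n))" for n
      unfolding rad_def p_def[symmetric] by (simp only: times_divide_eq_right[symmetric] add_divide_distrib)
    ultimately show ?thesis by simp
  qed
  have ep: "(\<lambda>n. (rad n + 4 * (K1 * real n powr (sx - 1/2)) / \<kappa>) / p n) \<longlonglongrightarrow> 2 / \<kappa> + 4 / \<kappa> * 0"
  proof -
    have "(\<lambda>n. rad n / p n + 4 / \<kappa> * (K1 * real n powr (sx - 1/2) / p n)) \<longlonglongrightarrow> 2 / \<kappa> + 4 / \<kappa> * 0"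
      by (rule tendsto_add[OF rp tendsto_mult_left[OF b1[of K1, folded p_def]]])
    then show ?thesis by (simp add: add_divide_distrib mult.commute)
  qed
  define RP where "RP n = rad n / p n" for n
  define EP where "EP n = (rad n + 4 * (K1 * real n powr (sx - 1/2)) / \<kappa>) / p n" for n
  define PP where "PP n = sqrt (real n) * (p n)\<^sup>2" for n
  define A1 where "A1 n = sqrt (real n) * (3 * (K1 * real n powr (- 1/2 - sx)))" for n
  define A2 where "A2 n = sqrt (real n) * (2 * L1 * (1 / real n))" for n
  define A4 where "A4 n = K5 * real n powr (- sx)" for n
  note lims = rp[folded RP_def] ep[folded EP_def] a3[folded p_def, folded PP_def] a1[of K1, folded A1_def] a2[of L1, folded A2_def] a4[of K5, folded A4_def]
  have "(\<lambda>n. 1 / \<kappa> * (A1 n + A2 n + L3 * EP n * RP n * PP n) + A4 n / \<kappa>)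
     \<longlonglongrightarrow> 1 / \<kappa> * (0 + 0 + L3 * (2 / \<kappa> + 4 / \<kappa> * 0) * (2 / \<kappa>) * 0) + 0 / \<kappa>"
    by (intro tendsto_intros lims k)
  moreover have "\<forall>\<^sub>F n in sequentially. 1 / \<kappa> * (A1 n + A2 n + L3 * EP n * RP n * PP n) + A4 n / \<kappa> = kap n"
    using eventually_ge_at_top[of 1]
  proof eventually_elim
    case (elim n)
    then have "p n > 0" by (simp add: p_def)
    then have q: "L3 * (u / p n) * (v / p n) * (sqrt (real n) * (p n)\<^sup>2) = sqrt (real n) * (L3 * u * v)" for u v
      by (simp add: power2_eq_square)
    show ?case unfolding kap_def A1_def A2_def A4_def EP_def RP_def PP_def q
      by (simp add: distrib_left add_divide_distrib)
  qed
  ultimately show ?thesis by (simp add: Lim_transform_eventually)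
qed

text \<open>The conditions say in turn that the estimators stay in the ball of radius
  \<open>r\<close>, that the distances and the test step \<open>1 / n\<close> stay below the
  localization radius, and that a wild gradient above \<open>n powr (2 * sx)\<close> dominates both
  the rates and twice the main part of \<open>Wn_bound\<close>.\<close>

lemma eventually_rates:
  "\<forall>\<^sub>F n in sequentially. 2 * (K1 * real n powr (sx - 1/2)) / \<kappa> + rad n + 1 / real n \<le> r \<and> 2 * (K1 * real n powr (sx - 1/2)) / \<kappa> \<le> real n powr (- 1/4) \<and> rad n \<le> real n powr (- 1/4)
     \<and> 1 / real n \<le> real n powr (- 1/4)
     \<and> sqrt (real n) * ((K1 * real n powr (- 1/2 - sx)) + L1 * (1 / real n) + 2 * (K1 * real n powr (sx - 1/2))) \<le> real n powr (2 * sx) \<and> K5 * real n powr sx \<le> real n powr (2 * sx) / 2"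
proof (intro eventually_conj)
  have s: "sx > 0" "2 * sx - 1/2 < - 1/4" "sx - 1/2 < - 1/4" "sx - 1/2 < 0" "2 * sx - 1/2 < 0" using sx_bounds by linarith+
  have p1: "(\<lambda>n. k * real n powr (sx - 1/2) * real n powr (1/4)) \<longlonglongrightarrow> 0" for k using s by real_asymp
  have p2: "(\<lambda>n. k * real n powr (2 * sx - 1/2) * real n powr (1/4)) \<longlonglongrightarrow> 0" for k using s by real_asymp
  have p3: "(\<lambda>n. k * real n powr (- 1/2 - sx) * real n powr (1/4)) \<longlonglongrightarrow> 0" for k using s by real_asymp
  have p4: "(\<lambda>n. k * (1 / real n) * real n powr (1/4)) \<longlonglongrightarrow> 0" for k by real_asymp
  have q1: "(\<lambda>n. k * real n powr (sx - 1/2)) \<longlonglongrightarrow> 0" for k using s by real_asymp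
  have q2: "(\<lambda>n. real n powr (2 * sx - 1/2)) \<longlonglongrightarrow> 0" using s by real_asymp
  have q3: "(\<lambda>n. k * real n powr (- 1/2 - sx)) \<longlonglongrightarrow> 0" for k using s by real_asymp
  have q4: "(\<lambda>n. k * (1 / real n)) \<longlonglongrightarrow> 0" for k by real_asymp
  have k: "\<kappa> \<noteq> 0" by (rule less_imp_neq[OF kappa_pos, symmetric])
  have "rad \<longlonglongrightarrow> 2 / \<kappa> * (0 + (0 + 0) + 2 * 0)"
    unfolding rad_def[abs_def] using q1[of K1] q2 q3[of K1] q4[of L1] by (intro tendsto_intros)
  then have "(\<lambda>n. 2 * (K1 * real n powr (sx - 1/2)) / \<kappa> + rad n + 1 * (1 / real n)) \<longlonglongrightarrow> 2 * 0 / \<kappa> + 2 / \<kappa> * (0 + (0 + 0) + 2 * 0) + 0"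
    using q1[of K1] q4[of 1] k by (intro tendsto_intros)
  then have "\<forall>\<^sub>F n in sequentially. 2 * (K1 * real n powr (sx - 1/2)) / \<kappa> + rad n + 1 * (1 / real n) < r" using r_pos by (intro order_tendstoD(2)) auto
  then show "\<forall>\<^sub>F n in sequentially. 2 * (K1 * real n powr (sx - 1/2)) / \<kappa> + rad n + 1 / real n \<le> r" by (rule eventually_mono) simp
  have from_lim: "\<forall>\<^sub>F n in sequentially. a n \<le> real n powr (- 1/4)" if "(\<lambda>n. a n * real n powr (1/4)) \<longlonglongrightarrow> 0" for a
  proof -
    have "\<forall>\<^sub>F n in sequentially. a n * real n powr (1/4) < 1" using that by (rule order_tendstoD) simp
    then show ?thesis using eventually_ge_at_top[of 1]
    proof eventually_elim
      case (elim n)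
      then have "a n \<le> 1 / real n powr (1/4)" by (simp add: field_simps)
      then show ?case by (simp add: powr_minus_divide)
    qed
  qed
  show "\<forall>\<^sub>F n in sequentially. 2 * (K1 * real n powr (sx - 1/2)) / \<kappa> \<le> real n powr (- 1/4)"
    using p1[of "2 * K1 / \<kappa>"] by (intro from_lim) (simp add: mult_ac)
  show "\<forall>\<^sub>F n in sequentially. 1 / real n \<le> real n powr (- 1/4)"
    using p4[of 1] by (intro from_lim) simp
  show "\<forall>\<^sub>F n in sequentially. rad n \<le> real n powr (- 1/4)"
  proof (rule from_lim)
    have "(\<lambda>n. 2 / \<kappa> * (1 * real n powr (2 * sx - 1/2) * real n powr (1/4) + ((K1 * real n powr (- 1/2 - sx)) * real n powr (1/4) + L1 * (1 / real n) * real n powr (1/4)) + 2 * ((K1 * real n powr (sx - 1/2)) * real n powr (1/4)))) \<longlonglongrightarrow> 2 / \<kappa> * (0 + (0 + 0) + 2 * 0)"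
      using p1[of K1] p2[of 1] p3[of K1] p4[of L1] by (intro tendsto_intros)
    then show "(\<lambda>n. rad n * real n powr (1/4)) \<longlonglongrightarrow> 0" by (simp add: rad_def algebra_simps)
  qed
  show "\<forall>\<^sub>F n in sequentially. K5 * real n powr sx \<le> real n powr (2 * sx) / 2"
  proof -
    have "(\<lambda>n. K5 * real n powr sx / real n powr (2 * sx)) \<longlonglongrightarrow> 0" using s by real_asymp
    then have "\<forall>\<^sub>F n in sequentially. K5 * real n powr sx / real n powr (2 * sx) < 1/2" by (rule order_tendstoD) simp
    then show ?thesis using eventually_ge_at_top[of 1] by eventually_elim (simp add: field_simps)
  qed
  show "\<forall>\<^sub>F n in sequentially. sqrt (real n) * ((K1 * real n powr (- 1/2 - sx)) + L1 * (1 / real n) + 2 * (K1 * real n powr (sx - 1/2))) \<le> real n powr (2 * sx)"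
  proof -
    have r1: "(\<lambda>n. sqrt (real n) * (k * real n powr (- 1/2 - sx)) / real n powr (2 * sx)) \<longlonglongrightarrow> 0" for k using s by real_asymp
    have r2: "(\<lambda>n. sqrt (real n) * (k * (1 / real n)) / real n powr (2 * sx)) \<longlonglongrightarrow> 0" for k using s by real_asymp
    have r3: "(\<lambda>n. sqrt (real n) * (k * real n powr (sx - 1/2)) / real n powr (2 * sx)) \<longlonglongrightarrow> 0" for k using s by real_asymp
    have "(\<lambda>n. sqrt (real n) * (K1 * real n powr (- 1/2 - sx)) / real n powr (2 * sx) + sqrt (real n) * (L1 * (1 / real n)) / real n powr (2 * sx) + 2 * (sqrt (real n) * (K1 * real n powr (sx - 1/2)) / real n powr (2 * sx))) \<longlonglongrightarrow> 0 + 0 + 2 * 0"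
      using r1[of K1] r2[of L1] r3[of K1] by (intro tendsto_intros)
    then have "\<forall>\<^sub>F n in sequentially. sqrt (real n) * (K1 * real n powr (- 1/2 - sx)) / real n powr (2 * sx) + sqrt (real n) * (L1 * (1 / real n)) / real n powr (2 * sx) + 2 * (sqrt (real n) * (K1 * real n powr (sx - 1/2)) / real n powr (2 * sx)) < 1"
      by (rule order_tendstoD) simp
    then show ?thesis using eventually_ge_at_top[of 1]
    proof eventually_elim
      case (elim n)
      have "sqrt (real n) * (K1 * real n powr (- 1/2 - sx)) / real n powr (2 * sx) + sqrt (real n) * (L1 * (1 / real n)) / real n powr (2 * sx) + 2 * (sqrt (real n) * (K1 * real n powr (sx - 1/2)) / real n powr (2 * sx))
        = sqrt (real n) * ((K1 * real n powr (- 1/2 - sx)) + L1 * (1 / real n) + 2 * (K1 * real n powr (sx - 1/2))) / real n powr (2 * sx)"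
        by (simp add: add_divide_distrib distrib_left)
      with elim have "sqrt (real n) * ((K1 * real n powr (- 1/2 - sx)) + L1 * (1 / real n) + 2 * (K1 * real n powr (sx - 1/2))) / real n powr (2 * sx) < 1" by linarith
      then show ?case using elim by (subst (asm) divide_less_eq_1_pos) auto
    qed
  qed
qed

end

context wild_grid
begin

text \<open>\<open>ah\<close> and \<open>as\<close> are quantified inside, so the bound holds for
  every choice of minimizers and depends neither on them nor on the level. The wild gradient stands
  at the true parameter, which makes the leading term measurable with coefficients that are
  functions of the data.\<close>

lemma bahadur_remainder:
  "\<forall>\<^sub>F n in sequentially. \<forall>w\<in>data_good n. \<forall>\<tau>\<in>T. \<forall>ah as.
     is_arg_min (\<lambda>b. objective c Y X n w b \<tau>) (\<lambda>b. b \<in> B) ah \<longrightarrow>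
     is_arg_min (\<lambda>b. boot_objective c Y X W n w ah b \<tau>) (\<lambda>b. b \<in> B) as \<longrightarrow>
     norm (sqrt (real n) *\<^sub>R (as - ah) + matrix_inv (Jn n \<tau>) *v Wn n w (\<beta> \<tau>) \<tau>) \<le> rho n w"
  using eventually_rates eventually_ge_at_top[of 1]
proof (eventually_elim, intro ballI allI impI)
  fix n w \<tau> ah as
  let ?N = "real n" and ?e1 = "K1 * real n powr (sx - 1/2)" and ?e2 = "K1 * real n powr (- 1/2 - sx)"
  assume rates: "2 * ?e1 / \<kappa> + rad n + 1 / ?N \<le> r \<and> 2 * ?e1 / \<kappa> \<le> ?N powr (- 1/4) \<and> rad n \<le> ?N powr (- 1/4)
     \<and> 1 / ?N \<le> ?N powr (- 1/4)
     \<and> sqrt ?N * (?e2 + L1 * (1 / ?N) + 2 * ?e1) \<le> ?N powr (2 * sx) \<and> K5 * ?N powr sx \<le> ?N powr (2 * sx) / 2"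
    and n: "1 \<le> n" and good: "w \<in> data_good n" and \<tau>: "\<tau> \<in> T"
    and ah: "is_arg_min (\<lambda>b. objective c Y X n w b \<tau>) (\<lambda>b. b \<in> B) ah"
    and as: "is_arg_min (\<lambda>b. boot_objective c Y X W n w ah b \<tau>) (\<lambda>b. b \<in> B) as"
  have t: "\<tau> \<in> {0..1}" by (rule T_in_unit[OF \<tau>])
  \<comment> \<open>The bootstrap criterion is the empirical one plus the linear function with slope
    \<open>wv\<close>.\<close>
  define wv where "wv = (1 / sqrt ?N) *\<^sub>R Wn n w ah \<tau>"
  have ah0: "is_arg_min (\<lambda>b. objective c Y X n w b \<tau> + 0 \<bullet> b) (\<lambda>b. b \<in> B) ah" using ah by simp
  have as': "is_arg_min (\<lambda>b. objective c Y X n w b \<tau> + wv \<bullet> b) (\<lambda>b. b \<in> B) as"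
    using as by (simp add: boot_objective_def wv_def)
  have in_B: "ah \<in> B" "as \<in> B" using ah as by (auto simp: is_arg_min_def)
  have kp: "\<kappa> > 0" by (rule kappa_pos)
  have e_nonneg: "0 \<le> ?e1" "0 \<le> ?e2" "0 \<le> L1" "0 \<le> L3" using K_nonneg Cf_nonneg Cd_nonneg R_pos by auto
  \<comment> \<open>The localization radius is \<open>n powr (- 1/4)\<close>. The test step
    \<open>1 / n\<close> makes the Lipschitz contribution \<open>L1 * s\<close> negligible against
    \<open>n powr (- 1/2)\<close>.\<close>
  interpret minty_pair "\<lambda>b. grad n b \<tau> w" "\<lambda>b. mean_grad n b \<tau>" B "\<beta> \<tau>" ah as wv "Jn n \<tau>" \<kappa> L1 L3 ?e1 ?e2 "?N powr (- 1/4)" "1 / ?N" r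
  proof
    show "convex B" by (rule B_convex)
    show "\<beta> \<tau> \<in> B" "ah \<in> B" "as \<in> B" using \<beta>_in_B \<tau> in_B by auto
    show "0 < \<kappa>" by (rule kp)
    show "0 < 1 / ?N" using n by simp
    show "1 / ?N \<le> ?N powr (- 1/4)" using rates by simp
    show "0 \<le> ?e1" "0 \<le> ?e2" "0 \<le> L1" "0 \<le> L3" by (rule e_nonneg)+
    show "\<kappa> * (norm (b - b'))\<^sup>2 \<le> (mean_grad n b \<tau> - mean_grad n b' \<tau>) \<bullet> (b - b')" if "b \<in> B" "b' \<in> B" for b b'
      by (rule mean_grad_strongly_monotone[OF n that t])
    show "norm (mean_grad n b \<tau> - mean_grad n b' \<tau>) \<le> L1 * norm (b - b')" for b b'
      by (rule mean_grad_lipschitz[OF n t])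
    show "norm (mean_grad n b \<tau> - mean_grad n b' \<tau> - Jn n \<tau> *v (b - b')) \<le> L3 * (norm (b - \<beta> \<tau>) + norm (b' - \<beta> \<tau>)) * norm (b - b')" for b b'
      by (rule mean_grad_linearization[OF n \<tau>])
    show "mean_grad n (\<beta> \<tau>) \<tau> = 0" by (rule mean_grad_at_beta[OF n \<tau>])
    show "cball (\<beta> \<tau>) r \<subseteq> B" by (rule beta_ball[OF \<tau>])
    show "norm (grad n b \<tau> w - mean_grad n b \<tau>) \<le> ?e1" if "b \<in> B" for b
      by (rule grad_deviation[OF n good that t])
    show "norm ((grad n b \<tau> w - mean_grad n b \<tau>) - (grad n b' \<tau> w - mean_grad n b' \<tau>)) \<le> ?e2"
      if "b \<in> B" "b' \<in> B" "norm (b - b') \<le> ?N powr (- 1/4)" for b b'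
      by (rule grad_increment_deviation[OF n good that t])
    show "0 \<le> grad n b \<tau> w \<bullet> (b - ah)" if "b \<in> B" for b
      using minty_inequality[OF t ah0 that] by simp
    show "0 \<le> (grad n b \<tau> w + wv) \<bullet> (b - as)" if "b \<in> B" for b
      by (rule minty_inequality[OF t as' that])
  qed
  have rad_nonneg: "0 \<le> rad n" using e_nonneg kp n by (simp add: rad_def)
  have ah_close: "norm (ah - \<beta> \<tau>) \<le> 2 * ?e1 / \<kappa>" by (rule estimator_close)
  then have ah_r: "norm (ah - \<beta> \<tau>) + 1 / ?N \<le> r" using rates rad_nonneg by linarith
  have sq: "sqrt ?N > 0" using n by simp
  define U where "U = norm (Wn n w ah \<tau>)"
  have U0: "0 \<le> U" by (simp add: U_def)
  have nw: "norm wv = U / sqrt ?N" by (simp add: wv_def U_def)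
  have crude: "norm (as - ah) \<le> 2 / \<kappa> * (U / sqrt ?N + (?e2 + L1 * (1 / ?N)) + 2 * ?e1)"
    using boot_crude[OF ah_r] unfolding nw .
  let ?Ji = "matrix_inv (Jn n \<tau>)"
  note inv = coercive_inverse[OF Jn_ge[OF n \<tau>] kp]
  define I where "I = indicat_real (space M - weight_good n) w"
  have wM: "w \<in> space M" using good by (simp add: data_good_def)
  have I0: "0 \<le> I" by (simp add: I_def)
  have k14: "0 \<le> SB / \<kappa>" using SB_ge kp by simp
  \<comment> \<open>A moderate wild gradient keeps the bootstrap estimator within
    \<open>rad n\<close>, where the linearization is available. For a large one the crude bound is
    of the order of \<open>U\<close> itself, and \<open>U\<close> is then traced back to the
    truncation error or to bad weights.\<close>
  have lin_part: "norm (sqrt ?N *\<^sub>R (as - ah) + ?Ji *v Wn n w ah \<tau>)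
     \<le> sqrt ?N / \<kappa> * (3 * ?e2 + 2 * L1 * (1 / ?N) + L3 * (rad n + 4 * ?e1 / \<kappa>) * rad n) + 10 * SB / \<kappa> * Qn n w + 10 * SB / \<kappa> * ?N * I"
  proof (cases "U \<le> ?N powr (2 * sx)")
    case True
    have "U / sqrt ?N \<le> ?N powr (2 * sx - 1/2)"
    proof -
      have "U / sqrt ?N \<le> ?N powr (2 * sx) / ?N powr (1/2)"
        unfolding sqrt_powr[OF n good] using True by (intro divide_right_mono) auto
      then show ?thesis by (simp add: powr_diff)
    qed
    then have "norm (as - ah) \<le> rad n"
      unfolding rad_def using kp by (intro order_trans[OF crude] mult_left_mono[of _ _ "2 / \<kappa>"] add_right_mono) auto
    moreover have "norm (as - \<beta> \<tau>) \<le> norm (as - ah) + norm (ah - \<beta> \<tau>)"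
      using norm_triangle_ineq[of "as - ah" "ah - \<beta> \<tau>"] by simp
    ultimately have d: "norm (as - ah) \<le> rad n" "norm (as - \<beta> \<tau>) \<le> rad n + 2 * ?e1 / \<kappa>"
      using ah_close by auto
    have "norm (Jn n \<tau> *v (as - ah) + wv) \<le> 3 * ?e2 + 2 * L1 * (1 / ?N) + L3 * (norm (as - \<beta> \<tau>) + norm (ah - \<beta> \<tau>)) * norm (as - ah)"
      by (rule boot_linearization[OF ah_r]) (use d rates in linarith)+
    also have "\<dots> \<le> 3 * ?e2 + 2 * L1 * (1 / ?N) + L3 * (rad n + 4 * ?e1 / \<kappa>) * rad n"
    proof (intro add_left_mono mult_mono)
      show "norm (as - \<beta> \<tau>) + norm (ah - \<beta> \<tau>) \<le> rad n + 4 * ?e1 / \<kappa>" using d ah_close by simp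
      show "0 \<le> L3 * (rad n + 4 * ?e1 / \<kappa>)" using e_nonneg rad_nonneg kp Cd_nonneg R_pos by (intro mult_nonneg_nonneg add_nonneg_nonneg) auto
    qed (use e_nonneg d Cd_nonneg R_pos in auto)
    finally have lin: "norm (Jn n \<tau> *v (as - ah) + wv) \<le> 3 * ?e2 + 2 * L1 * (1 / ?N) + L3 * (rad n + 4 * ?e1 / \<kappa>) * rad n" .
    have "sqrt ?N *\<^sub>R (as - ah) + ?Ji *v Wn n w ah \<tau> = ?Ji *v (sqrt ?N *\<^sub>R (Jn n \<tau> *v (as - ah) + wv))"
    proof -
      have "sqrt ?N *\<^sub>R (Jn n \<tau> *v (as - ah) + wv) = Jn n \<tau> *v (sqrt ?N *\<^sub>R (as - ah)) + Wn n w ah \<tau>"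
        using sq by (simp add: wv_def scaleR_add_right matrix_vector_mult_scaleR)
      then show ?thesis by (simp add: matrix_vector_right_distrib inv)
    qed
    then have "norm (sqrt ?N *\<^sub>R (as - ah) + ?Ji *v Wn n w ah \<tau>) \<le> norm (sqrt ?N *\<^sub>R (Jn n \<tau> *v (as - ah) + wv)) / \<kappa>"
      by (simp only: inv(3))
    also have "\<dots> = sqrt ?N / \<kappa> * norm (Jn n \<tau> *v (as - ah) + wv)" using sq by simp
    also have "\<dots> \<le> sqrt ?N / \<kappa> * (3 * ?e2 + 2 * L1 * (1 / ?N) + L3 * (rad n + 4 * ?e1 / \<kappa>) * rad n)"
      using sq kp by (intro mult_left_mono lin) auto
    finally have "norm (sqrt ?N *\<^sub>R (as - ah) + ?Ji *v Wn n w ah \<tau>) \<le> sqrt ?N / \<kappa> * (3 * ?e2 + 2 * L1 * (1 / ?N) + L3 * (rad n + 4 * ?e1 / \<kappa>) * rad n)" .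
    moreover have "0 \<le> 10 * SB / \<kappa> * Qn n w" "0 \<le> 10 * SB / \<kappa> * ?N * I"
      using SB_ge kp Qn_nonneg I0 by (auto intro!: mult_nonneg_nonneg divide_nonneg_pos)
    ultimately show ?thesis by linarith
  next
    case False
    \<comment> \<open>On \<open>weight_good\<close> the regular part of \<open>U\<close> is at most
      \<open>n powr (2 * sx) / 2\<close>, less than \<open>U / 2\<close>, so the truncation error
      accounts for the other half. Off \<open>weight_good\<close> the indicator \<open>I\<close>
      equals 1 and pays for the crude bound.\<close>
    have U_le: "U \<le> 2 * (SB * Qn n w + SB * ?N * I)"
    proof (cases "w \<in> weight_good n")
      case True
      have "U \<le> K5 * ?N powr sx + SB * Qn n w"
        unfolding U_def by (rule Wn_bound[OF n good True in_B(1) t])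
      moreover have "0 \<le> SB * ?N * I" using SB_ge I0 by auto
      moreover have "K5 * ?N powr sx \<le> ?N powr (2 * sx) / 2" using rates by blast
      moreover have "U \<le> 2 * (x + y)" if "U \<le> k + x" "0 \<le> y" "k \<le> z / 2" "\<not> U \<le> z" for x y k z :: real
        using that by argo
      ultimately show ?thesis using False by blast
    next
      case ng: False
      have "U \<le> 2 * SB * ?N + SB * Qn n w" unfolding U_def by (rule Wn_crude[OF n good t])
      moreover have "I = 1" using ng wM by (simp add: I_def)
      moreover have "0 \<le> SB * Qn n w" using SB_ge Qn_nonneg by auto
      ultimately show ?thesis by simp
    qed
    have "norm (sqrt ?N *\<^sub>R (as - ah)) = sqrt ?N * norm (as - ah)" using sq by simp
    also have "\<dots> \<le> sqrt ?N * (2 / \<kappa> * (U / sqrt ?N + (?e2 + L1 * (1 / ?N)) + 2 * ?e1))"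
      using sq by (intro mult_left_mono crude) auto
    also have "\<dots> = 2 / \<kappa> * (U + sqrt ?N * (?e2 + L1 * (1 / ?N) + 2 * ?e1))"
    proof -
      have "sqrt ?N * (U / sqrt ?N) = U" using sq by simp
      then show ?thesis by (simp only: distrib_left mult.left_commute[of "sqrt ?N" "2 / \<kappa>"] add.assoc)
    qed
    also have "\<dots> \<le> 2 / \<kappa> * (U + U)"
      using rates False kp by (intro mult_left_mono add_left_mono) auto
    finally have 1: "norm (sqrt ?N *\<^sub>R (as - ah)) \<le> 4 * U / \<kappa>" by simp
    have 2: "norm (?Ji *v Wn n w ah \<tau>) \<le> U / \<kappa>" unfolding U_def by (rule inv(3))
    have "norm (sqrt ?N *\<^sub>R (as - ah) + ?Ji *v Wn n w ah \<tau>) \<le> 4 * U / \<kappa> + U / \<kappa>"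
      by (rule order_trans[OF norm_triangle_ineq add_mono[OF 1 2]])
    also have "\<dots> = 5 / \<kappa> * U" by (simp add: field_simps)
    also have "\<dots> \<le> 5 / \<kappa> * (2 * (SB * Qn n w + SB * ?N * I))"
      using kp by (intro mult_left_mono U_le) auto
    also have "\<dots> = 10 * SB / \<kappa> * Qn n w + 10 * SB / \<kappa> * ?N * I" by (simp add: distrib_left)
    finally have "norm (sqrt ?N *\<^sub>R (as - ah) + ?Ji *v Wn n w ah \<tau>) \<le> 10 * SB / \<kappa> * Qn n w + 10 * SB / \<kappa> * ?N * I" .
    moreover have "0 \<le> sqrt ?N / \<kappa> * (3 * ?e2 + 2 * L1 * (1 / ?N) + L3 * (rad n + 4 * ?e1 / \<kappa>) * rad n)"
      using e_nonneg rad_nonneg kp sq Cd_nonneg Cf_nonneg R_pos K_nonneg by (intro mult_nonneg_nonneg add_nonneg_nonneg divide_nonneg_pos) auto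
    ultimately show ?thesis by linarith
  qed
  \<comment> \<open>The wild gradient is moved from the estimator to the true parameter. The 4
    obtained here and the 10 of \<open>lin_part\<close> add up to the 14 in
    \<open>rho\<close>.\<close>
  have inc: "norm (Wn n w (\<beta> \<tau>) \<tau> - Wn n w ah \<tau>) \<le> K5 * ?N powr (- sx) + 4 * SB * Qn n w + 4 * SB * ?N * I"
  proof (cases "w \<in> weight_good n")
    case True
    have "norm (\<beta> \<tau> - ah) \<le> ?N powr (- 1/4)" using ah_close rates by (simp add: norm_minus_commute)
    from Wn_increment[OF n good True \<beta>_in_B[OF \<tau>] in_B(1) this t]
    have "norm (Wn n w (\<beta> \<tau>) \<tau> - Wn n w ah \<tau>) \<le> K5 * ?N powr (- sx) + 2 * SB * Qn n w" .
    moreover have "0 \<le> SB * Qn n w" "0 \<le> SB * ?N * I" using SB_ge Qn_nonneg I0 by auto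
    ultimately show ?thesis by linarith
  next
    case False
    then have "I = 1" using wM by (simp add: I_def)
    have "norm (Wn n w (\<beta> \<tau>) \<tau> - Wn n w ah \<tau>) \<le> norm (Wn n w (\<beta> \<tau>) \<tau>) + norm (Wn n w ah \<tau>)" by (rule norm_triangle_ineq4)
    also have "\<dots> \<le> (2 * SB * ?N + SB * Qn n w) + (2 * SB * ?N + SB * Qn n w)"
      by (intro add_mono Wn_crude[OF n good t])
    finally have "norm (Wn n w (\<beta> \<tau>) \<tau> - Wn n w ah \<tau>) \<le> 4 * SB * ?N + 2 * SB * Qn n w" by (simp add: algebra_simps)
    moreover have "0 \<le> K5 * ?N powr (- sx)" "0 \<le> SB * Qn n w" using K_nonneg SB_ge Qn_nonneg by auto
    ultimately show ?thesis using \<open>I = 1\<close> by simp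
  qed
  have "sqrt ?N *\<^sub>R (as - ah) + ?Ji *v Wn n w (\<beta> \<tau>) \<tau> = (sqrt ?N *\<^sub>R (as - ah) + ?Ji *v Wn n w ah \<tau>) + ?Ji *v (Wn n w (\<beta> \<tau>) \<tau> - Wn n w ah \<tau>)"
    by (simp add: matrix_vector_mult_diff_distrib)
  then have "norm (sqrt ?N *\<^sub>R (as - ah) + ?Ji *v Wn n w (\<beta> \<tau>) \<tau>) \<le> norm (sqrt ?N *\<^sub>R (as - ah) + ?Ji *v Wn n w ah \<tau>) + norm (?Ji *v (Wn n w (\<beta> \<tau>) \<tau> - Wn n w ah \<tau>))"
    by (simp only: norm_triangle_ineq)
  also have "norm (?Ji *v (Wn n w (\<beta> \<tau>) \<tau> - Wn n w ah \<tau>)) \<le> (K5 * ?N powr (- sx) + 4 * SB * Qn n w + 4 * SB * ?N * I) / \<kappa>"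
    using kp by (intro order_trans[OF inv(3)] divide_right_mono inc) auto
  finally have "norm (sqrt ?N *\<^sub>R (as - ah) + ?Ji *v Wn n w (\<beta> \<tau>) \<tau>)
    \<le> sqrt ?N / \<kappa> * (3 * ?e2 + 2 * L1 * (1 / ?N) + L3 * (rad n + 4 * ?e1 / \<kappa>) * rad n) + 10 * SB / \<kappa> * Qn n w + 10 * SB / \<kappa> * ?N * I
      + (K5 * ?N powr (- sx) + 4 * SB * Qn n w + 4 * SB * ?N * I) / \<kappa>"
    using lin_part by linarith
  also have "\<dots> = rho n w"
    unfolding rho_def kap_def I_def[symmetric] by (simp add: add_divide_distrib algebra_simps)
  finally show "norm (sqrt ?N *\<^sub>R (as - ah) + ?Ji *v Wn n w (\<beta> \<tau>) \<tau>) \<le> rho n w" .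
qed

section \<open>Mean square of the truncation error and of the remainder\<close>

definition Lq :: real where "Lq = expectation (\<lambda>w. \<bar>W 1 w\<bar> powr q)"

definition rest :: "real \<Rightarrow> real \<Rightarrow> real" where "rest m x = \<bar>x - trunc m x\<bar>"

lemma rest_measurable[measurable]: "rest m \<in> borel_measurable borel"
  unfolding rest_def[abs_def] by measurable

lemma rest_eq: "rest m x = \<bar>(if m < \<bar>x\<bar> then x else 0) + tmean m\<bar>"
  by (simp add: rest_def trunc_def)

lemma tail_powr:
  assumes "m > 0" "p \<le> q"
  shows "(if m < \<bar>x\<bar> then \<bar>x\<bar> powr p else 0) \<le> m powr (p - q) * \<bar>x\<bar> powr q"
proof (cases "m < \<bar>x\<bar>")
  case True
  then have "\<bar>x\<bar> powr p = \<bar>x\<bar> powr (p - q) * \<bar>x\<bar> powr q" by (simp add: powr_add[symmetric])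
  also have "\<dots> \<le> m powr (p - q) * \<bar>x\<bar> powr q"
    using True assms by (intro mult_right_mono powr_mono2') auto
  finally show ?thesis using True by simp
qed simp

lemma rest_moments:
  assumes m: "m > 0" and i: "i \<ge> 1"
  shows "integrable M (\<lambda>w. rest m (W i w))" "integrable M (\<lambda>w. (rest m (W i w))\<^sup>2)"
    "expectation (\<lambda>w. rest m (W i w)) \<le> 2 * m powr (1 - q) * Lq"
    "expectation (\<lambda>w. (rest m (W i w))\<^sup>2) \<le> m powr (2 - q) * Lq"
    "expectation (\<lambda>w. rest m (W i w)) = expectation (\<lambda>w. rest m (W 1 w))"
proof -
  have [measurable]: "W 1 \<in> borel_measurable M" "W i \<in> borel_measurable M" using i by auto
  let ?t = "\<lambda>w. if m < \<bar>W 1 w\<bar> then W 1 w else 0"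
  have abs_t: "\<bar>?t w\<bar> \<le> m powr (1 - q) * \<bar>W 1 w\<bar> powr q" for w
    using tail_powr[OF m, of 1 "W 1 w"] q m by (simp split: if_splits)
  have sq_t: "(?t w)\<^sup>2 \<le> m powr (2 - q) * \<bar>W 1 w\<bar> powr q" for w
    using tail_powr[OF m, of 2 "W 1 w"] q m by (simp split: if_splits)
  have it: "integrable M ?t"
    by (rule Bochner_Integration.integrable_bound[OF W_integrable(1)[of 1]]) auto
  have it2: "integrable M (\<lambda>w. (?t w)\<^sup>2)"
    by (rule Bochner_Integration.integrable_bound[OF W_integrable(2)[of 1]]) auto
  have iu: "integrable M (\<lambda>w. if \<bar>W 1 w\<bar> \<le> m then W 1 w else 0)"
    by (rule Bochner_Integration.integrable_bound[OF W_integrable(1)[of 1]]) auto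
  \<comment> \<open>As the weight has mean 0, the recentring constant is minus the mean of the tail.
    Hence \<open>rest\<close> is the absolute value of a centred tail, and its second moment is a
    variance.\<close>
  have "expectation ?t + tmean m = expectation (\<lambda>w. ?t w + (if \<bar>W 1 w\<bar> \<le> m then W 1 w else 0))"
    unfolding tmean_def using it iu by simp
  also have "\<dots> = expectation (W 1)" by (intro Bochner_Integration.integral_cong) auto
  finally have tm: "expectation ?t = - tmean m" using W_mean by simp
  have et: "expectation (\<lambda>w. \<bar>?t w\<bar>) \<le> m powr (1 - q) * Lq"
  proof -
    have "expectation (\<lambda>w. \<bar>?t w\<bar>) \<le> expectation (\<lambda>w. m powr (1 - q) * \<bar>W 1 w\<bar> powr q)"
      using it W_moment abs_t by (intro integral_mono) auto
    then show ?thesis by (simp add: Lq_def)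
  qed
  have et2: "expectation (\<lambda>w. (?t w)\<^sup>2) \<le> m powr (2 - q) * Lq"
  proof -
    have "expectation (\<lambda>w. (?t w)\<^sup>2) \<le> expectation (\<lambda>w. m powr (2 - q) * \<bar>W 1 w\<bar> powr q)"
      using it2 W_moment sq_t by (intro integral_mono) auto
    then show ?thesis by (simp add: Lq_def)
  qed
  have r1: "integrable M (\<lambda>w. rest m (W 1 w))" unfolding rest_eq using it by simp
  have r2: "integrable M (\<lambda>w. (rest m (W 1 w))\<^sup>2)"
    unfolding rest_eq power2_abs power2_sum using it it2 by simp
  show "integrable M (\<lambda>w. rest m (W i w))" using W_transfer(2)[OF i rest_measurable] r1 by simp
  show "integrable M (\<lambda>w. (rest m (W i w))\<^sup>2)" using W_transfer(2)[OF i, of "\<lambda>x. (rest m x)\<^sup>2"] r2 by simp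
  show *: "expectation (\<lambda>w. rest m (W i w)) = expectation (\<lambda>w. rest m (W 1 w))"
    by (rule W_transfer(1)[OF i rest_measurable])
  have "\<bar>tmean m\<bar> \<le> expectation (\<lambda>w. \<bar>?t w\<bar>)" using integral_abs_bound[of M ?t, unfolded tm] by (simp only: abs_minus_cancel)
  have "expectation (\<lambda>w. rest m (W 1 w)) \<le> expectation (\<lambda>w. \<bar>?t w\<bar> + \<bar>tmean m\<bar>)"
    unfolding rest_eq using it by (intro integral_mono) auto
  also have "\<dots> = expectation (\<lambda>w. \<bar>?t w\<bar>) + \<bar>tmean m\<bar>" using it by (simp add: prob_space)
  finally show "expectation (\<lambda>w. rest m (W i w)) \<le> 2 * m powr (1 - q) * Lq"
    using * et \<open>\<bar>tmean m\<bar> \<le> _\<close> by linarith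
  have "expectation (\<lambda>w. (rest m (W i w))\<^sup>2) = expectation (\<lambda>w. (rest m (W 1 w))\<^sup>2)"
    by (rule W_transfer(1)[OF i]) measurable
  also have "\<dots> = expectation (\<lambda>w. (?t w)\<^sup>2 + (tmean m)\<^sup>2 + 2 * ?t w * tmean m)"
    unfolding rest_eq power2_abs power2_sum ..
  also have "\<dots> = expectation (\<lambda>w. (?t w)\<^sup>2) - (tmean m)\<^sup>2"
    using it it2 tm by (simp add: prob_space power2_eq_square)
  also have "\<dots> \<le> m powr (2 - q) * Lq" using et2 zero_le_power2[of "tmean m"] by linarith
  finally show "expectation (\<lambda>w. (rest m (W i w))\<^sup>2) \<le> m powr (2 - q) * Lq" .
qed

lemma Lq_nonneg: "0 \<le> Lq" unfolding Lq_def by simp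

lemma rest_product:
  assumes m: "m > 0" and ij: "i \<ge> 1" "j \<ge> 1" "i \<noteq> j"
  shows "expectation (\<lambda>w. rest m (W i w) * rest m (W j w)) = (expectation (\<lambda>w. rest m (W 1 w)))\<^sup>2"
    "integrable M (\<lambda>w. rest m (W i w) * rest m (W j w))"
proof -
  have "indep_vars (\<lambda>_. borel) W {i, j}" by (rule indep_vars_subset[OF W_indep]) (use ij in auto)
  then have ind: "indep_vars (\<lambda>_. borel) (\<lambda>i w. rest m (W i w)) {i, j}"
    by (rule indep_vars_compose2) simp
  have int: "integrable M (\<lambda>w. rest m (W l w))" if "l \<in> {i, j}" for l
    using rest_moments(1)[OF m, of l] ij that by auto
  show "expectation (\<lambda>w. rest m (W i w) * rest m (W j w)) = (expectation (\<lambda>w. rest m (W 1 w)))\<^sup>2"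
    using indep_vars_lebesgue_integral[OF _ ind int] rest_moments(5)[OF m ij(1)] rest_moments(5)[OF m ij(2)] ij
    by (simp add: power2_eq_square)
  show "integrable M (\<lambda>w. rest m (W i w) * rest m (W j w))"
    using indep_vars_integrable[OF _ ind int] ij by simp
qed

text \<open>The absolute values destroy the centring: the off-diagonal products contribute
  \<open>n\<close> times a squared mean, the diagonal only a second moment of the tail. The
  off-diagonal part is the one that requires the lower bound on \<open>gam\<close>.\<close>

lemma Qn_second_moment:
  assumes n: "n \<ge> 1"
  defines "m \<equiv> real n powr gam"
  shows "integrable M (\<lambda>w. (Qn n w)\<^sup>2)" "expectation (\<lambda>w. (Qn n w)\<^sup>2) \<le> m powr (2 - q) * Lq + real n * (2 * m powr (1 - q) * Lq)\<^sup>2"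
proof -
  have m: "m > 0" using n by (simp add: m_def)
  let ?r = "\<lambda>i w. rest m (W i w)"
  have Q: "(Qn n w)\<^sup>2 = (1 / real n) * (\<Sum>i=1..n. \<Sum>j=1..n. ?r i w * ?r j w)" for w
  proof -
    have "(Qn n w)\<^sup>2 = (1 / sqrt (real n))\<^sup>2 * ((\<Sum>i=1..n. ?r i w) * (\<Sum>j=1..n. ?r j w))"
      by (simp add: Qn_def rest_def m_def power_mult_distrib power2_eq_square)
    then show ?thesis by (simp add: power_divide sum_product)
  qed
  have int: "integrable M (\<lambda>w. ?r i w * ?r j w)" if "i \<in> {1..n}" "j \<in> {1..n}" for i j
    using rest_product(2)[OF m, of i j] rest_moments(2)[OF m, of i] that by (cases "i = j") (auto simp: power2_eq_square)
  show "integrable M (\<lambda>w. (Qn n w)\<^sup>2)" unfolding Q using int by (intro integrable_mult_right Bochner_Integration.integrable_sum) auto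
  define a where "a = expectation (\<lambda>w. rest m (W 1 w))"
  define v where "v = m powr (2 - q) * Lq"
  have a: "0 \<le> a" "a \<le> 2 * m powr (1 - q) * Lq"
    using rest_moments(3)[OF m, of 1] by (auto simp: a_def rest_def)
  have v: "0 \<le> v" using Lq_nonneg by (simp add: v_def)
  have e: "expectation (\<lambda>w. ?r i w * ?r j w) \<le> (if i = j then v else 0) + a\<^sup>2" if "i \<in> {1..n}" "j \<in> {1..n}" for i j
    using rest_product(1)[OF m, of i j] rest_moments(4)[OF m, of i] that v
    by (cases "i = j") (auto simp: power2_eq_square v_def a_def intro: add_increasing2)
  have "expectation (\<lambda>w. (Qn n w)\<^sup>2) = (1 / real n) * (\<Sum>i=1..n. \<Sum>j=1..n. expectation (\<lambda>w. ?r i w * ?r j w))"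
  proof -
    have "expectation (\<lambda>w. \<Sum>i=1..n. \<Sum>j=1..n. ?r i w * ?r j w) = (\<Sum>i=1..n. expectation (\<lambda>w. \<Sum>j=1..n. ?r i w * ?r j w))"
      by (intro Bochner_Integration.integral_sum Bochner_Integration.integrable_sum int)
    also have "\<dots> = (\<Sum>i=1..n. \<Sum>j=1..n. expectation (\<lambda>w. ?r i w * ?r j w))"
      by (intro sum.cong refl Bochner_Integration.integral_sum int)
    finally show ?thesis unfolding Q by (simp only: integral_mult_right_zero)
  qed
  also have "\<dots> \<le> (1 / real n) * (\<Sum>i=1..n. \<Sum>j=1..n. (if i = j then v else 0) + a\<^sup>2)"
    by (intro mult_left_mono sum_mono e) auto
  also have "\<dots> = v + real n * a\<^sup>2"
    using n by (simp add: sum.distrib field_simps power2_eq_square)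
  also have "\<dots> \<le> v + real n * (2 * m powr (1 - q) * Lq)\<^sup>2"
    using a by (intro add_left_mono mult_left_mono power_mono) auto
  finally show "expectation (\<lambda>w. (Qn n w)\<^sup>2) \<le> m powr (2 - q) * Lq + real n * (2 * m powr (1 - q) * Lq)\<^sup>2" by (simp add: v_def)
qed

lemma Qn_second_moment_tendsto: "(\<lambda>n. expectation (\<lambda>w. (Qn n w)\<^sup>2)) \<longlonglongrightarrow> 0"
proof (rule tendsto_sandwich[OF _ _ tendsto_const])
  have g1: "gam * (2 - q) < 0" using gam_bounds q by (simp add: mult_pos_neg)
  have "1 < gam * (2 * q - 2)" using gam_bounds(1) q by (simp add: field_simps)
  then have g2: "1 + 2 * (gam * (1 - q)) < 0" by (simp add: algebra_simps)
  show "\<forall>\<^sub>F n in sequentially. expectation (\<lambda>w. (Qn n w)\<^sup>2) \<le> real n powr (gam * (2 - q)) * Lq + 4 * Lq\<^sup>2 * real n powr (1 + 2 * (gam * (1 - q)))"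
    using eventually_ge_at_top[of 1]
  proof eventually_elim
    case (elim n)
    have "real n * (2 * (real n powr gam) powr (1 - q) * Lq)\<^sup>2 = 4 * Lq\<^sup>2 * (real n powr 1 * (real n powr (gam * (1 - q)) * real n powr (gam * (1 - q))))"
      using elim by (simp add: powr_powr power2_eq_square)
    also have "\<dots> = 4 * Lq\<^sup>2 * real n powr (1 + 2 * (gam * (1 - q)))" unfolding powr_add[symmetric] by simp
    finally show ?case using Qn_second_moment(2)[OF elim] by (simp add: powr_powr)
  qed
  have l1: "(\<lambda>n. real n powr (gam * (2 - q))) \<longlonglongrightarrow> 0" using g1 by real_asymp
  have l2: "(\<lambda>n. real n powr (1 + 2 * (gam * (1 - q)))) \<longlonglongrightarrow> 0" using g2 by real_asymp
  have "(\<lambda>n. real n powr (gam * (2 - q)) * Lq + 4 * Lq\<^sup>2 * real n powr (1 + 2 * (gam * (1 - q)))) \<longlonglongrightarrow> 0 * Lq + 4 * Lq\<^sup>2 * 0"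
    by (intro tendsto_intros l1 l2)
  then show "(\<lambda>n. real n powr (gam * (2 - q)) * Lq + 4 * Lq\<^sup>2 * real n powr (1 + 2 * (gam * (1 - q)))) \<longlonglongrightarrow> 0" by simp
qed simp

lemma Qn_measurable[measurable]: "Qn n \<in> borel_measurable M"
  unfolding Qn_def[abs_def]
  by (intro borel_measurable_times borel_measurable_const borel_measurable_sum borel_measurable_abs borel_measurable_diff tw_measurable W_measurable) auto

lemma rho_measurable: "n \<ge> 1 \<Longrightarrow> rho n \<in> borel_measurable M"
  unfolding rho_def[abs_def] using weight_good_measurable[of n] by measurable

text \<open>The indicator term contributes \<open>n\<^sup>2\<close> times the probability of bad
  weights, which vanishes by superpolynomial decay; the other two terms are \<open>kap\<close>,
  which tends to 0, and the truncation error.\<close>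

lemma rho_second_moment:
  "n \<ge> 1 \<Longrightarrow> integrable M (\<lambda>w. (rho n w)\<^sup>2)" "(\<lambda>n. expectation (\<lambda>w. (rho n w)\<^sup>2)) \<longlonglongrightarrow> 0"
proof -
  define D where "D = 14 * SB / \<kappa>"
  define b where "b n w = 3 * ((kap n)\<^sup>2 + D\<^sup>2 * (Qn n w)\<^sup>2 + D\<^sup>2 * (real n)\<^sup>2 * indicator (space M - weight_good n) w)" for n w
  have le: "(rho n w)\<^sup>2 \<le> b n w" for n w
  proof -
    have three: "(x + y + z)\<^sup>2 \<le> 3 * (x\<^sup>2 + y\<^sup>2 + z\<^sup>2)" for x y z :: real
      using zero_le_power2[of "x - y"] zero_le_power2[of "y - z"] zero_le_power2[of "x - z"]
      by (simp add: power2_eq_square algebra_simps)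
    have i: "(indicator S w :: real)\<^sup>2 = indicator S w" for S by (simp add: indicator_def)
    show ?thesis
      using three[of "kap n" "D * Qn n w" "D * real n * indicator (space M - weight_good n) w"]
      unfolding rho_def D_def[symmetric] b_def power_mult_distrib i .
  qed
  have bint: "integrable M (b n)" if n: "n \<ge> 1" for n
  proof -
    have "space M - weight_good n \<in> events" using weight_good_measurable[OF n] by auto
    then show ?thesis unfolding b_def[abs_def] using Qn_second_moment(1)[OF n]
      by (intro integrable_mult_right Bochner_Integration.integrable_add integrable_const integrable_real_indicator) (auto simp: emeasure_eq_measure)
  qed
  show int: "integrable M (\<lambda>w. (rho n w)\<^sup>2)" if n: "n \<ge> 1" for n
  proof (rule Bochner_Integration.integrable_bound[OF bint[OF n]])
    show "(\<lambda>w. (rho n w)\<^sup>2) \<in> borel_measurable M" using rho_measurable[OF n] by measurable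
    show "AE w in M. norm ((rho n w)\<^sup>2) \<le> norm (b n w)"
      using le by (intro AE_I2) (simp add: abs_of_nonneg order_trans[OF zero_le_power2 le])
  qed
  show "(\<lambda>n. expectation (\<lambda>w. (rho n w)\<^sup>2)) \<longlonglongrightarrow> 0"
  proof (rule tendsto_sandwich[OF _ _ tendsto_const])
    show "\<forall>\<^sub>F n in sequentially. expectation (\<lambda>w. (rho n w)\<^sup>2) \<le> 3 * ((kap n)\<^sup>2 + D\<^sup>2 * expectation (\<lambda>w. (Qn n w)\<^sup>2) + D\<^sup>2 * ((real n)\<^sup>2 * prob (space M - weight_good n)))"
      using eventually_ge_at_top[of 1]
    proof eventually_elim
      case (elim n)
      have [measurable]: "space M - weight_good n \<in> events" using weight_good_measurable[OF elim] by auto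
      have "expectation (\<lambda>w. (rho n w)\<^sup>2) \<le> expectation (b n)"
        by (intro integral_mono int bint elim le)
      also have "\<dots> = 3 * ((kap n)\<^sup>2 + D\<^sup>2 * expectation (\<lambda>w. (Qn n w)\<^sup>2) + D\<^sup>2 * (real n)\<^sup>2 * prob (space M - weight_good n))"
        unfolding b_def[abs_def] using Qn_second_moment(1)[OF elim] by (simp add: prob_space emeasure_eq_measure)
      finally show ?case by simp
    qed
    have "(\<lambda>n. 3 * ((kap n)\<^sup>2 + D\<^sup>2 * expectation (\<lambda>w. (Qn n w)\<^sup>2) + D\<^sup>2 * ((real n)\<^sup>2 * prob (space M - weight_good n)))) \<longlonglongrightarrow> 3 * (0\<^sup>2 + D\<^sup>2 * 0 + D\<^sup>2 * 0)"
      by (intro tendsto_intros kap_tendsto Qn_second_moment_tendsto superpoly_limit(1)[OF prob_weight_good]) simp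
    then show "(\<lambda>n. 3 * ((kap n)\<^sup>2 + D\<^sup>2 * expectation (\<lambda>w. (Qn n w)\<^sup>2) + D\<^sup>2 * ((real n)\<^sup>2 * prob (space M - weight_good n)))) \<longlonglongrightarrow> 0" by simp
  qed simp
qed

end

section \<open>Conditional moments of the leading term\<close>

context wild_grid
begin

definition uvec :: "nat \<Rightarrow> nat \<Rightarrow> real \<Rightarrow> 'a \<Rightarrow> real ^ 'd" where
  "uvec n i \<tau> w = matrix_inv (Jn n \<tau>) *v cscore i (\<beta> \<tau>) \<tau> w"

definition avec :: "nat \<Rightarrow> real \<Rightarrow> 'a \<Rightarrow> real ^ 'd" where
  "avec n \<tau> w = matrix_inv (Jn n \<tau>) *v Wn n w (\<beta> \<tau>) \<tau>"

text \<open>The conditional covariance of \<open>avec\<close> given the data: the weights are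
  uncorrelated with variance 1, so only the diagonal \<open>i = j\<close> survives.\<close>

definition covm :: "nat \<Rightarrow> real \<Rightarrow> real \<Rightarrow> 'a \<Rightarrow> real ^ 'd ^ 'd" where
  "covm n \<tau> \<tau>' w = (1 / real n) *\<^sub>R (\<Sum>i=1..n. outer_prod (uvec n i \<tau> w) (uvec n i \<tau>' w))"

abbreviation Fn :: "nat \<Rightarrow> 'a measure" where "Fn n \<equiv> data_algebra M c Y X {1..n}"

lemma subalgebra_Fn: "subalgebra M (Fn n)" by (rule subalgebra_data_algebra) auto

lemma matrix_vector_mult_sum: "A *v (\<Sum>i\<in>I. v i) = (\<Sum>i\<in>I. A *v (v i :: real ^ 'd))" for A :: "real ^ 'd ^ 'd"
  by (rule linear_sum) simp

lemma avec_eq: "avec n \<tau> w = (1 / sqrt (real n)) *\<^sub>R (\<Sum>i=1..n. W i w *\<^sub>R uvec n i \<tau> w)"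
  unfolding avec_def Wn_eq uvec_def by (simp add: matrix_vector_mult_scaleR matrix_vector_mult_sum)

lemma avec_product:
  "n \<ge> 1 \<Longrightarrow> avec n \<tau> w $ k * avec n \<tau>' w $ l = (1 / real n) * (\<Sum>i=1..n. \<Sum>j=1..n. (W i w * W j w) * (uvec n i \<tau> w $ k * uvec n j \<tau>' w $ l))"
proof -
  assume n: "n \<ge> 1"
  have "avec n \<tau> w $ k * avec n \<tau>' w $ l = (1 / sqrt (real n))\<^sup>2 * ((\<Sum>i=1..n. W i w * uvec n i \<tau> w $ k) * (\<Sum>j=1..n. W j w * uvec n j \<tau>' w $ l))"
    by (simp add: avec_eq power2_eq_square)
  also have "(1 / sqrt (real n))\<^sup>2 = 1 / real n" by (simp add: power_divide)
  finally show ?thesis by (simp add: sum_product mult_ac)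
qed

lemma uvec_bound:
  assumes "n \<ge> 1" "i \<in> {1..n}" "\<tau> \<in> T" "okX i w"
  shows "norm (uvec n i \<tau> w) \<le> SB / \<kappa>"
proof -
  have "norm (uvec n i \<tau> w) \<le> norm (cscore i (\<beta> \<tau>) \<tau> w) / \<kappa>"
    unfolding uvec_def by (rule coercive_inverse(3)[OF Jn_ge[OF assms(1,3)] kappa_pos])
  also have "\<dots> \<le> SB / \<kappa>"
    using kappa_pos assms T_in_unit by (intro divide_right_mono norm_cscore_le) auto
  finally show ?thesis .
qed

lemma uvec_measurable:
  assumes "i \<in> {1..n}"
  shows "uvec n i \<tau> \<in> borel_measurable (Fn n)" "(\<lambda>w. uvec n i \<tau> w $ k) \<in> borel_measurable (Fn n)"
proof -
  have "continuous_on UNIV ((*v) (matrix_inv (Jn n \<tau>)))" by (rule linear_continuous_on) simp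
  from measurable_compose[OF cscore_data_measurable[OF assms] borel_measurable_continuous_onI[OF this]]
  show 1: "uvec n i \<tau> \<in> borel_measurable (Fn n)" by (simp add: uvec_def[abs_def])
  show "(\<lambda>w. uvec n i \<tau> w $ k) \<in> borel_measurable (Fn n)"
    by (rule measurable_compose[OF 1]) (auto intro!: borel_measurable_continuous_onI continuous_intros)
qed

lemma W_product:
  assumes "i \<ge> 1" "j \<ge> 1"
  shows "integrable M (\<lambda>w. W i w * W j w)" "expectation (\<lambda>w. W i w * W j w) = of_bool (i = j)"
    "(\<lambda>w. W i w * W j w) \<in> borel_measurable (weight_algebra M W)"
proof -
  have sq: "expectation (\<lambda>w. (W i w)\<^sup>2) = 1"
    using W_transfer(1)[OF assms(1), of "\<lambda>x. x\<^sup>2"] W_var by simp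
  have mean: "expectation (W l) = 0" if "l \<ge> 1" for l
    using W_transfer(1)[OF that, of "\<lambda>x. x"] W_mean by simp
  show "(\<lambda>w. W i w * W j w) \<in> borel_measurable (weight_algebra M W)"
    using measurable_weight_algebra assms by (intro borel_measurable_times) auto
  show "integrable M (\<lambda>w. W i w * W j w)" "expectation (\<lambda>w. W i w * W j w) = of_bool (i = j)"
  proof (atomize (full), cases "i = j")
    case True
    then show "integrable M (\<lambda>w. W i w * W j w) \<and> expectation (\<lambda>w. W i w * W j w) = of_bool (i = j)"
      using sq W_integrable(2)[OF assms(1)] by (simp add: power2_eq_square)
  next
    case False
    have ind: "indep_vars (\<lambda>_. borel) W {i, j}" by (rule indep_vars_subset[OF W_indep]) (use assms in auto)
    have int: "integrable M (W l)" if "l \<in> {i, j}" for l using W_integrable(1) assms that by auto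
    show "integrable M (\<lambda>w. W i w * W j w) \<and> expectation (\<lambda>w. W i w * W j w) = of_bool (i = j)"
      using indep_vars_lebesgue_integral[OF _ ind int] indep_vars_integrable[OF _ ind int] mean assms False by simp
  qed
qed

lemma uprod_integrable:
  assumes "n \<ge> 1" "i \<in> {1..n}" "j \<in> {1..n}" "\<tau> \<in> T" "\<tau>' \<in> T"
  shows "integrable M (\<lambda>w. uvec n i \<tau> w $ k * uvec n j \<tau>' w $ l)"
proof (rule integrable_const_bound[where B="(SB / \<kappa>) * (SB / \<kappa>)"])
  have ij: "i \<ge> 1" "j \<ge> 1" using assms by auto
  show "AE w in M. norm (uvec n i \<tau> w $ k * uvec n j \<tau>' w $ l) \<le> (SB / \<kappa>) * (SB / \<kappa>)"
    using AE_okX[OF ij(1)] AE_okX[OF ij(2)]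
  proof eventually_elim
    case (elim w)
    have "0 \<le> SB / \<kappa>" using SB_ge kappa_pos by simp
    then show ?case unfolding real_norm_def abs_mult
      using order_trans[OF component_le_norm_cart uvec_bound[OF assms(1,2,4) elim(1)]]
        order_trans[OF component_le_norm_cart uvec_bound[OF assms(1,3,5) elim(2)]]
      by (intro mult_mono) auto
  qed
  show "(\<lambda>w. uvec n i \<tau> w $ k * uvec n j \<tau>' w $ l) \<in> borel_measurable M"
    using measurable_from_subalg[OF subalgebra_Fn uvec_measurable(2)] assms by (intro borel_measurable_times) auto
qed

lemma covm_component: "covm n \<tau> \<tau>' w $ k $ l = (1 / real n) * (\<Sum>i=1..n. uvec n i \<tau> w $ k * uvec n i \<tau>' w $ l)"
  by (simp add: covm_def outer_prod_def)

lemma covm_integrable: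
  assumes "n \<ge> 1" "\<tau> \<in> T" "\<tau>' \<in> T"
  shows "integrable M (\<lambda>w. covm n \<tau> \<tau>' w $ k $ l)" "(\<lambda>w. covm n \<tau> \<tau>' w $ k $ l) \<in> borel_measurable (Fn n)"
  unfolding covm_component using assms
  by (intro integrable_mult_right Bochner_Integration.integrable_sum uprod_integrable; simp)
     (intro borel_measurable_times borel_measurable_const borel_measurable_sum uvec_measurable, auto)

lemma weight_uprod:
  assumes "n \<ge> 1" "i \<in> {1..n}" "j \<in> {1..n}" "\<tau> \<in> T" "\<tau>' \<in> T" "A \<in> sets (Fn n)"
  shows "integrable M (\<lambda>w. (W i w * W j w) * (indicator A w * (uvec n i \<tau> w $ k * uvec n j \<tau>' w $ l)))"
    "expectation (\<lambda>w. (W i w * W j w) * (indicator A w * (uvec n i \<tau> w $ k * uvec n j \<tau>' w $ l))) =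
      of_bool (i = j) * expectation (\<lambda>w. indicator A w * (uvec n i \<tau> w $ k * uvec n j \<tau>' w $ l))"
proof -
  have ij: "i \<ge> 1" "j \<ge> 1" using assms by auto
  have AM: "A \<in> events" using assms(6) sets_data_algebra_M by auto
  have "subalgebra (data_algebra M c Y X {1..}) (Fn n)"
    using data_algebra_mono[of "{1..n}" "{1..}"] by (auto simp: subalgebra_def)
  moreover have "(\<lambda>w. indicator A w * (uvec n i \<tau> w $ k * uvec n j \<tau>' w $ l)) \<in> borel_measurable (Fn n)"
    using assms uvec_measurable by (intro borel_measurable_times borel_measurable_indicator) auto
  ultimately have m: "(\<lambda>w. indicator A w * (uvec n i \<tau> w $ k * uvec n j \<tau>' w $ l)) \<in> borel_measurable (data_algebra M c Y X {1..})"
    by (rule measurable_from_subalg)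
  have int: "integrable M (\<lambda>w. indicator A w * (uvec n i \<tau> w $ k * uvec n j \<tau>' w $ l))"
    using integrable_mult_indicator[OF AM uprod_integrable[OF assms(1-5)]] by simp
  show "integrable M (\<lambda>w. (W i w * W j w) * (indicator A w * (uvec n i \<tau> w $ k * uvec n j \<tau>' w $ l)))"
    "expectation (\<lambda>w. (W i w * W j w) * (indicator A w * (uvec n i \<tau> w $ k * uvec n j \<tau>' w $ l))) =
      of_bool (i = j) * expectation (\<lambda>w. indicator A w * (uvec n i \<tau> w $ k * uvec n j \<tau>' w $ l))"
    using expectation_weight_data[OF W_product(3)[OF ij] W_product(1)[OF ij] m int] W_product(2)[OF ij] by simp_all
qed

text \<open>Integrals over sets of \<open>Fn n\<close> identify a conditional expectation. The
  weights are independent of such a set together with the scores, so their products can be averaged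
  first.\<close>

lemma avec_product_restricted:
  assumes n: "n \<ge> 1" and T: "\<tau> \<in> T" "\<tau>' \<in> T" and A: "A \<in> sets (Fn n)"
  shows "integrable M (\<lambda>w. indicator A w * (avec n \<tau> w $ k * avec n \<tau>' w $ l))"
    "expectation (\<lambda>w. indicator A w * (avec n \<tau> w $ k * avec n \<tau>' w $ l)) = expectation (\<lambda>w. indicator A w * covm n \<tau> \<tau>' w $ k $ l)"
proof -
  let ?g = "\<lambda>i j w. (W i w * W j w) * (indicator A w * (uvec n i \<tau> w $ k * uvec n j \<tau>' w $ l))"
  let ?h = "\<lambda>i w. indicator A w * (uvec n i \<tau> w $ k * uvec n i \<tau>' w $ l)"
  have AM: "A \<in> events" using A sets_data_algebra_M by auto
  have eq: "indicator A w * (avec n \<tau> w $ k * avec n \<tau>' w $ l) = (1 / real n) * (\<Sum>i=1..n. \<Sum>j=1..n. ?g i j w)" for w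
    unfolding avec_product[OF n] sum_distrib_left by (intro sum.cong refl) (simp only: mult_ac)
  note gi = weight_uprod[OF n _ _ T A]
  show "integrable M (\<lambda>w. indicator A w * (avec n \<tau> w $ k * avec n \<tau>' w $ l))"
    unfolding eq by (intro integrable_mult_right Bochner_Integration.integrable_sum gi)
  have hint: "integrable M (?h i)" if "i \<in> {1..n}" for i
    using integrable_mult_indicator[OF AM uprod_integrable[OF n that that T]] by simp
  have "expectation (\<lambda>w. indicator A w * (avec n \<tau> w $ k * avec n \<tau>' w $ l)) = (1 / real n) * expectation (\<lambda>w. \<Sum>i=1..n. \<Sum>j=1..n. ?g i j w)"
    unfolding eq by (rule integral_mult_right_zero)
  also have "expectation (\<lambda>w. \<Sum>i=1..n. \<Sum>j=1..n. ?g i j w) = (\<Sum>i=1..n. expectation (\<lambda>w. \<Sum>j=1..n. ?g i j w))"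
    by (intro Bochner_Integration.integral_sum Bochner_Integration.integrable_sum gi)
  also have "\<dots> = (\<Sum>i=1..n. \<Sum>j=1..n. expectation (?g i j))"
    by (intro sum.cong refl Bochner_Integration.integral_sum gi)
  also have "\<dots> = (\<Sum>i=1..n. \<Sum>j=1..n. of_bool (i = j) * expectation (\<lambda>w. indicator A w * (uvec n i \<tau> w $ k * uvec n j \<tau>' w $ l)))"
    by (intro sum.cong refl gi(2))
  also have "\<dots> = (\<Sum>i=1..n. expectation (?h i))"
    by (intro sum.cong refl) (simp add: of_bool_def if_distrib[where f="\<lambda>x. x * _"] cong: if_cong)
  also have "\<dots> = expectation (\<lambda>w. \<Sum>i=1..n. ?h i w)"
    by (intro Bochner_Integration.integral_sum[symmetric] hint)
  also have "(1 / real n) * \<dots> = expectation (\<lambda>w. (1 / real n) * (\<Sum>i=1..n. ?h i w))" by simp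
  also have "\<dots> = expectation (\<lambda>w. indicator A w * covm n \<tau> \<tau>' w $ k $ l)"
    unfolding covm_component sum_distrib_left by (intro Bochner_Integration.integral_cong sum.cong refl) (simp only: mult_ac)
  finally show "expectation (\<lambda>w. indicator A w * (avec n \<tau> w $ k * avec n \<tau>' w $ l)) = expectation (\<lambda>w. indicator A w * covm n \<tau> \<tau>' w $ k $ l)" .
qed

lemma avec_product_integrable:
  assumes n: "n \<ge> 1" and T: "\<tau> \<in> T" "\<tau>' \<in> T"
  shows "integrable M (\<lambda>w. avec n \<tau> w $ k * avec n \<tau>' w $ l)"
proof -
  have "space M \<in> sets (Fn n)" using sets.top[of "Fn n"] by simp
  from avec_product_restricted(1)[OF n T this, of k l]
  show ?thesis by (rule Bochner_Integration.integrable_cong[THEN iffD1, rotated -1]) auto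
qed

lemma avec_product_cond_exp:
  assumes n: "n \<ge> 1" and T: "\<tau> \<in> T" "\<tau>' \<in> T"
  shows "AE w in M. real_cond_exp M (Fn n) (\<lambda>w. avec n \<tau> w $ k * avec n \<tau>' w $ l) w = covm n \<tau> \<tau>' w $ k $ l"
proof -
  interpret F: finite_measure_subalgebra M "Fn n" by standard (rule subalgebra_Fn)
  show ?thesis
    by (rule F.real_cond_exp_charact)
       (use avec_product_restricted(2)[OF n T] avec_product_integrable[OF n T] covm_integrable[OF n T] in \<open>auto simp: set_lebesgue_integral_def\<close>)
qed

text \<open>The trace is the average of \<open>(norm (uvec n i \<tau> w))\<^sup>2\<close>. It equals
  the conditional second moment of \<open>norm (avec n \<tau> w)\<close>, which is thus bounded by a
  constant on \<open>data_good\<close>.\<close>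

lemma covm_trace_le:
  assumes n: "n \<ge> 1" and good: "w \<in> data_good n" and T: "\<tau> \<in> T"
  shows "(\<Sum>k\<in>UNIV. covm n \<tau> \<tau> w $ k $ k) \<le> (SB / \<kappa>)\<^sup>2"
proof -
  have "(\<Sum>k\<in>UNIV. covm n \<tau> \<tau> w $ k $ k) = (1 / real n) * (\<Sum>i=1..n. (norm (uvec n i \<tau> w))\<^sup>2)"
    unfolding covm_component sum_distrib_left[symmetric]
    by (subst sum.swap) (simp add: power2_norm_eq_inner inner_vec_def)
  also have "\<dots> \<le> (1 / real n) * (\<Sum>i=1..n. (SB / \<kappa>)\<^sup>2)"
    using uvec_bound[OF n _ T good_ok[OF n good]] by (intro mult_left_mono sum_mono power_mono) auto
  also have "\<dots> = (SB / \<kappa>)\<^sup>2" using n by simp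
  finally show ?thesis .
qed

lemma norm_avec_sq: "(norm (avec n \<tau> w))\<^sup>2 = (\<Sum>k\<in>UNIV. avec n \<tau> w $ k * avec n \<tau> w $ k)"
  by (simp add: power2_norm_eq_inner inner_vec_def)

text \<open>
  The error of replacing \<open>h\<close> by \<open>- avec\<close> in a product of components; the weight \<open>\<alpha>\<close> takes the place
  of the Cauchy-Schwarz inequality for conditional expectations.
\<close>

definition perr :: "real \<Rightarrow> nat \<Rightarrow> real \<Rightarrow> real \<Rightarrow> 'a \<Rightarrow> real" where
  "perr \<alpha> n \<tau> \<tau>' w = \<alpha> * ((norm (avec n \<tau> w))\<^sup>2 + (norm (avec n \<tau>' w))\<^sup>2) + (2 / \<alpha> + 1) * (rho n w)\<^sup>2"

lemma product_error:
  fixes h h' :: "real ^ 'd"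
  assumes "\<alpha> > 0" "norm (h + avec n \<tau> w) \<le> rho n w" "norm (h' + avec n \<tau>' w) \<le> rho n w"
  shows "\<bar>h $ k * h' $ l - avec n \<tau> w $ k * avec n \<tau>' w $ l\<bar> \<le> perr \<alpha> n \<tau> \<tau>' w"
proof -
  define x y a b p where "x = h $ k" "y = h' $ l" "a = avec n \<tau> w $ k" "b = avec n \<tau>' w $ l" "p = rho n w"
  define A A' where "A = norm (avec n \<tau> w)" "A' = norm (avec n \<tau>' w)"
  have xa: "\<bar>x + a\<bar> \<le> p" "\<bar>y + b\<bar> \<le> p"
    using order_trans[OF component_le_norm_cart assms(2), of k] order_trans[OF component_le_norm_cart assms(3), of l]
    by (auto simp: x_y_a_b_p_def)
  have ab: "\<bar>a\<bar> \<le> A" "\<bar>b\<bar> \<le> A'" by (auto simp: x_y_a_b_p_def A_A'_def component_le_norm_cart)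
  have p0: "0 \<le> p" using xa by linarith
  \<comment> \<open>Young's inequality by completing a square, with constants that are not
    sharp.\<close>
  have young: "p * z \<le> \<alpha> * z\<^sup>2 + p\<^sup>2 / \<alpha>" for z
  proof -
    have "0 \<le> (\<alpha> * z - p)\<^sup>2 + (\<alpha> * z)\<^sup>2 + p\<^sup>2" by simp
    then have "p * (\<alpha> * z) \<le> (\<alpha> * z)\<^sup>2 + p\<^sup>2" by (simp add: power2_eq_square algebra_simps)
    then have "p * (\<alpha> * z) / \<alpha> \<le> ((\<alpha> * z)\<^sup>2 + p\<^sup>2) / \<alpha>" using assms(1) by (intro divide_right_mono) auto
    then show ?thesis using assms(1) by (simp add: add_divide_distrib power2_eq_square mult.left_commute)
  qed
  \<comment> \<open>The minus signs of the two approximations cancel in the product, so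
    \<open>a * b\<close> is the right comparison.\<close>
  have "x * y - a * b = (x + a) * (y + b) - (x + a) * b - a * (y + b)" by (simp add: algebra_simps)
  then have "\<bar>x * y - a * b\<bar> \<le> \<bar>x + a\<bar> * \<bar>y + b\<bar> + \<bar>x + a\<bar> * \<bar>b\<bar> + \<bar>a\<bar> * \<bar>y + b\<bar>"
    unfolding abs_mult[symmetric] by linarith
  also have "\<dots> \<le> p * p + p * A' + A * p"
    using xa ab p0 by (intro add_mono mult_mono) (auto simp: A_A'_def)
  also have "\<dots> \<le> p\<^sup>2 + (\<alpha> * A'\<^sup>2 + p\<^sup>2 / \<alpha>) + (\<alpha> * A\<^sup>2 + p\<^sup>2 / \<alpha>)"
    using young[of A'] young[of A] by (simp only: power2_eq_square mult.commute[of A p])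
  also have "\<dots> = perr \<alpha> n \<tau> \<tau>' w"
    unfolding perr_def A_A'_def[symmetric] x_y_a_b_p_def(5)[symmetric] by (simp add: algebra_simps add_divide_distrib)
  finally show ?thesis by (simp add: x_y_a_b_p_def)
qed

lemma perr_integrable:
  assumes "n \<ge> 1" "\<tau> \<in> T" "\<tau>' \<in> T"
  shows "integrable M (perr \<alpha> n \<tau> \<tau>')"
  unfolding perr_def[abs_def] norm_avec_sq
  by (intro Bochner_Integration.integrable_add integrable_mult_right Bochner_Integration.integrable_sum avec_product_integrable rho_second_moment assms)

lemma perr_cond_exp:
  assumes n: "n \<ge> 1" and T: "\<tau> \<in> T" "\<tau>' \<in> T" and \<alpha>: "\<alpha> > 0"
  shows "AE w in M. w \<in> data_good n \<longrightarrow> real_cond_exp M (Fn n) (perr \<alpha> n \<tau> \<tau>') w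
     \<le> \<alpha> * (2 * (SB / \<kappa>)\<^sup>2) + (2 / \<alpha> + 1) * real_cond_exp M (Fn n) (\<lambda>w. (rho n w)\<^sup>2) w"
proof -
  interpret F: finite_measure_subalgebra M "Fn n" by standard (rule subalgebra_Fn)
  have sqi: "integrable M (\<lambda>w. (norm (avec n t w))\<^sup>2)" if "t \<in> T" for t
    unfolding norm_avec_sq by (intro Bochner_Integration.integrable_sum avec_product_integrable n that)
  have sq: "AE w in M. w \<in> data_good n \<longrightarrow> real_cond_exp M (Fn n) (\<lambda>w. (norm (avec n t w))\<^sup>2) w \<le> (SB / \<kappa>)\<^sup>2" if t: "t \<in> T" for t
  proof -
    have 1: "AE w in M. real_cond_exp M (Fn n) (\<lambda>w. \<Sum>k\<in>UNIV. avec n t w $ k * avec n t w $ k) w = (\<Sum>k\<in>UNIV. real_cond_exp M (Fn n) (\<lambda>w. avec n t w $ k * avec n t w $ k) w)"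
      by (rule F.real_cond_exp_sum) (rule avec_product_integrable[OF n t t])
    have 2: "AE w in M. \<forall>k\<in>UNIV. real_cond_exp M (Fn n) (\<lambda>w. avec n t w $ k * avec n t w $ k) w = covm n t t w $ k $ k"
      by (intro AE_finite_allI avec_product_cond_exp n t) simp
    show ?thesis unfolding norm_avec_sq using 1 2
      by eventually_elim (use covm_trace_le[OF n _ t] in auto)
  qed
  let ?a = "\<lambda>w. \<alpha> * ((norm (avec n \<tau> w))\<^sup>2 + (norm (avec n \<tau>' w))\<^sup>2)" and ?b = "\<lambda>w. (2 / \<alpha> + 1) * (rho n w)\<^sup>2"
  have ri: "integrable M (\<lambda>w. (rho n w)\<^sup>2)" by (rule rho_second_moment(1)[OF n])
  have "AE w in M. real_cond_exp M (Fn n) (\<lambda>w. ?a w + ?b w) w = real_cond_exp M (Fn n) ?a w + real_cond_exp M (Fn n) ?b w"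
    using sqi T ri by (intro F.real_cond_exp_add) auto
  moreover have "AE w in M. real_cond_exp M (Fn n) ?a w = \<alpha> * real_cond_exp M (Fn n) (\<lambda>w. (norm (avec n \<tau> w))\<^sup>2 + (norm (avec n \<tau>' w))\<^sup>2) w"
    using sqi T by (intro F.real_cond_exp_cmult) auto
  moreover have "AE w in M. real_cond_exp M (Fn n) (\<lambda>w. (norm (avec n \<tau> w))\<^sup>2 + (norm (avec n \<tau>' w))\<^sup>2) w = real_cond_exp M (Fn n) (\<lambda>w. (norm (avec n \<tau> w))\<^sup>2) w + real_cond_exp M (Fn n) (\<lambda>w. (norm (avec n \<tau>' w))\<^sup>2) w"
    using sqi T by (intro F.real_cond_exp_add) auto
  moreover have "AE w in M. real_cond_exp M (Fn n) ?b w = (2 / \<alpha> + 1) * real_cond_exp M (Fn n) (\<lambda>w. (rho n w)\<^sup>2) w"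
    using ri by (intro F.real_cond_exp_cmult) auto
  ultimately show ?thesis using sq[OF T(1)] sq[OF T(2)]
  proof eventually_elim
    case (elim w)
    show ?case
    proof
      assume g: "w \<in> data_good n"
      have "\<alpha> * (real_cond_exp M (Fn n) (\<lambda>w. (norm (avec n \<tau> w))\<^sup>2) w + real_cond_exp M (Fn n) (\<lambda>w. (norm (avec n \<tau>' w))\<^sup>2) w) \<le> \<alpha> * (2 * (SB / \<kappa>)\<^sup>2)"
        using elim g \<alpha> by (intro mult_left_mono) auto
      moreover have "real_cond_exp M (Fn n) (perr \<alpha> n \<tau> \<tau>') w = \<alpha> * (real_cond_exp M (Fn n) (\<lambda>w. (norm (avec n \<tau> w))\<^sup>2) w + real_cond_exp M (Fn n) (\<lambda>w. (norm (avec n \<tau>' w))\<^sup>2) w)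
          + (2 / \<alpha> + 1) * real_cond_exp M (Fn n) (\<lambda>w. (rho n w)\<^sup>2) w"
        by (simp only: perr_def[abs_def] elim(1-4))
      ultimately show "real_cond_exp M (Fn n) (perr \<alpha> n \<tau> \<tau>') w \<le> \<alpha> * (2 * (SB / \<kappa>)\<^sup>2) + (2 / \<alpha> + 1) * real_cond_exp M (Fn n) (\<lambda>w. (rho n w)\<^sup>2) w"
        by linarith
    qed
  qed
qed

text \<open>
  Both readings of the conditional outer expectation are squeezed between the conditional
  expectations of measurable bounds; outside \<open>data_good\<close> nothing is claimed.
\<close>

lemma cond_outer_exp_sandwich:
  fixes Z p e :: "'a \<Rightarrow> real"
  assumes n: "n \<ge> 1" and bounded: "\<And>w. w \<in> space M \<Longrightarrow> \<bar>Z w\<bar> \<le> C"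
    and near: "\<And>w. w \<in> data_good n \<Longrightarrow> \<bar>Z w - p w\<bar> \<le> e w"
    and p: "integrable M p" and e: "integrable M e"
  shows "AE w in M. w \<in> data_good n \<longrightarrow> \<bar>cond_outer_exp M (Fn n) Z w - real_cond_exp M (Fn n) p w\<bar> \<le> real_cond_exp M (Fn n) e w"
proof -
  interpret F: finite_measure_subalgebra M "Fn n" by standard (rule subalgebra_Fn)
  have gF[measurable]: "data_good n \<in> sets (Fn n)" by (rule data_good_measurable[OF n])
  then have gM[measurable]: "data_good n \<in> events" using sets_data_algebra_M by auto
  define U where "U = (SOME U. is_measurable_cover M Z U)"
  have U: "is_measurable_cover M Z U"
    unfolding U_def using measurable_cover_exists[of Z C] bounded by (intro someI_ex[where P="is_measurable_cover M Z"]) blast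
  then have Um[measurable]: "U \<in> borel_measurable M" and ZU: "\<And>w. w \<in> space M \<Longrightarrow> Z w \<le> U w"
    and min: "\<And>U'. U' \<in> borel_measurable M \<Longrightarrow> (\<forall>w\<in>space M. Z w \<le> U' w) \<Longrightarrow> AE w in M. U w \<le> U' w"
    by (auto simp: is_measurable_cover_def)
  have [measurable]: "p \<in> borel_measurable M" "e \<in> borel_measurable M" using p e by auto
  have "AE w in M. U w \<le> C"
    by (rule min) (use bounded in \<open>auto simp: abs_le_iff\<close>)
  moreover have "AE w in M. - C \<le> U w"
  proof (rule AE_I2)
    fix w assume "w \<in> space M"
    then show "- C \<le> U w" using ZU bounded by (fastforce simp: abs_le_iff)
  qed
  ultimately have "AE w in M. norm (U w) \<le> C" by eventually_elim (simp add: abs_le_iff)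
  then have iU: "integrable M U" by (rule integrable_const_bound) simp
  \<comment> \<open>Off the good event the constant \<open>C\<close> majorizes \<open>Z\<close>, so
    the glued function is a measurable majorant and lies above the minimal cover.\<close>
  define U' where "U' w = (if w \<in> data_good n then p w + e w else C)" for w
  have "AE w in M. U w \<le> U' w"
  proof (rule min)
    show "U' \<in> borel_measurable M" unfolding U'_def[abs_def] by measurable
    show "\<forall>w\<in>space M. Z w \<le> U' w"
    proof
      fix w assume w: "w \<in> space M"
      show "Z w \<le> U' w"
        using near[of w] bounded[OF w] by (auto simp: U'_def abs_le_iff)
    qed
  qed
  then have up: "AE w in M. indicator (data_good n) w * U w \<le> indicator (data_good n) w * (p w + e w)"
    by eventually_elim (auto simp: U'_def indicator_def)
  have lo: "AE w in M. indicator (data_good n) w * (p w - e w) \<le> indicator (data_good n) w * U w"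
  proof (rule AE_I2)
    fix w assume w: "w \<in> space M"
    show "indicator (data_good n) w * (p w - e w) \<le> indicator (data_good n) w * U w"
      using near[of w] ZU[OF w] by (auto simp: indicator_def abs_le_iff)
  qed
  have ii: "integrable M (\<lambda>w. indicator (data_good n) w * g w)" if "integrable M g" for g :: "'a \<Rightarrow> real"
    using integrable_mult_indicator[OF gM that] by simp
  \<comment> \<open>\<open>data_good n\<close> belongs to \<open>Fn n\<close>, so its indicator
    leaves the conditional expectation and the comparison survives on the event itself.\<close>
  have pull: "AE w in M. real_cond_exp M (Fn n) (\<lambda>w. indicator (data_good n) w * g w) w = indicator (data_good n) w * real_cond_exp M (Fn n) g w"
    if "integrable M g" for g
    by (rule F.real_cond_exp_mult) (use that ii gF in \<open>auto intro!: borel_measurable_indicator\<close>)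
  have pe: "integrable M (\<lambda>w. p w + e w)" "integrable M (\<lambda>w. p w - e w)" using p e by auto
  have "AE w in M. real_cond_exp M (Fn n) (\<lambda>w. indicator (data_good n) w * U w) w \<le> real_cond_exp M (Fn n) (\<lambda>w. indicator (data_good n) w * (p w + e w)) w"
    by (rule F.real_cond_exp_mono[OF up ii[OF iU] ii[OF pe(1)]])
  moreover have "AE w in M. real_cond_exp M (Fn n) (\<lambda>w. indicator (data_good n) w * (p w - e w)) w \<le> real_cond_exp M (Fn n) (\<lambda>w. indicator (data_good n) w * U w) w"
    by (rule F.real_cond_exp_mono[OF lo ii[OF pe(2)] ii[OF iU]])
  moreover note pull[OF iU] pull[OF pe(1)] pull[OF pe(2)] F.real_cond_exp_add[OF p e] F.real_cond_exp_diff[OF p e]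
  ultimately show ?thesis
    unfolding cond_outer_exp_def U_def[symmetric]
    by eventually_elim (auto simp: abs_le_iff)
qed

lemma outer_expectation_sandwich:
  fixes Z p e :: "'b \<Rightarrow> real"
  assumes N: "prob_space N" and g: "g \<in> sets N" "AE w in N. w \<in> g"
    and bounded: "\<And>w. w \<in> space N \<Longrightarrow> \<bar>Z w\<bar> \<le> C"
    and near: "\<And>w. w \<in> g \<Longrightarrow> \<bar>Z w - p w\<bar> \<le> e w"
    and p: "integrable N p" and e: "integrable N e"
  shows "\<bar>outer_expectation N Z - (\<integral>w. p w \<partial>N)\<bar> \<le> (\<integral>w. e w \<partial>N)"
proof -
  interpret N: prob_space N by fact
  let ?S = "{\<integral>w. U w \<partial>N | U. integrable N U \<and> (\<forall>w\<in>space N. Z w \<le> U w)}"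
  define U where "U w = (if w \<in> g then p w + e w else C)" for w
  have Um: "U \<in> borel_measurable N"
    unfolding U_def[abs_def] using g(1) p e by (intro measurable_If_set borel_measurable_add) auto
  have UAE: "AE w in N. U w = p w + e w" using g(2) by eventually_elim (simp add: U_def)
  have Ui: "integrable N U"
    using integrable_cong_AE[OF Um _ UAE] p e by auto
  have UI: "(\<integral>w. U w \<partial>N) = (\<integral>w. p w \<partial>N) + (\<integral>w. e w \<partial>N)"
    using integral_cong_AE[OF Um _ UAE] p e by auto
  have maj: "\<forall>w\<in>space N. Z w \<le> U w"
  proof
    fix w assume w: "w \<in> space N"
    show "Z w \<le> U w" using near[of w] bounded[OF w] by (auto simp: U_def abs_le_iff)
  qed
  \<comment> \<open>Every majorant is almost surely above \<open>p - e\<close>. This bounds the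
    infimum from below and also shows that the set has a lower bound, without which the infimum
    would be meaningless.\<close>
  have lower: "(\<integral>w. p w \<partial>N) - (\<integral>w. e w \<partial>N) \<le> x" if x: "x \<in> ?S" for x
  proof -
    obtain V where V: "integrable N V" "\<forall>w\<in>space N. Z w \<le> V w" "x = (\<integral>w. V w \<partial>N)" using x by auto
    have "AE w in N. p w - e w \<le> V w"
      using g(2) AE_space
    proof eventually_elim
      case (elim w)
      show ?case using near[OF elim(1)] V(2) elim(2) by (force simp: abs_le_iff)
    qed
    then have "(\<integral>w. p w - e w \<partial>N) \<le> (\<integral>w. V w \<partial>N)"
      using p e V(1) by (intro integral_mono_AE) auto
    then show ?thesis using p e V(3) by simp
  qed
  have "outer_expectation N Z \<le> (\<integral>w. p w \<partial>N) + (\<integral>w. e w \<partial>N)"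
    unfolding outer_expectation_def UI[symmetric]
    by (rule cInf_lower) (use Ui maj lower in \<open>auto intro!: bdd_belowI[where m="(\<integral>w. p w \<partial>N) - (\<integral>w. e w \<partial>N)"]\<close>)
  moreover have "(\<integral>w. p w \<partial>N) - (\<integral>w. e w \<partial>N) \<le> outer_expectation N Z"
    unfolding outer_expectation_def by (rule cInf_greatest) (use Ui maj lower in auto)
  ultimately show ?thesis by (simp add: abs_le_iff)
qed

end

section \<open>Convergence of the conditional covariance\<close>

text \<open>The limit inherits the Lipschitz constant, and a finite net of mesh
  \<open>\<delta>\<close> with \<open>C * \<delta> \<le> e / 4\<close> reduces uniformity to
  finitely many points.\<close>

lemma equilipschitz_uniform_limit:
  fixes F :: "nat \<Rightarrow> 'b::metric_space \<Rightarrow> 'c::real_normed_vector"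
  assumes S: "compact S" and C: "0 \<le> C"
    and lip: "\<And>n x y. n \<ge> 1 \<Longrightarrow> x \<in> S \<Longrightarrow> y \<in> S \<Longrightarrow> norm (F n x - F n y) \<le> C * dist x y"
    and lim: "\<And>x. x \<in> S \<Longrightarrow> (\<lambda>n. F n x) \<longlonglongrightarrow> f x"
  shows "uniform_limit S F f sequentially"
proof (rule uniform_limitI)
  fix e :: real assume e: "e > 0"
  have flip: "norm (f x - f y) \<le> C * dist x y" if "x \<in> S" "y \<in> S" for x y
  proof (rule LIMSEQ_le_const2)
    show "(\<lambda>n. norm (F n x - F n y)) \<longlonglongrightarrow> norm (f x - f y)" by (intro tendsto_intros lim that)
    show "\<exists>N. \<forall>n\<ge>N. norm (F n x - F n y) \<le> C * dist x y" using lip that by blast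
  qed
  define \<delta> where "\<delta> = e / (4 * (C + 1))"
  have \<delta>: "\<delta> > 0" "C * \<delta> \<le> e / 4" using e C by (auto simp: \<delta>_def field_simps)
  obtain D where D: "D \<subseteq> S" "finite D" "S \<subseteq> (\<Union>x\<in>D. ball x \<delta>)"
    using compactE_image[OF S, of S "\<lambda>x. ball x \<delta>"] \<delta> by (metis UN_I centre_in_ball open_ball subsetI)
  have "\<forall>\<^sub>F n in sequentially. \<forall>x\<in>D. dist (F n x) (f x) < e / 4"
  proof (intro eventually_ball_finite ballI D(2))
    fix x assume "x \<in> D"
    then show "\<forall>\<^sub>F n in sequentially. dist (F n x) (f x) < e / 4"
      using D(1) e by (intro tendstoD lim) auto
  qed
  then show "\<forall>\<^sub>F n in sequentially. \<forall>x\<in>S. dist (F n x) (f x) < e"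
    using eventually_ge_at_top[of 1]
  proof eventually_elim
    case (elim n)
    show ?case
    proof
      fix x assume x: "x \<in> S"
      then obtain y where y: "y \<in> D" "dist y x < \<delta>" using D(3) by auto
      then have yS: "y \<in> S" using D by auto
      have d: "C * dist x y \<le> e / 4"
        using mult_left_mono[of "dist x y" \<delta> C] y \<delta> C by (simp add: dist_commute)
      have "dist (F n x) (f x) \<le> dist (F n x) (F n y) + dist (F n y) (f y) + dist (f y) (f x)"
        by (metis add_right_mono dist_triangle order_trans)
      also have "\<dots> \<le> e / 4 + e / 4 + e / 4"
        using lip[OF elim(2) x yS] flip[OF yS x] d elim(1) y by (intro add_mono) (auto simp: dist_norm[symmetric] dist_commute less_imp_le)
      finally show "dist (F n x) (f x) < e" using e by linarith
    qed
  qed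
qed

section \<open>Frobenius norms and inverses of coercive matrices\<close>

lemma norm_matrix_le_entries:
  fixes A :: "real ^ 'd ^ 'd"
  assumes "\<And>k l. \<bar>A $ k $ l\<bar> \<le> t"
  shows "norm A \<le> (real CARD('d))\<^sup>2 * t"
proof -
  have "norm A \<le> (\<Sum>k\<in>UNIV. norm (A $ k))" unfolding norm_vec_def by (rule L2_set_le_sum) simp
  also have "\<dots> \<le> (\<Sum>k\<in>(UNIV :: 'd set). real CARD('d) * t)"
    by (intro sum_mono norm_le_card_times assms)
  finally show ?thesis by (simp add: power2_eq_square)
qed

lemma norm_transpose: "norm (transpose A) = norm (A :: real ^ 'd ^ 'd)"
proof -
  have "transpose A \<bullet> transpose A = A \<bullet> A"
    unfolding inner_vec_def transpose_def by (simp, subst sum.swap, simp)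
  then show ?thesis by (simp add: norm_eq_sqrt_inner)
qed

lemma norm_matrix_mult: "norm (A ** B) \<le> norm A * norm (B :: real ^ 'd ^ 'd)" for A :: "real ^ 'd ^ 'd"
proof -
  have row: "(A ** B) $ i = transpose B *v (A $ i)" for i
    by (simp add: vec_eq_iff matrix_matrix_mult_def matrix_vector_mult_def transpose_def mult.commute)
  have "norm (A ** B) = L2_set (\<lambda>i. norm (transpose B *v (A $ i))) UNIV"
    unfolding norm_vec_def[of "A ** B"] row ..
  also have "\<dots> \<le> L2_set (\<lambda>i. norm (A $ i) * norm B) UNIV"
  proof (intro L2_set_mono)
    show "norm (transpose B *v (A $ i)) \<le> norm (A $ i) * norm B" for i
      using norm_matrix_vector_mult_le[of "transpose B" "A $ i"] by (simp only: norm_transpose mult.commute)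
  qed simp
  also have "\<dots> = norm A * norm B"
    unfolding norm_vec_def[of A] by (rule L2_set_left_distrib[symmetric]) simp
  finally show ?thesis .
qed

lemma matrix_mult_diff:
  fixes A B C :: "real ^ 'd ^ 'd"
  shows "A ** (B - C) = A ** B - A ** C" "(B - C) ** A = B ** A - C ** A"
  by (simp_all add: matrix_matrix_mult_def vec_eq_iff algebra_simps sum_subtractf)

text \<open>The columns of the inverse are images of unit vectors, which coercivity bounds by
  \<open>1 / \<kappa>\<close>; the dimension factor comes from passing from entries to the Frobenius
  norm.\<close>

lemma coercive_inverse_norm:
  fixes A :: "real ^ 'd ^ 'd"
  assumes "\<And>v. \<kappa> * (norm v)\<^sup>2 \<le> (A *v v) \<bullet> v" "\<kappa> > 0"
  shows "norm (matrix_inv A) \<le> (real CARD('d))\<^sup>2 * (1 / \<kappa>)"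
proof (rule norm_matrix_le_entries)
  fix k l
  have "matrix_inv A $ k $ l = (matrix_inv A *v axis l 1) $ k" by (simp add: matrix_vector_mul_component inner_axis)
  also have "\<bar>\<dots>\<bar> \<le> norm (matrix_inv A *v axis l 1)" by (rule component_le_norm_cart)
  also have "\<dots> \<le> 1 / \<kappa>" using coercive_inverse(3)[OF assms, of "axis l 1"] by simp
  finally show "\<bar>matrix_inv A $ k $ l\<bar> \<le> 1 / \<kappa>" .
qed

lemma coercive_inverse_mult:
  fixes A :: "real ^ 'd ^ 'd"
  assumes "\<And>v. \<kappa> * (norm v)\<^sup>2 \<le> (A *v v) \<bullet> v" "\<kappa> > 0"
  shows "A ** matrix_inv A = mat 1" "matrix_inv A ** A = mat 1"
proof -
  have "A ** matrix_inv A = mat 1 \<and> matrix_inv A ** A = mat 1"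
    using coercive_invertible[OF assms] unfolding invertible_def matrix_inv_def by (rule someI_ex)
  then show "A ** matrix_inv A = mat 1" "matrix_inv A ** A = mat 1" by auto
qed

text \<open>Follows from the identity \<open>matrix_inv A - matrix_inv A' = matrix_inv A ** (A' - A)
  ** matrix_inv A'\<close>.\<close>

lemma coercive_inverse_diff:
  fixes A A' :: "real ^ 'd ^ 'd"
  assumes "\<And>v. \<kappa> * (norm v)\<^sup>2 \<le> (A *v v) \<bullet> v" "\<And>v. \<kappa> * (norm v)\<^sup>2 \<le> (A' *v v) \<bullet> v" "\<kappa> > 0"
  defines "k \<equiv> (real CARD('d))\<^sup>2 * (1 / \<kappa>)"
  shows "norm (matrix_inv A - matrix_inv A') \<le> k\<^sup>2 * norm (A - A')"
proof -
  note m = coercive_inverse_mult[OF assms(1,3)] coercive_inverse_mult[OF assms(2,3)]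
  note b = coercive_inverse_norm[OF assms(1,3), folded k_def] coercive_inverse_norm[OF assms(2,3), folded k_def]
  have k0: "0 \<le> k" using assms(3) by (simp add: k_def)
  have "matrix_inv A ** (A' - A) ** matrix_inv A' = matrix_inv A ** (A' ** matrix_inv A') - (matrix_inv A ** A) ** matrix_inv A'"
    by (simp add: matrix_mult_diff matrix_mul_assoc)
  then have "matrix_inv A - matrix_inv A' = matrix_inv A ** (A' - A) ** matrix_inv A'" by (simp add: m)
  then have "norm (matrix_inv A - matrix_inv A') \<le> norm (matrix_inv A ** (A' - A)) * norm (matrix_inv A')"
    by (simp only: norm_matrix_mult)
  also have "\<dots> \<le> (norm (matrix_inv A) * norm (A' - A)) * norm (matrix_inv A')"
    by (intro mult_right_mono norm_matrix_mult) simp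
  also have "\<dots> \<le> (k * norm (A' - A)) * k"
    using b k0 by (intro mult_mono) auto
  finally show ?thesis by (simp add: power2_eq_square norm_minus_commute mult_ac)
qed

lemma symmetric_inverse:
  fixes A :: "real ^ 'd ^ 'd"
  assumes "\<And>v. \<kappa> * (norm v)\<^sup>2 \<le> (A *v v) \<bullet> v" "\<kappa> > 0" "transpose A = A"
  shows "transpose (matrix_inv A) = matrix_inv A"
proof -
  note m = coercive_inverse_mult[OF assms(1,2)]
  have "transpose (matrix_inv A) ** A = mat 1"
    using arg_cong[OF m(1), of transpose] assms(3) by (simp add: matrix_transpose_mul transpose_mat)
  then have "transpose (matrix_inv A) ** A ** matrix_inv A = matrix_inv A" by simp
  then show ?thesis by (simp add: matrix_mul_assoc[symmetric] m)
qed

lemma outer_prod_matrix: "outer_prod (A *v u) (A' *v v) = A ** outer_prod u v ** transpose A'"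
  for A A' :: "real ^ 'd ^ 'd"
proof -
  have "(A ** outer_prod u v ** transpose A') $ k $ l = (\<Sum>j\<in>UNIV. (\<Sum>i\<in>UNIV. A $ k $ i * (u $ i * v $ j)) * A' $ l $ j)" for k l
    by (simp add: matrix_matrix_mult_def outer_prod_def transpose_def)
  also have "\<dots> k l = (\<Sum>i\<in>UNIV. A $ k $ i * u $ i) * (\<Sum>j\<in>UNIV. A' $ l $ j * v $ j)" for k l
    by (simp add: sum_distrib_left sum_distrib_right mult_ac)
  finally show ?thesis by (simp add: vec_eq_iff outer_prod_def matrix_vector_mult_def)
qed

lemma outer_prob_le:
  assumes "E \<in> sets M" "A \<subseteq> E"
  shows "outer_prob M A \<le> measure M E"
  unfolding outer_prob_def using assms by (intro cINF_lower bdd_belowI[of _ 0]) auto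

lemma (in prob_space) outer_prob_nonneg: "A \<subseteq> space M \<Longrightarrow> 0 \<le> outer_prob M A"
  unfolding outer_prob_def by (intro cINF_greatest) auto

text \<open>\<open>Z n\<close> may be nonmeasurable, so the event is enclosed in a measurable set:
  the complement of \<open>E n\<close>, the set where \<open>R n\<close> is at least
  \<open>e / 2\<close>, and a null set. Markov's inequality handles the second.\<close>

lemma (in prob_space) tends_to_zero_in_probI:
  assumes E: "\<And>n. n \<ge> 1 \<Longrightarrow> E n \<in> events" "(\<lambda>n. prob (space M - E n)) \<longlonglongrightarrow> 0"
    and Rn: "\<And>n. n \<ge> 1 \<Longrightarrow> integrable M (R n)" "\<And>n. n \<ge> 1 \<Longrightarrow> AE w in M. 0 \<le> R n w" "(\<lambda>n. expectation (R n)) \<longlonglongrightarrow> 0"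
    and main: "\<And>e. e > 0 \<Longrightarrow> \<forall>\<^sub>F n in sequentially. AE w in M. w \<in> E n \<longrightarrow> Z n w \<le> ennreal (R n w + e)"
  shows "tends_to_zero_in_prob M Z"
  unfolding tends_to_zero_in_prob_def
proof (intro allI impI)
  fix e :: real assume e: "e > 0"
  have lim: "(\<lambda>n. prob (space M - E n) + expectation (R n) / (e / 2)) \<longlonglongrightarrow> 0 + 0 / (e / 2)"
    by (intro tendsto_intros E Rn) (use e in auto)
  show "(\<lambda>n. outer_prob M {w \<in> space M. Z n w > ennreal e}) \<longlonglongrightarrow> 0"
  proof (rule tendsto_sandwich[OF _ _ tendsto_const])
    show "\<forall>\<^sub>F n in sequentially. 0 \<le> outer_prob M {w \<in> space M. Z n w > ennreal e}"
      by (intro always_eventually allI outer_prob_nonneg) auto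
    show "(\<lambda>n. prob (space M - E n) + expectation (R n) / (e / 2)) \<longlonglongrightarrow> 0" using lim by simp
    have "\<forall>\<^sub>F n in sequentially. AE w in M. w \<in> E n \<longrightarrow> Z n w \<le> ennreal (R n w + e / 2)" using main e by simp
    then show "\<forall>\<^sub>F n in sequentially. outer_prob M {w \<in> space M. Z n w > ennreal e} \<le> prob (space M - E n) + expectation (R n) / (e / 2)"
      using eventually_ge_at_top[of 1]
    proof eventually_elim
      case (elim n)
      obtain N where N: "{w\<in>space M. \<not> (w \<in> E n \<longrightarrow> Z n w \<le> ennreal (R n w + e / 2))} \<subseteq> N" "emeasure M N = 0" "N \<in> events"
        using elim(1) by (rule AE_E)
      have [measurable]: "R n \<in> borel_measurable M" "E n \<in> events" using Rn(1) E(1) elim by auto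
      let ?H = "{w\<in>space M. e / 2 \<le> R n w}"
      have sub: "{w \<in> space M. Z n w > ennreal e} \<subseteq> ((space M - E n) \<union> ?H) \<union> N"
      proof
        fix w assume w: "w \<in> {w \<in> space M. Z n w > ennreal e}"
        show "w \<in> ((space M - E n) \<union> ?H) \<union> N"
        proof (cases "w \<in> E n \<and> w \<notin> N")
          case True
          then have "Z n w \<le> ennreal (R n w + e / 2)" using N(1) w by blast
          with w have "ennreal e < ennreal (R n w + e / 2)" by (auto intro: less_le_trans)
          then have "e < R n w + e / 2" using e by (simp add: ennreal_less_iff)
          then show ?thesis using w by simp
        next
          case False then show ?thesis using w by auto
        qed
      qed
      have "outer_prob M {w \<in> space M. Z n w > ennreal e} \<le> prob (((space M - E n) \<union> ?H) \<union> N)"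
        using N by (intro outer_prob_le sub sets.Un) auto
      also have "\<dots> \<le> prob ((space M - E n) \<union> ?H) + prob N" using N by (intro measure_Un_le) auto
      also have "prob N = 0" using N by (simp add: measure_def)
      also have "prob ((space M - E n) \<union> ?H) \<le> prob (space M - E n) + prob ?H" by (intro measure_Un_le) auto
      also have "prob ?H \<le> expectation (R n) / (e / 2)"
        by (rule integral_Markov_inequality_measure[where A="{}"]) (use Rn elim e in auto)
      finally show ?case by simp
    qed
  qed
qed

section \<open>Uniform limit of the leading covariance\<close>

context wild_grid
begin

text \<open>The sample counterpart of \<open>Sigma_mat\<close>, taken at the true parameter instead
  of the estimator.\<close>

definition Shat :: "nat \<Rightarrow> real \<Rightarrow> real \<Rightarrow> 'a \<Rightarrow> real ^ 'd ^ 'd" where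
  "Shat n \<tau> \<tau>' w = (1 / real n) *\<^sub>R (\<Sum>i=1..n. outer_prod (cscore i (\<beta> \<tau>) \<tau> w) (cscore i (\<beta> \<tau>') \<tau>' w))"

lemma Jn_symmetric: "transpose (Jn n \<tau>) = Jn n \<tau>"
proof -
  have "(Jn n \<tau> *v w) \<bullet> v = (Jn n \<tau> *v v) \<bullet> w" for w v
    unfolding Jn_inner by (simp add: mult_ac)
  then have "(Jn n \<tau> *v axis l 1) \<bullet> axis k 1 = (Jn n \<tau> *v axis k 1) \<bullet> axis l 1" for k l .
  then show ?thesis
    by (simp add: vec_eq_iff transpose_def inner_axis matrix_vector_mul_component)
qed

lemma covm_eq:
  assumes n: "n \<ge> 1" and T: "\<tau> \<in> T" "\<tau>' \<in> T"
  shows "covm n \<tau> \<tau>' w = matrix_inv (Jn n \<tau>) ** Shat n \<tau> \<tau>' w ** matrix_inv (Jn n \<tau>')"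
proof -
  let ?A = "matrix_inv (Jn n \<tau>)" and ?A' = "matrix_inv (Jn n \<tau>')"
  have s: "transpose ?A' = ?A'" by (rule symmetric_inverse[OF Jn_ge[OF n T(2)] kappa_pos Jn_symmetric])
  interpret l: linear "\<lambda>P :: real ^ 'd ^ 'd. ?A ** P ** ?A'"
    by (rule linearI) (simp_all add: matrix_matrix_mult_def vec_eq_iff algebra_simps sum.distrib sum_distrib_left sum_distrib_right)
  show ?thesis
    unfolding covm_def Shat_def uvec_def outer_prod_matrix s l.scaleR l.sum ..
qed

lemma Shat_deviation:
  assumes n: "n \<ge> 1" and good: "w \<in> data_good n" and T: "\<tau> \<in> T" "\<tau>' \<in> T"
  shows "norm (Shat n \<tau> \<tau>' w - Sn n \<tau> \<tau>') \<le> (real CARD('d))\<^sup>2 * (K3 * real n powr (sx - 1/2))"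
proof (rule norm_matrix_le_entries)
  fix k l :: 'd
  have E: "expectation (\<lambda>w. outer_prod (cscore i (\<beta> \<tau>) \<tau> w) (cscore i (\<beta> \<tau>') \<tau>' w)) $ k $ l = expectation (\<lambda>w. cscore i (\<beta> \<tau>) \<tau> w $ k * cscore i (\<beta> \<tau>') \<tau>' w $ l)" if i: "i \<in> {1..n}" for i
  proof -
    have "integrable M (\<lambda>w. outer_prod (cscore i (\<beta> \<tau>) \<tau> w) (cscore i (\<beta> \<tau>') \<tau>' w))"
      using i T T_in_unit by (intro outer_cscore_integrable) auto
    from integral_bounded_linear[OF bounded_linear_compose[OF bounded_linear_vec_nth bounded_linear_vec_nth] this, of k l]
    show ?thesis by (simp add: outer_prod_def)
  qed
  have "(Shat n \<tau> \<tau>' w - Sn n \<tau> \<tau>') $ k $ l = (1 / real n) * (\<Sum>i=1..n. cscore i (\<beta> \<tau>) \<tau> w $ k * cscore i (\<beta> \<tau>') \<tau>' w $ l - expectation (\<lambda>w. cscore i (\<beta> \<tau>) \<tau> w $ k * cscore i (\<beta> \<tau>') \<tau>' w $ l))"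
    unfolding Shat_def Sn_eq[OF T] using E by (simp add: sum_subtractf outer_prod_def right_diff_distrib)
  then have "\<bar>(Shat n \<tau> \<tau>' w - Sn n \<tau> \<tau>') $ k $ l\<bar> = (1 / real n) * \<bar>\<Sum>i=1..n. cscore i (\<beta> \<tau>) \<tau> w $ k * cscore i (\<beta> \<tau>') \<tau>' w $ l - expectation (\<lambda>w. cscore i (\<beta> \<tau>) \<tau> w $ k * cscore i (\<beta> \<tau>') \<tau>' w $ l)\<bar>"
    by (simp add: abs_mult)
  also have "\<dots> \<le> (1 / real n) * (K3 * real n powr (1/2 + sx))"
    using T \<beta>_in_B T_in_unit by (intro mult_left_mono product_deviation[OF n good]) auto
  also have "1 / real n = real n powr (-1)" using n by (simp add: powr_minus divide_inverse)
  also have "real n powr (-1) * (K3 * real n powr (1/2 + sx)) = K3 * (real n powr (-1) * real n powr (1/2 + sx))" by (rule mult.left_commute)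
  also have "\<dots> = K3 * real n powr (sx - 1/2)" unfolding powr_add[symmetric] by simp
  finally show "\<bar>(Shat n \<tau> \<tau>' w - Sn n \<tau> \<tau>') $ k $ l\<bar> \<le> K3 * real n powr (sx - 1/2)" .
qed

lemma Shat_bound:
  assumes n: "n \<ge> 1" and good: "w \<in> data_good n" and T: "\<tau> \<in> T" "\<tau>' \<in> T"
  shows "norm (Shat n \<tau> \<tau>' w) \<le> SB * SB"
proof -
  have "norm (Shat n \<tau> \<tau>' w) \<le> (1 / real n) * (\<Sum>i=1..n. norm (outer_prod (cscore i (\<beta> \<tau>) \<tau> w) (cscore i (\<beta> \<tau>') \<tau>' w)))"
    unfolding Shat_def norm_scaleR by (simp add: divide_right_mono norm_sum)
  also have "\<dots> \<le> (1 / real n) * (\<Sum>i=1..n. SB * SB)"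
    unfolding norm_outer_prod using good_cscore_le[OF n good T_in_unit] T SB_ge by (intro mult_left_mono sum_mono mult_mono) auto
  finally show ?thesis using n by simp
qed

text \<open>\<open>Jn\<close> and \<open>Sn\<close> are Lipschitz in the levels with constants free
  of \<open>n\<close>, so their pointwise limits are uniform over the compact set \<open>T\<close>.
  The limit \<open>J\<close> keeps the coercivity constant, hence it is invertible and inversion is
  Lipschitz on all matrices that occur.\<close>

lemma covm_limit:
  assumes T_compact: "compact T"
    and J_lim: "\<And>\<tau>. \<tau> \<in> T \<Longrightarrow> (\<lambda>n. Jn n \<tau>) \<longlonglongrightarrow> J \<tau>"
    and \<Sigma>_lim: "\<And>\<tau> \<tau>'. \<tau> \<in> T \<Longrightarrow> \<tau>' \<in> T \<Longrightarrow> (\<lambda>n. Sn n \<tau> \<tau>') \<longlonglongrightarrow> \<Sigma> \<tau> \<tau>'"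
    and e: "e > 0"
  shows "\<forall>\<^sub>F n in sequentially. \<forall>w\<in>data_good n. \<forall>\<tau>\<in>T. \<forall>\<tau>'\<in>T.
    norm (covm n \<tau> \<tau>' w - matrix_inv (J \<tau>) ** \<Sigma> \<tau> \<tau>' ** matrix_inv (J \<tau>')) \<le> e"
proof -
  define Lb where "Lb = real c_max * R / \<kappa>"
  have Lb0: "0 \<le> Lb" using R_pos kappa_pos by (simp add: Lb_def)
  have bl: "norm (\<beta> \<tau> - \<beta> \<tau>') \<le> Lb * \<bar>\<tau> - \<tau>'\<bar>" if "\<tau> \<in> T" "\<tau>' \<in> T" for \<tau> \<tau>'
    unfolding Lb_def by (rule beta_lipschitz[OF that])
  have Junif: "uniform_limit T Jn J sequentially"
  proof (rule equilipschitz_uniform_limit[OF T_compact _ _ J_lim])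
    show "0 \<le> L3 * Lb" using Lb0 Cd_nonneg R_pos by auto
    fix n :: nat and x y assume *: "n \<ge> 1" "x \<in> T" "y \<in> T"
    have "norm (Jn n x - Jn n y) \<le> L3 * norm (\<beta> x - \<beta> y)" by (rule Jn_lipschitz[OF *(1)])
    also have "\<dots> \<le> L3 * (Lb * \<bar>x - y\<bar>)" using Cd_nonneg R_pos by (intro mult_left_mono bl *) auto
    finally show "norm (Jn n x - Jn n y) \<le> L3 * Lb * dist x y" by (simp add: dist_real_def mult.assoc)
  qed
  have Sunif: "uniform_limit (T \<times> T) (\<lambda>n p. Sn n (fst p) (snd p)) (\<lambda>p. \<Sigma> (fst p) (snd p)) sequentially"
  proof (rule equilipschitz_uniform_limit)
    let ?C = "SB\<^sup>2 * (1 + 2 * R * Cf * Lb)"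
    have C0: "0 \<le> ?C" using Lb0 Cf_nonneg R_pos by simp
    then show "0 \<le> 2 * ?C" by simp
    show "compact (T \<times> T)" by (intro compact_Times T_compact)
    fix n :: nat and x y assume *: "n \<ge> 1" "x \<in> T \<times> T" "y \<in> T \<times> T"
    have part: "SB\<^sup>2 * (\<bar>s - t\<bar> + 2 * R * Cf * norm (\<beta> s - \<beta> t)) \<le> ?C * \<bar>s - t\<bar>" if "s \<in> T" "t \<in> T" for s t
    proof -
      have "SB\<^sup>2 * (\<bar>s - t\<bar> + 2 * R * Cf * norm (\<beta> s - \<beta> t)) \<le> SB\<^sup>2 * (\<bar>s - t\<bar> + 2 * R * Cf * (Lb * \<bar>s - t\<bar>))"
        using Cf_nonneg R_pos by (intro mult_left_mono add_left_mono bl that) auto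
      then show ?thesis by (simp add: algebra_simps)
    qed
    have "norm (Sn n (fst x) (snd x) - Sn n (fst y) (snd y)) \<le> ?C * \<bar>fst x - fst y\<bar> + ?C * \<bar>snd x - snd y\<bar>"
      using * by (intro order_trans[OF Sn_increment] add_mono part) auto
    also have "\<dots> \<le> ?C * dist x y + ?C * dist x y"
      using C0 dist_fst_le[of x y] dist_snd_le[of x y] by (intro add_mono mult_left_mono) (auto simp: dist_real_def)
    moreover have "2 * x * y = x * y + x * y" for x y :: real by simp
    ultimately show "norm (Sn n (fst x) (snd x) - Sn n (fst y) (snd y)) \<le> 2 * ?C * dist x y" by (simp only:)
  qed (use \<Sigma>_lim in auto)
  have J_ge: "\<kappa> * (norm v)\<^sup>2 \<le> (J \<tau> *v v) \<bullet> v" if "\<tau> \<in> T" for \<tau> v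
  proof (rule LIMSEQ_le_const)
    show "(\<lambda>n. (Jn n \<tau> *v v) \<bullet> v) \<longlonglongrightarrow> (J \<tau> *v v) \<bullet> v"
      by (rule bounded_linear.tendsto[OF bounded_linear_quadratic_form J_lim[OF that]])
    show "\<exists>N. \<forall>n\<ge>N. \<kappa> * (norm v)\<^sup>2 \<le> (Jn n \<tau> *v v) \<bullet> v" using Jn_ge[OF _ that] by blast
  qed
  have S_bound: "norm (\<Sigma> \<tau> \<tau>') \<le> SB * SB" if T: "\<tau> \<in> T" "\<tau>' \<in> T" for \<tau> \<tau>'
  proof (rule LIMSEQ_le_const2)
    show "(\<lambda>n. norm (Sn n \<tau> \<tau>')) \<longlonglongrightarrow> norm (\<Sigma> \<tau> \<tau>')" by (intro tendsto_norm \<Sigma>_lim T)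
    have "norm (Sn n \<tau> \<tau>') \<le> SB * SB" if n: "n \<ge> 1" for n
    proof -
      have "norm (Sn n \<tau> \<tau>') \<le> (1 / real n) * (\<Sum>i=1..n. norm (expectation (\<lambda>w. outer_prod (cscore i (\<beta> \<tau>) \<tau> w) (cscore i (\<beta> \<tau>') \<tau>' w))))"
        unfolding Sn_eq[OF T] norm_scaleR by (simp add: divide_right_mono norm_sum)
      also have "\<dots> \<le> (1 / real n) * (\<Sum>i=1..n. SB * SB)"
      proof (intro mult_left_mono sum_mono norm_expectation_le)
        fix i assume "i \<in> {1..n}"
        then have i: "i \<ge> 1" by simp
        show "AE w in M. norm (outer_prod (cscore i (\<beta> \<tau>) \<tau> w) (cscore i (\<beta> \<tau>') \<tau>' w)) \<le> SB * SB"
          using AE_okX[OF i]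
        proof eventually_elim
          case (elim w)
          show ?case unfolding norm_outer_prod using norm_cscore_le[OF i elim T_in_unit] T SB_ge by (intro mult_mono) auto
        qed
      qed (use SB_ge in auto)
      finally show ?thesis using n by simp
    qed
    then show "\<exists>N. \<forall>n\<ge>N. norm (Sn n \<tau> \<tau>') \<le> SB * SB" by blast
  qed
  define k where "k = (real CARD('d))\<^sup>2 * (1 / \<kappa>)"
  have k0: "0 \<le> k" using kappa_pos by (simp add: k_def)
  \<comment> \<open>The coefficient of \<open>a\<close> in the three-term bound below, increased by
    1 to be positive.\<close>
  define D where "D = 2 * (k * k * k * (SB * SB)) + 2 * (k * k) + 1"
  have D0: "D > 0" unfolding D_def using k0 SB_ge R_pos by (intro add_nonneg_pos add_nonneg_nonneg mult_nonneg_nonneg) auto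
  define a where "a = e / D"
  have a0: "a > 0" using e D0 by (simp add: a_def)
  have "(\<lambda>n. (real CARD('d))\<^sup>2 * (K3 * real n powr (sx - 1/2))) \<longlonglongrightarrow> 0"
    using sx_bounds by real_asymp
  then have "\<forall>\<^sub>F n in sequentially. (real CARD('d))\<^sup>2 * (K3 * real n powr (sx - 1/2)) < a" using a0 by (rule order_tendstoD)
  then show ?thesis
    using uniform_limitD[OF Junif a0] uniform_limitD[OF Sunif a0] eventually_ge_at_top[of 1]
  proof (eventually_elim, intro ballI)
    fix n w \<tau> \<tau>'
    assume s: "(real CARD('d))\<^sup>2 * (K3 * real n powr (sx - 1/2)) < a"
      and Ju: "\<forall>x\<in>T. dist (Jn n x) (J x) < a" and Su: "\<forall>x\<in>T \<times> T. dist (Sn n (fst x) (snd x)) (\<Sigma> (fst x) (snd x)) < a"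
      and n: "1 \<le> n" and good: "w \<in> data_good n" and T: "\<tau> \<in> T" "\<tau>' \<in> T"
    define A A' A0 A0' where "A = matrix_inv (Jn n \<tau>)" "A' = matrix_inv (Jn n \<tau>')" "A0 = matrix_inv (J \<tau>)" "A0' = matrix_inv (J \<tau>')"
    note A_defs = A_A'_A0_A0'_def
    have nA: "norm A \<le> k" "norm A' \<le> k" "norm A0 \<le> k" "norm A0' \<le> k"
      unfolding A_defs k_def using T n kappa_pos by (intro coercive_inverse_norm[OF Jn_ge] coercive_inverse_norm[OF J_ge]; simp)+
    have dJ: "norm (matrix_inv (Jn n t) - matrix_inv (J t)) \<le> (k * k) * a" if t: "t \<in> T" for t
    proof -
      have "norm (matrix_inv (Jn n t) - matrix_inv (J t)) \<le> k\<^sup>2 * norm (Jn n t - J t)"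
        unfolding k_def by (rule coercive_inverse_diff[OF Jn_ge[OF n t] J_ge[OF t] kappa_pos])
      also have "\<dots> \<le> k\<^sup>2 * a" using Ju t by (intro mult_left_mono) (auto simp: dist_norm less_imp_le)
      finally show ?thesis by (simp add: power2_eq_square)
    qed
    let ?H = "Shat n \<tau> \<tau>' w" and ?S = "\<Sigma> \<tau> \<tau>'"
    have dS: "norm (?H - ?S) \<le> 2 * a"
    proof -
      have "norm (?H - ?S) \<le> norm (?H - Sn n \<tau> \<tau>') + norm (Sn n \<tau> \<tau>' - ?S)"
        using norm_triangle_ineq[of "?H - Sn n \<tau> \<tau>'" "Sn n \<tau> \<tau>' - ?S"] by simp
      also have "norm (?H - Sn n \<tau> \<tau>') \<le> a" using Shat_deviation[OF n good T] s by linarith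
      also have "norm (Sn n \<tau> \<tau>' - ?S) \<le> a" using Su T by (auto simp: dist_norm less_imp_le)
      finally show ?thesis by simp
    qed
    have triple: "norm (P ** Q ** P') \<le> x * y * z" if "norm P \<le> x" "norm Q \<le> y" "norm P' \<le> z" "0 \<le> x" "0 \<le> y" for P Q P' :: "real ^ 'd ^ 'd" and x y z
    proof -
      have "norm (P ** Q ** P') \<le> norm (P ** Q) * norm P'" by (rule norm_matrix_mult)
      also have "\<dots> \<le> (norm P * norm Q) * norm P'" by (intro mult_right_mono norm_matrix_mult) simp
      also have "\<dots> \<le> (x * y) * z" using that by (intro mult_mono) auto
      finally show ?thesis .
    qed
    \<comment> \<open>Telescoping: one factor of the triple product is exchanged at a time.\<close>
    have "A ** ?H ** A' - A0 ** ?S ** A0' = (A - A0) ** ?H ** A' + A0 ** (?H - ?S) ** A' + A0 ** ?S ** (A' - A0')"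
      by (simp add: matrix_mult_diff)
    then have "norm (A ** ?H ** A' - A0 ** ?S ** A0') \<le> norm ((A - A0) ** ?H ** A') + norm (A0 ** (?H - ?S) ** A') + norm (A0 ** ?S ** (A' - A0'))"
      by (simp only:) (intro order_trans[OF norm_triangle_ineq] add_right_mono norm_triangle_ineq)
    also have "\<dots> \<le> (k * k * a) * (SB * SB) * k + k * (2 * a) * k + k * (SB * SB) * (k * k * a)"
      using nA dS Shat_bound[OF n good T] S_bound[OF T] dJ[OF T(1)] dJ[OF T(2)] k0 a0 SB_ge
      by (intro add_mono triple) (auto simp: A_defs)
    also have "\<dots> = (2 * (k * k * k * (SB * SB)) + 2 * (k * k)) * a" by (simp add: algebra_simps)
    also have "\<dots> \<le> D * a" using a0 by (intro mult_right_mono) (auto simp: D_def)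
    also have "D * a = e" using D0 by (simp add: a_def)
    finally show "norm (covm n \<tau> \<tau>' w - matrix_inv (J \<tau>) ** \<Sigma> \<tau> \<tau>' ** matrix_inv (J \<tau>')) \<le> e"
      unfolding covm_eq[OF n T] A_defs .
  qed
qed

end

context wild_grid
begin

text \<open>\<open>alp\<close> balances the two terms of \<open>perr\<close>.\<close>

definition alp :: "nat \<Rightarrow> real" where
  "alp n = sqrt (expectation (\<lambda>w. (rho n w)\<^sup>2)) + 1 / real n"

lemma alp_pos: "n \<ge> 1 \<Longrightarrow> alp n > 0"
  unfolding alp_def by (intro add_nonneg_pos) auto

text \<open>The right side of \<open>perr_cond_exp\<close> at \<open>\<alpha> = alp n\<close>; it is
  free of the levels and of the minimizers.\<close>

definition bnd :: "nat \<Rightarrow> 'a \<Rightarrow> real" where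
  "bnd n w = alp n * (2 * (SB / \<kappa>)\<^sup>2) + (2 / alp n + 1) * real_cond_exp M (Fn n) (\<lambda>w. (rho n w)\<^sup>2) w"

lemma bnd_integrable: "n \<ge> 1 \<Longrightarrow> integrable M (bnd n)"
  and bnd_nonneg: "n \<ge> 1 \<Longrightarrow> AE w in M. 0 \<le> bnd n w"
  and bnd_expectation: "n \<ge> 1 \<Longrightarrow> expectation (bnd n) = alp n * (2 * (SB / \<kappa>)\<^sup>2) + (2 / alp n + 1) * expectation (\<lambda>w. (rho n w)\<^sup>2)"
proof -
  assume n: "n \<ge> 1"
  interpret F: finite_measure_subalgebra M "Fn n" by standard (rule subalgebra_Fn)
  note ri = rho_second_moment(1)[OF n]
  note ci = F.real_cond_exp_int[OF ri]
  show "integrable M (bnd n)" unfolding bnd_def[abs_def] using ci(1) by simp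
  show "expectation (bnd n) = alp n * (2 * (SB / \<kappa>)\<^sup>2) + (2 / alp n + 1) * expectation (\<lambda>w. (rho n w)\<^sup>2)"
    unfolding bnd_def[abs_def] using ci by (simp add: prob_space)
  have "AE w in M. 0 \<le> real_cond_exp M (Fn n) (\<lambda>w. (rho n w)\<^sup>2) w"
    using ri by (intro F.real_cond_exp_pos) auto
  then show "AE w in M. 0 \<le> bnd n w"
    by eventually_elim (use alp_pos[OF n] in \<open>auto simp: bnd_def intro!: add_nonneg_nonneg mult_nonneg_nonneg\<close>)
qed

lemma bnd_tendsto: "(\<lambda>n. expectation (bnd n)) \<longlonglongrightarrow> 0"
proof (rule tendsto_sandwich[OF _ _ tendsto_const])
  let ?e = "\<lambda>n. expectation (\<lambda>w. (rho n w)\<^sup>2)"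
  have e0: "0 \<le> ?e n" for n by simp
  show "\<forall>\<^sub>F n in sequentially. 0 \<le> expectation (bnd n)"
    using eventually_ge_at_top[of 1] by eventually_elim (intro integral_nonneg_AE bnd_nonneg)
  show "\<forall>\<^sub>F n in sequentially. expectation (bnd n) \<le> (sqrt (?e n) + 1 / real n) * (2 * (SB / \<kappa>)\<^sup>2) + (2 * sqrt (?e n) + ?e n)"
    using eventually_ge_at_top[of 1]
  proof eventually_elim
    case (elim n)
    \<comment> \<open>\<open>alp n\<close> is at least the root of the mean square, so the quotient
      is at most that root. The summand \<open>1 / n\<close> keeps \<open>alp n\<close> positive
      even if the mean square is 0.\<close>
    have "?e n / alp n \<le> sqrt (?e n)"
    proof -
      have "?e n = sqrt (?e n) * sqrt (?e n)" using e0[of n] by simp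
      also have "\<dots> \<le> sqrt (?e n) * alp n" using e0[of n] by (intro mult_left_mono) (auto simp: alp_def)
      finally show ?thesis using alp_pos[OF elim] by (simp add: pos_divide_le_eq)
    qed
    then have "(2 / alp n + 1) * ?e n \<le> 2 * sqrt (?e n) + ?e n"
      by (simp add: distrib_right)
    then show ?case unfolding bnd_expectation[OF elim] by (simp add: alp_def)
  qed
  have inv: "(\<lambda>n. 1 / real n) \<longlonglongrightarrow> 0" by (rule lim_1_over_n)
  have "(\<lambda>n. (sqrt (?e n) + 1 / real n) * (2 * (SB / \<kappa>)\<^sup>2) + (2 * sqrt (?e n) + ?e n)) \<longlonglongrightarrow> (sqrt 0 + 0) * (2 * (SB / \<kappa>)\<^sup>2) + (2 * sqrt 0 + 0)"
    by (intro tendsto_add tendsto_mult_left tendsto_mult_right tendsto_real_sqrt rho_second_moment(2) inv)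
  then show "(\<lambda>n. (sqrt (?e n) + 1 / real n) * (2 * (SB / \<kappa>)\<^sup>2) + (2 * sqrt (?e n) + ?e n)) \<longlonglongrightarrow> 0" by simp
qed

end

section \<open>The bootstrap covariance and its two limits\<close>

locale wild_estimators = wild_grid M c c_max Y X f T B \<beta> R Cf Cd \<epsilon> lam W q r G Cg pg
  for M :: "'a measure"
    and c :: "nat \<Rightarrow> nat" and c_max :: nat
    and Y :: "nat \<Rightarrow> nat \<Rightarrow> 'a \<Rightarrow> real"
    and X :: "nat \<Rightarrow> nat \<Rightarrow> 'a \<Rightarrow> real ^ 'd"
    and f :: "nat \<Rightarrow> nat \<Rightarrow> real \<Rightarrow> real ^ 'd \<Rightarrow> real"
    and T :: "real set" and B :: "(real ^ 'd) set"
    and \<beta> :: "real \<Rightarrow> real ^ 'd"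
    and R Cf Cd \<epsilon> lam :: real
    and W :: "nat \<Rightarrow> 'a \<Rightarrow> real" and q r :: real
    and G :: "nat \<Rightarrow> (real ^ 'd) set" and Cg :: real and pg :: nat +
  fixes bh bs :: "nat \<Rightarrow> real \<Rightarrow> 'a \<Rightarrow> real ^ 'd"
  assumes bh: "\<And>n \<tau> w. n \<ge> 1 \<Longrightarrow> \<tau> \<in> T \<Longrightarrow> w \<in> space M \<Longrightarrow>
      is_arg_min (\<lambda>b. objective c Y X n w b \<tau>) (\<lambda>b. b \<in> B) (bh n \<tau> w)"
    and bs: "\<And>n \<tau> w. n \<ge> 1 \<Longrightarrow> \<tau> \<in> T \<Longrightarrow> w \<in> space M \<Longrightarrow>
      is_arg_min (\<lambda>b. boot_objective c Y X W n w (bh n \<tau> w) b \<tau>) (\<lambda>b. b \<in> B) (bs n \<tau> w)"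
begin

definition hvec :: "nat \<Rightarrow> real \<Rightarrow> 'a \<Rightarrow> real ^ 'd" where
  "hvec n \<tau> w = sqrt (real n) *\<^sub>R (bs n \<tau> w - bh n \<tau> w)"

text \<open>Spelled exactly as the integrand in \<open>boot_cov\<close>; \<open>Zfun_eq\<close> then
  distributes the factor \<open>n\<close> over the two estimators.\<close>

definition Zfun :: "nat \<Rightarrow> real \<Rightarrow> real \<Rightarrow> 'd \<Rightarrow> 'd \<Rightarrow> 'a \<Rightarrow> real" where
  "Zfun n \<tau> \<tau>' k l = (\<lambda>w. (real n *\<^sub>R outer_prod (bs n \<tau> w - bh n \<tau> w) (bs n \<tau>' w - bh n \<tau>' w)) $ k $ l)"

lemma Zfun_eq: "Zfun n \<tau> \<tau>' k l w = hvec n \<tau> w $ k * hvec n \<tau>' w $ l"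
proof -
  have "real n * (a * b) = (sqrt (real n) * a) * (sqrt (real n) * b)" for a b
  proof -
    have "(sqrt (real n) * a) * (sqrt (real n) * b) = (sqrt (real n) * sqrt (real n)) * (a * b)" by (simp only: mult_ac)
    then show ?thesis by simp
  qed
  then show ?thesis by (simp add: Zfun_def hvec_def outer_prod_def)
qed

text \<open>The bound comes from compactness of \<open>B\<close> and grows with \<open>n\<close>. It
  only serves to provide a measurable cover and a majorant off \<open>data_good\<close>.\<close>

lemma Zfun_bounded:
  assumes "n \<ge> 1" "\<tau> \<in> T" "\<tau>' \<in> T"
  obtains C where "\<And>w. w \<in> space M \<Longrightarrow> \<bar>Zfun n \<tau> \<tau>' k l w\<bar> \<le> C"
proof -
  obtain K where K: "\<And>b. b \<in> B \<Longrightarrow> norm b \<le> K"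
    using compact_imp_bounded[OF B_compact] by (auto simp: bounded_iff)
  have h: "\<bar>hvec n t w $ j\<bar> \<le> sqrt (real n) * (2 * K)" if "t \<in> T" "w \<in> space M" for t w j
  proof -
    have B: "bh n t w \<in> B" "bs n t w \<in> B"
      using bh[OF assms(1) that] bs[OF assms(1) that] by (auto simp: is_arg_min_def)
    have "\<bar>hvec n t w $ j\<bar> \<le> norm (hvec n t w)" by (rule component_le_norm_cart)
    also have "\<dots> = sqrt (real n) * norm (bs n t w - bh n t w)" by (simp add: hvec_def)
    also have "\<dots> \<le> sqrt (real n) * (2 * K)"
      using norm_triangle_ineq4[of "bs n t w" "bh n t w"] K[OF B(1)] K[OF B(2)] by (intro mult_left_mono) auto
    finally show ?thesis .
  qed
  have "\<bar>Zfun n \<tau> \<tau>' k l w\<bar> \<le> (sqrt (real n) * (2 * K)) * (sqrt (real n) * (2 * K))" if "w \<in> space M" for w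
    unfolding Zfun_eq abs_mult
    by (intro mult_mono h assms that order_trans[OF abs_ge_zero h[OF assms(3) that]]) auto
  then show thesis by (rule that)
qed

definition valid :: "nat \<Rightarrow> bool" where
  "valid n \<longleftrightarrow> n \<ge> 1 \<and> (\<forall>w\<in>data_good n. \<forall>\<tau>\<in>T. norm (hvec n \<tau> w + avec n \<tau> w) \<le> rho n w)"

lemma eventually_valid: "\<forall>\<^sub>F n in sequentially. valid n"
  using bahadur_remainder eventually_ge_at_top[of 1]
proof eventually_elim
  case (elim n)
  show ?case unfolding valid_def
  proof (intro conjI ballI)
    fix w \<tau> assume w: "w \<in> data_good n" and \<tau>: "\<tau> \<in> T"
    then have "w \<in> space M" by (simp add: data_good_def)
    then show "norm (hvec n \<tau> w + avec n \<tau> w) \<le> rho n w"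
      using elim(1) bh[OF elim(2) \<tau>] bs[OF elim(2) \<tau>] w \<tau> unfolding hvec_def avec_def by blast
  qed (rule elim(2))
qed

lemma Zfun_near:
  assumes "valid n" "w \<in> data_good n" "\<tau> \<in> T" "\<tau>' \<in> T"
  shows "\<bar>Zfun n \<tau> \<tau>' k l w - avec n \<tau> w $ k * avec n \<tau>' w $ l\<bar> \<le> perr (alp n) n \<tau> \<tau>' w"
  unfolding Zfun_eq using assms alp_pos by (intro product_error) (auto simp: valid_def)

lemma boot_cov_bound:
  assumes "\<And>k l. \<bar>Est (Zfun n \<tau> \<tau>' k l) w - covm n \<tau> \<tau>' w $ k $ l\<bar> \<le> b"
  shows "norm (boot_cov Est bh bs n \<tau> \<tau>' w - covm n \<tau> \<tau>' w) \<le> (real CARD('d))\<^sup>2 * b"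
proof (rule norm_matrix_le_entries)
  show "\<bar>(boot_cov Est bh bs n \<tau> \<tau>' w - covm n \<tau> \<tau>' w) $ k $ l\<bar> \<le> b" for k l
    using assms[of k l] by (simp add: boot_cov_def Zfun_def)
qed

text \<open>The exceptional null set depends on the two levels here, since a version of the
  conditional expectation is chosen for each integrand separately.\<close>

lemma pointwise_bound:
  assumes v: "valid n" and T: "\<tau> \<in> T" "\<tau>' \<in> T"
  shows "AE w in M. w \<in> data_good n \<longrightarrow>
    norm (boot_cov (cond_outer_exp M (Fn n)) bh bs n \<tau> \<tau>' w - covm n \<tau> \<tau>' w) \<le> (real CARD('d))\<^sup>2 * bnd n w"
proof -
  have n: "n \<ge> 1" using v by (simp add: valid_def)
  have "AE w in M. w \<in> data_good n \<longrightarrow> \<bar>cond_outer_exp M (Fn n) (Zfun n \<tau> \<tau>' k l) w - covm n \<tau> \<tau>' w $ k $ l\<bar> \<le> bnd n w" for k l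
  proof -
    obtain C where C: "\<And>w. w \<in> space M \<Longrightarrow> \<bar>Zfun n \<tau> \<tau>' k l w\<bar> \<le> C" using Zfun_bounded[OF n T] by blast
    have "AE w in M. w \<in> data_good n \<longrightarrow> \<bar>cond_outer_exp M (Fn n) (Zfun n \<tau> \<tau>' k l) w - real_cond_exp M (Fn n) (\<lambda>w. avec n \<tau> w $ k * avec n \<tau>' w $ l) w\<bar>
        \<le> real_cond_exp M (Fn n) (perr (alp n) n \<tau> \<tau>') w"
      by (rule cond_outer_exp_sandwich[OF n C Zfun_near[OF v _ T] avec_product_integrable[OF n T] perr_integrable[OF n T]])
    then show ?thesis
      using avec_product_cond_exp[OF n T, of k l] perr_cond_exp[OF n T alp_pos[OF n]]
      by eventually_elim (auto simp: bnd_def)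
  qed
  then have "AE w in M. \<forall>k\<in>UNIV. \<forall>l\<in>UNIV. w \<in> data_good n \<longrightarrow> \<bar>cond_outer_exp M (Fn n) (Zfun n \<tau> \<tau>' k l) w - covm n \<tau> \<tau>' w $ k $ l\<bar> \<le> bnd n w"
    by (intro AE_finite_allI) auto
  then show ?thesis by eventually_elim (auto intro!: boot_cov_bound)
qed

text \<open>One null set has to serve all levels. It is determined by finitely many facts about the
  kernel that do not involve levels: the moments of products of two weights, the mean square of
  \<open>rho\<close>, the freezing of the data and the membership in \<open>data_good\<close>.
  Everything else is computed under the fixed measure \<open>K w\<close>, separately for each pair
  of levels.\<close>

lemma uniform_bound:
  assumes v: "valid n" and K: "is_regular_cond_prob M (Fn n) K"
  shows "AE w in M. w \<in> data_good n \<longrightarrow> (\<forall>\<tau>\<in>T. \<forall>\<tau>'\<in>T.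
    norm (boot_cov (\<lambda>Z w. outer_expectation (K w) Z) bh bs n \<tau> \<tau>' w - covm n \<tau> \<tau>' w) \<le> (real CARD('d))\<^sup>2 * bnd n w)"
proof -
  have n: "n \<ge> 1" using v by (simp add: valid_def)
  note Km = regular_cond_prob_measurable[OF K subalgebra_Fn]
  interpret F: finite_measure_subalgebra M "Fn n" by standard (rule subalgebra_Fn)
  have gF: "data_good n \<in> sets (Fn n)" by (rule data_good_measurable[OF n])
  then have gM: "data_good n \<in> events" using sets_data_algebra_M by auto
  have k1: "AE w in M. \<forall>i\<in>{1..n}. \<forall>j\<in>{1..n}. integrable (K w) (\<lambda>w. W i w * W j w) \<and> (\<integral>w'. W i w' * W j w' \<partial>K w) = of_bool (i = j)"
  proof (intro AE_finite_allI finite_atLeastAtMost)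
    fix i j assume "i \<in> {1..n}" "j \<in> {1..n}"
    then have ij: "i \<ge> 1" "j \<ge> 1" by auto
    have ind: "indep_set (sets (Fn n)) (sets (weight_algebra M W))"
    proof (rule indep_setI)
      show "sets (Fn n) \<subseteq> events" by (rule sets_data_algebra_M)
      show "sets (weight_algebra M W) \<subseteq> events" using W_indep_data by (auto simp: indep_set_def indep_sets_def split: bool.splits)
      show "prob (a \<inter> b) = prob a * prob b" if "a \<in> sets (Fn n)" "b \<in> sets (weight_algebra M W)" for a b
        using that data_algebra_mono[of "{1..n}" "{1..}"] by (intro indep_setD[OF W_indep_data]) auto
    qed
    have "AE w in M. real_cond_exp M (Fn n) (\<lambda>w. W i w * W j w) w = expectation (\<lambda>w. W i w * W j w)"
      by (rule real_cond_exp_indep[OF subalgebra_Fn ind W_product(1)[OF ij]])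
         (use measurable_sets[OF W_product(3)[OF ij]] in auto)
    then show "AE w in M. integrable (K w) (\<lambda>w. W i w * W j w) \<and> (\<integral>w'. W i w' * W j w' \<partial>K w) = of_bool (i = j)"
      using regular_cond_prob_integral[OF K subalgebra_Fn W_product(1)[OF ij]]
      by eventually_elim (simp add: W_product(2)[OF ij])
  qed
  have k2: "AE w in M. integrable (K w) (\<lambda>w. (rho n w)\<^sup>2) \<and> (\<integral>w'. (rho n w')\<^sup>2 \<partial>K w) = real_cond_exp M (Fn n) (\<lambda>w. (rho n w)\<^sup>2) w"
    by (rule regular_cond_prob_integral[OF K subalgebra_Fn rho_second_moment(1)[OF n]])
  have k3: "AE w in M. \<forall>i\<in>{1..n}. \<forall>k\<in>{1..c i}. AE w' in K w. Y i k w' = Y i k w \<and> X i k w' = X i k w"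
  proof (intro AE_finite_allI finite_atLeastAtMost)
    fix i k assume ik: "i \<in> {1..n}" "k \<in> {1..c i}"
    have Ym: "Y i k \<in> borel_measurable (Fn n)" by (rule measurable_data_algebra(1)) (use ik in auto)
    have Xm: "(\<lambda>w. X i k w $ l) \<in> borel_measurable (Fn n)" for l
    proof -
      have "X i k \<in> borel_measurable (Fn n)" by (rule measurable_data_algebra(2)) (use ik in auto)
      then show ?thesis by (rule measurable_compose) (auto intro!: borel_measurable_continuous_onI continuous_intros)
    qed
    have "AE w in M. \<forall>l\<in>UNIV. AE w' in K w. X i k w' $ l = X i k w $ l"
      by (intro AE_finite_allI regular_cond_prob_const[OF K subalgebra_Fn Xm]) simp
    with regular_cond_prob_const[OF K subalgebra_Fn Ym]
    show "AE w in M. AE w' in K w. Y i k w' = Y i k w \<and> X i k w' = X i k w"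
    proof eventually_elim
      case (elim w)
      have "AE w' in K w. \<forall>l\<in>UNIV. X i k w' $ l = X i k w $ l" using elim(2) by (intro AE_finite_allI) auto
      with elim(1) show ?case by eventually_elim (auto simp: vec_eq_iff)
    qed
  qed
  have k4: "AE w in M. AE w' in K w. w' \<in> data_good n \<longleftrightarrow> w \<in> data_good n"
    by (rule regular_cond_prob_AE_iff[OF K subalgebra_Fn gF])
  show ?thesis
    using k1 k2 k3 k4 AE_space
  proof (eventually_elim, intro impI ballI boot_cov_bound)
    fix w \<tau> \<tau>' k l
    assume k1: "\<forall>i\<in>{1..n}. \<forall>j\<in>{1..n}. integrable (K w) (\<lambda>w. W i w * W j w) \<and> (\<integral>w'. W i w' * W j w' \<partial>K w) = of_bool (i = j)"
      and k2: "integrable (K w) (\<lambda>w. (rho n w)\<^sup>2) \<and> (\<integral>w'. (rho n w')\<^sup>2 \<partial>K w) = real_cond_exp M (Fn n) (\<lambda>w. (rho n w)\<^sup>2) w"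
      and k3: "\<forall>i\<in>{1..n}. \<forall>k\<in>{1..c i}. AE w' in K w. Y i k w' = Y i k w \<and> X i k w' = X i k w"
      and k4: "AE w' in K w. w' \<in> data_good n \<longleftrightarrow> w \<in> data_good n"
      and w: "w \<in> space M" and good: "w \<in> data_good n" and T: "\<tau> \<in> T" "\<tau>' \<in> T"
    interpret Kw: prob_space "K w" by (rule Km(3)[OF w])
    have Ks: "sets (K w) = sets M" by (rule Km(4)[OF w])
    have "AE w' in K w. \<forall>i\<in>{1..n}. \<forall>k\<in>{1..c i}. Y i k w' = Y i k w \<and> X i k w' = X i k w"
      using k3 by (intro AE_finite_allI) auto
    \<comment> \<open>With the data frozen, the coefficients of the weights are constants under
      \<open>K w\<close>, for all levels simultaneously.\<close>
    then have uconst: "AE w' in K w. \<forall>t. \<forall>i\<in>{1..n}. uvec n i t w' = uvec n i t w"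
    proof eventually_elim
      case (elim w')
      then have "cscore i b t w' = cscore i b t w" if "i \<in> {1..n}" for i b t
        unfolding cscore_def score_def using that by (intro sum.cong) auto
      then show ?case by (simp add: uvec_def)
    qed
    have prod_int: "integrable (K w) (\<lambda>w'. avec n s w' $ k * avec n s' w' $ l) \<and> (\<integral>w'. avec n s w' $ k * avec n s' w' $ l \<partial>K w) = covm n s s' w $ k $ l"
      if s: "s \<in> T" "s' \<in> T" for s s' k l
    proof -
      let ?g = "\<lambda>w'. (1 / real n) * (\<Sum>i=1..n. \<Sum>j=1..n. (W i w' * W j w') * (uvec n i s w $ k * uvec n j s' w $ l))"
      have ae: "AE w' in K w. avec n s w' $ k * avec n s' w' $ l = ?g w'"
        using uconst by eventually_elim (simp add: avec_product[OF n])
      have m: "(\<lambda>w'. avec n s w' $ k * avec n s' w' $ l) \<in> borel_measurable (K w)"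
        using borel_measurable_integrable[OF avec_product_integrable[OF n s, of k l]] by (simp cong: measurable_cong_sets add: Ks)
      have gi: "integrable (K w) (\<lambda>w'. (W i w' * W j w') * a)" if "i \<in> {1..n}" "j \<in> {1..n}" for i j and a :: real
        using k1 that by (intro integrable_mult_left) auto
      have gint: "integrable (K w) ?g"
        by (intro integrable_mult_right Bochner_Integration.integrable_sum gi)
      have "(\<integral>w'. ?g w' \<partial>K w) = (1 / real n) * (\<integral>w'. (\<Sum>i=1..n. \<Sum>j=1..n. (W i w' * W j w') * (uvec n i s w $ k * uvec n j s' w $ l)) \<partial>K w)"
        by (rule integral_mult_right_zero)
      also have "(\<integral>w'. (\<Sum>i=1..n. \<Sum>j=1..n. (W i w' * W j w') * (uvec n i s w $ k * uvec n j s' w $ l)) \<partial>K w)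
          = (\<Sum>i=1..n. \<integral>w'. (\<Sum>j=1..n. (W i w' * W j w') * (uvec n i s w $ k * uvec n j s' w $ l)) \<partial>K w)"
        by (intro Bochner_Integration.integral_sum Bochner_Integration.integrable_sum gi)
      also have "\<dots> = (\<Sum>i=1..n. \<Sum>j=1..n. \<integral>w'. (W i w' * W j w') * (uvec n i s w $ k * uvec n j s' w $ l) \<partial>K w)"
        by (intro sum.cong refl Bochner_Integration.integral_sum gi)
      also have "\<dots> = (\<Sum>i=1..n. \<Sum>j=1..n. of_bool (i = j) * (uvec n i s w $ k * uvec n j s' w $ l))"
      proof (intro sum.cong refl)
        fix i j assume ij: "i \<in> {1..n}" "j \<in> {1..n}"
        have "(\<integral>w'. (W i w' * W j w') * (uvec n i s w $ k * uvec n j s' w $ l) \<partial>K w) = (\<integral>w'. W i w' * W j w' \<partial>K w) * (uvec n i s w $ k * uvec n j s' w $ l)"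
          by (rule integral_mult_left_zero)
        also have "(\<integral>w'. W i w' * W j w' \<partial>K w) = of_bool (i = j)" using k1 ij by blast
        finally show "(\<integral>w'. (W i w' * W j w') * (uvec n i s w $ k * uvec n j s' w $ l) \<partial>K w) = of_bool (i = j) * (uvec n i s w $ k * uvec n j s' w $ l)" .
      qed
      also have "\<dots> = (\<Sum>i=1..n. uvec n i s w $ k * uvec n i s' w $ l)"
        by (intro sum.cong refl) (simp add: of_bool_def if_distrib[where f="\<lambda>x. x * _"] cong: if_cong)
      finally have "(\<integral>w'. ?g w' \<partial>K w) = covm n s s' w $ k $ l" unfolding covm_component .
      moreover have "integrable (K w) (\<lambda>w'. avec n s w' $ k * avec n s' w' $ l)"
        using integrable_cong_AE[OF m borel_measurable_integrable[OF gint] ae] gint by simp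
      moreover have "(\<integral>w'. avec n s w' $ k * avec n s' w' $ l \<partial>K w) = (\<integral>w'. ?g w' \<partial>K w)"
        by (rule integral_cong_AE[OF m borel_measurable_integrable[OF gint] ae])
      ultimately show ?thesis by simp
    qed
    have sq: "integrable (K w) (\<lambda>w'. (norm (avec n s w'))\<^sup>2) \<and> (\<integral>w'. (norm (avec n s w'))\<^sup>2 \<partial>K w) \<le> (SB / \<kappa>)\<^sup>2" if s: "s \<in> T" for s
    proof -
      have "(\<integral>w'. (\<Sum>k\<in>UNIV. avec n s w' $ k * avec n s w' $ k) \<partial>K w) = (\<Sum>k\<in>UNIV. covm n s s w $ k $ k)"
        using prod_int[OF s s] by (subst Bochner_Integration.integral_sum) auto
      then show ?thesis
        unfolding norm_avec_sq using prod_int[OF s s] covm_trace_le[OF n good s] by auto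
    qed
    have perr_int: "integrable (K w) (perr (alp n) n \<tau> \<tau>')" and perr_le: "(\<integral>w'. perr (alp n) n \<tau> \<tau>' w' \<partial>K w) \<le> bnd n w"
    proof -
      show "integrable (K w) (perr (alp n) n \<tau> \<tau>')"
        unfolding perr_def[abs_def] using sq T k2 by simp
      have "(\<integral>w'. perr (alp n) n \<tau> \<tau>' w' \<partial>K w) = alp n * ((\<integral>w'. (norm (avec n \<tau> w'))\<^sup>2 \<partial>K w) + (\<integral>w'. (norm (avec n \<tau>' w'))\<^sup>2 \<partial>K w)) + (2 / alp n + 1) * real_cond_exp M (Fn n) (\<lambda>w. (rho n w)\<^sup>2) w"
        unfolding perr_def using sq T k2 by simp
      also have "\<dots> \<le> bnd n w"
        unfolding bnd_def using sq[OF T(1)] sq[OF T(2)] alp_pos[OF n] by (intro add_right_mono mult_left_mono) auto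
      finally show "(\<integral>w'. perr (alp n) n \<tau> \<tau>' w' \<partial>K w) \<le> bnd n w" .
    qed
    obtain C where C: "\<And>w. w \<in> space M \<Longrightarrow> \<bar>Zfun n \<tau> \<tau>' k l w\<bar> \<le> C" using Zfun_bounded[OF n T] by blast
    have "\<bar>outer_expectation (K w) (Zfun n \<tau> \<tau>' k l) - (\<integral>w'. avec n \<tau> w' $ k * avec n \<tau>' w' $ l \<partial>K w)\<bar> \<le> (\<integral>w'. perr (alp n) n \<tau> \<tau>' w' \<partial>K w)"
    proof (rule outer_expectation_sandwich)
      show "prob_space (K w)" by (rule Km(3)[OF w])
      show "data_good n \<in> sets (K w)" using gM Ks by simp
      show "AE w' in K w. w' \<in> data_good n" using k4 good by simp
      show "\<bar>Zfun n \<tau> \<tau>' k l w'\<bar> \<le> C" if "w' \<in> space (K w)" for w' using that C Km(5)[OF w] by simp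
      show "\<bar>Zfun n \<tau> \<tau>' k l w' - avec n \<tau> w' $ k * avec n \<tau>' w' $ l\<bar> \<le> perr (alp n) n \<tau> \<tau>' w'" if "w' \<in> data_good n" for w'
        by (rule Zfun_near[OF v that T])
      show "integrable (K w) (\<lambda>w'. avec n \<tau> w' $ k * avec n \<tau>' w' $ l)" using prod_int[OF T] by simp
    qed (rule perr_int)
    then show "\<bar>outer_expectation (K w) (Zfun n \<tau> \<tau>' k l) - covm n \<tau> \<tau>' w $ k $ l\<bar> \<le> bnd n w"
      using perr_le prod_int[OF T] by simp
  qed
qed

lemma data_good_event: "n \<ge> 1 \<Longrightarrow> data_good n \<in> events"
  using data_good_measurable sets_data_algebra_M by auto

text \<open>On \<open>data_good\<close> the bootstrap covariance is almost surely within a multiple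
  of \<open>bnd\<close> of \<open>covm\<close>, and \<open>covm\<close> is there uniformly close to
  its deterministic limit. The probability of the complement and the mean of \<open>bnd\<close> tend
  to 0.\<close>

lemma bootstrap_covariance_consistent:
  assumes T_compact: "compact T"
    and J_lim: "\<And>\<tau>. \<tau> \<in> T \<Longrightarrow> (\<lambda>n. Jn n \<tau>) \<longlonglongrightarrow> J \<tau>"
    and \<Sigma>_lim: "\<And>\<tau> \<tau>'. \<tau> \<in> T \<Longrightarrow> \<tau>' \<in> T \<Longrightarrow> (\<lambda>n. Sn n \<tau> \<tau>') \<longlonglongrightarrow> \<Sigma> \<tau> \<tau>'"
    and V: "\<And>\<tau> \<tau>'. V \<tau> \<tau>' = matrix_inv (J \<tau>) ** \<Sigma> \<tau> \<tau>' ** matrix_inv (J \<tau>')"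
  shows "\<tau> \<in> T \<Longrightarrow> \<tau>' \<in> T \<Longrightarrow> tends_to_zero_in_prob M (\<lambda>n w.
        ennreal (norm (boot_cov (cond_outer_exp M (Fn n)) bh bs n \<tau> \<tau>' w - V \<tau> \<tau>')))"
    and "(\<And>n. n \<ge> 1 \<Longrightarrow> is_regular_cond_prob M (Fn n) (K n)) \<Longrightarrow> tends_to_zero_in_prob M (\<lambda>n w. SUP \<tau>\<in>T. SUP \<tau>'\<in>T.
          ennreal (norm (boot_cov (\<lambda>Z w. outer_expectation (K n w) Z) bh bs n \<tau> \<tau>' w - V \<tau> \<tau>')))"
proof -
  let ?d = "(real CARD('d))\<^sup>2"
  have E: "(\<lambda>n. prob (space M - data_good n)) \<longlonglongrightarrow> 0"
    by (rule superpoly_limit(2)[OF prob_data_good]) simp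
  have R: "integrable M (\<lambda>w. ?d * bnd n w)" "AE w in M. 0 \<le> ?d * bnd n w" if "n \<ge> 1" for n
    using bnd_integrable[OF that] bnd_nonneg[OF that] by auto
  have Rl: "(\<lambda>n. expectation (\<lambda>w. ?d * bnd n w)) \<longlonglongrightarrow> 0"
    using tendsto_mult_left[OF bnd_tendsto, of ?d] by simp
  have tri: "norm (P - V \<tau> \<tau>') \<le> ?d * bnd n w + e"
    if "norm (P - covm n \<tau> \<tau>' w) \<le> ?d * bnd n w" "norm (covm n \<tau> \<tau>' w - V \<tau> \<tau>') \<le> e" for P \<tau> \<tau>' n w e
    using norm_triangle_ineq[of "P - covm n \<tau> \<tau>' w" "covm n \<tau> \<tau>' w - V \<tau> \<tau>'"] that by simp
  have lim: "\<forall>\<^sub>F n in sequentially. \<forall>w\<in>data_good n. \<forall>\<tau>\<in>T. \<forall>\<tau>'\<in>T. norm (covm n \<tau> \<tau>' w - V \<tau> \<tau>') \<le> e"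
    if "e > 0" for e
    unfolding V by (intro covm_limit T_compact J_lim \<Sigma>_lim that)
  show "tends_to_zero_in_prob M (\<lambda>n w. ennreal (norm (boot_cov (cond_outer_exp M (Fn n)) bh bs n \<tau> \<tau>' w - V \<tau> \<tau>')))"
    if T: "\<tau> \<in> T" "\<tau>' \<in> T"
  proof (rule tends_to_zero_in_probI[OF data_good_event E R Rl])
    fix e :: real assume "e > 0"
    from lim[OF this] eventually_valid
    show "\<forall>\<^sub>F n in sequentially. AE w in M. w \<in> data_good n \<longrightarrow>
      ennreal (norm (boot_cov (cond_outer_exp M (Fn n)) bh bs n \<tau> \<tau>' w - V \<tau> \<tau>')) \<le> ennreal (?d * bnd n w + e)"
    proof eventually_elim
      case (elim n)
      show ?case using pointwise_bound[OF elim(2) T]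
        by eventually_elim (use elim(1) T in \<open>auto intro!: ennreal_leI tri\<close>)
    qed
  qed
  show "tends_to_zero_in_prob M (\<lambda>n w. SUP \<tau>\<in>T. SUP \<tau>'\<in>T.
          ennreal (norm (boot_cov (\<lambda>Z w. outer_expectation (K n w) Z) bh bs n \<tau> \<tau>' w - V \<tau> \<tau>')))"
    if K: "\<And>n. n \<ge> 1 \<Longrightarrow> is_regular_cond_prob M (Fn n) (K n)"
  proof (rule tends_to_zero_in_probI[OF data_good_event E R Rl])
    fix e :: real assume "e > 0"
    from lim[OF this] eventually_valid
    show "\<forall>\<^sub>F n in sequentially. AE w in M. w \<in> data_good n \<longrightarrow>
      (SUP \<tau>\<in>T. SUP \<tau>'\<in>T. ennreal (norm (boot_cov (\<lambda>Z w. outer_expectation (K n w) Z) bh bs n \<tau> \<tau>' w - V \<tau> \<tau>'))) \<le> ennreal (?d * bnd n w + e)"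
    proof eventually_elim
      case (elim n)
      have "is_regular_cond_prob M (Fn n) (K n)" using K elim(2) by (simp add: valid_def)
      from uniform_bound[OF elim(2) this] show ?case
        by eventually_elim (use elim(1) in \<open>auto intro!: SUP_least ennreal_leI tri\<close>)
    qed
  qed
qed

end

section \<open>From the hypotheses of the theorem to the quantitative model\<close>

lemma mean_gram_quadratic_form:
  assumes "\<And>i k. i \<ge> 1 \<Longrightarrow> k \<in> {1..c i} \<Longrightarrow> integrable M (\<lambda>\<omega>. outer_prod (X i k \<omega>) (X i k \<omega>))"
  shows "(mean_gram M c X n *v u) \<bullet> v = (1 / real n) * (\<Sum>i=1..n. \<Sum>k=1..c i. \<integral>\<omega>. (X i k \<omega> \<bullet> u) * (X i k \<omega> \<bullet> v) \<partial>M)"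
proof -
  let ?L = "\<lambda>A :: real ^ 'b ^ 'b. (A *v u) \<bullet> v"
  interpret L: bounded_linear ?L by (rule bounded_linear_quadratic_form)
  have "?L (mean_gram M c X n) = (1 / real n) * (\<Sum>i=1..n. \<Sum>k=1..c i. ?L (\<integral>\<omega>. outer_prod (X i k \<omega>) (X i k \<omega>) \<partial>M))"
    unfolding mean_gram_def L.scaleR L.sum by simp
  also have "\<dots> = (1 / real n) * (\<Sum>i=1..n. \<Sum>k=1..c i. \<integral>\<omega>. (X i k \<omega> \<bullet> u) * (X i k \<omega> \<bullet> v) \<partial>M)"
  proof (intro arg_cong[where f = "\<lambda>x. (1 / real n) * x"] sum.cong refl)
    fix i k assume "i \<in> {1..n}" "k \<in> {1..c i}"
    then have "integrable M (\<lambda>\<omega>. outer_prod (X i k \<omega>) (X i k \<omega>))" using assms by auto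
    from integral_bounded_linear[OF bounded_linear_quadratic_form this, of u v]
    show "?L (\<integral>\<omega>. outer_prod (X i k \<omega>) (X i k \<omega>) \<partial>M) = (\<integral>\<omega>. (X i k \<omega> \<bullet> u) * (X i k \<omega> \<bullet> v) \<partial>M)"
      by (simp add: outer_prod_inner)
  qed
  finally show ?thesis .
qed

lemma smallest_eigenvalue_mean_gram:
  assumes "\<And>i k. i \<ge> 1 \<Longrightarrow> k \<in> {1..c i} \<Longrightarrow> integrable M (\<lambda>\<omega>. outer_prod (X i k \<omega>) (X i k \<omega>))"
  shows "smallest_eigenvalue (mean_gram M c X n) * (norm v)\<^sup>2 \<le>
    (1 / real n) * (\<Sum>i=1..n. \<Sum>k=1..c i. \<integral>\<omega>. (X i k \<omega> \<bullet> v)\<^sup>2 \<partial>M)"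
proof -
  have "smallest_eigenvalue (mean_gram M c X n) * (norm v)\<^sup>2 \<le> (mean_gram M c X n *v v) \<bullet> v"
    by (rule smallest_eigenvalue_le_quadratic_form) (simp only: mean_gram_quadratic_form[OF assms] mult.commute)
  then show ?thesis by (simp only: mean_gram_quadratic_form[OF assms] power2_eq_square)
qed

lemma compact_uniform_cball:
  fixes S B :: "'a :: euclidean_space set"
  assumes "compact S" "S \<subseteq> interior B"
  obtains r where "r > 0" "\<And>x. x \<in> S \<Longrightarrow> cball x r \<subseteq> B"
proof -
  have "closed (- interior B)" "S \<inter> - interior B = {}" using assms by auto
  from separate_compact_closed[OF assms(1) this]
  obtain d where d: "d > 0" "\<And>x y. x \<in> S \<Longrightarrow> y \<in> - interior B \<Longrightarrow> d \<le> dist x y" by blast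
  show thesis
  proof (rule that[of "d / 2"])
    show "cball x (d / 2) \<subseteq> B" if "x \<in> S" for x
    proof
      fix y assume "y \<in> cball x (d / 2)"
      then have "dist x y < d" using d(1) by simp
      then have "y \<in> interior B" using d(2)[OF that, of y] by force
      then show "y \<in> B" using interior_subset by blast
    qed
  qed (use d in simp)
qed

theorem theorem3p3:
  fixes M :: "'a measure"
    and c :: "nat \<Rightarrow> nat" and c_max :: nat
    and Y :: "nat \<Rightarrow> nat \<Rightarrow> 'a \<Rightarrow> real"
    and X :: "nat \<Rightarrow> nat \<Rightarrow> 'a \<Rightarrow> real ^ 'd"
    and f :: "nat \<Rightarrow> nat \<Rightarrow> real \<Rightarrow> real ^ 'd \<Rightarrow> real"
    and T :: "real set" and B :: "(real ^ 'd) set"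
    and \<beta> :: "real \<Rightarrow> real ^ 'd" and q :: real
    and J :: "real \<Rightarrow> real ^ 'd ^ 'd"
    and \<Sigma> :: "real \<Rightarrow> real \<Rightarrow> real ^ 'd ^ 'd"
    and W :: "nat \<Rightarrow> 'a \<Rightarrow> real"
    and \<beta>hat \<beta>star :: "nat \<Rightarrow> real \<Rightarrow> 'a \<Rightarrow> real ^ 'd"
    and V :: "real \<Rightarrow> real \<Rightarrow> real ^ 'd ^ 'd"
  assumes M: "prob_space M"
    and Y_rv: "\<And>i k. i \<ge> 1 \<Longrightarrow> k \<in> {1..c i} \<Longrightarrow> Y i k \<in> borel_measurable M"
    and X_rv: "\<And>i k. i \<ge> 1 \<Longrightarrow> k \<in> {1..c i} \<Longrightarrow> X i k \<in> borel_measurable M"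
    and clusters_indep:
      "prob_space.indep_vars M (\<lambda>i. PiM {1..c i} (\<lambda>_. borel)) (cluster c Y X) {1..}"
    and clusters_bounded: "\<And>i. i \<ge> 1 \<Longrightarrow> c i \<le> c_max"
    and T: "closed T" "T \<subseteq> {0<..<1}"
    and B: "compact B" "convex B"
    and \<beta>_interior: "\<And>\<tau>. \<tau> \<in> T \<Longrightarrow> \<beta> \<tau> \<in> interior B"
    and f_density: "\<And>i k. i \<ge> 1 \<Longrightarrow> k \<in> {1..c i} \<Longrightarrow> is_cond_density M (Y i k) (X i k) (f i k)"
    and quantile_linear:
      "\<And>i k \<tau> x. i \<ge> 1 \<Longrightarrow> k \<in> {1..c i} \<Longrightarrow> \<tau> \<in> T \<Longrightarrow> x \<in> law_support M (X i k) \<Longrightarrow>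
         cond_quantile (f i k) \<tau> x = x \<bullet> \<beta> \<tau>"
    and q: "q > 2"
    and X_moments:
      "\<exists>C. \<forall>i\<ge>1. \<forall>k\<in>{1..c i}. integrable M (\<lambda>\<omega>. norm (X i k \<omega>) powr q) \<and>
         (\<integral>\<omega>. norm (X i k \<omega>) powr q \<partial>M) \<le> C"
    and gram_pos_def: "\<exists>\<epsilon>>0. \<forall>n\<ge>1. smallest_eigenvalue (mean_gram M c X n) \<ge> \<epsilon>"
    and f_bounded:
      "\<exists>C. \<forall>i\<ge>1. \<forall>k\<in>{1..c i}. \<forall>x\<in>law_support M (X i k). \<forall>y. \<bar>f i k y x\<bar> \<le> C"
    and f_deriv_bounded:
      "\<exists>C. \<forall>i\<ge>1. \<forall>k\<in>{1..c i}. \<forall>x\<in>law_support M (X i k). \<forall>y.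
         (\<lambda>u. f i k u x) differentiable (at y) \<and> \<bar>deriv (\<lambda>u. f i k u x) y\<bar> \<le> C"
    and f_away_from_zero:
      "\<exists>\<epsilon>>0. \<forall>i\<ge>1. \<forall>k\<in>{1..c i}. \<forall>x\<in>law_support M (X i k). \<forall>b\<in>B. f i k (x \<bullet> b) x \<ge> \<epsilon>"
    and J_lim: "\<And>\<tau>. \<tau> \<in> T \<Longrightarrow> (\<lambda>n. J_mat M c X f \<beta> n \<tau>) \<longlonglongrightarrow> J \<tau>"
    and \<Sigma>_lim:
      "\<And>\<tau> \<tau>'. \<tau> \<in> T \<Longrightarrow> \<tau>' \<in> T \<Longrightarrow> (\<lambda>n. Sigma_mat M c Y X \<beta> n \<tau> \<tau>') \<longlonglongrightarrow> \<Sigma> \<tau> \<tau>'"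
    and W_indep: "prob_space.indep_vars M (\<lambda>_. borel) W {1..}"
    and W_ident: "\<And>i. i \<ge> 1 \<Longrightarrow> distr M borel (W i) = distr M borel (W 1)"
    and W_indep_data:
      "prob_space.indep_set M (sets (data_algebra M c Y X {1..})) (sets (weight_algebra M W))"
    and W_mean: "(\<integral>\<omega>. W 1 \<omega> \<partial>M) = 0"
    and W_var: "(\<integral>\<omega>. (W 1 \<omega> - (\<integral>\<omega>'. W 1 \<omega>' \<partial>M))\<^sup>2 \<partial>M) = 1"
    and W_moment: "integrable M (\<lambda>\<omega>. \<bar>W 1 \<omega>\<bar> powr q)"
    and \<beta>hat:
      "\<And>n \<tau> \<omega>. n \<ge> 1 \<Longrightarrow> \<tau> \<in> T \<Longrightarrow> \<omega> \<in> space M \<Longrightarrow>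
         is_arg_min (\<lambda>b. objective c Y X n \<omega> b \<tau>) (\<lambda>b. b \<in> B) (\<beta>hat n \<tau> \<omega>)"
    and \<beta>star:
      "\<And>n \<tau> \<omega>. n \<ge> 1 \<Longrightarrow> \<tau> \<in> T \<Longrightarrow> \<omega> \<in> space M \<Longrightarrow>
         is_arg_min (\<lambda>b. boot_objective c Y X W n \<omega> (\<beta>hat n \<tau> \<omega>) b \<tau>) (\<lambda>b. b \<in> B)
           (\<beta>star n \<tau> \<omega>)"
    and V: "\<And>\<tau> \<tau>'. V \<tau> \<tau>' = matrix_inv (J \<tau>) ** \<Sigma> \<tau> \<tau>' ** matrix_inv (J \<tau>')"
  shows
    "(\<forall>\<tau>\<in>T. \<forall>\<tau>'\<in>T. tends_to_zero_in_prob M (\<lambda>n \<omega>.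
        ennreal (norm (boot_cov (cond_outer_exp M (data_algebra M c Y X {1..n})) \<beta>hat \<beta>star n \<tau> \<tau>' \<omega>
                       - V \<tau> \<tau>')))) \<and>
     (q > 4 \<longrightarrow> (\<forall>K. (\<forall>n\<ge>1. is_regular_cond_prob M (data_algebra M c Y X {1..n}) (K n)) \<longrightarrow>
        tends_to_zero_in_prob M (\<lambda>n \<omega>. SUP \<tau>\<in>T. SUP \<tau>'\<in>T.
          ennreal (norm (boot_cov (\<lambda>Z \<omega>. outer_expectation (K n \<omega>) Z) \<beta>hat \<beta>star n \<tau> \<tau>' \<omega>
                         - V \<tau> \<tau>')))))"
proof -
  interpret prob_space M by (rule M)
  show ?thesis
  \<comment> \<open>For empty \<open>T\<close> the supremum is 0. Otherwise some level
    \<open>\<tau>0\<close> provides a ball inside \<open>B\<close>, which is needed to bound the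
    supports.\<close>
  proof (cases "T = {}")
    case True
    have "outer_prob M {} = 0"
    proof (rule antisym)
      show "outer_prob M {} \<le> 0" using outer_prob_le[of "{}" M "{}"] by simp
      show "0 \<le> outer_prob M {}" unfolding outer_prob_def by (intro cINF_greatest) auto
    qed
    then show ?thesis using True by (simp add: tends_to_zero_in_prob_def bot_ennreal)
  next
    case False
    then obtain \<tau>0 where \<tau>0: "\<tau>0 \<in> T" by blast
    obtain Cf0 where Cf0: "\<And>i k x y. i \<ge> 1 \<Longrightarrow> k \<in> {1..c i} \<Longrightarrow> x \<in> law_support M (X i k) \<Longrightarrow> \<bar>f i k y x\<bar> \<le> Cf0"
      using f_bounded by blast
    obtain Cd0 where Cd0: "\<And>i k x y. i \<ge> 1 \<Longrightarrow> k \<in> {1..c i} \<Longrightarrow> x \<in> law_support M (X i k) \<Longrightarrow>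
        (\<lambda>u. f i k u x) differentiable (at y) \<and> \<bar>deriv (\<lambda>u. f i k u x) y\<bar> \<le> Cd0"
      using f_deriv_bounded by blast
    obtain \<epsilon> where \<epsilon>: "\<epsilon> > 0" "\<And>i k x b. i \<ge> 1 \<Longrightarrow> k \<in> {1..c i} \<Longrightarrow> x \<in> law_support M (X i k) \<Longrightarrow> b \<in> B \<Longrightarrow> \<epsilon> \<le> f i k (x \<bullet> b) x"
      using f_away_from_zero by blast
    obtain lam where lam: "lam > 0" "\<And>n. n \<ge> 1 \<Longrightarrow> lam \<le> smallest_eigenvalue (mean_gram M c X n)"
      using gram_pos_def by blast
    obtain r0 where r0: "r0 > 0" "ball (\<beta> \<tau>0) r0 \<subseteq> B"
      using \<beta>_interior[OF \<tau>0] by (auto simp: mem_interior)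
    \<comment> \<open>The ball around the single parameter \<open>\<beta> \<tau>0\<close> already
      bounds the supports of all regressors.\<close>
    define R where "R = max 1 (1 / (\<epsilon> * r0))"
    have supp: "norm x \<le> R" if "i \<ge> 1" "k \<in> {1..c i}" "x \<in> law_support M (X i k)" for i k x
    proof -
      interpret O: density_observation M "X i k" "Y i k" "f i k" B Cf0 Cd0 \<epsilon>
        by unfold_locales
          (fact Y_rv[OF that(1,2)] X_rv[OF that(1,2)] f_density[OF that(1,2)] Cf0[OF that(1,2)] Cd0[OF that(1,2)] \<epsilon>(1) \<epsilon>(2)[OF that(1,2)] B)+
      show ?thesis using O.norm_supp_le[OF that(3) r0] by (simp add: R_def)
    qed
    have int: "integrable M (\<lambda>\<omega>. outer_prod (X i k \<omega>) (X i k \<omega>))" if "i \<ge> 1" "k \<in> {1..c i}" for i k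
    proof (rule integrable_const_bound[where B = "R * R"])
      show "AE \<omega> in M. norm (outer_prod (X i k \<omega>) (X i k \<omega>)) \<le> R * R"
        using AE_in_law_support[OF M X_rv[OF that]]
      proof eventually_elim
        case (elim \<omega>)
        then show ?case unfolding norm_outer_prod by (intro mult_mono supp[OF that]) (auto simp: R_def)
      qed
      show "(\<lambda>\<omega>. outer_prod (X i k \<omega>) (X i k \<omega>)) \<in> borel_measurable M"
        by (intro measurable_outer_prod X_rv that)
    qed
    \<comment> \<open>Raising the constants to at least 1 or 0 provides the sign conditions and
      normalizations of the model.\<close>
    interpret qr_model M c "max 1 c_max" Y X f T B \<beta> R "max 0 Cf0" "max 0 Cd0" \<epsilon> lam
    proof
      show "lam * (norm v)\<^sup>2 \<le> (1 / real n) * (\<Sum>i=1..n. \<Sum>k=1..c i. expectation (\<lambda>\<omega>. (X i k \<omega> \<bullet> v)\<^sup>2))" if "n \<ge> 1" for n v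
        using smallest_eigenvalue_mean_gram[of c M X n v, OF int] mult_right_mono[OF lam(2)[OF that], of "(norm v)\<^sup>2"] by simp
      show "\<beta> \<tau> \<in> B" if "\<tau> \<in> T" for \<tau> using \<beta>_interior[OF that] interior_subset by blast
      show "\<bar>f i k y x\<bar> \<le> max 0 Cf0" if "i \<ge> 1" "k \<in> {1..c i}" "x \<in> law_support M (X i k)" for i k x y
        using Cf0[OF that, of y] by simp
      show "(\<lambda>u. f i k u x) differentiable (at y) \<and> \<bar>deriv (\<lambda>u. f i k u x) y\<bar> \<le> max 0 Cd0"
        if "i \<ge> 1" "k \<in> {1..c i}" "x \<in> law_support M (X i k)" for i k x y
        using Cd0[OF that, of y] by auto
      show "c i \<le> max 1 c_max" if "i \<ge> 1" for i using clusters_bounded[OF that] by simp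
    qed (fact Y_rv X_rv clusters_indep T(2) B f_density quantile_linear \<epsilon> supp lam(1) | simp add: R_def)+
    have T_compact: "compact T"
      using T bounded_subset[OF bounded_box[of 0 "1::real"]] by (simp add: compact_eq_bounded_closed box_real)
    \<comment> \<open>Continuity makes the set of true parameters compact, so that one radius fits
      around all of them inside \<open>B\<close>.\<close>
    have "continuous_on T \<beta>"
    proof (rule lipschitz_on_continuous_on)
      show "(real (max 1 c_max) * R / \<kappa>)-lipschitz_on T \<beta>"
        by (rule lipschitz_onI) (use beta_lipschitz kappa_pos R_pos in \<open>auto simp: dist_norm\<close>)
    qed
    then have "compact (\<beta> ` T)" using T_compact by (rule compact_continuous_image)
    then obtain r where r: "r > 0" "\<And>x. x \<in> \<beta> ` T \<Longrightarrow> cball x r \<subseteq> B"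
      using compact_uniform_cball[of "\<beta> ` T" B] \<beta>_interior by blast
    obtain Cg pg where net: "\<And>n::nat. n \<ge> 1 \<Longrightarrow>
        \<exists>G. finite G \<and> real (card G) \<le> Cg * real n ^ pg \<and> (\<forall>b\<in>B. \<exists>g\<in>G. norm (b - g) \<le> 1 / real n)"
      using polynomial_net[OF compact_imp_bounded[OF B(1)]] by blast
    then obtain G where G: "\<And>n. n \<ge> 1 \<Longrightarrow> finite (G n) \<and> real (card (G n)) \<le> Cg * real n ^ pg \<and> (\<forall>b\<in>B. \<exists>g\<in>G n. norm (b - g) \<le> 1 / real n)"
      by metis
    interpret wild_estimators M c "max 1 c_max" Y X f T B \<beta> R "max 0 Cf0" "max 0 Cd0" \<epsilon> lam W q r G Cg pg \<beta>hat \<beta>star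
    proof
      show "expectation (\<lambda>\<omega>. (W 1 \<omega>)\<^sup>2) = 1" using W_var W_mean by simp
      show "cball (\<beta> \<tau>) r \<subseteq> B" if "\<tau> \<in> T" for \<tau> using r(2) that by blast
    qed (use q W_indep W_ident W_indep_data W_mean W_moment r(1) G \<beta>hat \<beta>star in blast)+
    show ?thesis
      by (intro conjI ballI impI allI bootstrap_covariance_consistent[where J = J and \<Sigma> = \<Sigma>] T_compact J_lim \<Sigma>_lim V) blast+
  qed
qed

end
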